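(* Let $d\ge1$, let $n\ge2$, and let $G$ be a length-weighted Sobolev metric of order $n$ with coefficient functions $a_0,\dots,a_n$, satisfying $$\max_{1\le k\le n}\int_0^1 r^{1/2-k}\sqrt{a_k(r)}\,\mathrm{d}r=\infty \qquad\text{and}\qquad \max_{1\le k\le n}\int_1^\infty r^{1/2-k}\sqrt{a_k(r)}\,\mathrm{d}r=\infty .$$ Then $G$ has the following property: given a metric ball $B(c_0,R)$ in $\operatorname{Imm}(S^1,\mathbb R^d)$ (with respect to the geodesic distance of $G$ on $\operatorname{Imm}(S^1,\mathbb R^d)$), there exists a constant $C$ such that $$\|h\|_{H^n(ds)}^2=\int_{S^1}|h|^2+|D_s^nh|^2\,\mathrm{d}s\le C\,G_c(h,h)$$ holds for all $c\in B(c_0,R)$ and all $h\in C^\infty(S^1,\mathbb R^d)$. Furthermore, given a metric ball $B(c_0,R)$ in $\mathcal I^n(S^1,\mathbb R^d)$ (with respect to the geodesic distance of $G$ on $\mathcal I^n(S^1,\mathbb R^d)$), there exists a constant $C$ such that $$C^{-1}\|h\|_{H^n(d\theta)}\le\sqrt{G_c(h,h)}\le C\|h\|_{H^n(d\theta)}$$ holds for all $c\in B(c_0,R)$ and all $h\in H^n(S^1,\mathbb R^d)$.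
   Context: $S^1=\mathbb R/2\pi\mathbb Z$ with parameter $\theta$, and $'=\partial_\theta$. $\operatorname{Imm}(S^1,\mathbb R^d)=\{c\in C^\infty(S^1,\mathbb R^d): c'(\theta)\ne0\text{ for all }\theta\}$, an open subset of the Fréchet space $C^\infty(S^1,\mathbb R^d)$. For $n\ge2$, $\mathcal I^n(S^1,\mathbb R^d)=\{c\in H^n(S^1,\mathbb R^d): c'(\theta)\ne0 \text{ for all }\theta\}$, an open subset of the Sobolev space $H^n(S^1,\mathbb R^d)$, hence a Hilbert manifold. For a curve $c$: $D_s=\frac1{|c'|}\partial_\theta$ and $\mathrm{d}s=|c'|\,\mathrm{d}\theta$ are differentiation and integration with respect to arc length, and $\ell_c=\int_{S^1}1\,\mathrm{d}s$ is the length of $c$. The norm $\|h\|_{H^n(d\theta)}$ is defined by $\|h\|_{H^n(d\theta)}^2=\int_{S^1}|h|^2+|\partial_\theta^nh|^2\,\mathrm{d}\theta$. A length-weighted Sobolev metric of order $n$ is a Riemannian metric of the form $$G_c(h,k)=\sum_{j=0}^n\int_{S^1}a_j(\ell_c)\langle D_s^jh,D_s^jk\rangle\,\mathrm{d}s,$$ where the coefficients are smooth functions $a_j\in C^\infty(\mathbb R_{>0},\mathbb R_{\ge0})$ with $a_0(\ell)>0$ and $a_n(\ell)>0$ for all $\ell>0$; it is defined on $\operatorname{Imm}(S^1,\mathbb R^d)$ and, for $n\ge2$, extends by the same formula to a smooth strong Riemannian metric on $\mathcal I^n(S^1,\mathbb R^d)$. On either space the geodesic distance $\operatorname{dist}(c_0,c_1)$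 is the infimum of $\int_0^1\sqrt{G_c(\partial_tc,\partial_tc)}\,\mathrm{d}t$ over piecewise smooth paths in that space from $c_0$ to $c_1$ (and $\infty$ if there is none), and $B(c_0,R)=\{c:\operatorname{dist}(c_0,c)<R\}$. *)

theory Defs
  imports "HOL-Analysis.Analysis"
begin

(* A function on the circle R / 2 pi Z is represented by a 2 pi-periodic function on the real
   line; integrals over the circle are Lebesgue integrals over {0..2 * pi}. *)

definition periodic :: "(real \<Rightarrow> 'a) \<Rightarrow> bool" where
  "periodic f \<longleftrightarrow> (\<forall>x. f (x + 2 * pi) = f x)"

abbreviation circle_measure :: "real measure" where
  "circle_measure \<equiv> lebesgue_on {0..2 * pi}"

definition cderiv :: "(real \<Rightarrow> 'a::real_normed_vector) \<Rightarrow> real \<Rightarrow> 'a" where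
  "cderiv f = (\<lambda>x. vector_derivative f (at x))"

(* Meaningful for open S only. *)
definition smooth_on :: "real set \<Rightarrow> (real \<Rightarrow> 'a::real_normed_vector) \<Rightarrow> bool" where
  "smooth_on S f \<longleftrightarrow> (\<forall>k. \<forall>x\<in>S. (cderiv ^^ k) f differentiable (at x))"

definition Cinf :: "(real \<Rightarrow> 'a::real_normed_vector) set" where
  "Cinf = {h. periodic h \<and> smooth_on UNIV h}"

definition L2 :: "(real \<Rightarrow> 'a::euclidean_space) set" where
  "L2 = {f. periodic f \<and> f \<in> borel_measurable circle_measure
            \<and> integrable circle_measure (\<lambda>\<theta>. (norm (f \<theta>))\<^sup>2)}"

definition has_weak_deriv ::
    "(real \<Rightarrow> 'a::euclidean_space) \<Rightarrow> (real \<Rightarrow> 'a) \<Rightarrow> bool" where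
  "has_weak_deriv f g \<longleftrightarrow>
     periodic f \<and> periodic g \<and> integrable circle_measure f \<and> integrable circle_measure g \<and>
     (\<forall>\<phi>::real \<Rightarrow> real. \<phi> \<in> Cinf \<longrightarrow>
        (LINT \<theta>|circle_measure. cderiv \<phi> \<theta> *\<^sub>R f \<theta>) = - (LINT \<theta>|circle_measure. \<phi> \<theta> *\<^sub>R g \<theta>))"

(* Some representative of the weak derivative. It is determined up to null sets, and depends
   only on the almost-everywhere class of f, so it can be iterated and used under integrals. *)
definition wderiv :: "(real \<Rightarrow> 'a::euclidean_space) \<Rightarrow> real \<Rightarrow> 'a" where
  "wderiv f = (SOME g. has_weak_deriv f g)"

(* Elements of the Sobolev space H^n of the circle (n \<ge> 1) are given by their unique continuous
   representatives. *)
definition Hspace :: "nat \<Rightarrow> (real \<Rightarrow> 'a::euclidean_space) set" where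
  "Hspace n = {h. periodic h \<and> continuous_on UNIV h \<and>
     (\<exists>g. g 0 = h \<and> (\<forall>j<n. has_weak_deriv (g j) (g (Suc j))) \<and> (\<forall>j\<le>n. g j \<in> L2))}"

definition Hnorm :: "nat \<Rightarrow> (real \<Rightarrow> 'a::euclidean_space) \<Rightarrow> real" where
  "Hnorm n h =
     sqrt (LINT \<theta>|circle_measure. (norm (h \<theta>))\<^sup>2 + (norm ((wderiv ^^ n) h \<theta>))\<^sup>2)"

definition Imm :: "(real \<Rightarrow> 'a::euclidean_space) set" where
  "Imm = {c \<in> Cinf. \<forall>\<theta>. cderiv c \<theta> \<noteq> 0}"

(* For n \<ge> 2 the continuous representative c is of class C^1, so cderiv c is its derivative. *)
definition In :: "nat \<Rightarrow> (real \<Rightarrow> 'a::euclidean_space) set" where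
  "In n = {c \<in> Hspace n. \<forall>\<theta>. cderiv c \<theta> \<noteq> 0}"

definition arc_integral ::
    "(real \<Rightarrow> 'a::euclidean_space) \<Rightarrow> (real \<Rightarrow> real) \<Rightarrow> real" where
  "arc_integral c f = (LINT \<theta>|circle_measure. f \<theta> * norm (cderiv c \<theta>))"

definition curve_length :: "(real \<Rightarrow> 'a::euclidean_space) \<Rightarrow> real" where
  "curve_length c = arc_integral c (\<lambda>_. 1)"

(* The parameter D below is the meaning of the theta-derivative of a vector field along c:
   cderiv for smooth fields and wderiv for Sobolev fields. *)
definition arc_deriv ::
    "((real \<Rightarrow> 'a) \<Rightarrow> real \<Rightarrow> 'a) \<Rightarrow> (real \<Rightarrow> 'a::euclidean_space) \<Rightarrow> (real \<Rightarrow> 'a) \<Rightarrow> real \<Rightarrow> 'a" where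
  "arc_deriv D c h = (\<lambda>\<theta>. D h \<theta> /\<^sub>R norm (cderiv c \<theta>))"

definition metric_coeffs :: "nat \<Rightarrow> (nat \<Rightarrow> real \<Rightarrow> real) \<Rightarrow> bool" where
  "metric_coeffs n a \<longleftrightarrow>
     (\<forall>j\<le>n. smooth_on {0<..} (a j) \<and> (\<forall>l>0. a j l \<ge> 0)) \<and>
     (\<forall>l>0. a 0 l > 0 \<and> a n l > 0)"

definition Gmetric ::
    "((real \<Rightarrow> 'a) \<Rightarrow> real \<Rightarrow> 'a) \<Rightarrow> nat \<Rightarrow> (nat \<Rightarrow> real \<Rightarrow> real) \<Rightarrow>
     (real \<Rightarrow> 'a::euclidean_space) \<Rightarrow> (real \<Rightarrow> 'a) \<Rightarrow> (real \<Rightarrow> 'a) \<Rightarrow> real" where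
  "Gmetric D n a c h k =
     (\<Sum>j\<le>n. arc_integral c
        (\<lambda>\<theta>. a j (curve_length c) * ((arc_deriv D c ^^ j) h \<theta> \<bullet> (arc_deriv D c ^^ j) k \<theta>)))"

abbreviation G_Imm :: "nat \<Rightarrow> (nat \<Rightarrow> real \<Rightarrow> real) \<Rightarrow>
     (real \<Rightarrow> 'a::euclidean_space) \<Rightarrow> (real \<Rightarrow> 'a) \<Rightarrow> (real \<Rightarrow> 'a) \<Rightarrow> real" where
  "G_Imm \<equiv> Gmetric cderiv"

abbreviation G_In :: "nat \<Rightarrow> (nat \<Rightarrow> real \<Rightarrow> real) \<Rightarrow>
     (real \<Rightarrow> 'a::euclidean_space) \<Rightarrow> (real \<Rightarrow> 'a) \<Rightarrow> (real \<Rightarrow> 'a) \<Rightarrow> real" where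
  "G_In \<equiv> Gmetric wderiv"

definition Hnorm_ds_sq ::
    "nat \<Rightarrow> (real \<Rightarrow> 'a::euclidean_space) \<Rightarrow> (real \<Rightarrow> 'a) \<Rightarrow> real" where
  "Hnorm_ds_sq n c h =
     arc_integral c (\<lambda>\<theta>. (norm (h \<theta>))\<^sup>2 + (norm ((arc_deriv cderiv c ^^ n) h \<theta>))\<^sup>2)"

(* Paths in a space of functions are differentiated with respect to the topology given by a set
   P of (semi)norms: all C^k seminorms for the Frechet space of smooth functions, and the single
   H^n norm for the Sobolev space. *)
definition Cinf_seminorms :: "((real \<Rightarrow> 'a::euclidean_space) \<Rightarrow> real) set" where
  "Cinf_seminorms = range (\<lambda>k h. SUP \<theta>\<in>{0..2 * pi}. norm ((cderiv ^^ k) h \<theta>))"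

definition has_path_deriv ::
    "((real \<Rightarrow> 'a::euclidean_space) \<Rightarrow> real) set \<Rightarrow> (real \<Rightarrow> real \<Rightarrow> 'a) \<Rightarrow> (real \<Rightarrow> 'a) \<Rightarrow>
     real \<Rightarrow> real set \<Rightarrow> bool" where
  "has_path_deriv P \<gamma> v t T \<longleftrightarrow>
     (\<forall>p\<in>P. ((\<lambda>s. p (\<lambda>\<theta>. (\<gamma> s \<theta> - \<gamma> t \<theta>) /\<^sub>R (s - t) - v \<theta>)) \<longlongrightarrow> 0) (at t within T))"

(* For a nondegenerate compact interval T; derivatives at its end points are one-sided. *)
definition smooth_path_on ::
    "(real \<Rightarrow> 'a::euclidean_space) set \<Rightarrow> ((real \<Rightarrow> 'a) \<Rightarrow> real) set \<Rightarrow>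
     (real \<Rightarrow> real \<Rightarrow> 'a) \<Rightarrow> real set \<Rightarrow> bool" where
  "smooth_path_on V P \<gamma> T \<longleftrightarrow>
     (\<exists>\<Gamma>. \<Gamma> 0 = \<gamma> \<and>
        (\<forall>k. \<forall>t\<in>T. \<Gamma> k t \<in> V \<and> has_path_deriv P (\<Gamma> k) (\<Gamma> (Suc k) t) t T))"

(* V is the ambient vector space and U the subset in which the path has to stay. *)
definition pw_smooth_paths ::
    "(real \<Rightarrow> 'a::euclidean_space) set \<Rightarrow> ((real \<Rightarrow> 'a) \<Rightarrow> real) set \<Rightarrow> (real \<Rightarrow> 'a) set \<Rightarrow>
     (real \<Rightarrow> 'a) \<Rightarrow> (real \<Rightarrow> 'a) \<Rightarrow> (real \<Rightarrow> real \<Rightarrow> 'a) set" where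
  "pw_smooth_paths V P U c0 c1 =
     {\<gamma>. \<gamma> 0 = c0 \<and> \<gamma> 1 = c1 \<and> (\<forall>t\<in>{0..1}. \<gamma> t \<in> U) \<and>
         (\<exists>m \<tau>. \<tau> 0 = 0 \<and> \<tau> m = 1 \<and>
            (\<forall>i<m. \<tau> i < \<tau> (Suc i) \<and> smooth_path_on V P \<gamma> {\<tau> i..\<tau> (Suc i)}))}"

(* Unspecified at the finitely many break points of a piecewise smooth path; elsewhere the
   derivative is unique. *)
definition velocity ::
    "(real \<Rightarrow> 'a::euclidean_space) set \<Rightarrow> ((real \<Rightarrow> 'a) \<Rightarrow> real) set \<Rightarrow>
     (real \<Rightarrow> real \<Rightarrow> 'a) \<Rightarrow> real \<Rightarrow> real \<Rightarrow> 'a" where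
  "velocity V P \<gamma> t = (SOME v. v \<in> V \<and> has_path_deriv P \<gamma> v t {0..1})"

definition path_len ::
    "(real \<Rightarrow> 'a::euclidean_space) set \<Rightarrow> ((real \<Rightarrow> 'a) \<Rightarrow> real) set \<Rightarrow>
     ((real \<Rightarrow> 'a) \<Rightarrow> (real \<Rightarrow> 'a) \<Rightarrow> (real \<Rightarrow> 'a) \<Rightarrow> real) \<Rightarrow> (real \<Rightarrow> real \<Rightarrow> 'a) \<Rightarrow> real" where
  "path_len V P G \<gamma> =
     (LINT t|lebesgue_on {0..1}. sqrt (G (\<gamma> t) (velocity V P \<gamma> t) (velocity V P \<gamma> t)))"

definition geo_dist ::
    "(real \<Rightarrow> 'a::euclidean_space) set \<Rightarrow> ((real \<Rightarrow> 'a) \<Rightarrow> real) set \<Rightarrow> (real \<Rightarrow> 'a) set \<Rightarrow>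
     ((real \<Rightarrow> 'a) \<Rightarrow> (real \<Rightarrow> 'a) \<Rightarrow> (real \<Rightarrow> 'a) \<Rightarrow> real) \<Rightarrow> (real \<Rightarrow> 'a) \<Rightarrow> (real \<Rightarrow> 'a) \<Rightarrow> ereal" where
  "geo_dist V P U G c0 c1 = (INF \<gamma>\<in>pw_smooth_paths V P U c0 c1. ereal (path_len V P G \<gamma>))"

definition dist_Imm ::
    "nat \<Rightarrow> (nat \<Rightarrow> real \<Rightarrow> real) \<Rightarrow> (real \<Rightarrow> 'a::euclidean_space) \<Rightarrow> (real \<Rightarrow> 'a) \<Rightarrow> ereal" where
  "dist_Imm n a = geo_dist Cinf Cinf_seminorms Imm (G_Imm n a)"

definition dist_In ::
    "nat \<Rightarrow> (nat \<Rightarrow> real \<Rightarrow> real) \<Rightarrow> (real \<Rightarrow> 'a::euclidean_space) \<Rightarrow> (real \<Rightarrow> 'a) \<Rightarrow> ereal" where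
  "dist_In n a = geo_dist (Hspace n) {Hnorm n} (In n) (G_In n a)"

definition ball_Imm ::
    "nat \<Rightarrow> (nat \<Rightarrow> real \<Rightarrow> real) \<Rightarrow> (real \<Rightarrow> 'a::euclidean_space) \<Rightarrow> real \<Rightarrow> (real \<Rightarrow> 'a) set" where
  "ball_Imm n a c0 R = {c \<in> Imm. dist_Imm n a c0 c < ereal R}"

definition ball_In ::
    "nat \<Rightarrow> (nat \<Rightarrow> real \<Rightarrow> real) \<Rightarrow> (real \<Rightarrow> 'a::euclidean_space) \<Rightarrow> real \<Rightarrow> (real \<Rightarrow> 'a) set" where
  "ball_In n a c0 R = {c \<in> In n. dist_In n a c0 c < ereal R}"

end

(* The metric controls the derivative of the length l through
     l^(1/2-k) a_k(l)^(1/2) |dl/dt| <= sqrt (G_c(c_t, c_t)),   1 <= k <= n,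
   by Cauchy-Schwarz and k - 1 Poincare inequalities in arc length, so the divergence of the two
   integrals keeps l away from 0 and from infinity along all paths of bounded G-length. Then the
   L^2(ds) norms of all D_s^j h, j <= n, and the supremum of D_s h are bounded by sqrt (G_c(h, h)).
   Hence log |c'| is Lipschitz with respect to G, which bounds |c'| and 1/|c'|. Writing
   h' = |c'| D_s h, the algebra property of the Sobolev spaces shows that
   ||c'_t||_{H^(m+1)} <= C sqrt (G_c(c_t, c_t)) (1 + ||c'||_{H^(m+1)}) as soon as ||c'||_{H^m} is
   bounded, so that log (1 + ||c'||_{H^(m+1)}) is Lipschitz as well; m < n - 1 steps bound c in H^n,
   and a ball in H^n with |c'| pinched carries the uniform equivalence of norms. A path of smooth
   immersions is also a path in the Sobolev space, of the same length, so smooth balls lie in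
   Sobolev balls. *)

theory Submission
  imports Defs
begin

subsection \<open>Smooth periodic functions\<close>

text \<open>The length, the speed at a point and the Sobolev norms of \<open>c'\<close> need not be
  differentiable along a path. What they share is being seminorms of the curve that the H^n norm
  bounds, so their increments are locally at most their value on the velocity times the elapsed
  time. All Lipschitz estimates run on such local bounds and bisection, for \<Psi> of a seminorm
  with \<Psi> a primitive for the length, \<open>ln\<close> for the speed and ln (1 + y) for the
  Sobolev norms. The logarithm fits because the top derivative enters |p| linearly: its derivative
  is (p / |p|) . p', where p / |p| is needed at the lower order only, so the growth rate is affine
  in the norm to be bounded. What holds at a curve depends on the curves passed on the way to it,
  hence constants are uniform over all times of all paths of length below R. The index k starts at 1
  because the length changes through D_s h, which h alone does not control; lengths near 0 and near
  infinity may be excluded by different k.\<close>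

fun Ck :: "nat \<Rightarrow> (real \<Rightarrow> 'a::real_normed_vector) \<Rightarrow> bool" where
  "Ck 0 f = True"
| "Ck (Suc k) f = ((\<forall>x. f differentiable (at x)) \<and> Ck k (cderiv f))"

text \<open>\<open>smooth_on\<close> iterates \<open>cderiv\<close> from the outside, while the
  recursion of \<open>Ck\<close> removes the innermost derivative first. Inductions on the product
  rule need the latter, as they replace a factor by its derivative and lower the order.\<close>

lemma Ck_iff: "Ck k f \<longleftrightarrow> (\<forall>j<k. \<forall>x. (cderiv ^^ j) f differentiable (at x))"
proof (induction k arbitrary: f)
  case (Suc k)
  have "(\<forall>j<Suc k. \<forall>x. (cderiv ^^ j) f differentiable (at x)) \<longleftrightarrow>
     (\<forall>x. f differentiable (at x)) \<and> (\<forall>j<k. \<forall>x. (cderiv ^^ j) (cderiv f) differentiable (at x))"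
    unfolding All_less_Suc2 by (simp add: funpow_swap1)
  then show ?case using Suc[of "cderiv f"] by simp
qed simp

lemma Cinf_iff: "f \<in> Cinf \<longleftrightarrow> periodic f \<and> (\<forall>k. Ck k f)"
  unfolding Cinf_def smooth_on_def Ck_iff by auto

lemma Cinf_periodic: "f \<in> Cinf \<Longrightarrow> periodic f"
  by (simp add: Cinf_def)

lemma Ck_Suc_lower: "Ck (Suc k) f \<Longrightarrow> Ck k f"
  by (simp add: Ck_iff)

lemma has_vector_derivative_cderiv:
  "f differentiable (at x) \<Longrightarrow> (f has_vector_derivative cderiv f x) (at x)"
  unfolding cderiv_def by (simp add: vector_derivative_works)

lemma cderiv_eqI: "(\<And>x. (f has_vector_derivative g x) (at x)) \<Longrightarrow> cderiv f = g"
  unfolding cderiv_def by (auto intro: vector_derivative_at)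

lemma Ck_SucI:
  assumes "\<And>x. (f has_vector_derivative g x) (at x)" "Ck k g"
  shows "Ck (Suc k) f"
  using assms cderiv_eqI[of f g] by (auto intro: differentiableI_vector)

lemma Cinf_differentiable: "f \<in> Cinf \<Longrightarrow> f differentiable (at x)"
  using Ck.simps(2)[of 0 f] Cinf_iff by blast

lemma Cinf_has_vector_derivative: "f \<in> Cinf \<Longrightarrow> (f has_vector_derivative cderiv f x) (at x)"
  by (simp add: Cinf_differentiable has_vector_derivative_cderiv)

lemma Cinf_continuous_on: "f \<in> Cinf \<Longrightarrow> continuous_on S f"
  by (meson Cinf_differentiable continuous_at_imp_continuous_on differentiable_imp_continuous_within)

text \<open>No differentiability is assumed. The translation shows that both points admit the same
  derivatives, so the choice behind \<open>vector_derivative\<close> is the same, even when there is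
  nothing to choose from.\<close>

lemma periodic_vector_derivative:
  assumes "periodic f" shows "vector_derivative f (at (x + 2 * pi)) = vector_derivative f (at x)"
proof -
  have *: "f \<circ> (\<lambda>y. y + 2 * pi) = f" using assms by (auto simp: periodic_def)
  have **: "f \<circ> (\<lambda>y. y + - 2 * pi) = f"
  proof
    fix x
    have "f ((x + - 2 * pi) + 2 * pi) = f (x + - 2 * pi)" using assms unfolding periodic_def by blast
    then show "(f \<circ> (\<lambda>y. y + - 2 * pi)) x = f x" by simp
  qed
  have "(f has_vector_derivative D) (at (x + 2 * pi)) \<longleftrightarrow> (f has_vector_derivative D) (at x)" for D
  proof
    assume "(f has_vector_derivative D) (at (x + 2 * pi))"
    then have "(f \<circ> (\<lambda>y. y + 2 * pi) has_vector_derivative 1 *\<^sub>R D) (at x)"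
      by (intro vector_diff_chain_at) (auto intro!: derivative_eq_intros)
    then show "(f has_vector_derivative D) (at x)" by (simp add: *)
  next
    assume "(f has_vector_derivative D) (at x)"
    then have "(f \<circ> (\<lambda>y. y + - 2 * pi) has_vector_derivative 1 *\<^sub>R D) (at (x + 2 * pi))"
      by (intro vector_diff_chain_at) (auto intro!: derivative_eq_intros)
    then show "(f has_vector_derivative D) (at (x + 2 * pi))" unfolding ** by simp
  qed
  then show ?thesis unfolding vector_derivative_def by simp
qed

lemma periodic_cderiv: "periodic f \<Longrightarrow> periodic (cderiv f)"
  by (metis cderiv_def periodic_def periodic_vector_derivative)

lemma Cinf_cderiv: "f \<in> Cinf \<Longrightarrow> cderiv f \<in> Cinf"
  using periodic_cderiv Ck.simps(2) unfolding Cinf_iff by blast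

lemma Cinf_funpow_cderiv: "f \<in> Cinf \<Longrightarrow> (cderiv ^^ k) f \<in> Cinf"
  by (induction k) (auto simp: Cinf_cderiv)

lemma Ck_const: "Ck k (\<lambda>x. c)"
proof (induction k arbitrary: c)
  case (Suc k)
  show ?case by (rule Ck_SucI[of _ "\<lambda>x. 0"]) (use Suc in auto)
qed simp

lemma Ck_add: "Ck k f \<Longrightarrow> Ck k g \<Longrightarrow> Ck k (\<lambda>x. f x + g x)"
proof (induction k arbitrary: f g)
  case (Suc k)
  show ?case
    by (rule Ck_SucI[of _ "\<lambda>x. cderiv f x + cderiv g x"])
      (use Suc in \<open>auto intro!: derivative_intros has_vector_derivative_cderiv\<close>)
qed simp

lemma Ck_bilinear:
  assumes B: "bounded_bilinear B"
  shows "Ck k f \<Longrightarrow> Ck k g \<Longrightarrow> Ck k (\<lambda>x. B (f x) (g x))"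
proof (induction k arbitrary: f g)
  case (Suc k)
  have "Ck k (\<lambda>x. B (f x) (cderiv g x) + B (cderiv f x) (g x))"
    using Suc Ck_Suc_lower[OF Suc.prems(1)] Ck_Suc_lower[OF Suc.prems(2)] by (intro Ck_add) auto
  moreover have "((\<lambda>x. B (f x) (g x)) has_vector_derivative B (f x) (cderiv g x) + B (cderiv f x) (g x)) (at x)" for x
    using Suc.prems by (intro bounded_bilinear.has_vector_derivative[OF B] has_vector_derivative_cderiv) auto
  ultimately show ?case by (rule Ck_SucI[rotated])
qed simp

lemma Cinf_bilinear:
  "bounded_bilinear B \<Longrightarrow> f \<in> Cinf \<Longrightarrow> g \<in> Cinf \<Longrightarrow> (\<lambda>x. B (f x) (g x)) \<in> Cinf"
  unfolding Cinf_iff by (simp add: Ck_bilinear periodic_def)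

lemma Cinf_add: "f \<in> Cinf \<Longrightarrow> g \<in> Cinf \<Longrightarrow> (\<lambda>x. f x + g x) \<in> Cinf"
  unfolding Cinf_iff by (simp add: Ck_add periodic_def)

lemma Cinf_const: "(\<lambda>x. c) \<in> Cinf"
  unfolding Cinf_iff by (simp add: Ck_const periodic_def)

lemma Cinf_scaleR: "f \<in> Cinf \<Longrightarrow> (\<lambda>x. r *\<^sub>R f x) \<in> Cinf"
  using Cinf_bilinear[OF bounded_bilinear_scaleR Cinf_const] by blast

lemma Cinf_diff: 
  assumes "f \<in> Cinf" "g \<in> Cinf" shows "(\<lambda>x. f x - g x) \<in> Cinf"
  using Cinf_add[OF assms(1) Cinf_scaleR[OF assms(2), of "-1"]] by simp

lemma Ck_cos_sin: "Ck k (cos::real\<Rightarrow>real) \<and> Ck k (sin::real\<Rightarrow>real)"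
proof (induction k)
  case (Suc k)
  have "Ck k (\<lambda>x::real. - sin x)"
    using Ck_bilinear[OF bounded_bilinear_scaleR Ck_const, of k sin "-1"] Suc by simp
  then have "Ck (Suc k) (cos::real\<Rightarrow>real)"
    by (rule Ck_SucI[rotated]) (auto intro!: derivative_eq_intros simp flip: has_real_derivative_iff_has_vector_derivative)
  moreover have "Ck (Suc k) (sin::real\<Rightarrow>real)"
    using Suc by (intro Ck_SucI[of _ cos]) (auto intro!: derivative_eq_intros simp flip: has_real_derivative_iff_has_vector_derivative)
  ultimately show ?case by blast
qed simp

lemma Cinf_cos: "(cos::real\<Rightarrow>real) \<in> Cinf" and Cinf_sin: "(sin::real\<Rightarrow>real) \<in> Cinf"
  by (simp_all add: Cinf_iff Ck_cos_sin periodic_def)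

lemma has_vector_derivative_inverse_norm:
  fixes p :: "real \<Rightarrow> 'a::real_inner"
  assumes "(p has_vector_derivative p') (at x)" "p x \<noteq> 0"
  shows "((\<lambda>x. inverse (norm (p x))) has_vector_derivative - ((inverse (norm (p x)))^3 * (p' \<bullet> p x))) (at x)"
proof -
  have q: "((\<lambda>x. p x \<bullet> p x) has_real_derivative 2 * (p' \<bullet> p x)) (at x)"
    unfolding has_real_derivative_iff_has_vector_derivative
    using bounded_bilinear.has_vector_derivative[OF bounded_bilinear_inner assms(1) assms(1)]
    by (simp add: inner_commute)
  have pos: "p x \<bullet> p x > 0" using assms(2) by simp
  have "((\<lambda>x. inverse (sqrt (p x \<bullet> p x))) has_real_derivative
     - (inverse (sqrt (p x \<bullet> p x)) * (2 * (p' \<bullet> p x) * (inverse (sqrt (p x \<bullet> p x)) / 2)) * inverse (sqrt (p x \<bullet> p x)))) (at x)"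
    using pos q inner_ge_zero[of "p x"] by (auto intro!: derivative_eq_intros simp del: inner_ge_zero)
  then show ?thesis
    unfolding has_real_derivative_iff_has_vector_derivative norm_eq_sqrt_inner
    by (simp add: power3_eq_cube mult_ac)
qed

text \<open>The derivative of 1/|p| is a polynomial in 1/|p|, p and p', so the induction meets no
  functions other than these three, each at the lower order.\<close>

lemma Ck_inverse_norm:
  fixes p :: "real \<Rightarrow> 'a::real_inner"
  assumes nz: "\<And>x. p x \<noteq> 0"
  shows "Ck k p \<Longrightarrow> Ck k (\<lambda>x. inverse (norm (p x)))"
proof (induction k)
  case (Suc k)
  let ?w = "\<lambda>x. inverse (norm (p x))"
  have w: "Ck k ?w" and p: "Ck k p" and p': "Ck k (cderiv p)"
    using Suc Ck_Suc_lower by auto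
  have "Ck k (\<lambda>x. (- 1) *\<^sub>R ((?w x * ?w x * ?w x) * (cderiv p x \<bullet> p x)))"
    by (intro Ck_bilinear[OF bounded_bilinear_scaleR Ck_const] Ck_bilinear[OF bounded_bilinear_mult]
        Ck_bilinear[OF bounded_bilinear_inner] w p p')
  moreover have "(?w has_vector_derivative (- 1) *\<^sub>R ((?w x * ?w x * ?w x) * (cderiv p x \<bullet> p x))) (at x)" for x
    using has_vector_derivative_inverse_norm[of p "cderiv p x" x] has_vector_derivative_cderiv[of p x] nz Suc.prems
    by (simp add: power3_eq_cube)
  ultimately show ?case by (rule Ck_SucI[rotated])
qed simp

lemma Cinf_inverse_norm:
  fixes p :: "real \<Rightarrow> 'a::real_inner"
  assumes "p \<in> Cinf" "\<And>x. p x \<noteq> 0"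
  shows "(\<lambda>x. inverse (norm (p x))) \<in> Cinf"
  using assms Ck_inverse_norm[of p] unfolding Cinf_iff by (simp add: periodic_def)

subsection \<open>The fundamental lemma of the calculus of variations\<close>

text \<open>Transported to the unit circle by \<open>cis\<close>, this is Stone-Weierstrass:
  polynomials in real and imaginary part pull back to polynomials in cos and sin, which are smooth
  and periodic.\<close>

lemma smooth_uniform_approximation:
  fixes \<psi> :: "real \<Rightarrow> real"
  assumes c: "continuous_on {0..2*pi} \<psi>" and e: "\<psi> 0 = \<psi> (2 * pi)" "\<epsilon> > 0"
  shows "\<exists>\<phi>\<in>Cinf. \<forall>x\<in>{0..2*pi}. \<bar>\<psi> x - \<phi> x\<bar> < \<epsilon>"
proof -
  define F where "F = (\<lambda>z. \<psi> (Arg2pi z))"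
  have Fcis: "F (cis x) = \<psi> x" if "x \<in> {0..2*pi}" for x
  proof (cases "x = 2 * pi")
    case True
    then show ?thesis using e by (simp add: F_def cis_2pi Arg2pi_of_real[of 1, simplified])
  next
    case False
    then have "Arg2pi (cis x) = x" using that by (intro Arg2pi_unique[of 1]) (auto simp: cis_conv_exp)
    then show ?thesis by (simp add: F_def)
  qed
  have surj: "\<exists>x\<in>{0..2*pi}. z = cis x" if "z \<in> sphere 0 1" for z :: complex
    using that Arg2pi_eq[of z] Arg2pi_ge_0[of z] Arg2pi_lt_2pi[of z]
    by (intro bexI[of _ "Arg2pi z"]) (auto simp: cis_conv_exp)
  \<comment> \<open>\<open>Arg2pi\<close> jumps at 1, so F is not continuous by composition. The
    preimage of a closed set is instead the \<open>cis\<close> image of a compact set of parameters,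
    hence closed.\<close>
  have contF: "continuous_on (sphere 0 1) F"
    unfolding continuous_on_closed_vimage[OF closed_sphere]
  proof (intro allI impI)
    fix B :: "real set" assume B: "closed B"
    have "F -` B \<inter> sphere 0 1 = cis ` {x \<in> {0..2*pi}. \<psi> x \<in> B}"
    proof (intro set_eqI iffI)
      fix z assume z: "z \<in> F -` B \<inter> sphere 0 1"
      then obtain x where "x \<in> {0..2*pi}" "z = cis x" using surj by blast
      then show "z \<in> cis ` {x \<in> {0..2*pi}. \<psi> x \<in> B}" using z Fcis[of x] by auto
    next
      fix z assume "z \<in> cis ` {x \<in> {0..2*pi}. \<psi> x \<in> B}"
      then obtain x where "x \<in> {0..2*pi}" "z = cis x" "\<psi> x \<in> B" by blast
      then show "z \<in> F -` B \<inter> sphere 0 1" using Fcis[of x] by auto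
    qed
    moreover have "{x \<in> {0..2*pi}. \<psi> x \<in> B} = {0..2*pi} \<inter> \<psi> -` B" by auto
    then have "closed {x \<in> {0..2*pi}. \<psi> x \<in> B}"
      using continuous_closed_preimage[OF c closed_atLeastAtMost B] by simp
    then have "compact {x \<in> {0..2*pi}. \<psi> x \<in> B}"
      unfolding compact_eq_bounded_closed
      by (intro conjI bounded_subset[OF bounded_closed_interval[of 0 "2*pi"]]) auto
    then have "compact (cis ` {x \<in> {0..2*pi}. \<psi> x \<in> B})"
      by (intro compact_continuous_image continuous_intros) auto
    ultimately show "closed (F -` B \<inter> sphere 0 1)" by (simp add: compact_imp_closed)
  qed
  obtain g where g: "real_polynomial_function g" "\<And>z. z \<in> sphere 0 1 \<Longrightarrow> \<bar>F z - g z\<bar> < \<epsilon>"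
    using Stone_Weierstrass_real_polynomial_function[OF compact_sphere contF e(2)] by blast
  have "(\<lambda>x. g (cis x)) \<in> Cinf" using g(1)
  proof induction
    case (linear f)
    have "f (cis x) = cos x *\<^sub>R f 1 + sin x *\<^sub>R f \<i>" for x
    proof -
      have "cis x = cos x *\<^sub>R 1 + sin x *\<^sub>R \<i>" by (simp add: complex_eq_iff)
      then show ?thesis using linear by (metis bounded_linear.linear linear_add linear_scale)
    qed
    then have "(\<lambda>x. f (cis x)) = (\<lambda>x. cos x *\<^sub>R f 1 + sin x *\<^sub>R f \<i>)" by auto
    show ?case
      unfolding \<open>(\<lambda>x. f (cis x)) = _\<close>
      by (intro Cinf_add Cinf_bilinear[OF bounded_bilinear_scaleR] Cinf_cos Cinf_sin Cinf_const)
  next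
    case (mult f g)
    then show ?case by (intro Cinf_bilinear[OF bounded_bilinear_mult])
  qed (auto intro: Cinf_const Cinf_add)
  moreover have "\<forall>x\<in>{0..2*pi}. \<bar>\<psi> x - g (cis x)\<bar> < \<epsilon>"
    using g(2)[of "cis _"] Fcis by (metis dist_0_norm mem_sphere norm_cis)
  ultimately show ?thesis by (intro bexI[of _ "\<lambda>x. g (cis x)"])
qed

lemma integrable_bounded_scaleR:
  fixes f :: "'a \<Rightarrow> 'b::{banach, second_countable_topology}" and \<phi> :: "'a \<Rightarrow> real"
  assumes "integrable M f" "\<phi> \<in> borel_measurable M" "\<And>x. x \<in> space M \<Longrightarrow> \<bar>\<phi> x\<bar> \<le> K"
  shows "integrable M (\<lambda>x. \<phi> x *\<^sub>R f x)"
proof (rule Bochner_Integration.integrable_bound)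
  show "integrable M (\<lambda>x. K * norm (f x))" using assms(1) by simp
  show "(\<lambda>x. \<phi> x *\<^sub>R f x) \<in> borel_measurable M" using assms by measurable
  show "AE x in M. norm (\<phi> x *\<^sub>R f x) \<le> norm (K * norm (f x))"
    using assms(3) by (intro AE_I2) (auto simp: abs_mult intro!: mult_right_mono order_trans[OF _ abs_ge_self])
qed

lemma continuous_on_borel_circle:
  fixes f :: "real \<Rightarrow> 'b::euclidean_space"
  shows "continuous_on {0..2*pi} f \<Longrightarrow> f \<in> borel_measurable circle_measure"
  by (rule continuous_imp_measurable_on_sets_lebesgue) auto

lemma integrable_continuous_scaleR:
  fixes f :: "real \<Rightarrow> 'b::euclidean_space" and \<phi> :: "real \<Rightarrow> real"
  assumes "integrable circle_measure f" "continuous_on {0..2*pi} \<phi>"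
  shows "integrable circle_measure (\<lambda>x. \<phi> x *\<^sub>R f x)"
proof -
  have "compact (\<phi> ` {0..2*pi})" using assms(2) by (intro compact_continuous_image) auto
  then obtain K where "\<forall>y\<in>\<phi> ` {0..2*pi}. norm y \<le> K" by (meson compact_imp_bounded bounded_iff)
  then show ?thesis
    using assms by (intro integrable_bounded_scaleR[of _ _ _ K] continuous_on_borel_circle) auto
qed

text \<open>Replacing \<psi> by a smooth test function costs at most their uniform distance times
  the L^1 norm of f, and the distance can be made arbitrarily small.\<close>

lemma integral_continuous_test_eq_0:
  fixes f :: "real \<Rightarrow> 'b::euclidean_space"
  assumes f: "integrable circle_measure f"
    and test: "\<And>\<phi>::real\<Rightarrow>real. \<phi> \<in> Cinf \<Longrightarrow> (LINT x|circle_measure. \<phi> x *\<^sub>R f x) = 0"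
    and c: "continuous_on {0..2*pi} \<psi>" "\<psi> 0 = \<psi> (2 * pi)"
  shows "(LINT x|circle_measure. \<psi> x *\<^sub>R f x) = 0"
proof -
  let ?I = "LINT x|circle_measure. norm (f x)"
  have "norm (LINT x|circle_measure. \<psi> x *\<^sub>R f x) \<le> e * ?I" if e: "e > 0" for e :: real
  proof -
    obtain \<phi> where \<phi>: "\<phi> \<in> Cinf" "\<And>x. x\<in>{0..2*pi} \<Longrightarrow> \<bar>\<psi> x - \<phi> x\<bar> < e"
      using smooth_uniform_approximation[OF c e] by blast
    have i: "integrable circle_measure (\<lambda>x. \<psi> x *\<^sub>R f x)" "integrable circle_measure (\<lambda>x. \<phi> x *\<^sub>R f x)"
      using f c \<phi>(1) by (auto intro!: integrable_continuous_scaleR Cinf_continuous_on)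
    have "(LINT x|circle_measure. \<psi> x *\<^sub>R f x) = (LINT x|circle_measure. \<psi> x *\<^sub>R f x - \<phi> x *\<^sub>R f x)"
      using test[OF \<phi>(1)] i by simp
    also have "norm \<dots> \<le> (LINT x|circle_measure. e * norm (f x))"
    proof (rule order_trans[OF integral_norm_bound integral_mono])
      show "integrable circle_measure (\<lambda>x. norm (\<psi> x *\<^sub>R f x - \<phi> x *\<^sub>R f x))" using i by simp
      show "integrable circle_measure (\<lambda>x. e * norm (f x))" using f by simp
      show "norm (\<psi> x *\<^sub>R f x - \<phi> x *\<^sub>R f x) \<le> e * norm (f x)" if "x \<in> space circle_measure" for x
        using \<phi>(2)[of x] that unfolding scaleR_left_diff_distrib[symmetric] norm_scaleR
        by (intro mult_right_mono) auto
    qed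
    finally show ?thesis by simp
  qed
  moreover have "?I \<ge> 0" by simp
  ultimately have "norm (LINT x|circle_measure. \<psi> x *\<^sub>R f x) \<le> 0 + \<epsilon>" if "\<epsilon> > 0" for \<epsilon>
  proof -
    have "norm (LINT x|circle_measure. \<psi> x *\<^sub>R f x) \<le> \<epsilon> / (?I + 1) * ?I"
      using \<open>?I \<ge> 0\<close> that \<open>\<And>e. e > 0 \<Longrightarrow> _ \<le> e * ?I\<close>[of "\<epsilon> / (?I + 1)"] by (simp add: add_nonneg_pos)
    also have "\<dots> \<le> \<epsilon>" using \<open>?I \<ge> 0\<close> that
      by (simp add: divide_le_eq distrib_left add_nonneg_pos)
    finally show ?thesis by simp
  qed
  then have "norm (LINT x|circle_measure. \<psi> x *\<^sub>R f x) \<le> 0" by (rule field_le_epsilon)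
  then show ?thesis by simp
qed

text \<open>The ideal test function is sgn f, which turns the integral into that of |f|.
  Measurability provides continuous functions that converge to it almost everywhere, and dominated
  convergence with majorant |f| passes to the limit.\<close>

lemma fundamental_lemma_real:
  fixes f :: "real \<Rightarrow> real"
  assumes f: "integrable circle_measure f"
    and test: "\<And>\<phi>::real\<Rightarrow>real. \<phi> \<in> Cinf \<Longrightarrow> (LINT x|circle_measure. \<phi> x *\<^sub>R f x) = 0"
  shows "AE x in circle_measure. f x = 0"
proof -
  have fm: "f \<in> borel_measurable circle_measure" using f by simp
  have "(\<lambda>x. sgn (f x)) \<in> borel_measurable circle_measure"
    using measurable_comp[OF fm borel_measurable_sgn] by (simp add: comp_def)
  then have "(\<lambda>x. sgn (f x)) measurable_on {0..2*pi}"
    by (simp add: measurable_on_iff_borel_measurable)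
  then obtain N g where N: "negligible N" and g: "\<And>n::nat. continuous_on UNIV (g n)"
    and lim: "\<And>x. x \<notin> N \<Longrightarrow> (\<lambda>n. g n x) \<longlonglongrightarrow> (if x \<in> {0..2*pi} then sgn (f x) else 0)"
    unfolding measurable_on_def by blast
  \<comment> \<open>\<open>cut\<close> vanishes at both ends of the interval and tends to 1 inside,
    which makes the end values of \<open>\<psi> n\<close> agree; the truncation to [-1, 1] in the
    next line gives the domination.\<close>
  define cut where "cut n x = min 1 (real n * min x (2 * pi - x))" for n x
  define \<psi> where "\<psi> n x = cut n x * max (-1) (min 1 (g n x))" for n x
  have cont: "continuous_on S (\<psi> n)" for n S
    unfolding \<psi>_def cut_def by (intro continuous_intros continuous_on_subset[OF g]) auto
  have b: "\<bar>\<psi> n x\<bar> \<le> 1" if "x \<in> {0..2*pi}" for n x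
  proof -
    have "0 \<le> cut n x" "cut n x \<le> 1" using that by (auto simp: cut_def)
    then show ?thesis unfolding \<psi>_def abs_mult
      by (intro mult_le_one) auto
  qed
  have ends: "\<psi> n 0 = \<psi> n (2 * pi)" for n by (simp add: \<psi>_def cut_def)
  have "(\<lambda>n. LINT x|circle_measure. \<psi> n x *\<^sub>R f x) \<longlonglongrightarrow> (LINT x|circle_measure. norm (f x))"
  proof (rule integral_dominated_convergence)
    show "(\<lambda>x. norm (f x)) \<in> borel_measurable circle_measure" "\<And>n. (\<lambda>x. \<psi> n x *\<^sub>R f x) \<in> borel_measurable circle_measure"
      using fm continuous_on_borel_circle[OF cont] by measurable
    show "integrable circle_measure (\<lambda>x. norm (f x))" using f by simp
    show "AE x in circle_measure. norm (\<psi> n x *\<^sub>R f x) \<le> norm (f x)" for n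
      using b[of _ n] by (intro AE_I2) (auto simp: abs_mult intro: mult_left_le_one_le)
    have "negligible (N \<union> {0, 2*pi})" using N by (simp add: negligible_Un)
    then have "AE x in lebesgue. x \<notin> N \<union> {0, 2*pi}"
      unfolding negligible_iff_null_sets by (rule AE_not_in)
    then have "AE x in circle_measure. x \<notin> N \<union> {0, 2*pi}"
      by (subst AE_restrict_space_iff) auto
    moreover have "AE x in circle_measure. x \<in> {0..2*pi}" by (rule AE_I2) auto
    ultimately show "AE x in circle_measure. (\<lambda>n. \<psi> n x *\<^sub>R f x) \<longlonglongrightarrow> norm (f x)"
    proof eventually_elim
      case (elim x)
      then have x: "0 < min x (2 * pi - x)" by auto
      have "eventually (\<lambda>n. cut n x = 1) sequentially"
      proof -
        obtain k where k: "1 / min x (2*pi - x) < real k" using reals_Archimedean2 by blast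
        have "cut n x = 1" if "n \<ge> k" for n
        proof -
          have "1 / min x (2*pi - x) < real n" using k that by linarith
          then have "1 < real n * min x (2*pi - x)" using x by (simp add: field_simps)
          then show ?thesis by (simp add: cut_def)
        qed
        then show ?thesis by (auto simp: eventually_sequentially)
      qed
      then have l1: "(\<lambda>n. cut n x) \<longlonglongrightarrow> 1" by (rule tendsto_eventually)
      have "(\<lambda>n. max (-1) (min 1 (g n x))) \<longlonglongrightarrow> max (-1) (min 1 (sgn (f x)))"
        using lim[of x] elim by (intro tendsto_intros) auto
      also have "max (-1) (min 1 (sgn (f x))) = sgn (f x)" by (auto simp: sgn_if)
      finally have "(\<lambda>n. \<psi> n x *\<^sub>R f x) \<longlonglongrightarrow> (1 * sgn (f x)) *\<^sub>R f x"
        unfolding \<psi>_def by (intro tendsto_intros l1)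
      moreover have "(1 * sgn (f x)) *\<^sub>R f x = norm (f x)" by (simp add: sgn_if)
      ultimately show ?case by simp
    qed
  qed
  moreover have "(LINT x|circle_measure. \<psi> n x *\<^sub>R f x) = 0" for n
    using integral_continuous_test_eq_0[OF f test cont ends] by blast
  ultimately have "(LINT x|circle_measure. norm (f x)) = 0"
    by (simp add: LIMSEQ_const_iff)
  then show ?thesis using f
    by (subst (asm) integral_nonneg_eq_0_iff_AE) auto
qed

lemma fundamental_lemma:
  fixes f :: "real \<Rightarrow> 'b::euclidean_space"
  assumes f: "integrable circle_measure f"
    and test: "\<And>\<phi>::real\<Rightarrow>real. \<phi> \<in> Cinf \<Longrightarrow> (LINT x|circle_measure. \<phi> x *\<^sub>R f x) = 0"
  shows "AE x in circle_measure. f x = 0"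
proof -
  have "AE x in circle_measure. f x \<bullet> b = 0" if "b \<in> Basis" for b
  proof (rule fundamental_lemma_real)
    show "integrable circle_measure (\<lambda>x. f x \<bullet> b)" using f by simp
    fix \<phi> :: "real \<Rightarrow> real" assume \<phi>: "\<phi> \<in> Cinf"
    have "integrable circle_measure (\<lambda>x. \<phi> x *\<^sub>R f x)"
      by (intro integrable_continuous_scaleR f Cinf_continuous_on \<phi>)
    then have "(LINT x|circle_measure. (\<phi> x *\<^sub>R f x) \<bullet> b) = (LINT x|circle_measure. \<phi> x *\<^sub>R f x) \<bullet> b"
      by (intro integral_inner_left)
    then show "(LINT x|circle_measure. \<phi> x *\<^sub>R (f x \<bullet> b)) = 0" by (simp add: test[OF \<phi>])
  qed
  then have "AE x in circle_measure. \<forall>b\<in>Basis. f x \<bullet> b = 0" by (simp add: AE_ball_countable countable_finite)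
  then show ?thesis by eventually_elim (simp add: euclidean_all_zero_iff)
qed

subsection \<open>Absolutely continuous functions\<close>

text \<open>Absolute continuity in integrated form, with g as density. Nothing is differentiated,
  changing g on a null set is harmless, and f is constrained on one period only.\<close>

definition acd :: "(real \<Rightarrow> 'a::euclidean_space) \<Rightarrow> (real \<Rightarrow> 'a) \<Rightarrow> bool" where
  "acd f g \<longleftrightarrow> g absolutely_integrable_on {0..2*pi} \<and>
     (\<forall>x\<in>{0..2*pi}. f x = f 0 + integral {0..x} g)"

lemma acdI:
  "g absolutely_integrable_on {0..2*pi} \<Longrightarrow> (\<And>x. x \<in> {0..2*pi} \<Longrightarrow> f x = f 0 + integral {0..x} g) \<Longrightarrow> acd f g"
  unfolding acd_def by blast

lemma acd_eq: "acd f g \<Longrightarrow> x \<in> {0..2*pi} \<Longrightarrow> f x = f 0 + integral {0..x} g"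
  unfolding acd_def by blast

lemma acd_integrable: "acd f g \<Longrightarrow> g absolutely_integrable_on {0..2*pi}"
  unfolding acd_def by blast

lemma absolutely_integrable_circle_iff:
  fixes f :: "real \<Rightarrow> 'a::euclidean_space"
  shows "f absolutely_integrable_on {0..2*pi} \<longleftrightarrow> integrable circle_measure f"
  by (simp add: integrable_restrict_space set_integrable_def)

lemma circle_integral_eq:
  fixes f :: "real \<Rightarrow> 'a::euclidean_space"
  shows "integrable circle_measure f \<Longrightarrow> (LINT x|circle_measure. f x) = integral {0..2*pi} f"
  by (rule lebesgue_integral_eq_integral) auto

lemma absolutely_integrable_subinterval:
  fixes g :: "real \<Rightarrow> 'a::euclidean_space"
  assumes "g absolutely_integrable_on {0..2*pi}" "0 \<le> x" "y \<le> 2*pi"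
  shows "g absolutely_integrable_on {x..y}"
  using assms by (intro set_integrable_subset[OF assms(1)]) auto

lemma integrable_subinterval_circle:
  fixes g :: "real \<Rightarrow> 'a::euclidean_space"
  assumes "g absolutely_integrable_on {0..2*pi}" "0 \<le> x" "y \<le> 2*pi"
  shows "g integrable_on {x..y}" "(\<lambda>t. norm (g t)) integrable_on {x..y}"
  using absolutely_integrable_subinterval[OF assms] by (auto simp: absolutely_integrable_on_def)

lemma acd_diff:
  assumes "acd f g" "0 \<le> x" "x \<le> y" "y \<le> 2*pi"
  shows "f y - f x = integral {x..y} g"
proof -
  have "integral {0..x} g + integral {x..y} g = integral {0..y} g"
    using assms(2-) integrable_subinterval_circle[OF acd_integrable[OF assms(1)], of 0 y]
    by (intro Henstock_Kurzweil_Integration.integral_combine) auto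
  moreover have "f y = f 0 + integral {0..y} g" "f x = f 0 + integral {0..x} g"
    using assms(2-) by (auto intro!: acd_eq[OF assms(1)])
  ultimately show ?thesis by (metis add_diff_cancel_left add_diff_cancel_left')
qed

lemma acd_continuous: 
  assumes "acd f g" shows "continuous_on {0..2*pi} f"
proof -
  have "continuous_on {0..2*pi} (\<lambda>x. f 0 + integral {0..x} g)"
    using integrable_subinterval_circle[OF acd_integrable[OF assms], of 0 "2*pi"]
    by (intro continuous_intros indefinite_integral_continuous_1) auto
  then show ?thesis by (rule continuous_on_eq) (rule acd_eq[OF assms, symmetric])
qed

lemma acd_C1:
  assumes "\<And>x. x \<in> {0..2*pi} \<Longrightarrow> (f has_vector_derivative g x) (at x within {0..2*pi})"
    "continuous_on {0..2*pi} g"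
  shows "acd f g"
proof (rule acdI)
  show "g absolutely_integrable_on {0..2*pi}"
    by (rule absolutely_integrable_continuous_real[OF assms(2)])
  fix x assume x: "x \<in> {0..2*pi}"
  have "(g has_integral (f x - f 0)) {0..x}"
    using x by (intro fundamental_theorem_of_calculus has_vector_derivative_within_subset[OF assms(1)]) auto
  then show "f x = f 0 + integral {0..x} g" by (simp add: integral_unique)
qed

lemma acd_Cinf: "f \<in> Cinf \<Longrightarrow> acd f (cderiv f)"
  by (intro acd_C1 has_vector_derivative_at_within[OF Cinf_has_vector_derivative]
      Cinf_continuous_on Cinf_cderiv)

text \<open>The local estimates are added up by bisection; this replaces Fubini and differentiation
  almost everywhere in the product and chain rules below.\<close>

lemma eq_if_locally_dominated:
  fixes H :: "real \<Rightarrow> 'b::real_normed_vector" and \<alpha> :: "real \<Rightarrow> real"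
  assumes \<alpha>: "\<alpha> absolutely_integrable_on {0..2*pi}"
    and loc: "\<And>\<epsilon>. \<epsilon> > 0 \<Longrightarrow> \<exists>d>0. \<forall>a b. 0 \<le> a \<and> a \<le> b \<and> b \<le> 2*pi \<and> b - a < d \<longrightarrow>
       norm (H b - H a) \<le> \<epsilon> * integral {a..b} \<alpha>"
    and y: "y \<in> {0..2*pi}"
  shows "H y = H 0"
proof -
  have *: "norm (H y - H 0) \<le> \<epsilon> * integral {0..y} \<alpha>" if e: "\<epsilon> > 0" for \<epsilon>
  proof -
    have "0 \<le> (0::real) \<and> y \<le> 2*pi \<longrightarrow> norm (H y - H 0) \<le> \<epsilon> * integral {0..y} \<alpha>"
    proof (rule Bolzano[where P = "\<lambda>a b. 0 \<le> a \<and> b \<le> 2*pi \<longrightarrow> norm (H b - H a) \<le> \<epsilon> * integral {a..b} \<alpha>"])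
      show "0 \<le> y" using y by simp
      fix a b c :: real
      assume ab: "0 \<le> a \<and> b \<le> 2*pi \<longrightarrow> norm (H b - H a) \<le> \<epsilon> * integral {a..b} \<alpha>"
        and bc: "0 \<le> b \<and> c \<le> 2*pi \<longrightarrow> norm (H c - H b) \<le> \<epsilon> * integral {b..c} \<alpha>"
        and "a \<le> b" "b \<le> c"
      show "0 \<le> a \<and> c \<le> 2*pi \<longrightarrow> norm (H c - H a) \<le> \<epsilon> * integral {a..c} \<alpha>"
      proof
        assume ac: "0 \<le> a \<and> c \<le> 2*pi"
        have "integral {a..b} \<alpha> + integral {b..c} \<alpha> = integral {a..c} \<alpha>"
          using ac \<open>a \<le> b\<close> \<open>b \<le> c\<close> integrable_subinterval_circle[OF \<alpha>, of a c]
          by (intro Henstock_Kurzweil_Integration.integral_combine) auto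
        moreover have "norm (H c - H a) \<le> norm (H c - H b) + norm (H b - H a)"
          by (metis diff_add_cancel add_diff_eq norm_triangle_ineq)
        ultimately show "norm (H c - H a) \<le> \<epsilon> * integral {a..c} \<alpha>"
          using ab bc ac \<open>a \<le> b\<close> \<open>b \<le> c\<close> by (auto simp flip: \<open>_ = integral {a..c} \<alpha>\<close> simp: distrib_left)
      qed
    next
      fix x :: real
      obtain d where "d > 0" "\<forall>a b. 0 \<le> a \<and> a \<le> b \<and> b \<le> 2*pi \<and> b - a < d \<longrightarrow>
       norm (H b - H a) \<le> \<epsilon> * integral {a..b} \<alpha>" using loc[OF e] by blast
      then show "\<exists>d>0. \<forall>a b. a \<le> x \<and> x \<le> b \<and> b - a < d \<longrightarrow> 
         0 \<le> a \<and> b \<le> 2*pi \<longrightarrow> norm (H b - H a) \<le> \<epsilon> * integral {a..b} \<alpha>"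
        by (intro exI[of _ d]) auto
    qed
    then show ?thesis using y by simp
  qed
  have "norm (H y - H 0) \<le> 0 + e" if "e > 0" for e
  proof -
    define A where "A = \<bar>integral {0..y} \<alpha>\<bar> + 1"
    have "A > 0" by (simp add: A_def add_nonneg_pos)
    have "norm (H y - H 0) \<le> e / A * integral {0..y} \<alpha>" using that \<open>A > 0\<close> by (intro *) simp
    also have "\<dots> \<le> e / A * A" using that \<open>A > 0\<close> by (intro mult_left_mono) (auto simp: A_def)
    finally show ?thesis using \<open>A > 0\<close> by simp
  qed
  then have "norm (H y - H 0) \<le> 0" by (rule field_le_epsilon)
  then show ?thesis by simp
qed

lemma continuous_bilinear_absolutely_integrable:
  fixes f :: "real \<Rightarrow> 'a::euclidean_space" and g :: "real \<Rightarrow> 'b::euclidean_space" 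
    and B :: "'a \<Rightarrow> 'b \<Rightarrow> 'c::euclidean_space"
  assumes B: "bounded_bilinear B" and f: "continuous_on {x..y} f" and g: "g absolutely_integrable_on {x..y}"
  shows "(\<lambda>t. B (f t) (g t)) absolutely_integrable_on {x..y}"
proof (rule absolutely_integrable_bounded_measurable_product[OF bilinear_conv_bounded_bilinear[THEN iffD2, OF B]])
  show "f \<in> borel_measurable (lebesgue_on {x..y})" 
    by (rule continuous_imp_measurable_on_sets_lebesgue[OF f]) auto
  show "bounded (f ` {x..y})" using f by (intro compact_imp_bounded compact_continuous_image) auto
qed (use g in auto)

lemma continuous_on_circle_modulus:
  fixes f :: "real \<Rightarrow> 'a::real_normed_vector"
  assumes "continuous_on {0..2*pi} f" "e > 0"
  obtains d where "d > 0" "\<And>x y. x \<in> {0..2*pi} \<Longrightarrow> y \<in> {0..2*pi} \<Longrightarrow> \<bar>y - x\<bar> < d \<Longrightarrow> norm (f y - f x) \<le> e"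
proof -
  have "uniformly_continuous_on {0..2*pi} f" using assms by (intro compact_uniformly_continuous) auto
  then obtain d where "d > 0" "\<forall>x\<in>{0..2*pi}. \<forall>y\<in>{0..2*pi}. dist y x < d \<longrightarrow> dist (f y) (f x) < e"
    using assms(2) unfolding uniformly_continuous_on_def by blast
  then show thesis using that[of d] by (force simp: dist_norm)
qed

text \<open>On [a, b] the increment of B(f, g) minus the integral of the product rule is the
  integral of B(f', g(b) - g) + B(f(a) - f, g'). Uniform continuity makes the differences small on
  short intervals, which leaves a small multiple of the integral of |f'| + |g'|.\<close>

lemma acd_bilinear:
  fixes f :: "real \<Rightarrow> 'a::euclidean_space" and g :: "real \<Rightarrow> 'b::euclidean_space" 
    and B :: "'a \<Rightarrow> 'b \<Rightarrow> 'c::euclidean_space"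
  assumes B: "bounded_bilinear B" and f: "acd f f'" and g: "acd g g'"
  shows "acd (\<lambda>x. B (f x) (g x)) (\<lambda>x. B (f x) (g' x) + B (f' x) (g x))"
proof -
  interpret B: bounded_bilinear B by fact
  have cf: "continuous_on {0..2*pi} f" and cg: "continuous_on {0..2*pi} g"
    using f g acd_continuous by auto
  have f': "f' absolutely_integrable_on {0..2*pi}" and g': "g' absolutely_integrable_on {0..2*pi}"
    using f g by (auto intro: acd_integrable)
  have i1: "(\<lambda>x. B (f x) (g' x)) absolutely_integrable_on {0..2*pi}"
    by (rule continuous_bilinear_absolutely_integrable[OF B cf g'])
  have i2: "(\<lambda>x. B (f' x) (g x)) absolutely_integrable_on {0..2*pi}"
    by (rule continuous_bilinear_absolutely_integrable[OF B.flip cg f'])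
  let ?D = "\<lambda>x. B (f x) (g' x) + B (f' x) (g x)"
  have i: "?D absolutely_integrable_on {0..2*pi}" using i1 i2 by (rule set_integral_add)
  define H where "H x = B (f x) (g x) - integral {0..x} ?D" for x
  obtain K where K: "K > 0" "\<And>a b. norm (B a b) \<le> norm a * norm b * K" using B.pos_bounded by blast
  let ?\<alpha> = "\<lambda>t. norm (f' t) + norm (g' t)"
  have \<alpha>: "?\<alpha> absolutely_integrable_on {0..2*pi}"
    using f' g' by (intro set_integral_add absolutely_integrable_norm[unfolded comp_def])
  have "H y = H 0" if "y \<in> {0..2*pi}" for y
  proof (rule eq_if_locally_dominated[OF \<alpha> _ that])
    fix \<epsilon> :: real assume "\<epsilon> > 0"
    define e where "e = \<epsilon> / K"
    have e: "e > 0" using \<open>\<epsilon> > 0\<close> K by (simp add: e_def)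
    obtain d1 where d1: "d1 > 0" "\<And>x y. x \<in> {0..2*pi} \<Longrightarrow> y \<in> {0..2*pi} \<Longrightarrow> \<bar>y - x\<bar> < d1 \<Longrightarrow> norm (f y - f x) \<le> e"
      using continuous_on_circle_modulus[OF cf e] by blast
    obtain d2 where d2: "d2 > 0" "\<And>x y. x \<in> {0..2*pi} \<Longrightarrow> y \<in> {0..2*pi} \<Longrightarrow> \<bar>y - x\<bar> < d2 \<Longrightarrow> norm (g y - g x) \<le> e"
      using continuous_on_circle_modulus[OF cg e] by blast
    show "\<exists>d>0. \<forall>a b. 0 \<le> a \<and> a \<le> b \<and> b \<le> 2*pi \<and> b - a < d \<longrightarrow>
       norm (H b - H a) \<le> \<epsilon> * integral {a..b} ?\<alpha>"
    proof (intro exI[of _ "min d1 d2"] conjI allI impI)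
      show "0 < min d1 d2" using d1(1) d2(1) by simp
      fix a b assume ab: "0 \<le> a \<and> a \<le> b \<and> b \<le> 2*pi \<and> b - a < min d1 d2"
      have sub: "h absolutely_integrable_on {a..b}" if "h absolutely_integrable_on {0..2*pi}" for h :: "real \<Rightarrow> 'z::euclidean_space"
        using absolutely_integrable_subinterval[OF that] ab by simp
      have int: "h integrable_on {a..b}" if "h absolutely_integrable_on {0..2*pi}" for h :: "real \<Rightarrow> 'z::euclidean_space"
        using integrable_subinterval_circle[OF that] ab by simp
      have comb: "integral {0..b} ?D - integral {0..a} ?D = integral {a..b} ?D"
        using Henstock_Kurzweil_Integration.integral_combine[of 0 a b ?D] ab integrable_subinterval_circle[OF i, of 0 b]
        by (auto simp: algebra_simps)
      have l1: "B (integral {a..b} f') (g b) = integral {a..b} (\<lambda>t. B (f' t) (g b))"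
        using integral_linear[OF int[OF f'] B.bounded_linear_left[of "g b"]] by (simp add: comp_def)
      have l2: "B (f a) (integral {a..b} g') = integral {a..b} (\<lambda>t. B (f a) (g' t))"
        using integral_linear[OF int[OF g'] B.bounded_linear_right[of "f a"]] by (simp add: comp_def)
      have j1: "(\<lambda>t. B (f' t) (g b)) integrable_on {a..b}" and j2: "(\<lambda>t. B (f a) (g' t)) integrable_on {a..b}"
        using integrable_linear[OF int[OF f'] B.bounded_linear_left[of "g b"]]
          integrable_linear[OF int[OF g'] B.bounded_linear_right[of "f a"]] by (auto simp: comp_def)
      have "H b - H a = B (f b - f a) (g b) + B (f a) (g b - g a) - integral {a..b} ?D"
        unfolding comb[symmetric] H_def by (simp add: B.diff_left B.diff_right)
      also have "\<dots> = integral {a..b} (\<lambda>t. (B (f' t) (g b) + B (f a) (g' t)) - ?D t)"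
        using ab acd_diff[OF f, of a b] acd_diff[OF g, of a b] l1 l2 j1 j2 int[OF i]
        by (simp add: Henstock_Kurzweil_Integration.integral_add Henstock_Kurzweil_Integration.integral_diff integrable_add)
      also have "norm \<dots> \<le> integral {a..b} (\<lambda>t. \<epsilon> * ?\<alpha> t)"
      proof (rule integral_norm_bound_integral)
        show "(\<lambda>t. (B (f' t) (g b) + B (f a) (g' t)) - ?D t) integrable_on {a..b}"
          using integrable_diff[OF integrable_add[OF j1 j2] int[OF i]] .
        show "(\<lambda>t. \<epsilon> * ?\<alpha> t) integrable_on {a..b}"
          using int[OF \<alpha>] by (rule integrable_on_mult_right)
        fix t assume t: "t \<in> {a..b}"
        have "norm (g b - g t) \<le> e" "norm (f a - f t) \<le> e"
          using t ab d1(2)[of t a] d2(2)[of t b] by auto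
        moreover have "(B (f' t) (g b) + B (f a) (g' t)) - ?D t = B (f' t) (g b - g t) + B (f a - f t) (g' t)"
          by (simp add: B.diff_left B.diff_right)
        moreover have "norm (B (f' t) (g b - g t)) \<le> norm (f' t) * norm (g b - g t) * K" 
          "norm (B (f a - f t) (g' t)) \<le> norm (f a - f t) * norm (g' t) * K" by (rule K)+
        moreover have "norm (f' t) * norm (g b - g t) * K \<le> norm (f' t) * e * K"
          using \<open>norm (g b - g t) \<le> e\<close> K by (intro mult_right_mono mult_left_mono) auto
        moreover have "norm (f a - f t) * norm (g' t) * K \<le> e * norm (g' t) * K"
          using \<open>norm (f a - f t) \<le> e\<close> K by (intro mult_right_mono) auto
        ultimately have "norm ((B (f' t) (g b) + B (f a) (g' t)) - ?D t) \<le> norm (f' t) * e * K + e * norm (g' t) * K"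
          by (smt (verit) norm_triangle_ineq)
        also have "\<dots> = \<epsilon> * ?\<alpha> t" using K by (simp add: e_def field_simps)
        finally show "norm ((B (f' t) (g b) + B (f a) (g' t)) - ?D t) \<le> \<epsilon> * ?\<alpha> t" .
      qed
      finally show "norm (H b - H a) \<le> \<epsilon> * integral {a..b} ?\<alpha>" by simp
    qed
  qed
  note const = this
  show ?thesis
  proof (rule acdI[OF i])
    fix x assume "x \<in> {0..2*pi}"
    from const[OF this] show "B (f x) (g x) = B (f 0) (g 0) + integral {0..x} ?D"
      by (simp add: H_def diff_eq_eq add.commute)
  qed
qed

lemma mean_value_positive:
  fixes a b :: real
  assumes "a > 0" "b > 0" and \<phi>: "\<And>y. y > 0 \<Longrightarrow> (\<phi> has_real_derivative \<psi> y) (at y)"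
  shows "\<exists>z. min a b \<le> z \<and> z \<le> max a b \<and> \<phi> b - \<phi> a = \<psi> z * (b - a)"
proof -
  consider "a < b" | "b < a" | "a = b" by linarith
  then show ?thesis
  proof cases
    case 1
    have "\<exists>z. a < z \<and> z < b \<and> \<phi> b - \<phi> a = (b - a) * \<psi> z"
      using 1 assms by (intro MVT2) auto
    then obtain z where "a < z" "z < b" "\<phi> b - \<phi> a = (b - a) * \<psi> z" by blast
    then show ?thesis using 1 by (intro exI[of _ z]) (auto simp: mult.commute)
  next
    case 2
    have "\<exists>z. b < z \<and> z < a \<and> \<phi> a - \<phi> b = (a - b) * \<psi> z"
      using 2 assms by (intro MVT2) auto
    then obtain z where "b < z" "z < a" "\<phi> a - \<phi> b = (a - b) * \<psi> z" by blast
    then show ?thesis using 2 by (intro exI[of _ z]) (auto simp: algebra_simps)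
  qed (auto intro: exI[of _ a])
qed

text \<open>Only \<phi> is differentiated classically. On a short interval the mean value theorem
  for \<phi> expresses its increment as \<psi>(f(s)) times that of f, and \<psi> after f hardly
  varies there.\<close>

lemma acd_chain:
  fixes f :: "real \<Rightarrow> real"
  assumes f: "acd f f'" and pos: "\<And>x. x \<in> {0..2*pi} \<Longrightarrow> f x > 0"
    and \<phi>: "\<And>y. y > 0 \<Longrightarrow> (\<phi> has_real_derivative \<psi> y) (at y)" and c: "continuous_on {0<..} \<psi>"
  shows "acd (\<lambda>x. \<phi> (f x)) (\<lambda>x. \<psi> (f x) * f' x)"
proof -
  have cf: "continuous_on {0..2*pi} f" using f acd_continuous by auto
  have f': "f' absolutely_integrable_on {0..2*pi}" using f by (rule acd_integrable)
  have cp: "continuous_on {0..2*pi} (\<lambda>x. \<psi> (f x))"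
    using pos by (intro continuous_on_compose2[OF c cf]) auto
  let ?D = "\<lambda>x. \<psi> (f x) * f' x"
  have i: "?D absolutely_integrable_on {0..2*pi}"
    by (rule continuous_bilinear_absolutely_integrable[OF bounded_bilinear_mult cp f'])
  define H where "H x = \<phi> (f x) - integral {0..x} ?D" for x
  let ?\<alpha> = "\<lambda>t. norm (f' t)"
  have \<alpha>: "?\<alpha> absolutely_integrable_on {0..2*pi}"
    using f' by (intro absolutely_integrable_norm[unfolded comp_def])
  have "H y = H 0" if "y \<in> {0..2*pi}" for y
  proof (rule eq_if_locally_dominated[OF \<alpha> _ that])
    fix \<epsilon> :: real assume e: "\<epsilon> > 0"
    obtain d where d: "d > 0" 
      and d1: "\<And>x y. x \<in> {0..2*pi} \<Longrightarrow> y \<in> {0..2*pi} \<Longrightarrow> \<bar>y - x\<bar> < d \<Longrightarrow> norm (\<psi> (f y) - \<psi> (f x)) \<le> \<epsilon>"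
      using continuous_on_circle_modulus[OF cp e] by blast
    show "\<exists>d>0. \<forall>a b. 0 \<le> a \<and> a \<le> b \<and> b \<le> 2*pi \<and> b - a < d \<longrightarrow>
       norm (H b - H a) \<le> \<epsilon> * integral {a..b} ?\<alpha>"
    proof (intro exI[of _ d] conjI allI impI)
      show "0 < d" by fact
      fix a b assume ab: "0 \<le> a \<and> a \<le> b \<and> b \<le> 2*pi \<and> b - a < d"
      have int: "h integrable_on {a..b}" if "h absolutely_integrable_on {0..2*pi}" for h :: "real \<Rightarrow> 'z::euclidean_space"
        using integrable_subinterval_circle[OF that] ab by simp
      have comb: "integral {0..b} ?D - integral {0..a} ?D = integral {a..b} ?D"
        using Henstock_Kurzweil_Integration.integral_combine[of 0 a b ?D] ab integrable_subinterval_circle[OF i, of 0 b]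
        by (auto simp: algebra_simps)
      \<comment> \<open>The point z of the mean value theorem lies between f(a) and f(b). As the
        image of [a, b] is an interval, z is the value of f at some s in [a, b].\<close>
      have iv: "is_interval (f ` {a..b})"
        using ab by (intro connected_continuous_image[THEN is_interval_connected_1[THEN iffD2]] continuous_on_subset[OF cf]) auto
      have "\<exists>s\<in>{a..b}. \<phi> (f b) - \<phi> (f a) = \<psi> (f s) * (f b - f a)"
      proof -
        have P: "f a > 0" "f b > 0" using pos ab by auto
        obtain z where z: "min (f a) (f b) \<le> z" "z \<le> max (f a) (f b)" "\<phi> (f b) - \<phi> (f a) = \<psi> z * (f b - f a)"
          using mean_value_positive[OF P \<phi>] by blast
        have "f a \<in> f ` {a..b}" "f b \<in> f ` {a..b}" using ab by auto
        then have "z \<in> f ` {a..b}"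
          using iv z(1,2) mem_is_interval_1_I[of "f ` {a..b}"] by (smt (verit))
        then show ?thesis using z(3) by blast
      qed
      then obtain s where s: "s \<in> {a..b}" "\<phi> (f b) - \<phi> (f a) = \<psi> (f s) * (f b - f a)" by blast
      have "H b - H a = \<psi> (f s) * integral {a..b} f' - integral {a..b} ?D"
        unfolding comb[symmetric] H_def using s acd_diff[OF f, of a b] ab by simp
      also have "\<dots> = integral {a..b} (\<lambda>t. \<psi> (f s) * f' t - ?D t)"
        using int[OF f'] int[OF i] 
        by (simp add: Henstock_Kurzweil_Integration.integral_diff integrable_on_mult_right)
      also have "norm \<dots> \<le> integral {a..b} (\<lambda>t. \<epsilon> * ?\<alpha> t)"
      proof (rule integral_norm_bound_integral)
        show "(\<lambda>t. \<psi> (f s) * f' t - ?D t) integrable_on {a..b}"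
          using int[OF f'] int[OF i] by (intro integrable_diff integrable_on_mult_right)
        show "(\<lambda>t. \<epsilon> * ?\<alpha> t) integrable_on {a..b}"
          using int[OF \<alpha>] by (rule integrable_on_mult_right)
        fix t assume t: "t \<in> {a..b}"
        have "\<bar>\<psi> (f s) - \<psi> (f t)\<bar> \<le> \<epsilon>"
          using t ab s d1[of t s] by auto
        then show "norm (\<psi> (f s) * f' t - ?D t) \<le> \<epsilon> * ?\<alpha> t"
          unfolding left_diff_distrib[symmetric] norm_mult by (intro mult_right_mono) auto
      qed
      finally show "norm (H b - H a) \<le> \<epsilon> * integral {a..b} ?\<alpha>" by simp
    qed
  qed
  note const = this
  show ?thesis
  proof (rule acdI[OF i])
    fix x assume "x \<in> {0..2*pi}"
    from const[OF this] show "\<phi> (f x) = \<phi> (f 0) + integral {0..x} ?D"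
      by (simp add: H_def diff_eq_eq add.commute)
  qed
qed

subsection \<open>Weak derivatives\<close>

lemma acd_integration_by_parts:
  fixes f :: "real \<Rightarrow> 'a::euclidean_space" and \<phi> :: "real \<Rightarrow> real"
  assumes f: "acd f g" "f 0 = f (2*pi)" and \<phi>: "\<phi> \<in> Cinf"
  shows "(LINT x|circle_measure. cderiv \<phi> x *\<^sub>R f x) = - (LINT x|circle_measure. \<phi> x *\<^sub>R g x)"
proof -
  have a: "acd (\<lambda>x. \<phi> x *\<^sub>R f x) (\<lambda>x. \<phi> x *\<^sub>R g x + cderiv \<phi> x *\<^sub>R f x)"
    by (rule acd_bilinear[OF bounded_bilinear_scaleR acd_Cinf[OF \<phi>] f(1)])
  have "\<phi> (2*pi) = \<phi> 0" using Cinf_periodic[OF \<phi>] unfolding periodic_def by (metis add_0)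
  then have "integral {0..2*pi} (\<lambda>x. \<phi> x *\<^sub>R g x + cderiv \<phi> x *\<^sub>R f x) = 0"
    using acd_diff[OF a, of 0 "2*pi"] f(2) by simp
  moreover have "integrable circle_measure (\<lambda>x. \<phi> x *\<^sub>R g x)" 
    using acd_integrable[OF f(1)] \<phi> by (intro integrable_continuous_scaleR Cinf_continuous_on)
      (auto simp: absolutely_integrable_circle_iff)
  moreover have "integrable circle_measure (\<lambda>x. cderiv \<phi> x *\<^sub>R f x)"
    using acd_continuous[OF f(1)] \<phi> 
    by (intro integrable_continuous_scaleR Cinf_continuous_on Cinf_cderiv)
      (auto simp flip: absolutely_integrable_circle_iff intro: absolutely_integrable_continuous_real)
  ultimately show ?thesis
    using circle_integral_eq[of "\<lambda>x. \<phi> x *\<^sub>R g x + cderiv \<phi> x *\<^sub>R f x"]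
    by (simp add: eq_neg_iff_add_eq_0 add.commute)
qed

lemma integrable_circle_cong_AE:
  fixes f g :: "real \<Rightarrow> 'a::euclidean_space"
  assumes "AE x in circle_measure. f x = g x" "f \<in> borel_measurable circle_measure" "g \<in> borel_measurable circle_measure"
  shows "integrable circle_measure f \<longleftrightarrow> integrable circle_measure g"
  using assms by (intro integrable_cong_AE)

text \<open>Weak derivatives see only the almost everywhere class of f. So absolute continuity is
  asked of a representative F, for which equal end values take the place of periodicity.\<close>

lemma has_weak_derivI:
  fixes f :: "real \<Rightarrow> 'a::euclidean_space"
  assumes F: "acd F g" "F 0 = F (2*pi)" and FF: "AE x in circle_measure. f x = F x"
    and p: "periodic f" "periodic g" and m: "f \<in> borel_measurable circle_measure"
  shows "has_weak_deriv f g"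
proof -
  have cF: "continuous_on {0..2*pi} F" using acd_continuous[OF F(1)] .
  have Fm: "F \<in> borel_measurable circle_measure" using cF by (rule continuous_on_borel_circle)
  have "integrable circle_measure F"
    using cF by (simp flip: absolutely_integrable_circle_iff add: absolutely_integrable_continuous_real)
  then have "integrable circle_measure f" using integrable_circle_cong_AE[OF FF m Fm] by simp
  moreover have "integrable circle_measure g"
    using acd_integrable[OF F(1)] by (simp add: absolutely_integrable_circle_iff)
  moreover have "(LINT x|circle_measure. cderiv \<phi> x *\<^sub>R f x) = - (LINT x|circle_measure. \<phi> x *\<^sub>R g x)"
    if \<phi>: "\<phi> \<in> Cinf" for \<phi> :: "real \<Rightarrow> real"
  proof -
    have [measurable]: "cderiv \<phi> \<in> borel_measurable circle_measure"
      using \<phi> by (intro continuous_on_borel_circle Cinf_continuous_on Cinf_cderiv)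
    have "(LINT x|circle_measure. cderiv \<phi> x *\<^sub>R f x) = (LINT x|circle_measure. cderiv \<phi> x *\<^sub>R F x)"
      using FF m Fm by (intro integral_cong_AE) auto
    then show ?thesis using acd_integration_by_parts[OF F \<phi>] by simp
  qed
  ultimately show ?thesis unfolding has_weak_deriv_def using p by blast
qed

text \<open>A primitive of \<psi> grows by 2 pi k over a period, where k is the mean of \<psi>;
  subtracting k x makes it periodic.\<close>

lemma Cinf_primitive:
  fixes \<psi> :: "real \<Rightarrow> real"
  assumes "\<psi> \<in> Cinf"
  shows "\<exists>\<phi>\<in>Cinf. \<exists>k. \<forall>x. \<psi> x = cderiv \<phi> x + k"
proof -
  have "isCont \<psi> x" for x 
    using Cinf_differentiable[OF assms] differentiable_imp_continuous_within by blast
  then obtain F where F: "\<And>x. (F has_vector_derivative \<psi> x) (at x)"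
    using einterval_antiderivative[of "-\<infinity>" "\<infinity>" \<psi>] by auto
  define k where "k = (F (2*pi) - F 0) / (2*pi)"
  define \<phi> where "\<phi> x = F x - k * x" for x
  have d: "(\<phi> has_vector_derivative \<psi> x - k) (at x)" for x
    unfolding \<phi>_def using F[of x] 
    by (auto intro!: derivative_eq_intros simp flip: has_real_derivative_iff_has_vector_derivative)
  have k: "Ck j (\<phi>)" for j
  proof (cases j)
    case (Suc i)
    have "(\<lambda>x. \<psi> x - k) \<in> Cinf" using assms by (intro Cinf_diff Cinf_const)
    then show ?thesis unfolding Suc Cinf_iff by (intro Ck_SucI[OF d]) auto
  qed simp
  have "\<phi> (x + 2*pi) - \<phi> x = 0" for x
  proof -
    have "((\<lambda>y. \<phi> (y + 2*pi) - \<phi> y) has_real_derivative 0) (at y)" for y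
    proof -
      have "(\<phi> has_real_derivative \<psi> (y + 2*pi) - k) (at (y + 2*pi))" "(\<phi> has_real_derivative \<psi> y - k) (at y)"
        using d has_real_derivative_iff_has_vector_derivative by blast+
      moreover have "\<psi> (y + 2*pi) = \<psi> y" using Cinf_periodic[OF assms] by (simp add: periodic_def)
      ultimately show ?thesis
        by (auto intro!: derivative_eq_intros simp: DERIV_shift)
    qed
    then have "\<phi> (x + 2*pi) - \<phi> x = \<phi> (0 + 2*pi) - \<phi> 0"
      using DERIV_isconst_all[of "\<lambda>y. \<phi> (y + 2*pi) - \<phi> y" x 0] by blast
    also have "\<dots> = 0" by (simp add: \<phi>_def k_def)
    finally show ?thesis .
  qed
  then have "\<phi> \<in> Cinf" using k by (simp add: Cinf_iff periodic_def)
  moreover have "cderiv \<phi> = (\<lambda>x. \<psi> x - k)" by (rule cderiv_eqI[OF d])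
  ultimately show ?thesis by (intro bexI[of _ \<phi>] exI[of _ k]) auto
qed

lemma cderiv_const: "cderiv (\<lambda>x. c) = (\<lambda>x. 0)"
  by (rule cderiv_eqI) simp

lemma has_weak_deriv_integral_eq_0:
  fixes f :: "real \<Rightarrow> 'a::euclidean_space"
  assumes "has_weak_deriv f g" shows "(LINT x|circle_measure. g x) = 0"
proof -
  have "(LINT x|circle_measure. cderiv (\<lambda>x. 1::real) x *\<^sub>R f x) = - (LINT x|circle_measure. 1 *\<^sub>R g x)"
    using assms Cinf_const[of "1::real"] unfolding has_weak_deriv_def by blast
  then show ?thesis by (simp add: cderiv_const)
qed

text \<open>The du Bois-Reymond lemma. With P the indefinite integral of g, the difference f - P has
  weak derivative 0. A test function is a derivative plus a constant: the first part integrates to 0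
  against f - P - m for this reason, the second by the choice of m as mean value.\<close>

lemma has_weak_derivE:
  fixes f :: "real \<Rightarrow> 'a::euclidean_space"
  assumes h: "has_weak_deriv f g"
  obtains F where "acd F g" "F 0 = F (2*pi)" "AE x in circle_measure. f x = F x"
proof -
  have fi: "integrable circle_measure f" and gi: "integrable circle_measure g"
    using h by (auto simp: has_weak_deriv_def)
  define P where "P x = integral {0..x} g" for x
  have P: "acd P g" using gi by (intro acdI) (simp_all add: absolutely_integrable_circle_iff P_def)
  \<comment> \<open>The test function 1 shows that g has integral 0, so P takes the same value at
    both ends and integration by parts has no boundary term.\<close>
  have P0: "P 0 = 0" "P (2*pi) = 0" 
    using has_weak_deriv_integral_eq_0[OF h] circle_integral_eq[OF gi] by (simp_all add: P_def)
  have Pi: "integrable circle_measure P"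
    using acd_continuous[OF P] by (simp flip: absolutely_integrable_circle_iff add: absolutely_integrable_continuous_real)
  define m where "m = (LINT x|circle_measure. f x - P x) /\<^sub>R (2*pi)"
  have ci: "integrable circle_measure (\<lambda>x. c)" for c :: 'a by auto
  have meas: "measure circle_measure {0..2*pi} = 2 * pi"
    by (subst measure_restrict_space) auto
  have mean: "(LINT x|circle_measure. f x - P x - m) = 0"
  proof -
    have "(LINT x|circle_measure. f x - P x - m) = (LINT x|circle_measure. f x - P x) - (2*pi) *\<^sub>R m"
      using fi Pi ci meas by (subst Bochner_Integration.integral_diff) auto
    then show ?thesis by (simp add: m_def)
  qed
  have "AE x in circle_measure. f x - P x - m = 0"
  proof (rule fundamental_lemma)
    show i: "integrable circle_measure (\<lambda>x. f x - P x - m)" using fi Pi ci by (intro Bochner_Integration.integrable_diff)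
    fix \<psi> :: "real \<Rightarrow> real" assume \<psi>: "\<psi> \<in> Cinf"
    obtain \<phi> k where \<phi>: "\<phi> \<in> Cinf" "\<And>x. \<psi> x = cderiv \<phi> x + k" using Cinf_primitive[OF \<psi>] by blast
    have c: "continuous_on {0..2*pi} (cderiv \<phi>)" by (intro Cinf_continuous_on Cinf_cderiv \<phi>)
    have i1: "integrable circle_measure (\<lambda>x. cderiv \<phi> x *\<^sub>R h x)" if "integrable circle_measure h" for h :: "real \<Rightarrow> 'a"
      using that c by (intro integrable_continuous_scaleR)
    have "(LINT x|circle_measure. cderiv \<phi> x *\<^sub>R f x) = - (LINT x|circle_measure. \<phi> x *\<^sub>R g x)"
      using h \<phi>(1) unfolding has_weak_deriv_def by blast
    moreover have "(LINT x|circle_measure. cderiv \<phi> x *\<^sub>R P x) = - (LINT x|circle_measure. \<phi> x *\<^sub>R g x)"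
      using acd_integration_by_parts[OF P _ \<phi>(1)] P0 by simp
    moreover have "(LINT x|circle_measure. cderiv \<phi> x *\<^sub>R m) = 0"
    proof -
      have "acd (\<lambda>x. m) (\<lambda>x. 0)" by (intro acd_C1) auto
      from acd_integration_by_parts[OF this _ \<phi>(1)] show ?thesis by simp
    qed
    moreover have "(LINT x|circle_measure. \<psi> x *\<^sub>R (f x - P x - m)) =
      (LINT x|circle_measure. (cderiv \<phi> x *\<^sub>R f x - cderiv \<phi> x *\<^sub>R P x - cderiv \<phi> x *\<^sub>R m) + k *\<^sub>R (f x - P x - m))"
      unfolding \<phi>(2) by (intro Bochner_Integration.integral_cong) (auto simp: algebra_simps)
    moreover have "\<dots> = (LINT x|circle_measure. cderiv \<phi> x *\<^sub>R f x - cderiv \<phi> x *\<^sub>R P x - cderiv \<phi> x *\<^sub>R m) 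
        + k *\<^sub>R (LINT x|circle_measure. f x - P x - m)"
      using i1[OF fi] i1[OF Pi] i1[OF ci[of m]] i by simp
    moreover have "(LINT x|circle_measure. cderiv \<phi> x *\<^sub>R f x - cderiv \<phi> x *\<^sub>R P x - cderiv \<phi> x *\<^sub>R m) =
      (LINT x|circle_measure. cderiv \<phi> x *\<^sub>R f x) - (LINT x|circle_measure. cderiv \<phi> x *\<^sub>R P x)
       - (LINT x|circle_measure. cderiv \<phi> x *\<^sub>R m)"
      using i1[OF fi] i1[OF Pi] i1[OF ci[of m]] by (simp add: Bochner_Integration.integral_diff)
    ultimately show "(LINT x|circle_measure. \<psi> x *\<^sub>R (f x - P x - m)) = 0" using mean by simp
  qed
  then have "AE x in circle_measure. f x = P x + m" by eventually_elim (simp add: algebra_simps)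
  moreover have "acd (\<lambda>x. P x + m) g"
    using acd_integrable[OF P] by (intro acdI) (simp_all add: P_def)
  ultimately show thesis using that[of "\<lambda>x. P x + m"] P0 by simp
qed

lemma has_weak_deriv_unique:
  fixes f :: "real \<Rightarrow> 'a::euclidean_space"
  assumes "has_weak_deriv f g" "has_weak_deriv f h"
  shows "AE x in circle_measure. g x = h x"
proof -
  have gi: "integrable circle_measure g" "integrable circle_measure h" using assms by (auto simp: has_weak_deriv_def)
  have "AE x in circle_measure. g x - h x = 0"
  proof (rule fundamental_lemma)
    show "integrable circle_measure (\<lambda>x. g x - h x)" using gi by simp
    fix \<phi> :: "real \<Rightarrow> real" assume \<phi>: "\<phi> \<in> Cinf"
    have "integrable circle_measure (\<lambda>x. \<phi> x *\<^sub>R g x)" "integrable circle_measure (\<lambda>x. \<phi> x *\<^sub>R h x)"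
      using gi \<phi> by (auto intro!: integrable_continuous_scaleR Cinf_continuous_on)
    moreover have "- (LINT x|circle_measure. \<phi> x *\<^sub>R g x) = - (LINT x|circle_measure. \<phi> x *\<^sub>R h x)"
      using assms \<phi> unfolding has_weak_deriv_def by metis
    ultimately show "(LINT x|circle_measure. \<phi> x *\<^sub>R (g x - h x)) = 0" by (simp add: scaleR_diff_right)
  qed
  then show ?thesis by eventually_elim simp
qed

lemma has_weak_deriv_wderiv: "has_weak_deriv f g \<Longrightarrow> has_weak_deriv f (wderiv f)"
  unfolding wderiv_def by (rule someI[of "has_weak_deriv f"])

lemma wderiv_AE:
  fixes f :: "real \<Rightarrow> 'a::euclidean_space"
  shows "has_weak_deriv f g \<Longrightarrow> AE x in circle_measure. wderiv f x = g x"
  using has_weak_deriv_unique has_weak_deriv_wderiv by blast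

lemma has_weak_deriv_cong:
  fixes f :: "real \<Rightarrow> 'a::euclidean_space"
  assumes f: "f \<in> borel_measurable circle_measure" "f' \<in> borel_measurable circle_measure" "periodic f" "periodic f'"
    and eq: "AE x in circle_measure. f x = f' x"
  shows "has_weak_deriv f = has_weak_deriv f'"
proof
  fix g
  have "(LINT x|circle_measure. cderiv \<phi> x *\<^sub>R f x) = (LINT x|circle_measure. cderiv \<phi> x *\<^sub>R f' x)"
    if \<phi>: "\<phi> \<in> Cinf" for \<phi> :: "real \<Rightarrow> real"
  proof -
    have [measurable]: "cderiv \<phi> \<in> borel_measurable circle_measure"
      using \<phi> by (intro continuous_on_borel_circle Cinf_continuous_on Cinf_cderiv)
    show ?thesis using f eq by (intro integral_cong_AE) auto
  qed
  moreover have "integrable circle_measure f \<longleftrightarrow> integrable circle_measure f'"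
    using integrable_circle_cong_AE[OF eq f(1,2)] .
  ultimately show "has_weak_deriv f g = has_weak_deriv f' g"
    unfolding has_weak_deriv_def using f(3,4) by auto
qed

text \<open>The two functions are equal everywhere, not only almost everywhere:
  \<open>wderiv\<close> chooses from the set of all weak derivatives, and this set depends only on
  the almost everywhere class.\<close>

lemma wderiv_cong:
  fixes f :: "real \<Rightarrow> 'a::euclidean_space"
  assumes "f \<in> borel_measurable circle_measure" "f' \<in> borel_measurable circle_measure" "periodic f" "periodic f'"
    "AE x in circle_measure. f x = f' x"
  shows "wderiv f = wderiv f'"
  unfolding wderiv_def has_weak_deriv_cong[OF assms] ..

lemma has_weak_deriv_Cinf:
  fixes f :: "real \<Rightarrow> 'a::euclidean_space"
  shows "f \<in> Cinf \<Longrightarrow> has_weak_deriv f (cderiv f)"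
  using Cinf_periodic[of f] periodic_cderiv[of f] 
  by (intro has_weak_derivI[OF acd_Cinf] continuous_on_borel_circle Cinf_continuous_on)
    (auto simp: periodic_def dest: spec[of _ 0])

lemma has_weak_deriv_add:
  fixes f :: "real \<Rightarrow> 'a::euclidean_space"
  assumes "has_weak_deriv f g" "has_weak_deriv f' g'"
  shows "has_weak_deriv (\<lambda>x. f x + f' x) (\<lambda>x. g x + g' x)"
proof -
  have i: "integrable circle_measure f" "integrable circle_measure g" "integrable circle_measure f'" "integrable circle_measure g'" 
    using assms by (auto simp: has_weak_deriv_def)
  have "(LINT x|circle_measure. cderiv \<phi> x *\<^sub>R (f x + f' x)) = - (LINT x|circle_measure. \<phi> x *\<^sub>R (g x + g' x))"
    if \<phi>: "\<phi> \<in> Cinf" for \<phi> :: "real \<Rightarrow> real"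
  proof -
    have "integrable circle_measure (\<lambda>x. cderiv \<phi> x *\<^sub>R h x)" "integrable circle_measure (\<lambda>x. \<phi> x *\<^sub>R h x)"
      if "integrable circle_measure h" for h :: "real \<Rightarrow> 'a"
      using that \<phi> by (auto intro!: integrable_continuous_scaleR Cinf_continuous_on Cinf_cderiv)
    then show ?thesis using assms i \<phi> unfolding has_weak_deriv_def by (simp add: scaleR_add_right)
  qed
  then show ?thesis using assms i unfolding has_weak_deriv_def by (simp add: periodic_def)
qed

lemma has_weak_deriv_scaleR:
  fixes f :: "real \<Rightarrow> 'a::euclidean_space"
  assumes "has_weak_deriv f g"
  shows "has_weak_deriv (\<lambda>x. r *\<^sub>R f x) (\<lambda>x. r *\<^sub>R g x)"
  using assms unfolding has_weak_deriv_def
  by (auto simp: periodic_def scaleR_left_commute[of _ r] simp del: scaleR_scaleR)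

text \<open>The product rule is applied to the absolutely continuous representatives. Its density is
  then altered on a null set so as to be written with f and g themselves.\<close>

lemma has_weak_deriv_bilinear:
  fixes f :: "real \<Rightarrow> 'a::euclidean_space" and g :: "real \<Rightarrow> 'b::euclidean_space" 
    and B :: "'a \<Rightarrow> 'b \<Rightarrow> 'c::euclidean_space"
  assumes B: "bounded_bilinear B" and f: "has_weak_deriv f f'" and g: "has_weak_deriv g g'"
  shows "has_weak_deriv (\<lambda>x. B (f x) (g x)) (\<lambda>x. B (f x) (g' x) + B (f' x) (g x))"
proof -
  interpret B: bounded_bilinear B by fact
  obtain F where F: "acd F f'" "F 0 = F (2*pi)" "AE x in circle_measure. f x = F x" using has_weak_derivE[OF f] .
  obtain G where G: "acd G g'" "G 0 = G (2*pi)" "AE x in circle_measure. g x = G x" using has_weak_derivE[OF g] .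
  have [measurable]: "f \<in> borel_measurable circle_measure" "g \<in> borel_measurable circle_measure"
    "f' \<in> borel_measurable circle_measure" "g' \<in> borel_measurable circle_measure"
    using f g by (auto simp: has_weak_deriv_def)
  have [measurable]: "case_prod B \<in> borel_measurable borel"
    by (intro borel_measurable_continuous_onI)
      (auto simp: split_beta intro!: B.continuous_on continuous_intros)
  have Bm: "(\<lambda>x. B (a x) (b x)) \<in> borel_measurable circle_measure"
    if [measurable]: "a \<in> borel_measurable circle_measure" "b \<in> borel_measurable circle_measure" for a b
  proof -
    have "(\<lambda>x. case_prod B (a x, b x)) \<in> borel_measurable circle_measure"
      by (rule measurable_compose[of _ _ borel]) (auto intro!: borel_measurable_Pair that)
    then show ?thesis by simp
  qed
  have per: "periodic f" "periodic g" "periodic f'" "periodic g'" using f g by (auto simp: has_weak_deriv_def)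
  define d where "d x = B (F x) (g' x) + B (f' x) (G x)" for x
  have "acd (\<lambda>x. B (F x) (G x)) d"
    unfolding d_def by (rule acd_bilinear[OF B F(1) G(1)])
  have AE: "AE x in circle_measure. d x = B (f x) (g' x) + B (f' x) (g x)"
    using F(3) G(3) by eventually_elim (simp add: d_def)
  have dm: "(\<lambda>x. B (f x) (g' x) + B (f' x) (g x)) \<in> borel_measurable circle_measure"
    by (intro borel_measurable_add Bm) auto
  have "acd (\<lambda>x. B (F x) (G x)) (\<lambda>x. B (f x) (g' x) + B (f' x) (g x))"
  proof (rule acdI)
    have di: "integrable circle_measure d" 
      using acd_integrable[OF \<open>acd (\<lambda>x. B (F x) (G x)) d\<close>] by (simp add: absolutely_integrable_circle_iff)
    then show "(\<lambda>x. B (f x) (g' x) + B (f' x) (g x)) absolutely_integrable_on {0..2*pi}"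
      unfolding absolutely_integrable_circle_iff
      using integrable_circle_cong_AE[OF AE _ dm] by auto
    fix x assume x: "x \<in> {0..2*pi}"
    have "AE x in lebesgue. x \<in> {0..2*pi} \<longrightarrow> d x = B (f x) (g' x) + B (f' x) (g x)"
      using AE by (subst (asm) AE_restrict_space_iff) auto
    then obtain N where N: "N \<in> null_sets lebesgue" "\<And>x. x \<in> {0..2*pi} - N \<Longrightarrow> d x = B (f x) (g' x) + B (f' x) (g x)"
      by (auto elim!: AE_E3)
    have "integral {0..x} d = integral {0..x} (\<lambda>x. B (f x) (g' x) + B (f' x) (g x))"
      using N x by (intro integral_spike[of N]) (auto simp: negligible_iff_null_sets)
    then show "B (F x) (G x) = B (F 0) (G 0) + integral {0..x} (\<lambda>x. B (f x) (g' x) + B (f' x) (g x))"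
      using acd_eq[OF \<open>acd (\<lambda>x. B (F x) (G x)) d\<close> x] by simp
  qed
  moreover have "AE x in circle_measure. B (f x) (g x) = B (F x) (G x)"
    using F(3) G(3) by eventually_elim simp
  ultimately show ?thesis
    using F(2) G(2) per by (intro has_weak_derivI[of "\<lambda>x. B (F x) (G x)"] Bm) (auto simp: periodic_def)
qed

subsection \<open>Square integrable functions\<close>

definition sqint :: "(real \<Rightarrow> 'a::euclidean_space) \<Rightarrow> bool" where
  "sqint f \<longleftrightarrow> f \<in> borel_measurable circle_measure \<and> integrable circle_measure (\<lambda>x. (norm (f x))\<^sup>2)"

definition nrm :: "(real \<Rightarrow> 'a::euclidean_space) \<Rightarrow> real" where
  "nrm f = sqrt (LINT x|circle_measure. (norm (f x))\<^sup>2)"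

lemma L2_iff: "f \<in> L2 \<longleftrightarrow> periodic f \<and> sqint f"
  by (simp add: L2_def sqint_def)

lemma measure_circle [simp]: "measure circle_measure {0..2*pi} = 2 * pi"
  by (subst measure_restrict_space) auto

lemma sqint_measurable: "sqint f \<Longrightarrow> f \<in> borel_measurable circle_measure"
  by (simp add: sqint_def)

lemma nrm_nonneg [simp]: "0 \<le> nrm f"
  by (simp add: nrm_def)

lemma nrm_sq: "(nrm f)\<^sup>2 = (LINT x|circle_measure. (norm (f x))\<^sup>2)"
  by (simp add: nrm_def)

lemma sqint_dominated:
  assumes g: "sqint g" and f: "f \<in> borel_measurable circle_measure"
    and le: "AE x in circle_measure. norm (f x) \<le> K * norm (g x)"
  shows "sqint f"
proof -
  have gi: "integrable circle_measure (\<lambda>x. (norm (g x))\<^sup>2)" using g by (simp add: sqint_def)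
  have "integrable circle_measure (\<lambda>x. (norm (f x))\<^sup>2)"
  proof (rule Bochner_Integration.integrable_bound)
    show "integrable circle_measure (\<lambda>x. K\<^sup>2 * (norm (g x))\<^sup>2)" using gi by simp
    show "(\<lambda>x. (norm (f x))\<^sup>2) \<in> borel_measurable circle_measure" using f by measurable
    show "AE x in circle_measure. norm ((norm (f x))\<^sup>2) \<le> norm (K\<^sup>2 * (norm (g x))\<^sup>2)"
      using le
    proof eventually_elim
      case (elim x)
      then show ?case using power_mono[OF elim norm_ge_zero, of 2] by (simp add: power_mult_distrib)
    qed
  qed
  then show ?thesis using f by (simp add: sqint_def)
qed

lemma nrm_dominated:
  assumes g: "sqint g" and f: "f \<in> borel_measurable circle_measure"
    and le: "AE x in circle_measure. norm (f x) \<le> K * norm (g x)" and K: "K \<ge> 0"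
  shows "nrm f \<le> K * nrm g"
proof -
  have f2: "integrable circle_measure (\<lambda>x. (norm (f x))\<^sup>2)" and g2: "integrable circle_measure (\<lambda>x. (norm (g x))\<^sup>2)"
    using sqint_dominated[OF g f le] g by (auto simp: sqint_def)
  have "(LINT x|circle_measure. (norm (f x))\<^sup>2) \<le> (LINT x|circle_measure. K\<^sup>2 * (norm (g x))\<^sup>2)"
  proof (rule integral_mono_AE)
    show "AE x in circle_measure. (norm (f x))\<^sup>2 \<le> K\<^sup>2 * (norm (g x))\<^sup>2"
      using le
    proof eventually_elim
      case (elim x)
      then show ?case using power_mono[OF elim norm_ge_zero, of 2] by (simp add: power_mult_distrib)
    qed
  qed (use f2 g2 in auto)
  also have "\<dots> = (K * nrm g)\<^sup>2" by (simp add: power_mult_distrib nrm_sq)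
  finally show ?thesis using K unfolding nrm_def[of f] by (simp add: real_le_lsqrt)
qed

lemma sqint_cong_AE:
  assumes "sqint f" "g \<in> borel_measurable circle_measure" "AE x in circle_measure. f x = g x"
  shows "sqint g" "nrm g = nrm f"
proof -
  have le: "AE x in circle_measure. norm (g x) \<le> 1 * norm (f x)" "AE x in circle_measure. norm (f x) \<le> 1 * norm (g x)"
    using assms(3) by auto
  show g: "sqint g" using sqint_dominated[OF assms(1,2) le(1)] .
  show "nrm g = nrm f"
    using nrm_dominated[OF assms(1,2) le(1)] nrm_dominated[OF g _ le(2)] assms(1) by (auto simp: sqint_def)
qed

lemma sqint_bounded:
  fixes f :: "real \<Rightarrow> 'a::euclidean_space"
  assumes f: "f \<in> borel_measurable circle_measure" and le: "AE x in circle_measure. norm (f x) \<le> K" and K: "K \<ge> 0"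
  shows "sqint f" "nrm f \<le> 3 * K"
proof -
  have one: "sqint (\<lambda>x. 1::real)" by (auto simp: sqint_def)
  have le': "AE x in circle_measure. norm (f x) \<le> K * norm (1::real)" using le by simp
  show "sqint f" by (rule sqint_dominated[OF one f le'])
  have "nrm f \<le> K * nrm (\<lambda>x. 1::real)" by (rule nrm_dominated[OF one f le' K])
  also have "nrm (\<lambda>x. 1::real) = sqrt (2 * pi)" by (simp add: nrm_def)
  \<comment> \<open>The factor 3 bounds the square root of the total mass 2 pi, since 2 pi < 9. The
    factors 3 in later constants go back to this one.\<close>
  also have "K * sqrt (2 * pi) \<le> K * 3" using pi_less_4 K by (intro mult_left_mono real_le_lsqrt) auto
  finally show "nrm f \<le> 3 * K" by simp
qed

lemma sqint_mult_integrable: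
  assumes "sqint f" "sqint g"
  shows "integrable circle_measure (\<lambda>x. norm (f x) * norm (g x))"
proof (rule Bochner_Integration.integrable_bound)
  show "integrable circle_measure (\<lambda>x. (norm (f x))\<^sup>2 + (norm (g x))\<^sup>2)" using assms by (simp add: sqint_def)
  show "(\<lambda>x. norm (f x) * norm (g x)) \<in> borel_measurable circle_measure"
    using assms[THEN sqint_measurable] by measurable
  show "AE x in circle_measure. norm (norm (f x) * norm (g x)) \<le> norm ((norm (f x))\<^sup>2 + (norm (g x))\<^sup>2)"
  proof (rule AE_I2)
    fix x
    have "2 * (norm (f x) * norm (g x)) \<le> (norm (f x))\<^sup>2 + (norm (g x))\<^sup>2"
      using sum_squares_bound[of "norm (f x)" "norm (g x)"] by simp
    moreover have "0 \<le> norm (f x) * norm (g x)" by simp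
    ultimately have "norm (f x) * norm (g x) \<le> (norm (f x))\<^sup>2 + (norm (g x))\<^sup>2" by linarith
    then show "norm (norm (f x) * norm (g x)) \<le> norm ((norm (f x))\<^sup>2 + (norm (g x))\<^sup>2)"
      by (simp add: abs_mult)
  qed
qed

lemma quadratic_nonneg_discriminant:
  fixes a b c :: real
  assumes q: "\<And>t. 0 \<le> a - 2 * t * b + t\<^sup>2 * c" and b: "b \<ge> 0" and c: "c \<ge> 0"
  shows "b\<^sup>2 \<le> a * c"
proof (cases "c = 0")
  case True
  have "b = 0"
  proof (rule ccontr)
    assume "b \<noteq> 0"
    \<comment> \<open>For c = 0 the quadratic is linear in t, and at this t it has the value
      -1.\<close>
    then show False using q[of "(a + 1) / (2 * b)"] True by simp
  qed
  then show ?thesis using True by simp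
next
  case False
  then have c: "c > 0" using c by linarith
  have "0 \<le> (a - 2 * (b/c) * b + (b/c)\<^sup>2 * c) * c" using q[of "b/c"] c by simp
  also have "\<dots> = a * c - b\<^sup>2" using c by (simp add: field_simps power2_eq_square)
  finally show ?thesis by simp
qed

lemma Cauchy_Schwarz_circle:
  assumes "sqint f" "sqint g"
  shows "(LINT x|circle_measure. norm (f x) * norm (g x)) \<le> nrm f * nrm g"
proof -
  let ?a = "(nrm f)\<^sup>2" and ?b = "LINT x|circle_measure. norm (f x) * norm (g x)" and ?c = "(nrm g)\<^sup>2"
  have i: "integrable circle_measure (\<lambda>x. norm (f x) * norm (g x))" by (rule sqint_mult_integrable[OF assms])
  have f2: "integrable circle_measure (\<lambda>x. (norm (f x))\<^sup>2)" and g2: "integrable circle_measure (\<lambda>x. (norm (g x))\<^sup>2)"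
    using assms by (auto simp: sqint_def)
  have q: "0 \<le> ?a - 2 * t * ?b + t\<^sup>2 * ?c" for t
  proof -
    have "0 \<le> (LINT x|circle_measure. (norm (f x) - t * norm (g x))\<^sup>2)" by simp
    also have "\<dots> = (LINT x|circle_measure. (norm (f x))\<^sup>2 - (2 * t) * (norm (f x) * norm (g x)) + t\<^sup>2 * (norm (g x))\<^sup>2)"
      by (intro Bochner_Integration.integral_cong) (auto simp: power2_eq_square algebra_simps)
    also have "\<dots> = ?a - 2 * t * ?b + t\<^sup>2 * ?c"
      using i f2 g2 by (simp add: nrm_sq)
    finally show ?thesis .
  qed
  have "?b\<^sup>2 \<le> ?a * ?c" by (rule quadratic_nonneg_discriminant[OF q]) auto
  then have "?b\<^sup>2 \<le> (nrm f * nrm g)\<^sup>2" by (simp add: power_mult_distrib)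
  then show ?thesis by (rule power2_le_imp_le) simp
qed

lemma sqint_integrable:
  fixes f :: "real \<Rightarrow> 'a::euclidean_space"
  assumes "sqint f"
  shows "integrable circle_measure f" "(LINT x|circle_measure. norm (f x)) \<le> 3 * nrm f"
proof -
  have one: "sqint (\<lambda>x. 1::real)" by (auto simp: sqint_def)
  have "integrable circle_measure (\<lambda>x. norm (f x))"
    using sqint_mult_integrable[OF assms one] by simp
  then show "integrable circle_measure f"
    using assms by (subst (asm) integrable_norm_iff) (auto simp: sqint_def)
  have "(LINT x|circle_measure. norm (f x)) \<le> nrm f * nrm (\<lambda>x. 1::real)"
    using Cauchy_Schwarz_circle[OF assms one] by simp
  also have "\<dots> \<le> nrm f * 3" using sqint_bounded(2)[of "\<lambda>x. 1::real" 1] by (intro mult_left_mono) auto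
  finally show "(LINT x|circle_measure. norm (f x)) \<le> 3 * nrm f" by (simp add: mult.commute)
qed

lemma nrm_scaleR: "nrm (\<lambda>x. r *\<^sub>R f x) = \<bar>r\<bar> * nrm f"
  by (simp add: nrm_def power_mult_distrib real_sqrt_mult)

lemma sqint_scaleR: "sqint f \<Longrightarrow> sqint (\<lambda>x. r *\<^sub>R f x)"
  using borel_measurable_scaleR[OF borel_measurable_const[of r] sqint_measurable[of f]]
  by (simp add: sqint_def power_mult_distrib)

lemma sqint_add:
  assumes f: "sqint f" and g: "sqint g"
  shows "sqint (\<lambda>x. f x + g x)" "nrm (\<lambda>x. f x + g x) \<le> nrm f + nrm g"
proof -
  have m: "(\<lambda>x. f x + g x) \<in> borel_measurable circle_measure"
    by (intro borel_measurable_add sqint_measurable assms)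
  have f2: "integrable circle_measure (\<lambda>x. (norm (f x))\<^sup>2)" and g2: "integrable circle_measure (\<lambda>x. (norm (g x))\<^sup>2)"
    using assms by (auto simp: sqint_def)
  note i = sqint_mult_integrable[OF assms]
  have I: "integrable circle_measure (\<lambda>x. (norm (f x))\<^sup>2 + 2 * (norm (f x) * norm (g x)) + (norm (g x))\<^sup>2)"
    using f2 g2 i by simp
  have le: "(norm (f x + g x))\<^sup>2 \<le> (norm (f x))\<^sup>2 + 2 * (norm (f x) * norm (g x)) + (norm (g x))\<^sup>2" for x
    using power_mono[OF norm_triangle_ineq[of "f x" "g x"] norm_ge_zero, of 2] by (simp add: power2_sum)
  have fg: "integrable circle_measure (\<lambda>x. (norm (f x + g x))\<^sup>2)"
    using m le by (intro Bochner_Integration.integrable_bound[OF I]) 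
      (auto intro!: AE_I2 order_trans[OF le] borel_measurable_power borel_measurable_norm)
  then show "sqint (\<lambda>x. f x + g x)" using m by (simp add: sqint_def)
  have "(LINT x|circle_measure. (norm (f x + g x))\<^sup>2) 
     \<le> (LINT x|circle_measure. (norm (f x))\<^sup>2 + 2 * (norm (f x) * norm (g x)) + (norm (g x))\<^sup>2)"
    by (rule integral_mono[OF fg I le])
  also have "\<dots> = (nrm f)\<^sup>2 + 2 * (LINT x|circle_measure. norm (f x) * norm (g x)) + (nrm g)\<^sup>2"
    using f2 g2 i by (simp add: nrm_sq)
  also have "\<dots> \<le> (nrm f + nrm g)\<^sup>2"
    using Cauchy_Schwarz_circle[OF assms] by (simp add: power2_sum)
  finally show "nrm (\<lambda>x. f x + g x) \<le> nrm f + nrm g"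
    unfolding nrm_def[of "\<lambda>x. f x + g x"] by (intro real_le_lsqrt) auto
qed

lemma nrm_eq_0D:
  assumes "sqint f" "nrm f = 0" shows "AE x in circle_measure. f x = 0"
proof -
  have "(LINT x|circle_measure. (norm (f x))\<^sup>2) = 0" using assms(2) by (simp add: nrm_def)
  then have "AE x in circle_measure. (norm (f x))\<^sup>2 = 0"
    using assms(1) by (subst (asm) integral_nonneg_eq_0_iff_AE) (auto simp: sqint_def)
  then show ?thesis by eventually_elim simp
qed

lemma L2_add: "f \<in> L2 \<Longrightarrow> g \<in> L2 \<Longrightarrow> (\<lambda>x. f x + g x) \<in> L2"
  unfolding L2_iff using sqint_add(1)[of f g] by (auto simp: periodic_def)

lemma L2_scaleR: "f \<in> L2 \<Longrightarrow> (\<lambda>x. r *\<^sub>R f x) \<in> L2"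
  unfolding L2_iff using sqint_scaleR[of f r] by (auto simp: periodic_def)

lemma L2_continuous:
  fixes f :: "real \<Rightarrow> 'a::euclidean_space"
  assumes "periodic f" "continuous_on {0..2*pi} f" shows "f \<in> L2"
proof -
  have "compact (f ` {0..2*pi})" using assms(2) by (intro compact_continuous_image) auto
  then obtain K where K: "\<And>y. y \<in> f ` {0..2*pi} \<Longrightarrow> norm y \<le> K" by (meson compact_imp_bounded bounded_iff)
  have "norm (f 0) \<le> K" by (rule K) auto
  then have "K \<ge> 0" by (meson norm_ge_zero order_trans)
  have "sqint f"
    using assms K \<open>K \<ge> 0\<close> by (intro sqint_bounded(1)[of f K] continuous_on_borel_circle AE_I2) auto
  then show ?thesis using assms by (simp add: L2_iff)
qed

subsection \<open>Sobolev spaces on the circle\<close>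

text \<open>Iterating a choice of weak derivative is harmless: it only depends on the
  almost-everywhere class, so both notions below are invariant under changes on null sets.\<close>

fun Sob :: "nat \<Rightarrow> (real \<Rightarrow> 'a::euclidean_space) \<Rightarrow> bool" where
  "Sob 0 f = (f \<in> L2)"
| "Sob (Suc k) f = (f \<in> L2 \<and> has_weak_deriv f (wderiv f) \<and> Sob k (wderiv f))"

fun En :: "nat \<Rightarrow> (real \<Rightarrow> 'a::euclidean_space) \<Rightarrow> real" where
  "En 0 f = nrm f"
| "En (Suc k) f = nrm f + En k (wderiv f)"

lemma En_nonneg [simp]: "0 \<le> En k f"
  by (induction k arbitrary: f) auto

lemma Sob_L2: "Sob k f \<Longrightarrow> f \<in> L2"
  by (cases k) auto

lemma Sob_measurable: "Sob k f \<Longrightarrow> f \<in> borel_measurable circle_measure"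
  using Sob_L2 by (auto simp: L2_def)

lemma Sob_periodic: "Sob k f \<Longrightarrow> periodic f"
  using Sob_L2 by (auto simp: L2_def)

lemma nrm_le_En: "nrm f \<le> En k f"
  by (cases k) auto

lemma L2_cong:
  assumes "f \<in> L2" "periodic g" "g \<in> borel_measurable circle_measure" "AE x in circle_measure. f x = g x"
  shows "g \<in> L2"
  using assms sqint_cong_AE(1)[of f g] by (simp add: L2_iff)

lemma Sob_cong:
  assumes "Sob k f" "periodic g" "g \<in> borel_measurable circle_measure" "AE x in circle_measure. f x = g x"
  shows "Sob k g \<and> En k g = En k f"
proof -
  have L: "f \<in> L2" "g \<in> L2" using Sob_L2[OF assms(1)] L2_cong[OF _ assms(2-)] by auto
  have n: "nrm g = nrm f" using sqint_cong_AE(2)[OF _ assms(3,4)] L by (simp add: L2_iff)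
  have w: "wderiv f = wderiv g" "has_weak_deriv f = has_weak_deriv g"
    using wderiv_cong[of f g] has_weak_deriv_cong[of f g] assms L by (auto simp: L2_def)
  show ?thesis using assms(1) L n w by (cases k) auto
qed

text \<open>Weak derivatives agree almost everywhere, so any known one can stand in for the chosen
  \<open>wderiv f\<close>, in the regularity as well as in the norm.\<close>

lemma Sob_SucI:
  assumes "f \<in> L2" "has_weak_deriv f g" "Sob k g"
  shows "Sob (Suc k) f \<and> En (Suc k) f = nrm f + En k g"
proof -
  have w: "has_weak_deriv f (wderiv f)" using assms(2) by (rule has_weak_deriv_wderiv)
  have "AE x in circle_measure. g x = wderiv f x" using wderiv_AE[OF assms(2)] by eventually_elim simp
  then have "Sob k (wderiv f) \<and> En k (wderiv f) = En k g"
    using w by (intro Sob_cong[OF assms(3)]) (auto simp: has_weak_deriv_def)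
  then show ?thesis using assms w by simp
qed

lemma Sob_Suc_lower: "Sob (Suc k) f \<Longrightarrow> Sob k f \<and> En k f \<le> En (Suc k) f"
  by (induction k arbitrary: f) auto

lemma Sob_le: "j \<le> k \<Longrightarrow> Sob k f \<Longrightarrow> Sob j f \<and> En j f \<le> En k f"
proof (induction k rule: dec_induct)
  case (step n)
  then show ?case using Sob_Suc_lower[of n f] by auto
qed simp

lemma Sob_add:
  "Sob k f \<Longrightarrow> Sob k g \<Longrightarrow> Sob k (\<lambda>x. f x + g x) \<and> En k (\<lambda>x. f x + g x) \<le> En k f + En k g"
proof (induction k arbitrary: f g)
  case 0
  then show ?case using L2_add[of f g] sqint_add(2)[of f g] by (simp add: L2_iff)
next
  case (Suc k)
  have L: "(\<lambda>x. f x + g x) \<in> L2" using Suc.prems by (intro L2_add) auto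
  have IH: "Sob k (\<lambda>x. wderiv f x + wderiv g x) \<and> En k (\<lambda>x. wderiv f x + wderiv g x) \<le> En k (wderiv f) + En k (wderiv g)"
    using Suc by simp
  have "has_weak_deriv (\<lambda>x. f x + g x) (\<lambda>x. wderiv f x + wderiv g x)"
    using Suc.prems by (intro has_weak_deriv_add) auto
  from Sob_SucI[OF L this IH[THEN conjunct1]] IH sqint_add(2)[of f g] Suc.prems
  show ?case by (auto simp: L2_iff)
qed

lemma Sob_scaleR:
  "Sob k f \<Longrightarrow> Sob k (\<lambda>x. r *\<^sub>R f x) \<and> En k (\<lambda>x. r *\<^sub>R f x) = \<bar>r\<bar> * En k f"
proof (induction k arbitrary: f)
  case 0
  then show ?case using L2_scaleR[of f r] by (simp add: nrm_scaleR)
next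
  case (Suc k)
  have L: "(\<lambda>x. r *\<^sub>R f x) \<in> L2" using Suc.prems by (intro L2_scaleR) auto
  have IH: "Sob k (\<lambda>x. r *\<^sub>R wderiv f x) \<and> En k (\<lambda>x. r *\<^sub>R wderiv f x) = \<bar>r\<bar> * En k (wderiv f)"
    using Suc by simp
  have "has_weak_deriv (\<lambda>x. r *\<^sub>R f x) (\<lambda>x. r *\<^sub>R wderiv f x)"
    using Suc.prems by (intro has_weak_deriv_scaleR) auto
  from Sob_SucI[OF L this IH[THEN conjunct1]] IH
  show ?case by (simp add: nrm_scaleR distrib_left)
qed

lemma Sob_diff:
  assumes "Sob k f" "Sob k g"
  shows "Sob k (\<lambda>x. f x - g x)" "En k (\<lambda>x. f x - g x) \<le> En k f + En k g"
proof -
  have "Sob k (\<lambda>x. f x + (-1) *\<^sub>R g x) \<and> En k (\<lambda>x. f x + (-1) *\<^sub>R g x) \<le> En k f + En k (\<lambda>x. (-1) *\<^sub>R g x)"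
    using Sob_add[OF assms(1)] Sob_scaleR[OF assms(2), of "-1"] by blast
  then show "Sob k (\<lambda>x. f x - g x)" "En k (\<lambda>x. f x - g x) \<le> En k f + En k g"
    using Sob_scaleR[OF assms(2), of "-1"] by auto
qed

lemma wderiv_diff_AE:
  assumes "Sob (Suc k) f" "Sob (Suc k) g"
  shows "AE x in circle_measure. wderiv (\<lambda>x. f x - g x) x = wderiv f x - wderiv g x"
proof -
  have "has_weak_deriv (\<lambda>x. f x + (-1) *\<^sub>R g x) (\<lambda>x. wderiv f x + (-1) *\<^sub>R wderiv g x)"
    using assms by (intro has_weak_deriv_add has_weak_deriv_scaleR) auto
  then show ?thesis using wderiv_AE by fastforce
qed

text \<open>The oscillation of an absolutely continuous function is at most the L^1 norm of its
  derivative, and so is its distance from any weighted mean. Weight 1 serves the estimates in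
  \<theta>, weight |c'| those in arc length, where fields of the form D_s h have mean 0.\<close>

lemma weighted_mean_bound:
  fixes f :: "real \<Rightarrow> 'a::euclidean_space" and \<omega> :: "real \<Rightarrow> real"
  assumes h: "has_weak_deriv f g" and \<omega>: "continuous_on {0..2*pi} \<omega>" "\<And>x. x \<in> {0..2*pi} \<Longrightarrow> \<omega> x \<ge> 0"
    and L: "L = (LINT x|circle_measure. \<omega> x)" "L > 0"
  shows "AE x in circle_measure. norm (f x - (LINT y|circle_measure. \<omega> y *\<^sub>R f y) /\<^sub>R L) \<le> (LINT y|circle_measure. norm (g y))"
proof -
  obtain F where F: "acd F g" "F 0 = F (2*pi)" "AE x in circle_measure. f x = F x" using has_weak_derivE[OF h] .
  have gi: "integrable circle_measure g" using h by (simp add: has_weak_deriv_def)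
  have cF: "continuous_on {0..2*pi} F" by (rule acd_continuous[OF F(1)])
  define V where "V = (LINT y|circle_measure. norm (g y))"
  have V: "V = integral {0..2*pi} (\<lambda>y. norm (g y))" 
    unfolding V_def using gi by (intro circle_integral_eq) simp
  have osc: "norm (F y - F x) \<le> V" if "0 \<le> x" "x \<le> y" "y \<le> 2*pi" for x y
  proof -
    note sub = integrable_subinterval_circle[OF acd_integrable[OF F(1)]]
    have "norm (F y - F x) \<le> integral {x..y} (\<lambda>t. norm (g t))"
      unfolding acd_diff[OF F(1) that] using that by (intro integral_norm_bound_integral sub) auto
    also have "\<dots> \<le> V" unfolding V using that by (intro integral_subset_le sub) auto
    finally show ?thesis .
  qed
  have osc': "norm (F x - F y) \<le> V" if "x \<in> {0..2*pi}" "y \<in> {0..2*pi}" for x y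
    using osc[of x y] osc[of y x] that by (cases "x \<le> y") (auto simp: norm_minus_commute)
  have Fi: "integrable circle_measure (\<lambda>y. \<omega> y *\<^sub>R F y)"
    using \<omega>(1) cF by (intro integrable_continuous_scaleR) (simp add: absolutely_integrable_continuous_real flip: absolutely_integrable_circle_iff)
  have \<omega>i: "integrable circle_measure \<omega>"
    using \<omega>(1) by (simp add: absolutely_integrable_continuous_real flip: absolutely_integrable_circle_iff)
  have fm: "f \<in> borel_measurable circle_measure" using h by (auto simp: has_weak_deriv_def)
  have [measurable]: "\<omega> \<in> borel_measurable circle_measure" by (rule continuous_on_borel_circle[OF \<omega>(1)])
  have [measurable]: "F \<in> borel_measurable circle_measure" by (rule continuous_on_borel_circle[OF cF])
  have eqI: "(LINT y|circle_measure. \<omega> y *\<^sub>R f y) = (LINT y|circle_measure. \<omega> y *\<^sub>R F y)"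
    using F(3) fm by (intro integral_cong_AE) auto
  have main: "norm (F x - (LINT y|circle_measure. \<omega> y *\<^sub>R F y) /\<^sub>R L) \<le> V" if x: "x \<in> {0..2*pi}" for x
  proof -
    have i1: "integrable circle_measure (\<lambda>y. \<omega> y *\<^sub>R F x)" using \<omega>i by simp
    have "L *\<^sub>R F x - (LINT y|circle_measure. \<omega> y *\<^sub>R F y) = (LINT y|circle_measure. \<omega> y *\<^sub>R F x - \<omega> y *\<^sub>R F y)"
      using \<omega>i Fi i1 by (simp add: L(1))
    also have "norm \<dots> \<le> (LINT y|circle_measure. \<omega> y * V)"
    proof (rule order_trans[OF integral_norm_bound integral_mono])
      show "integrable circle_measure (\<lambda>y. norm (\<omega> y *\<^sub>R F x - \<omega> y *\<^sub>R F y))" using i1 Fi by simp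
      show "integrable circle_measure (\<lambda>y. \<omega> y * V)" using \<omega>i by simp
      show "norm (\<omega> y *\<^sub>R F x - \<omega> y *\<^sub>R F y) \<le> \<omega> y * V" if "y \<in> space circle_measure" for y
        using that \<omega>(2)[of y] osc'[OF x, of y] unfolding scaleR_diff_right[symmetric] norm_scaleR
        by (auto intro: mult_left_mono)
    qed
    also have "\<dots> = L * V" using L(1) by simp
    finally have "norm (L *\<^sub>R F x - (LINT y|circle_measure. \<omega> y *\<^sub>R F y)) \<le> L * V" .
    moreover have "L *\<^sub>R F x - (LINT y|circle_measure. \<omega> y *\<^sub>R F y) = L *\<^sub>R (F x - (LINT y|circle_measure. \<omega> y *\<^sub>R F y) /\<^sub>R L)"
      using L(2) by (simp add: scaleR_diff_right)
    ultimately show ?thesis using L(2) by simp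
  qed
  have "AE x in circle_measure. norm (F x - (LINT y|circle_measure. \<omega> y *\<^sub>R F y) /\<^sub>R L) \<le> V"
    by (rule AE_I2) (use main in auto)
  then show ?thesis using F(3) by eventually_elim (simp add: eqI V_def)
qed

lemma Sob_sup:
  fixes f :: "real \<Rightarrow> 'a::euclidean_space"
  assumes "Sob (Suc 0) f"
  shows "AE x in circle_measure. norm (f x) \<le> 3 * En (Suc 0) f"
proof -
  let ?z = "(LINT y|circle_measure. 1 *\<^sub>R f y) /\<^sub>R (2*pi)"
  have f: "sqint f" "sqint (wderiv f)" using assms by (auto simp: L2_iff)
  have *: "AE x in circle_measure. norm (f x - ?z) \<le> (LINT y|circle_measure. norm (wderiv f y))"
    using assms by (intro weighted_mean_bound) auto
  have z: "norm ?z \<le> 3 * nrm f"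
  proof -
    have "norm ?z = inverse (2*pi) * norm (LINT y|circle_measure. f y)"
      unfolding norm_scaleR scaleR_one by (simp only: abs_of_nonneg pi_ge_zero mult_nonneg_nonneg zero_le_numeral inverse_nonnegative_iff_nonnegative)
    also have "\<dots> \<le> 1 * (3 * nrm f)"
    proof (rule mult_mono)
      show "inverse (2*pi) \<le> 1" using pi_gt3 by (intro inverse_le_1_iff[THEN iffD2]) linarith
      show "norm (LINT y|circle_measure. f y) \<le> 3 * nrm f"
        using integral_norm_bound[of circle_measure f] sqint_integrable(2)[OF f(1)] by linarith
    qed auto
    finally show ?thesis by linarith
  qed
  from * show ?thesis
  proof eventually_elim
    case (elim x)
    have "norm (f x) \<le> norm ?z + norm (f x - ?z)" by (metis add.commute diff_add_cancel norm_triangle_ineq)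
    then show ?case using elim z sqint_integrable(2)[OF f(2)] by simp
  qed
qed

section \<open>Products of Sobolev functions\<close>

lemma measurable_bilinear:
  fixes B :: "'a::euclidean_space \<Rightarrow> 'b::euclidean_space \<Rightarrow> 'c::euclidean_space"
  assumes B: "bounded_bilinear B" and "f \<in> borel_measurable M" "g \<in> borel_measurable M"
  shows "(\<lambda>x. B (f x) (g x)) \<in> borel_measurable M"
proof -
  interpret B: bounded_bilinear B by fact
  have "case_prod B \<in> borel_measurable borel"
    by (intro borel_measurable_continuous_onI)
      (auto simp: split_beta intro!: B.continuous_on continuous_intros)
  then have "(\<lambda>x. case_prod B (f x, g x)) \<in> borel_measurable M"
    by (rule measurable_compose[rotated]) (intro borel_measurable_Pair assms)
  then show ?thesis by simp
qed

lemma L2_bilinear_left: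
  assumes B: "bounded_bilinear B" and K: "\<And>a b. norm (B a b) \<le> norm a * norm b * K" "K \<ge> 0"
    and f: "f \<in> L2" "AE x in circle_measure. norm (f x) \<le> M" "M \<ge> 0" and g: "g \<in> L2"
  shows "(\<lambda>x. B (f x) (g x)) \<in> L2 \<and> nrm (\<lambda>x. B (f x) (g x)) \<le> K * M * nrm g"
proof -
  have m: "(\<lambda>x. B (f x) (g x)) \<in> borel_measurable circle_measure"
    using f g by (intro measurable_bilinear[OF B]) (auto simp: L2_def)
  have le: "AE x in circle_measure. norm (B (f x) (g x)) \<le> (K * M) * norm (g x)"
    using f(2)
  proof eventually_elim
    case (elim x)
    have "norm (f x) * norm (g x) * K \<le> M * norm (g x) * K" using elim K by (intro mult_right_mono) auto
    then show ?case using K(1)[of "f x" "g x"] by (simp add: mult_ac)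
  qed
  have gs: "sqint g" using g by (simp add: L2_iff)
  have "periodic (\<lambda>x. B (f x) (g x))" using f g by (simp add: L2_def periodic_def)
  then show ?thesis using sqint_dominated[OF gs m le] nrm_dominated[OF gs m le] K f by (simp add: L2_iff)
qed

lemma L2_bilinear_right:
  assumes B: "bounded_bilinear B" and K: "\<And>a b. norm (B a b) \<le> norm a * norm b * K" "K \<ge> 0"
    and f: "f \<in> L2" "AE x in circle_measure. norm (f x) \<le> M" "M \<ge> 0" and g: "g \<in> L2"
  shows "(\<lambda>x. B (g x) (f x)) \<in> L2 \<and> nrm (\<lambda>x. B (g x) (f x)) \<le> K * M * nrm g"
  using L2_bilinear_left[OF bounded_bilinear.flip[OF B] _ K(2) f g] K(1) by (simp add: mult.commute)

text \<open>Order at least 1 makes one factor bounded, so that the other can be measured in L^2;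
  this settles the lowest order. A further derivative falls on one factor by the product rule and
  leaves products at the previous order.\<close>

lemma Sob_algebra:
  fixes B :: "'a::euclidean_space \<Rightarrow> 'b::euclidean_space \<Rightarrow> 'c::euclidean_space"
  assumes B: "bounded_bilinear B"
  shows "\<exists>C\<ge>0. \<forall>f g. Sob (Suc m) f \<longrightarrow> Sob (Suc m) g \<longrightarrow> Sob (Suc m) (\<lambda>x. B (f x) (g x)) \<and>
     En (Suc m) (\<lambda>x. B (f x) (g x)) \<le> C * En (Suc m) f * En (Suc m) g"
proof -
  obtain K where K: "K > 0" "\<And>a b. norm (B a b) \<le> norm a * norm b * K"
    using bounded_bilinear.pos_bounded[OF B] by blast
  have left: "(\<lambda>x. B (f x) (g x)) \<in> L2 \<and> nrm (\<lambda>x. B (f x) (g x)) \<le> 3 * K * (En (Suc 0) f * nrm g)"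
    if "Sob (Suc 0) f" "g \<in> L2" for f :: "real \<Rightarrow> 'a" and g :: "real \<Rightarrow> 'b"
    using L2_bilinear_left[OF B K(2) _ Sob_L2[OF that(1)] Sob_sup[OF that(1)] _ that(2)] K(1) by (simp add: mult_ac)
  have right: "(\<lambda>x. B (f x) (g x)) \<in> L2 \<and> nrm (\<lambda>x. B (f x) (g x)) \<le> 3 * K * (nrm f * En (Suc 0) g)"
    if "f \<in> L2" "Sob (Suc 0) g" for f :: "real \<Rightarrow> 'a" and g :: "real \<Rightarrow> 'b"
    using L2_bilinear_right[OF B K(2) _ Sob_L2[OF that(2)] Sob_sup[OF that(2)] _ that(1)] K(1) by (simp add: mult_ac)
  have deriv: "has_weak_deriv (\<lambda>x. B (f x) (g x)) (\<lambda>x. B (f x) (wderiv g x) + B (wderiv f x) (g x))"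
    if "Sob (Suc k) f" "Sob (Suc k) g" for f :: "real \<Rightarrow> 'a" and g :: "real \<Rightarrow> 'b" and k
    using that by (intro has_weak_deriv_bilinear[OF B]) auto
  show ?thesis
  proof (induction m)
    case 0
    have "Sob (Suc 0) (\<lambda>x. B (f x) (g x)) \<and> En (Suc 0) (\<lambda>x. B (f x) (g x)) \<le> 9 * K * En (Suc 0) f * En (Suc 0) g"
      if f: "Sob (Suc 0) f" and g: "Sob (Suc 0) g" for f :: "real \<Rightarrow> 'a" and g :: "real \<Rightarrow> 'b"
    proof -
      have d: "Sob 0 (\<lambda>x. B (f x) (wderiv g x))" "Sob 0 (\<lambda>x. B (wderiv f x) (g x))"
        using left[OF f, of "wderiv g"] right[OF _ g, of "wderiv f"] f g by auto
      have s: "Sob (Suc 0) (\<lambda>x. B (f x) (g x)) \<and> En (Suc 0) (\<lambda>x. B (f x) (g x)) = 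
        nrm (\<lambda>x. B (f x) (g x)) + En 0 (\<lambda>x. B (f x) (wderiv g x) + B (wderiv f x) (g x))"
        using left[OF f, of g] g by (intro Sob_SucI deriv[OF f g] Sob_add[THEN conjunct1] d) auto
      let ?P = "En (Suc 0) f * En (Suc 0) g"
      have "nrm (\<lambda>x. B (f x) (g x)) \<le> 3 * K * ?P"
        using left[OF f, of g] g K(1) by (auto intro!: order_trans[OF conjunct2[OF left[OF f, of g]]] mult_left_mono)
      moreover have "nrm (\<lambda>x. B (f x) (wderiv g x)) \<le> 3 * K * ?P"
        using g K(1) by (auto intro!: order_trans[OF conjunct2[OF left[OF f, of "wderiv g"]]] mult_left_mono)
      moreover have "nrm (\<lambda>x. B (wderiv f x) (g x)) \<le> 3 * K * ?P"
        using f K(1) by (auto intro!: order_trans[OF conjunct2[OF right[OF _ g, of "wderiv f"]]] mult_left_mono mult_right_mono)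
      moreover have "En 0 (\<lambda>x. B (f x) (wderiv g x) + B (wderiv f x) (g x)) \<le> nrm (\<lambda>x. B (f x) (wderiv g x)) + nrm (\<lambda>x. B (wderiv f x) (g x))"
        using Sob_add[OF d] by simp
      \<comment> \<open>Three terms, the product and the two of its derivative, are each bounded by
        3 K times the product of the norms.\<close>
      ultimately have "En (Suc 0) (\<lambda>x. B (f x) (g x)) \<le> 9 * K * ?P" using s by linarith
      then show ?thesis using s by (metis mult.assoc)
    qed
    then show ?case using K(1) by (intro exI[of _ "9 * K"]) auto
  next
    case (Suc m)
    then obtain C where C: "C \<ge> 0" "\<And>f g. Sob (Suc m) f \<Longrightarrow> Sob (Suc m) g \<Longrightarrow> Sob (Suc m) (\<lambda>x. B (f x) (g x)) \<and>
     En (Suc m) (\<lambda>x. B (f x) (g x)) \<le> C * En (Suc m) f * En (Suc m) g" by blast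
    have "Sob (Suc (Suc m)) (\<lambda>x. B (f x) (g x)) \<and> 
       En (Suc (Suc m)) (\<lambda>x. B (f x) (g x)) \<le> (3 * K + 2 * C) * En (Suc (Suc m)) f * En (Suc (Suc m)) g"
      if f: "Sob (Suc (Suc m)) f" and g: "Sob (Suc (Suc m)) g" for f :: "real \<Rightarrow> 'a" and g :: "real \<Rightarrow> 'b"
    proof -
      let ?P = "En (Suc (Suc m)) f * En (Suc (Suc m)) g"
      have f1: "Sob (Suc m) f" "En (Suc m) f \<le> En (Suc (Suc m)) f" "Sob (Suc m) (wderiv f)" "En (Suc m) (wderiv f) \<le> En (Suc (Suc m)) f"
        and g1: "Sob (Suc m) g" "En (Suc m) g \<le> En (Suc (Suc m)) g" "Sob (Suc m) (wderiv g)" "En (Suc m) (wderiv g) \<le> En (Suc (Suc m)) g"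
        using Sob_Suc_lower[OF f] Sob_Suc_lower[OF g] f g by auto
      have f0: "Sob (Suc 0) f" "En (Suc 0) f \<le> En (Suc (Suc m)) f" using Sob_le[OF _ f, of "Suc 0"] by auto
      have d: "Sob (Suc m) (\<lambda>x. B (f x) (wderiv g x))" "Sob (Suc m) (\<lambda>x. B (wderiv f x) (g x))"
        using C(2) f1 g1 by auto
      have s: "Sob (Suc (Suc m)) (\<lambda>x. B (f x) (g x)) \<and> En (Suc (Suc m)) (\<lambda>x. B (f x) (g x)) = 
        nrm (\<lambda>x. B (f x) (g x)) + En (Suc m) (\<lambda>x. B (f x) (wderiv g x) + B (wderiv f x) (g x))"
        using left[OF f0(1), of g] g by (intro Sob_SucI deriv[OF f g] Sob_add[THEN conjunct1] d) auto
      have "En (Suc 0) f * nrm g \<le> ?P" by (intro mult_mono f0(2) nrm_le_En En_nonneg nrm_nonneg)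
      then have "3 * K * (En (Suc 0) f * nrm g) \<le> 3 * K * ?P" using K(1) by (intro mult_left_mono) auto
      then have "nrm (\<lambda>x. B (f x) (g x)) \<le> 3 * K * ?P"
        using left[OF f0(1), of g] Sob_L2[OF g] by linarith
      moreover have "C * (En (Suc m) f * En (Suc m) (wderiv g)) \<le> C * ?P" "C * (En (Suc m) (wderiv f) * En (Suc m) g) \<le> C * ?P"
        using C(1) f1 g1 by (intro mult_left_mono mult_mono En_nonneg; simp)+
      then have "En (Suc m) (\<lambda>x. B (f x) (wderiv g x)) \<le> C * ?P" "En (Suc m) (\<lambda>x. B (wderiv f x) (g x)) \<le> C * ?P"
        using C(2)[OF f1(1) g1(3)] C(2)[OF f1(3) g1(1)] by (auto simp: mult.assoc)
      moreover have "En (Suc m) (\<lambda>x. B (f x) (wderiv g x) + B (wderiv f x) (g x)) 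
        \<le> En (Suc m) (\<lambda>x. B (f x) (wderiv g x)) + En (Suc m) (\<lambda>x. B (wderiv f x) (g x))"
        using Sob_add[OF d] by blast
      ultimately have "En (Suc (Suc m)) (\<lambda>x. B (f x) (g x)) \<le> 3 * K * ?P + C * ?P + C * ?P" using s by linarith
      also have "\<dots> = (3 * K + 2 * C) * En (Suc (Suc m)) f * En (Suc (Suc m)) g"
        by (simp only: distrib_right mult.assoc)
      finally show ?thesis using s by blast
    qed
    then show ?case using K(1) C(1) by (intro exI[of _ "3 * K + 2 * C"]) auto
  qed
qed

text \<open>Unlike \<^term>\<open>Sob m\<close> alone, this is an algebra acting on \<^term>\<open>Sob m\<close> for all \<^term>\<open>m\<close>, including \<^term>\<open>m = 0\<close>.\<close>

definition Bd :: "nat \<Rightarrow> real \<Rightarrow> (real \<Rightarrow> 'a::euclidean_space) \<Rightarrow> bool" where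
  "Bd m M f \<longleftrightarrow> Sob m f \<and> (AE x in circle_measure. norm (f x) \<le> M) \<and> En m f \<le> M"

lemma Bd_Sob: "Bd m M f \<Longrightarrow> Sob m f"
  by (simp add: Bd_def)

lemma Bd_nonneg: "Bd m M f \<Longrightarrow> M \<ge> 0"
  unfolding Bd_def by (meson En_nonneg order_trans)

lemma Bd_mono: "Bd m M f \<Longrightarrow> M \<le> N \<Longrightarrow> Bd m N f"
  unfolding Bd_def by (auto elim: eventually_mono)

lemma Bd_lower: "Bd (Suc m) M f \<Longrightarrow> Bd m M f"
  unfolding Bd_def using Sob_Suc_lower[of m f] by auto

lemma Bd_add:
  assumes "Bd m M f" "Bd m N g" shows "Bd m (M + N) (\<lambda>x. f x + g x)"
proof -
  have "AE x in circle_measure. norm (f x) \<le> M" "AE x in circle_measure. norm (g x) \<le> N"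
    using assms by (auto simp: Bd_def)
  then have "AE x in circle_measure. norm (f x + g x) \<le> M + N"
    by eventually_elim (intro order_trans[OF norm_triangle_ineq] add_mono)
  then show ?thesis using assms Sob_add[of m f g] by (auto simp: Bd_def)
qed

lemma Bd_SobI: "Sob (Suc m) f \<Longrightarrow> Bd (Suc m) (3 * En (Suc m) f) f"
proof -
  assume f: "Sob (Suc m) f"
  have f0: "Sob (Suc 0) f" "En (Suc 0) f \<le> En (Suc m) f" using Sob_le[OF _ f, of "Suc 0"] by auto
  have "AE x in circle_measure. norm (f x) \<le> 3 * En (Suc m) f"
    using Sob_sup[OF f0(1)] f0(2) by (auto elim: eventually_mono)
  then show ?thesis using f by (simp add: Bd_def)
qed

text \<open>For m = 0 the sup bound of f carries the estimate, for m > 0 the algebra property does.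
  C is independent of M, which is what makes products with a small factor small.\<close>

lemma Bd_Sob_bilinear:
  fixes B :: "'a::euclidean_space \<Rightarrow> 'b::euclidean_space \<Rightarrow> 'c::euclidean_space"
  assumes B: "bounded_bilinear B"
  shows "\<exists>C\<ge>0. \<forall>M f g. Bd m M f \<longrightarrow> Sob m g \<longrightarrow> Sob m (\<lambda>x. B (f x) (g x)) \<and>
     En m (\<lambda>x. B (f x) (g x)) \<le> C * M * En m g"
proof (cases m)
  case 0
  obtain K where K: "K > 0" "\<And>a b. norm (B a b) \<le> norm a * norm b * K"
    using bounded_bilinear.pos_bounded[OF B] by blast
  have "Sob m (\<lambda>x. B (f x) (g x)) \<and> En m (\<lambda>x. B (f x) (g x)) \<le> K * M * En m g"
    if "Bd m M f" "Sob m g" for M and f :: "real \<Rightarrow> 'a" and g :: "real \<Rightarrow> 'b"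
    using L2_bilinear_left[OF B K(2), of f M g] that K(1) Bd_nonneg[OF that(1)] 0 by (auto simp: Bd_def)
  then show ?thesis using K(1) by (intro exI[of _ K]) auto
next
  case (Suc k)
  obtain C where C: "C \<ge> 0" "\<And>f g. Sob (Suc k) f \<Longrightarrow> Sob (Suc k) g \<Longrightarrow> Sob (Suc k) (\<lambda>x. B (f x) (g x)) \<and>
     En (Suc k) (\<lambda>x. B (f x) (g x)) \<le> C * En (Suc k) f * En (Suc k) g" using Sob_algebra[OF B, of k] by blast
  have "Sob m (\<lambda>x. B (f x) (g x)) \<and> En m (\<lambda>x. B (f x) (g x)) \<le> C * M * En m g"
    if "Bd m M f" "Sob m g" for M and f :: "real \<Rightarrow> 'a" and g :: "real \<Rightarrow> 'b"
  proof -
    have f: "Sob (Suc k) f" "En (Suc k) f \<le> M" using that(1) by (auto simp: Bd_def Suc)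
    have "C * En (Suc k) f * En (Suc k) g \<le> C * M * En (Suc k) g"
      using f C(1) by (intro mult_right_mono mult_left_mono) auto
    then show ?thesis using C(2)[OF f(1), of g] that(2) unfolding Suc by linarith
  qed
  then show ?thesis using C(1) by (intro exI[of _ C]) auto
qed

lemma Bd_bilinear:
  fixes B :: "'a::euclidean_space \<Rightarrow> 'b::euclidean_space \<Rightarrow> 'c::euclidean_space"
  assumes B: "bounded_bilinear B"
  shows "\<exists>C\<ge>0. \<forall>M N f g. Bd m M f \<longrightarrow> Bd m N g \<longrightarrow> Bd m (C * M * N) (\<lambda>x. B (f x) (g x))"
proof -
  obtain K where K: "K > 0" "\<And>a b. norm (B a b) \<le> norm a * norm b * K"
    using bounded_bilinear.pos_bounded[OF B] by blast
  obtain C where C: "C \<ge> 0" "\<And>M f g. Bd m M f \<Longrightarrow> Sob m g \<Longrightarrow> Sob m (\<lambda>x. B (f x) (g x)) \<and>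
     En m (\<lambda>x. B (f x) (g x)) \<le> C * M * En m g" using Bd_Sob_bilinear[OF B, of m] by blast
  have "Bd m ((K + C) * M * N) (\<lambda>x. B (f x) (g x))"
    if f: "Bd m M f" and g: "Bd m N g" for M N and f :: "real \<Rightarrow> 'a" and g :: "real \<Rightarrow> 'b"
  proof -
    have MN: "M \<ge> 0" "N \<ge> 0" using Bd_nonneg f g by auto
    have le: "K * M * N \<le> (K + C) * M * N" "C * M * N \<le> (K + C) * M * N"
      using MN K(1) C(1) by (auto intro!: mult_right_mono)
    have "C * M * En m g \<le> C * M * N" using g MN C(1) by (intro mult_left_mono) (auto simp: Bd_def)
    then have En: "En m (\<lambda>x. B (f x) (g x)) \<le> (K + C) * M * N" using C(2)[OF f Bd_Sob[OF g]] le by linarith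
    have "AE x in circle_measure. norm (f x) \<le> M" "AE x in circle_measure. norm (g x) \<le> N"
      using f g by (auto simp: Bd_def)
    then have "AE x in circle_measure. norm (B (f x) (g x)) \<le> (K + C) * M * N"
    proof eventually_elim
      case (elim x)
      have "norm (B (f x) (g x)) \<le> norm (f x) * norm (g x) * K" by (rule K)
      also have "\<dots> \<le> M * N * K" using elim MN K(1) by (intro mult_right_mono mult_mono) auto
      finally show ?case using le by (simp add: mult_ac)
    qed
    then show ?thesis using C(2)[OF f Bd_Sob[OF g]] En by (simp add: Bd_def)
  qed
  then show ?thesis using K(1) C(1) by (intro exI[of _ "K + C"]) auto
qed

section \<open>Continuous representatives and norms of nonvanishing fields\<close>

lemma continuous_AE_le:
  fixes f :: "real \<Rightarrow> 'a::real_normed_vector"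
  assumes f: "continuous_on {0..2*pi} f" and ae: "AE x in circle_measure. norm (f x) \<le> M" and x: "x \<in> {0..2*pi}"
  shows "norm (f x) \<le> M"
proof (rule ccontr)
  assume "\<not> norm (f x) \<le> M"
  then have e: "norm (f x) - M > 0" by simp
  then obtain d where d: "d > 0" "\<And>y. y \<in> {0..2*pi} \<Longrightarrow> dist y x < d \<Longrightarrow> dist (f y) (f x) < norm (f x) - M"
    using f x unfolding continuous_on_iff by meson
  define a b where "a = max 0 (x - d/2)" and "b = min (2*pi) (x + d/2)"
  have ab: "a < b" "0 \<le> a" "b \<le> 2*pi" "{a..b} \<subseteq> {x - d/2..x + d/2}" using x d(1) pi_gt_zero by (auto simp: a_def b_def)
  have "norm (f y) > M" if y: "y \<in> {a..b}" for y
  proof -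
    have "dist (f y) (f x) < norm (f x) - M" using y ab d by (intro d(2)) (auto simp: dist_real_def subset_iff)
    moreover have "norm (f x) \<le> norm (f y) + dist (f y) (f x)"
      by (metis dist_norm norm_minus_commute norm_triangle_sub)
    ultimately show ?thesis by linarith
  qed
  note gt = this
  obtain N where N: "N \<in> null_sets lebesgue" "\<And>y. y \<in> {0..2*pi} - N \<Longrightarrow> norm (f y) \<le> M"
  proof -
    have "AE y in lebesgue. y \<in> {0..2*pi} \<longrightarrow> norm (f y) \<le> M"
      using ae by (subst (asm) AE_restrict_space_iff) auto
    then show thesis using that by (auto elim!: AE_E3)
  qed
  have "{a..b} \<subseteq> N"
  proof
    fix y assume y: "y \<in> {a..b}"
    show "y \<in> N"
    proof (rule ccontr)
      assume "y \<notin> N"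
      then have "norm (f y) \<le> M" using y ab(2,3) by (intro N(2)) auto
      then show False using gt[OF y] by linarith
    qed
  qed
  then have "negligible {a..b}" using N(1) negligible_subset unfolding negligible_iff_null_sets[symmetric] by blast
  then show False using ab(1) negligible_interval(1)[of a b] by (simp add: cbox_interval box_real)
qed

lemma continuous_AE_eq:
  fixes f :: "real \<Rightarrow> 'a::real_normed_vector"
  assumes "continuous_on {0..2*pi} f" "continuous_on {0..2*pi} g" "AE x in circle_measure. f x = g x" "x \<in> {0..2*pi}"
  shows "f x = g x"
proof -
  have "norm (f x - g x) \<le> 0"
    using assms(3) by (intro continuous_AE_le[of "\<lambda>x. f x - g x"] continuous_intros assms) (auto elim: eventually_mono)
  then show ?thesis by simp
qed

lemma acd_cong:
  assumes "acd f g" "\<And>x. x \<in> {0..2*pi} \<Longrightarrow> f x = f' x" "\<And>x. x \<in> {0..2*pi} \<Longrightarrow> g x = g' x"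
  shows "acd f' g'"
proof (rule acdI)
  have "g absolutely_integrable_on {0..2*pi} \<longleftrightarrow> g' absolutely_integrable_on {0..2*pi}"
    by (rule set_integrable_cong[OF refl refl]) (rule assms(3))
  then show "g' absolutely_integrable_on {0..2*pi}" using acd_integrable[OF assms(1)] by (rule iffD1)
  fix x assume x: "x \<in> {0..2*pi}"
  have "integral {0..x} g = integral {0..x} g'" using x assms(3) by (intro integral_cong) auto
  then show "f' x = f' 0 + integral {0..x} g'"
    using acd_eq[OF assms(1) x] assms(2)[OF x] assms(2)[of 0] by simp
qed

text \<open>A continuous function equals its absolutely continuous representative at every point of
  the period. Pointwise calculus with weak derivatives rests on this.\<close>

lemma acd_of_continuous:
  fixes f :: "real \<Rightarrow> 'a::euclidean_space"
  assumes "has_weak_deriv f g" "continuous_on {0..2*pi} f"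
  shows "acd f g"
proof -
  obtain F where F: "acd F g" "F 0 = F (2*pi)" "AE x in circle_measure. f x = F x" using has_weak_derivE[OF assms(1)] .
  show ?thesis
    using continuous_AE_eq[OF assms(2) acd_continuous[OF F(1)] F(3)] by (intro acd_cong[OF F(1)]) auto
qed

lemma periodic_ends: "periodic f \<Longrightarrow> f 0 = f (2*pi)"
  by (metis add_0 periodic_def)

text \<open>The norm is not differentiable at 0, so the chain rule is applied to the square p . p,
  which is positive, with outer functions y^(-1/2) and y^(1/2).\<close>

lemma has_weak_deriv_inverse_norm:
  fixes p :: "real \<Rightarrow> 'a::euclidean_space"
  assumes p: "has_weak_deriv p p'" "continuous_on {0..2*pi} p" and nz: "\<And>x. x \<in> {0..2*pi} \<Longrightarrow> p x \<noteq> 0"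
  defines "w \<equiv> \<lambda>x. inverse (norm (p x))"
  shows "has_weak_deriv w (\<lambda>x. - ((w x * w x * w x) * (p x \<bullet> p' x)))"
    and "has_weak_deriv (\<lambda>x. norm (p x)) (\<lambda>x. (w x *\<^sub>R p x) \<bullet> p' x)"
proof -
  have a: "acd p p'" by (rule acd_of_continuous[OF p])
  have q: "acd (\<lambda>x. p x \<bullet> p x) (\<lambda>x. p x \<bullet> p' x + p' x \<bullet> p x)"
    by (rule acd_bilinear[OF bounded_bilinear_inner a a])
  have pos: "p x \<bullet> p x > 0" if "x \<in> {0..2*pi}" for x using nz[OF that] by simp
  have per: "periodic p" "periodic p'" using p by (auto simp: has_weak_deriv_def)
  have cw: "continuous_on {0..2*pi} w" unfolding w_def using p(2) nz by (auto intro!: continuous_intros)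
  have cu: "continuous_on {0..2*pi} (\<lambda>x. norm (p x))" using p(2) by (intro continuous_intros)
  have "acd (\<lambda>x. inverse (sqrt (p x \<bullet> p x)))
     (\<lambda>x. - ((inverse (sqrt (p x \<bullet> p x)))^3 / 2) * (p x \<bullet> p' x + p' x \<bullet> p x))"
  proof (rule acd_chain[OF q pos])
    fix y :: real assume "y > 0"
    then show "((\<lambda>y. inverse (sqrt y)) has_real_derivative - ((inverse (sqrt y))^3 / 2)) (at y)"
      by (auto intro!: derivative_eq_intros simp: power3_eq_cube)
  next
    show "continuous_on {0<..} (\<lambda>y. - ((inverse (sqrt y))^3 / 2))" by (auto intro!: continuous_intros)
  qed
  then have w: "acd w (\<lambda>x. - ((w x * w x * w x) * (p x \<bullet> p' x)))"
    by (rule acd_cong) (auto simp: w_def norm_eq_sqrt_inner power3_eq_cube inner_commute)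
  show "has_weak_deriv w (\<lambda>x. - ((w x * w x * w x) * (p x \<bullet> p' x)))"
    using per by (intro has_weak_derivI[OF w] continuous_on_borel_circle cw)
      (auto simp: periodic_def w_def periodic_ends[OF per(1)])
  have "acd (\<lambda>x. sqrt (p x \<bullet> p x)) (\<lambda>x. (inverse (sqrt (p x \<bullet> p x)) / 2) * (p x \<bullet> p' x + p' x \<bullet> p x))"
  proof (rule acd_chain[OF q pos])
    fix y :: real assume "y > 0"
    then show "(sqrt has_real_derivative inverse (sqrt y) / 2) (at y)" by (rule DERIV_real_sqrt)
  next
    show "continuous_on {0<..} (\<lambda>y. inverse (sqrt y) / 2)" by (auto intro!: continuous_intros)
  qed
  then have u: "acd (\<lambda>x. norm (p x)) (\<lambda>x. (w x *\<^sub>R p x) \<bullet> p' x)"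
    by (rule acd_cong) (auto simp: w_def norm_eq_sqrt_inner inner_commute)
  show "has_weak_deriv (\<lambda>x. norm (p x)) (\<lambda>x. (w x *\<^sub>R p x) \<bullet> p' x)"
    using per by (intro has_weak_derivI[OF u] continuous_on_borel_circle cu)
      (auto simp: periodic_def w_def periodic_ends[OF per(1)])
qed

text \<open>One constant bounds |p| from above and, by its inverse, from below, so that a single
  number enters the later estimates. Continuity is included because nonvanishing is meant at every
  point.\<close>

definition pinched :: "real \<Rightarrow> (real \<Rightarrow> 'a::euclidean_space) \<Rightarrow> bool" where
  "pinched K p \<longleftrightarrow> periodic p \<and> continuous_on {0..2*pi} p \<and>
     (\<forall>x\<in>{0..2*pi}. inverse K \<le> norm (p x) \<and> norm (p x) \<le> K)"

lemma pinched_nz: "pinched K p \<Longrightarrow> K > 0 \<Longrightarrow> x \<in> {0..2*pi} \<Longrightarrow> p x \<noteq> 0"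
  unfolding pinched_def by (metis inverse_positive_iff_positive norm_zero not_le)

lemma pinched_inverse_norm:
  assumes "pinched K p" "K > 0"
  shows "(\<lambda>x. inverse (norm (p x))) \<in> L2" "x \<in> {0..2*pi} \<Longrightarrow> inverse (norm (p x)) \<le> K"
    "Bd 0 (3 * K) (\<lambda>x. inverse (norm (p x)))" "Bd 0 (3 * K) (\<lambda>x. norm (p x))"
proof -
  show le: "inverse (norm (p x)) \<le> K" if "x \<in> {0..2*pi}" for x
    using assms that unfolding pinched_def by (metis inverse_inverse_eq inverse_positive_iff_positive le_imp_inverse_le)
  have c: "continuous_on {0..2*pi} (\<lambda>x. inverse (norm (p x)))" "continuous_on {0..2*pi} (\<lambda>x. norm (p x))"
    using assms pinched_nz[OF assms] by (auto simp: pinched_def intro!: continuous_intros)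
  show L: "(\<lambda>x. inverse (norm (p x))) \<in> L2" using assms(1) by (intro L2_continuous c) (auto simp: pinched_def periodic_def)
  have L': "(\<lambda>x. norm (p x)) \<in> L2" using assms(1) by (intro L2_continuous c) (auto simp: pinched_def periodic_def)
  have ae: "AE x in circle_measure. norm (inverse (norm (p x))) \<le> K" using le by (intro AE_I2) auto
  have ae': "AE x in circle_measure. norm (norm (p x)) \<le> K" using assms(1) by (intro AE_I2) (auto simp: pinched_def)
  show "Bd 0 (3 * K) (\<lambda>x. inverse (norm (p x)))"
    using L ae assms(2) sqint_bounded(2)[OF continuous_on_borel_circle[OF c(1)] ae] unfolding Bd_def 
    by (auto elim: eventually_mono)
  show "Bd 0 (3 * K) (\<lambda>x. norm (p x))"
    using L' ae' assms(2) sqint_bounded(2)[OF continuous_on_borel_circle[OF c(2)] ae'] unfolding Bd_def 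
    by (auto elim: eventually_mono)
qed

lemma Bd_pinched: "pinched K p \<Longrightarrow> Sob m p \<Longrightarrow> En m p \<le> K \<Longrightarrow> Bd m K p"
  unfolding Bd_def pinched_def by (auto intro!: AE_I2)

text \<open>To bound w = 1/|p| at order m + 1, the factors of its derivative -w^3 (p . p') are
  needed at order m only. The constant is fixed before p, so it is uniform over all curves with the
  same bounds.\<close>

lemma inverse_norm_Bd:
  assumes K: "K > 0"
  shows "\<exists>C. \<forall>p::real \<Rightarrow> 'a::euclidean_space. pinched K p \<and> Sob m p \<and> En m p \<le> K \<longrightarrow> Bd m C (\<lambda>x. inverse (norm (p x)))"
proof (induction m)
  case 0
  show ?case using pinched_inverse_norm(3)[OF _ K] by blast
next
  case (Suc m)
  then obtain C where C: "\<And>p::real \<Rightarrow> 'a. pinched K p \<Longrightarrow> Sob m p \<Longrightarrow> En m p \<le> K \<Longrightarrow> Bd m C (\<lambda>x. inverse (norm (p x)))"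
    by blast
  obtain A where A: "A \<ge> 0" "\<And>M N f g. Bd m M f \<Longrightarrow> Bd m N g \<Longrightarrow> Bd m (A * M * N) (\<lambda>x. f x * g x :: real)"
    using Bd_bilinear[OF bounded_bilinear_mult[where 'a=real], of m] by blast
  obtain D where D: "D \<ge> 0" "\<And>M f g. Bd m M f \<Longrightarrow> Sob m g \<Longrightarrow> Sob m (\<lambda>x. f x \<bullet> g x) \<and> En m (\<lambda>x. f x \<bullet> g x) \<le> D * M * En m (g :: real \<Rightarrow> 'a)"
    using Bd_Sob_bilinear[OF bounded_bilinear_inner[where 'a='a], of m] by blast
  obtain E where E: "E \<ge> 0" "\<And>M f g. Bd m M f \<Longrightarrow> Sob m g \<Longrightarrow> Sob m (\<lambda>x. f x * g x) \<and> En m (\<lambda>x. f x * g x) \<le> E * M * En m (g :: real \<Rightarrow> real)"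
    using Bd_Sob_bilinear[OF bounded_bilinear_mult[where 'a=real], of m] by blast
  \<comment> \<open>\<open>?W\<close> bounds w^3, as two successive products of functions with bound
    C, and \<open>D * K * K\<close> in the next line bounds p . p'.\<close>
  let ?W = "A * (A * C * C) * C"
  let ?C = "3 * K + E * ?W * (D * K * K)"
  have "Bd (Suc m) ?C (\<lambda>x. inverse (norm (p x)))" if p: "pinched K p" "Sob (Suc m) p" "En (Suc m) p \<le> K" for p :: "real \<Rightarrow> 'a"
  proof -
    define w where "w x = inverse (norm (p x))" for x
    have p': "Sob m (wderiv p)" "En m (wderiv p) \<le> K"
      using p by (auto intro: order_trans[rotated] simp: add_increasing)
    have p0: "Sob m p" "En m p \<le> K" using Sob_Suc_lower[OF p(2)] p(3) by auto
    have w: "Bd m C w" using C[OF p(1) p0] unfolding w_def .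
    have C0: "C \<ge> 0" using Bd_nonneg[OF w] .
    have w3: "Bd m ?W (\<lambda>x. w x * w x * w x)" by (intro A w)
    have i: "Sob m (\<lambda>x. p x \<bullet> wderiv p x) \<and> En m (\<lambda>x. p x \<bullet> wderiv p x) \<le> D * K * K"
      using D(2)[OF Bd_pinched[OF p(1) p0] p'(1)] mult_left_mono[OF p'(2), of "D * K"] D(1) K by auto
    have "E * ?W * En m (\<lambda>x. p x \<bullet> wderiv p x) \<le> E * ?W * (D * K * K)"
      using i E(1) Bd_nonneg[OF w3] by (intro mult_left_mono) auto
    then have d: "Sob m (\<lambda>x. (w x * w x * w x) * (p x \<bullet> wderiv p x)) \<and> En m (\<lambda>x. (w x * w x * w x) * (p x \<bullet> wderiv p x)) \<le> E * ?W * (D * K * K)"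
      using E(2)[OF w3 conjunct1[OF i]] by auto
    then have d': "Sob m (\<lambda>x. - ((w x * w x * w x) * (p x \<bullet> wderiv p x))) \<and> En m (\<lambda>x. - ((w x * w x * w x) * (p x \<bullet> wderiv p x))) \<le> E * ?W * (D * K * K)"
      using Sob_scaleR[of m "\<lambda>x. (w x * w x * w x) * (p x \<bullet> wderiv p x)" "-1"] by simp
    have "has_weak_deriv w (\<lambda>x. - ((w x * w x * w x) * (p x \<bullet> wderiv p x)))"
      unfolding w_def using p pinched_nz[OF p(1) K] by (intro has_weak_deriv_inverse_norm(1)) (auto simp: pinched_def)
    from Sob_SucI[OF pinched_inverse_norm(1)[OF p(1) K, folded w_def] this conjunct1[OF d']]
    have "Sob (Suc m) w \<and> En (Suc m) w \<le> nrm w + E * ?W * (D * K * K)" using d' by auto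
    moreover have "AE x in circle_measure. norm (w x) \<le> 3 * K" "nrm w \<le> 3 * K"
      using pinched_inverse_norm(3)[OF p(1) K] unfolding Bd_def w_def by auto
    moreover have "E * ?W * (D * K * K) \<ge> 0" using E(1) Bd_nonneg[OF w3] D(1) K by simp
    ultimately show ?thesis unfolding w_def[symmetric] Bd_def by (auto elim: eventually_mono)
  qed
  then show ?case by blast
qed

text \<open>The derivative of |p| is (p / |p|) . p', and p / |p| is bounded at order m in terms of
  K. So the bound at order m + 1 is affine in the norm of p', with constants that see order m only;
  a higher power would defeat the exponential growth estimate.\<close>

lemma norm_Sob:
  assumes K: "K > 0"
  shows "\<exists>C\<ge>0. \<forall>p::real \<Rightarrow> 'a::euclidean_space. pinched K p \<and> Sob (Suc m) p \<and> En m p \<le> K \<longrightarrow> 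
     Sob (Suc m) (\<lambda>x. norm (p x)) \<and> En (Suc m) (\<lambda>x. norm (p x)) \<le> C * (1 + En m (wderiv p))"
proof -
  obtain C where C: "\<And>p::real \<Rightarrow> 'a. pinched K p \<Longrightarrow> Sob m p \<Longrightarrow> En m p \<le> K \<Longrightarrow> Bd m C (\<lambda>x. inverse (norm (p x)))"
    using inverse_norm_Bd[OF K, of m] by blast
  obtain A where A: "A \<ge> 0" "\<And>M N f g. Bd m M f \<Longrightarrow> Bd m N g \<Longrightarrow> Bd m (A * M * N) (\<lambda>x. f x *\<^sub>R g x :: 'a)"
    using Bd_bilinear[OF bounded_bilinear_scaleR[where 'a='a], of m] by blast
  obtain D where D: "D \<ge> 0" "\<And>M f g. Bd m M f \<Longrightarrow> Sob m g \<Longrightarrow> Sob m (\<lambda>x. f x \<bullet> g x) \<and> En m (\<lambda>x. f x \<bullet> g x) \<le> D * M * En m (g :: real \<Rightarrow> 'a)"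
    using Bd_Sob_bilinear[OF bounded_bilinear_inner[where 'a='a], of m] by blast
  let ?C = "3 * K + \<bar>D * (A * C * K)\<bar>"
  have "Sob (Suc m) (\<lambda>x. norm (p x)) \<and> En (Suc m) (\<lambda>x. norm (p x)) \<le> ?C * (1 + En m (wderiv p))"
    if p: "pinched K p" "Sob (Suc m) p" "En m p \<le> K" for p :: "real \<Rightarrow> 'a"
  proof -
    have p0: "Sob m p" "Sob m (wderiv p)" using Sob_Suc_lower[OF p(2)] p(2) by auto
    have wp: "Bd m (A * C * K) (\<lambda>x. inverse (norm (p x)) *\<^sub>R p x)"
      using A(2)[OF C[OF p(1) p0(1) p(3)] Bd_pinched[OF p(1) p0(1) p(3)]] .
    have d: "has_weak_deriv (\<lambda>x. norm (p x)) (\<lambda>x. (inverse (norm (p x)) *\<^sub>R p x) \<bullet> wderiv p x)"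
      using p pinched_nz[OF p(1) K] by (intro has_weak_deriv_inverse_norm(2)) (auto simp: pinched_def)
    have B0: "Bd 0 (3 * K) (\<lambda>x. norm (p x))" by (rule pinched_inverse_norm(4)[OF p(1) K])
    have "Sob (Suc m) (\<lambda>x. norm (p x)) \<and> En (Suc m) (\<lambda>x. norm (p x)) = nrm (\<lambda>x. norm (p x)) + 
      En m (\<lambda>x. (inverse (norm (p x)) *\<^sub>R p x) \<bullet> wderiv p x)"
      using B0 D(2)[OF wp p0(2)] by (intro Sob_SucI[OF _ d]) (auto simp: Bd_def)
    moreover have "nrm (\<lambda>x. norm (p x)) \<le> 3 * K" using B0 by (simp add: Bd_def)
    moreover have "En m (\<lambda>x. (inverse (norm (p x)) *\<^sub>R p x) \<bullet> wderiv p x) \<le> D * (A * C * K) * En m (wderiv p)"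
      using D(2)[OF wp p0(2)] by blast
    moreover have "D * (A * C * K) * En m (wderiv p) \<le> \<bar>D * (A * C * K)\<bar> * En m (wderiv p)"
      by (intro mult_right_mono) auto
    moreover have "?C * (1 + En m (wderiv p)) = 3 * K + 3 * K * En m (wderiv p) + \<bar>D * (A * C * K)\<bar> + \<bar>D * (A * C * K)\<bar> * En m (wderiv p)"
      by (simp add: algebra_simps)
    moreover have "3 * K * En m (wderiv p) \<ge> 0" using K by simp
    ultimately show ?thesis by linarith
  qed
  then show ?thesis using K by (intro exI[of _ ?C]) auto
qed

subsection \<open>Convergence in Sobolev spaces\<close>

text \<open>\<^term>\<open>En m (\<lambda>x. fs s x - f x)\<close> is meaningful only together with Sobolev regularity of the
  difference, hence eventual bounds instead of a limit.\<close>

definition cvS :: "nat \<Rightarrow> 's filter \<Rightarrow> ('s \<Rightarrow> real \<Rightarrow> 'a::euclidean_space) \<Rightarrow> (real \<Rightarrow> 'a) \<Rightarrow> bool" where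
  "cvS m F fs f \<longleftrightarrow> Sob m f \<and> (\<forall>\<epsilon>>0. \<forall>\<^sub>F s in F. Sob m (\<lambda>x. fs s x - f x) \<and> En m (\<lambda>x. fs s x - f x) \<le> \<epsilon>)"

text \<open>Convergence of multipliers. At m = 0 a product of two L^2 functions need not be in L^2,
  hence the sup bound inside \<open>Bd\<close>.\<close>

definition cvB :: "nat \<Rightarrow> 's filter \<Rightarrow> ('s \<Rightarrow> real \<Rightarrow> 'a::euclidean_space) \<Rightarrow> (real \<Rightarrow> 'a) \<Rightarrow> bool" where
  "cvB m F fs f \<longleftrightarrow> (\<exists>M. Bd m M f) \<and> (\<forall>\<epsilon>>0. \<forall>\<^sub>F s in F. Bd m \<epsilon> (\<lambda>x. fs s x - f x))"

lemma cvB_imp_cvS: "cvB m F fs f \<Longrightarrow> cvS m F fs f"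
  unfolding cvB_def cvS_def Bd_def by (auto elim: eventually_mono)

lemma cvB_lower: "cvB (Suc m) F fs f \<Longrightarrow> cvB m F fs f"
  unfolding cvB_def by (blast intro: Bd_lower eventually_mono)

lemma cvS_lower: "cvS (Suc m) F fs f \<Longrightarrow> cvS m F fs f"
proof -
  assume *: "cvS (Suc m) F fs f"
  have "\<forall>\<^sub>F s in F. Sob m (\<lambda>x. fs s x - f x) \<and> En m (\<lambda>x. fs s x - f x) \<le> \<epsilon>" if e: "\<epsilon> > 0" for \<epsilon>
  proof -
    have "\<forall>\<^sub>F s in F. Sob (Suc m) (\<lambda>x. fs s x - f x) \<and> En (Suc m) (\<lambda>x. fs s x - f x) \<le> \<epsilon>"
      using * e unfolding cvS_def by blast
    then show ?thesis
    proof eventually_elim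
      case (elim s)
      then show ?case using Sob_Suc_lower[of m "\<lambda>x. fs s x - f x"] by linarith
    qed
  qed
  then show ?thesis using * Sob_Suc_lower[of m f] unfolding cvS_def by blast
qed

lemma cvS_le: "j \<le> m \<Longrightarrow> cvS m F fs f \<Longrightarrow> cvS j F fs f"
  by (induction m rule: dec_induct) (auto dest: cvS_lower)

lemma cvS_Sob: "cvS m F fs f \<Longrightarrow> \<forall>\<^sub>F s in F. Sob m (fs s)"
proof -
  assume *: "cvS m F fs f"
  then have "\<forall>\<^sub>F s in F. Sob m (\<lambda>x. fs s x - f x)"
    unfolding cvS_def by (auto dest!: spec[of _ "1::real"] elim: eventually_mono)
  then show ?thesis
  proof eventually_elim
    case (elim s)
    then show ?case using Sob_add[OF elim, of f] * by (simp add: cvS_def)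
  qed
qed

lemma cvS_imp_cvB: "cvS (Suc m) F fs f \<Longrightarrow> cvB (Suc m) F fs f"
proof -
  assume *: "cvS (Suc m) F fs f"
  have "\<forall>\<^sub>F s in F. Bd (Suc m) \<epsilon> (\<lambda>x. fs s x - f x)" if "\<epsilon> > 0" for \<epsilon>
  proof -
    have "\<epsilon> / 3 > 0" using that by simp
    then have "\<forall>\<^sub>F s in F. Sob (Suc m) (\<lambda>x. fs s x - f x) \<and> En (Suc m) (\<lambda>x. fs s x - f x) \<le> \<epsilon> / 3"
      using * unfolding cvS_def by blast
    then show ?thesis by eventually_elim (auto intro: Bd_mono[OF Bd_SobI] simp del: Sob.simps En.simps)
  qed
  moreover have "Bd (Suc m) (3 * En (Suc m) f) f" using * unfolding cvS_def by (intro Bd_SobI) blast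
  ultimately show ?thesis unfolding cvB_def by blast
qed

text \<open>Product estimates yield bounds of the form A \<epsilon>, where \<epsilon> \<le> 1
  absorbs the quadratic term. Dividing \<delta> by A + 1 also covers A = 0.\<close>

lemma eventually_small_scale:
  fixes A :: real
  assumes "A \<ge> 0" "\<And>\<epsilon>. 0 < \<epsilon> \<Longrightarrow> \<epsilon> \<le> 1 \<Longrightarrow> \<forall>\<^sub>F s in F. P (A * \<epsilon>) s"
    and mono: "\<And>x y s. x \<le> y \<Longrightarrow> P x s \<Longrightarrow> P y s" and "\<delta> > 0"
  shows "\<forall>\<^sub>F s in F. P \<delta> s"
proof -
  define e where "e = min 1 (\<delta> / (A + 1))"
  have e: "0 < e" "e \<le> 1" using assms(1,4) by (auto simp: e_def)
  have "A * e \<le> A * (\<delta> / (A + 1))" using assms(1) by (intro mult_left_mono) (auto simp: e_def)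
  also have "\<dots> \<le> \<delta>" using assms(1,4) by (simp add: divide_le_eq)
  finally show ?thesis using assms(2)[OF e] mono by (auto elim: eventually_mono)
qed

lemma cvS_bilinear:
  fixes B :: "'a::euclidean_space \<Rightarrow> 'b::euclidean_space \<Rightarrow> 'c::euclidean_space"
  assumes B: "bounded_bilinear B" and f: "cvB m F fs f" and g: "cvS m F gs g"
  shows "cvS m F (\<lambda>s x. B (fs s x) (gs s x)) (\<lambda>x. B (f x) (g x))"
proof -
  interpret B: bounded_bilinear B by fact
  obtain C where C: "C \<ge> 0" "\<And>M f g. Bd m M f \<Longrightarrow> Sob m g \<Longrightarrow> Sob m (\<lambda>x. B (f x) (g x)) \<and>
     En m (\<lambda>x. B (f x) (g x)) \<le> C * M * En m g" using Bd_Sob_bilinear[OF B, of m] by blast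
  obtain M where M: "Bd m M f" using f by (auto simp: cvB_def)
  have gS: "Sob m g" using g by (simp add: cvS_def)
  let ?Q = "\<lambda>\<delta> s. Sob m (\<lambda>x. B (fs s x) (gs s x) - B (f x) (g x)) \<and> En m (\<lambda>x. B (fs s x) (gs s x) - B (f x) (g x)) \<le> \<delta>"
  \<comment> \<open>With df and dg the differences from the limits, the summands belong to the terms
    df dg, df g and f dg of the expanded product; in the first one dg is bounded by 1.\<close>
  let ?A = "C + C * En m g + C * M"
  have M0: "M \<ge> 0" by (rule Bd_nonneg[OF M])
  have "\<forall>\<^sub>F s in F. ?Q \<delta> s" if "\<delta> > 0" for \<delta>
  proof (rule eventually_small_scale[where P = ?Q and A = ?A])
    show "0 \<le> ?A" using C(1) M0 by simp
    fix \<epsilon> :: real assume e: "0 < \<epsilon>" "\<epsilon> \<le> 1"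
    have "\<forall>\<^sub>F s in F. Bd m \<epsilon> (\<lambda>x. fs s x - f x)" using f e by (auto simp: cvB_def)
    moreover have "\<forall>\<^sub>F s in F. Sob m (\<lambda>x. gs s x - g x) \<and> En m (\<lambda>x. gs s x - g x) \<le> \<epsilon>" using g e by (auto simp: cvS_def)
    ultimately show "\<forall>\<^sub>F s in F. ?Q (?A * \<epsilon>) s"
    proof eventually_elim
      case (elim s)
      let ?a = "\<lambda>x. B (fs s x - f x) (gs s x - g x)" and ?b = "\<lambda>x. B (fs s x - f x) (g x)" and ?c = "\<lambda>x. B (f x) (gs s x - g x)"
      have a: "Sob m ?a \<and> En m ?a \<le> C * \<epsilon> * En m (\<lambda>x. gs s x - g x)" using C(2) elim by blast
      have b: "Sob m ?b \<and> En m ?b \<le> C * \<epsilon> * En m g" using C(2) elim gS by blast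
      have c: "Sob m ?c \<and> En m ?c \<le> C * M * En m (\<lambda>x. gs s x - g x)" using C(2) elim M by blast
      have "C * \<epsilon> * En m (\<lambda>x. gs s x - g x) \<le> C * \<epsilon> * 1" using elim e C(1) by (intro mult_left_mono) auto
      moreover have "C * M * En m (\<lambda>x. gs s x - g x) \<le> C * M * \<epsilon>" using elim M0 C(1) by (intro mult_left_mono) auto
      moreover have eq: "(\<lambda>x. B (fs s x) (gs s x) - B (f x) (g x)) = (\<lambda>x. (?a x + ?b x) + ?c x)"
        by (auto simp: B.diff_left B.diff_right)
      moreover have "Sob m (\<lambda>x. (?a x + ?b x) + ?c x) \<and> En m (\<lambda>x. (?a x + ?b x) + ?c x) \<le> En m ?a + En m ?b + En m ?c"
        using Sob_add[of m ?a ?b] Sob_add[of m "\<lambda>x. ?a x + ?b x" ?c] a b c by force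
      moreover have "?A * \<epsilon> = C * \<epsilon> * 1 + C * \<epsilon> * En m g + C * M * \<epsilon>" by (simp add: algebra_simps)
      ultimately show ?case unfolding eq using a b c by linarith
    qed
  qed (use that in auto)
  then show ?thesis using C(2)[OF M gS] by (simp add: cvS_def)
qed

lemma cvB_bilinear:
  fixes B :: "'a::euclidean_space \<Rightarrow> 'b::euclidean_space \<Rightarrow> 'c::euclidean_space"
  assumes B: "bounded_bilinear B" and f: "cvB m F fs f" and g: "cvB m F gs g"
  shows "cvB m F (\<lambda>s x. B (fs s x) (gs s x)) (\<lambda>x. B (f x) (g x))"
proof -
  interpret B: bounded_bilinear B by fact
  obtain C where C: "C \<ge> 0" "\<And>M N f g. Bd m M f \<Longrightarrow> Bd m N g \<Longrightarrow> Bd m (C * M * N) (\<lambda>x. B (f x) (g x))"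
    using Bd_bilinear[OF B, of m] by blast
  obtain M where M: "Bd m M f" using f by (auto simp: cvB_def)
  obtain N where N: "Bd m N g" using g by (auto simp: cvB_def)
  let ?Q = "\<lambda>\<delta> s. Bd m \<delta> (\<lambda>x. B (fs s x) (gs s x) - B (f x) (g x))"
  let ?A = "C + C * N + C * M"
  have "\<forall>\<^sub>F s in F. ?Q \<delta> s" if "\<delta> > 0" for \<delta>
  proof (rule eventually_small_scale[where P = ?Q and A = ?A])
    show "0 \<le> ?A" using C(1) Bd_nonneg[OF M] Bd_nonneg[OF N] by simp
    fix \<epsilon> :: real assume e: "0 < \<epsilon>" "\<epsilon> \<le> 1"
    have "\<forall>\<^sub>F s in F. Bd m \<epsilon> (\<lambda>x. fs s x - f x)" "\<forall>\<^sub>F s in F. Bd m \<epsilon> (\<lambda>x. gs s x - g x)"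
      using f g e by (auto simp: cvB_def)
    then show "\<forall>\<^sub>F s in F. ?Q (?A * \<epsilon>) s"
    proof eventually_elim
      case (elim s)
      let ?a = "\<lambda>x. B (fs s x - f x) (gs s x - g x)" and ?b = "\<lambda>x. B (fs s x - f x) (g x)" and ?c = "\<lambda>x. B (f x) (gs s x - g x)"
      have eq: "(\<lambda>x. B (fs s x) (gs s x) - B (f x) (g x)) = (\<lambda>x. (?a x + ?b x) + ?c x)"
        by (auto simp: B.diff_left B.diff_right)
      have "Bd m ((C * \<epsilon> * \<epsilon> + C * \<epsilon> * N) + C * M * \<epsilon>) (\<lambda>x. (?a x + ?b x) + ?c x)"
        using C(2) elim M N by (intro Bd_add) auto
      moreover have "C * \<epsilon> * \<epsilon> \<le> C * \<epsilon> * 1" using e C(1) by (intro mult_left_mono) auto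
      then have "(C * \<epsilon> * \<epsilon> + C * \<epsilon> * N) + C * M * \<epsilon> \<le> ?A * \<epsilon>" by (simp add: algebra_simps)
      ultimately show ?case unfolding eq by (rule Bd_mono)
    qed
  qed (use that in \<open>auto intro: Bd_mono\<close>)
  then show ?thesis using C(2)[OF M N] by (auto simp: cvB_def)
qed

lemma cvS_wderiv:
  assumes "cvS (Suc m) F fs f" shows "cvS m F (\<lambda>s. wderiv (fs s)) (wderiv f)"
  unfolding cvS_def
proof (intro conjI allI impI)
  have f: "Sob (Suc m) f" using assms by (simp add: cvS_def)
  then show "Sob m (wderiv f)" by simp
  fix \<epsilon> :: real assume "\<epsilon> > 0"
  then have "\<forall>\<^sub>F s in F. Sob (Suc m) (\<lambda>x. fs s x - f x) \<and> En (Suc m) (\<lambda>x. fs s x - f x) \<le> \<epsilon>"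
    using assms by (auto simp: cvS_def simp del: Sob.simps En.simps)
  with cvS_Sob[OF assms]
  show "\<forall>\<^sub>F s in F. Sob m (\<lambda>x. wderiv (fs s) x - wderiv f x) \<and> En m (\<lambda>x. wderiv (fs s) x - wderiv f x) \<le> \<epsilon>"
  proof eventually_elim
    case (elim s)
    have ae: "AE x in circle_measure. wderiv (\<lambda>x. fs s x - f x) x = wderiv (fs s) x - wderiv f x"
      using elim(1) f by (rule wderiv_diff_AE)
    have L: "Sob m (\<lambda>x. wderiv (fs s) x - wderiv f x)" using elim(1) f by (intro Sob_diff) auto
    have "Sob m (\<lambda>x. wderiv (fs s) x - wderiv f x) \<and> 
       En m (\<lambda>x. wderiv (fs s) x - wderiv f x) = En m (wderiv (\<lambda>x. fs s x - f x))"
      using elim(2) by (intro Sob_cong[OF _ _ _ ae] Sob_periodic[OF L] Sob_measurable[OF L]) auto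
    moreover have "En m (wderiv (\<lambda>x. fs s x - f x)) \<le> \<epsilon>"
      using conjunct2[OF elim(2)] nrm_nonneg[of "\<lambda>x. fs s x - f x"] unfolding En.simps by linarith
    ultimately show ?case by simp
  qed
qed

lemma cvS_SucI:
  assumes 0: "cvS 0 F fs f" and d: "\<forall>\<^sub>F s in F. has_weak_deriv (fs s) (ds s)" "has_weak_deriv f d" and c: "cvS m F ds d"
  shows "cvS (Suc m) F fs f"
  unfolding cvS_def
proof (intro conjI allI impI)
  show "Sob (Suc m) f" using Sob_SucI[of f d m] 0 d(2) c by (simp add: cvS_def)
  fix \<epsilon> :: real assume "\<epsilon> > 0"
  then have e: "\<epsilon>/2 > 0" by simp
  have "\<forall>\<^sub>F s in F. Sob 0 (\<lambda>x. fs s x - f x) \<and> En 0 (\<lambda>x. fs s x - f x) \<le> \<epsilon>/2"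
    using 0 e unfolding cvS_def by blast
  moreover have "\<forall>\<^sub>F s in F. Sob m (\<lambda>x. ds s x - d x) \<and> En m (\<lambda>x. ds s x - d x) \<le> \<epsilon>/2"
    using c e unfolding cvS_def by blast
  ultimately show "\<forall>\<^sub>F s in F. Sob (Suc m) (\<lambda>x. fs s x - f x) \<and> En (Suc m) (\<lambda>x. fs s x - f x) \<le> \<epsilon>"
    using d(1)
  proof eventually_elim
    case (elim s)
    have "has_weak_deriv (\<lambda>x. fs s x + (-1) *\<^sub>R f x) (\<lambda>x. ds s x + (-1) *\<^sub>R d x)"
      by (intro has_weak_deriv_add has_weak_deriv_scaleR elim d)
    then have "has_weak_deriv (\<lambda>x. fs s x - f x) (\<lambda>x. ds s x - d x)" by simp
    then have "Sob (Suc m) (\<lambda>x. fs s x - f x) \<and> En (Suc m) (\<lambda>x. fs s x - f x) = nrm (\<lambda>x. fs s x - f x) + En m (\<lambda>x. ds s x - d x)"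
      using elim by (intro Sob_SucI) auto
    then show ?case using elim by auto
  qed
qed

lemma cvS_uminus: "cvS m F fs f \<Longrightarrow> cvS m F (\<lambda>s x. - fs s x) (\<lambda>x. - f x)"
proof -
  assume *: "cvS m F fs f"
  have "Sob m (\<lambda>x. - f x)" using Sob_scaleR[of m f "-1"] * by (simp add: cvS_def)
  moreover have "\<forall>\<^sub>F s in F. Sob m (\<lambda>x. - fs s x - - f x) \<and> En m (\<lambda>x. - fs s x - - f x) \<le> \<epsilon>" if "\<epsilon> > 0" for \<epsilon>
  proof -
    have "\<forall>\<^sub>F s in F. Sob m (\<lambda>x. fs s x - f x) \<and> En m (\<lambda>x. fs s x - f x) \<le> \<epsilon>" using * that unfolding cvS_def by blast
    then show ?thesis
    proof eventually_elim
      case (elim s)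
      have "(\<lambda>x. - fs s x - - f x) = (\<lambda>x. (-1) *\<^sub>R (fs s x - f x))" by auto
      then show ?case using Sob_scaleR[of m "\<lambda>x. fs s x - f x" "-1"] elim by simp
    qed
  qed
  ultimately show ?thesis by (simp add: cvS_def)
qed

lemma continuous_uniform_imp_cvB_0:
  fixes fs :: "'s \<Rightarrow> real \<Rightarrow> 'a::euclidean_space"
  assumes c: "\<forall>\<^sub>F s in F. periodic (fs s) \<and> continuous_on {0..2*pi} (fs s)" and f: "periodic f" "continuous_on {0..2*pi} f"
    and u: "\<And>\<epsilon>. \<epsilon> > 0 \<Longrightarrow> \<forall>\<^sub>F s in F. \<forall>x\<in>{0..2*pi}. norm (fs s x - f x) \<le> \<epsilon>"
  shows "cvB 0 F fs f"
proof -
  have "\<exists>M. \<forall>x\<in>{0..2*pi}. norm (f x) \<le> M"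
  proof -
    have "compact (f ` {0..2*pi})" using f(2) by (intro compact_continuous_image) auto
    then have "bounded (f ` {0..2*pi})" by (rule compact_imp_bounded)
    then obtain M where "\<forall>y\<in>f ` {0..2*pi}. norm y \<le> M" unfolding bounded_iff by (elim exE)
    then show ?thesis by (intro exI[of _ M]) blast
  qed
  then obtain M where M: "\<forall>x\<in>{0..2*pi}. norm (f x) \<le> M" by blast
  have "f \<in> L2" by (rule L2_continuous[OF f])
  moreover have "AE x in circle_measure. norm (f x) \<le> max M (nrm f)"
    using M by (intro AE_I2) (auto intro: max.coboundedI1)
  ultimately have "Bd 0 (max M (nrm f)) f" unfolding Bd_def by auto
  moreover have "\<forall>\<^sub>F s in F. Bd 0 \<epsilon> (\<lambda>x. fs s x - f x)" if e: "\<epsilon> > 0" for \<epsilon>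
  proof -
    have "\<epsilon>/3 > 0" using e by simp
    from u[OF this] c show ?thesis
    proof eventually_elim
      case (elim s)
      have cont: "continuous_on {0..2*pi} (\<lambda>x. fs s x - f x)" using elim f by (intro continuous_intros) auto
      have L: "(\<lambda>x. fs s x - f x) \<in> L2" using elim f by (intro L2_continuous cont) (auto simp: periodic_def)
      have ae: "AE x in circle_measure. norm (fs s x - f x) \<le> \<epsilon>/3" using elim(1) by (intro AE_I2) auto
      have "nrm (\<lambda>x. fs s x - f x) \<le> 3 * (\<epsilon>/3)"
        using e by (intro sqint_bounded(2)[OF continuous_on_borel_circle[OF cont] ae]) auto
      moreover have "AE x in circle_measure. norm (fs s x - f x) \<le> \<epsilon>" using e ae by (auto elim: eventually_mono)
      ultimately show ?case using L by (simp add: Bd_def)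
    qed
  qed
  ultimately show ?thesis by (auto simp: cvB_def)
qed

lemma cvB_uniform:
  fixes fs :: "'s \<Rightarrow> real \<Rightarrow> 'a::euclidean_space"
  assumes cv: "cvB m F fs f" and c: "\<forall>\<^sub>F s in F. continuous_on {0..2*pi} (fs s)" and f: "continuous_on {0..2*pi} f" and e: "\<epsilon> > 0"
  shows "\<forall>\<^sub>F s in F. \<forall>x\<in>{0..2*pi}. norm (fs s x - f x) \<le> \<epsilon>"
proof -
  have "\<forall>\<^sub>F s in F. Bd m \<epsilon> (\<lambda>x. fs s x - f x)" using cv e by (auto simp: cvB_def)
  then show ?thesis using c
    by eventually_elim (auto simp: Bd_def intro!: continuous_AE_le[of "\<lambda>x. _ x - _ x"] continuous_intros f)
qed

text \<open>For continuous functions \<open>cvB\<close> implies uniform convergence. So the norms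
  eventually stay above half the lower bound of |p|, where inversion is Lipschitz.\<close>

lemma cvB_inverse_norm_0:
  fixes ps :: "'s \<Rightarrow> real \<Rightarrow> 'a::euclidean_space"
  assumes cv: "cvB m F ps p" and c: "\<forall>\<^sub>F s in F. periodic (ps s) \<and> continuous_on {0..2*pi} (ps s)"
    and p: "pinched K p" and K: "K > 0"
  shows "cvB 0 F (\<lambda>s x. inverse (norm (ps s x))) (\<lambda>x. inverse (norm (p x)))"
    and "\<forall>\<^sub>F s in F. \<forall>x\<in>{0..2*pi}. ps s x \<noteq> 0"
proof -
  have cp: "continuous_on {0..2*pi} p" "periodic p" using p by (auto simp: pinched_def)
  have c': "\<forall>\<^sub>F s in F. continuous_on {0..2*pi} (ps s)" using c by eventually_elim auto
  have u: "\<forall>\<^sub>F s in F. \<forall>x\<in>{0..2*pi}. norm (ps s x - p x) \<le> \<epsilon>" if "\<epsilon> > 0" for \<epsilon>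
    by (rule cvB_uniform[OF cv c' cp(1) that])
  have low: "\<forall>\<^sub>F s in F. \<forall>x\<in>{0..2*pi}. norm (ps s x) \<ge> inverse K / 2"
  proof -
    have "\<forall>\<^sub>F s in F. \<forall>x\<in>{0..2*pi}. norm (ps s x - p x) \<le> inverse K / 2" using K by (intro u) auto
    then show ?thesis
    proof eventually_elim
      case (elim s)
      show ?case
      proof
        fix x assume x: "x \<in> {0..2*pi}"
        have "norm (p x) \<le> norm (ps s x) + norm (ps s x - p x)" by (metis norm_minus_commute norm_triangle_sub)
        moreover have "inverse K \<le> norm (p x)" using p x by (auto simp: pinched_def)
        moreover have "norm (ps s x - p x) \<le> inverse K / 2" using elim x by blast
        ultimately show "norm (ps s x) \<ge> inverse K / 2" by linarith
      qed
    qed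
  qed
  have K2: "inverse K / 2 > 0" using K by simp
  show nz: "\<forall>\<^sub>F s in F. \<forall>x\<in>{0..2*pi}. ps s x \<noteq> 0"
    using low by eventually_elim (use K2 in force)
  show "cvB 0 F (\<lambda>s x. inverse (norm (ps s x))) (\<lambda>x. inverse (norm (p x)))"
  proof (rule continuous_uniform_imp_cvB_0)
    show "\<forall>\<^sub>F s in F. periodic (\<lambda>x. inverse (norm (ps s x))) \<and> continuous_on {0..2*pi} (\<lambda>x. inverse (norm (ps s x)))"
      using nz c by eventually_elim (auto intro!: continuous_intros simp: periodic_def)
    show "periodic (\<lambda>x. inverse (norm (p x)))" using cp by (simp add: periodic_def)
    show "continuous_on {0..2*pi} (\<lambda>x. inverse (norm (p x)))" 
      using cp pinched_nz[OF p K] by (auto intro!: continuous_intros)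
    fix \<epsilon> :: real assume e: "\<epsilon> > 0"
    \<comment> \<open>The two inverses are at most 2 K and K, so they differ by at most 2 K d
      K.\<close>
    define d where "d = \<epsilon> / (2 * K * K)"
    have d: "d > 0" using e K by (simp add: d_def)
    from u[OF d] low nz show "\<forall>\<^sub>F s in F. \<forall>x\<in>{0..2*pi}. norm (inverse (norm (ps s x)) - inverse (norm (p x))) \<le> \<epsilon>"
    proof eventually_elim
      case (elim s)
      show ?case
      proof
        fix x assume x: "x \<in> {0..2*pi}"
        have nz: "norm (ps s x) \<noteq> 0" "norm (p x) \<noteq> 0" using elim x pinched_nz[OF p K x] by auto
        have "inverse (norm (ps s x)) \<le> inverse (inverse K / 2)" using elim x K2 by (intro le_imp_inverse_le) auto
        then have i1: "inverse (norm (ps s x)) \<le> 2 * K" using K by (simp add: field_simps)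
        have i2: "inverse (norm (p x)) \<le> K" by (rule pinched_inverse_norm(2)[OF p K x])
        have "\<bar>norm (ps s x) - norm (p x)\<bar> \<le> norm (ps s x - p x)" by (rule norm_triangle_ineq3)
        also have "\<dots> \<le> d" using elim x by blast
        finally have nd: "\<bar>norm (ps s x) - norm (p x)\<bar> \<le> d" .
        have "norm (inverse (norm (ps s x)) - inverse (norm (p x))) = inverse (norm (ps s x)) * \<bar>norm (ps s x) - norm (p x)\<bar> * inverse (norm (p x))"
          by (simp add: inverse_diff_inverse[OF nz] abs_mult)
        also have "\<dots> \<le> (2 * K) * d * K" using i1 i2 nd K d by (intro mult_mono) auto
        also have "\<dots> = \<epsilon>" using K by (simp add: d_def)
        finally show "norm (inverse (norm (ps s x)) - inverse (norm (p x))) \<le> \<epsilon>" .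
      qed
    qed
  qed
qed

text \<open>Runs along \<open>inverse_norm_Bd\<close> with limits in place of bounds: the derivative
  of 1/|p| involves 1/|p|, p and p' at the lower order, where they converge.\<close>

lemma cvB_inverse_norm:
  fixes ps :: "'s \<Rightarrow> real \<Rightarrow> 'a::euclidean_space"
  assumes c: "\<forall>\<^sub>F s in F. periodic (ps s) \<and> continuous_on {0..2*pi} (ps s)"
    and p: "pinched K p" and K: "K > 0"
  shows "cvB m F ps p \<Longrightarrow> cvB m F (\<lambda>s x. inverse (norm (ps s x))) (\<lambda>x. inverse (norm (p x)))"
proof (induction m)
  case 0
  then show ?case by (rule cvB_inverse_norm_0(1)[OF _ c p K])
next
  case (Suc m)
  let ?w = "\<lambda>x. inverse (norm (p x))" and ?ws = "\<lambda>s x. inverse (norm (ps s x))"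
  have w: "cvB m F ?ws ?w" by (rule Suc.IH[OF cvB_lower[OF Suc.prems]])
  have p': "cvS m F (\<lambda>s. wderiv (ps s)) (wderiv p)" by (rule cvS_wderiv[OF cvB_imp_cvS[OF Suc.prems]])
  have w0: "cvB 0 F ?ws ?w" by (rule cvB_inverse_norm_0(1)[OF Suc.prems c p K])
  have nz: "\<forall>\<^sub>F s in F. \<forall>x\<in>{0..2*pi}. ps s x \<noteq> 0" by (rule cvB_inverse_norm_0(2)[OF Suc.prems c p K])
  have d: "cvS m F (\<lambda>s x. - ((?ws s x * ?ws s x * ?ws s x) * (ps s x \<bullet> wderiv (ps s) x))) (\<lambda>x. - ((?w x * ?w x * ?w x) * (p x \<bullet> wderiv p x)))"
    by (intro cvS_uminus cvS_bilinear[OF bounded_bilinear_mult] cvB_bilinear[OF bounded_bilinear_mult] w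
        cvS_bilinear[OF bounded_bilinear_inner] cvB_lower[OF Suc.prems] p')
  have "\<forall>\<^sub>F s in F. has_weak_deriv (?ws s) (\<lambda>x. - ((?ws s x * ?ws s x * ?ws s x) * (ps s x \<bullet> wderiv (ps s) x)))"
    using nz c cvS_Sob[OF cvB_imp_cvS[OF Suc.prems]]
    by eventually_elim (intro has_weak_deriv_inverse_norm(1); auto)
  moreover have "has_weak_deriv ?w (\<lambda>x. - ((?w x * ?w x * ?w x) * (p x \<bullet> wderiv p x)))"
    using Suc.prems p pinched_nz[OF p K] by (intro has_weak_deriv_inverse_norm(1)) (auto simp: cvB_def Bd_def pinched_def)
  ultimately have "cvS (Suc m) F ?ws ?w" by (intro cvS_SucI[OF cvB_imp_cvS[OF w0] _ _ d])
  then show ?case by (rule cvS_imp_cvB)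
qed

lemma cvS_nrm:
  fixes fs :: "'s \<Rightarrow> real \<Rightarrow> 'a::euclidean_space"
  assumes "cvS 0 F fs f" shows "((\<lambda>s. nrm (fs s)) \<longlongrightarrow> nrm f) F"
proof (rule tendstoI)
  fix e :: real assume "e > 0"
  then have "e/2 > 0" by simp
  then have "\<forall>\<^sub>F s in F. Sob 0 (\<lambda>x. fs s x - f x) \<and> En 0 (\<lambda>x. fs s x - f x) \<le> e/2"
    using assms unfolding cvS_def by blast
  with cvS_Sob[OF assms] show "\<forall>\<^sub>F s in F. dist (nrm (fs s)) (nrm f) < e"
  proof eventually_elim
    case (elim s)
    have s: "sqint (fs s)" "sqint f" "sqint (\<lambda>x. fs s x - f x)" using elim assms by (auto simp: cvS_def L2_iff)
    have "nrm (fs s) \<le> nrm (\<lambda>x. fs s x - f x) + nrm f" using sqint_add(2)[OF s(3,2)] by simp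
    moreover have "nrm f \<le> nrm (\<lambda>x. fs s x - f x) + nrm (fs s)"
      using sqint_add(2)[OF sqint_scaleR[OF s(3), of "-1"] s(1)] nrm_scaleR[of "-1" "\<lambda>x. fs s x - f x"] by (simp only: scaleR_minus1_left) simp
    moreover have "nrm (\<lambda>x. fs s x - f x) \<le> e / 2" using elim by simp
    ultimately show ?case using \<open>e > 0\<close> unfolding dist_real_def by linarith
  qed
qed

subsection \<open>Sobolev fields and curves\<close>

lemma Sob_funpow: "Sob (j + k) f \<Longrightarrow> Sob k ((wderiv ^^ j) f)"
proof (induction j arbitrary: k)
  case (Suc j)
  have "Sob (Suc k) ((wderiv ^^ j) f)" using Suc by (metis add_Suc_shift)
  then show ?case by simp
qed simp

lemma Sob_funpow_weak: 
  assumes "Sob n f" "j < n" shows "has_weak_deriv ((wderiv ^^ j) f) ((wderiv ^^ Suc j) f)"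
proof -
  have "Sob (Suc (n - Suc j)) ((wderiv ^^ j) f)" using assms by (intro Sob_funpow) simp
  then show ?thesis by simp
qed

text \<open>A chain of weak derivatives can be traded for iterated choices: read from its last
  member upwards, it certifies regularity order by order through \<open>Sob_SucI\<close>. Continuity
  remains as the condition that singles out the representative.\<close>

lemma Hspace_iff: "h \<in> Hspace n \<longleftrightarrow> periodic h \<and> continuous_on UNIV h \<and> Sob n h"
proof
  assume h: "h \<in> Hspace n"
  then obtain g where g: "g 0 = h" "\<And>j. j < n \<Longrightarrow> has_weak_deriv (g j) (g (Suc j))" "\<And>j. j \<le> n \<Longrightarrow> g j \<in> L2"
    unfolding Hspace_def by blast
  have "j \<le> n \<Longrightarrow> Sob j (g (n - j))" for j
  proof (induction j)
    case (Suc j)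
    have "has_weak_deriv (g (n - Suc j)) (g (n - j))" 
      using g(2)[of "n - Suc j"] Suc.prems by (simp add: Suc_diff_Suc)
    then show ?case using Suc g(3)[of "n - Suc j"] Sob_SucI[of "g (n - Suc j)" "g (n - j)" j] by auto
  qed (use g in auto)
  from this[of n] show "periodic h \<and> continuous_on UNIV h \<and> Sob n h" using h g(1) by (simp add: Hspace_def)
next
  assume h: "periodic h \<and> continuous_on UNIV h \<and> Sob n h"
  have "\<forall>j<n. has_weak_deriv ((wderiv ^^ j) h) ((wderiv ^^ Suc j) h)" using Sob_funpow_weak h by blast
  moreover have "\<forall>j\<le>n. (wderiv ^^ j) h \<in> L2"
  proof (intro allI impI)
    fix j assume "j \<le> n"
    then have "Sob (n - j) ((wderiv ^^ j) h)" using h by (intro Sob_funpow) simp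
    then show "(wderiv ^^ j) h \<in> L2" by (rule Sob_L2)
  qed
  ultimately show "h \<in> Hspace n" unfolding Hspace_def using h
    by (auto intro!: exI[of _ "\<lambda>j. (wderiv ^^ j) h"])
qed

lemma Hspace_add: "f \<in> Hspace n \<Longrightarrow> g \<in> Hspace n \<Longrightarrow> (\<lambda>x. f x + g x) \<in> Hspace n"
  unfolding Hspace_iff using Sob_add[of n f g] by (auto simp: periodic_def intro!: continuous_intros)

lemma Hspace_scaleR: "f \<in> Hspace n \<Longrightarrow> (\<lambda>x. r *\<^sub>R f x) \<in> Hspace n"
  unfolding Hspace_iff using Sob_scaleR[of n f r] by (auto simp: periodic_def intro!: continuous_intros)

lemma Hspace_diff: "f \<in> Hspace n \<Longrightarrow> g \<in> Hspace n \<Longrightarrow> (\<lambda>x. f x - g x) \<in> Hspace n"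
  using Hspace_add[of f n "\<lambda>x. (-1) *\<^sub>R g x"] Hspace_scaleR[of g n "-1"] by simp

lemma Cinf_measurable:
  fixes f :: "real \<Rightarrow> 'a::euclidean_space"
  shows "f \<in> Cinf \<Longrightarrow> f \<in> borel_measurable circle_measure"
  by (intro continuous_on_borel_circle Cinf_continuous_on)

lemma Cinf_Sob: 
  fixes f :: "real \<Rightarrow> 'a::euclidean_space"
  shows "f \<in> Cinf \<Longrightarrow> Sob k f"
proof (induction k arbitrary: f)
  case 0
  then show ?case by (simp add: L2_continuous Cinf_periodic Cinf_continuous_on)
next
  case (Suc k)
  then show ?case using Sob_SucI[OF _ has_weak_deriv_Cinf, of f k] Cinf_cderiv[of f]
    by (simp add: L2_continuous Cinf_periodic Cinf_continuous_on)
qed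

lemma Cinf_Hspace: "f \<in> Cinf \<Longrightarrow> f \<in> Hspace n"
  unfolding Hspace_iff by (simp add: Cinf_periodic Cinf_continuous_on Cinf_Sob)

lemma wderiv_funpow_Cinf:
  fixes f :: "real \<Rightarrow> 'a::euclidean_space"
  assumes f: "f \<in> Cinf"
  shows "AE x in circle_measure. (wderiv ^^ j) f x = (cderiv ^^ j) f x"
proof (induction j)
  case (Suc j)
  have S: "Sob 0 ((wderiv ^^ j) f)" using Sob_funpow[of j 0 f] Cinf_Sob[OF f] by simp
  have c: "(cderiv ^^ j) f \<in> Cinf" by (rule Cinf_funpow_cderiv[OF f])
  have "wderiv ((wderiv ^^ j) f) = wderiv ((cderiv ^^ j) f)"
    by (rule wderiv_cong[OF Sob_measurable[OF S] Cinf_measurable[OF c] Sob_periodic[OF S] Cinf_periodic[OF c] Suc])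
  then show ?case using wderiv_AE[OF has_weak_deriv_Cinf[OF c]] by simp
qed simp

text \<open>A derivative has mean 0 on the circle, so the mean bound becomes a Poincare inequality.
  The constant is 3 for sup to L^2 times 3 for L^2 to L^1.\<close>

lemma nrm_derivative_le:
  fixes g :: "real \<Rightarrow> 'a::euclidean_space"
  assumes "Sob (Suc (Suc 0)) g"
  shows "nrm (wderiv g) \<le> 9 * nrm (wderiv (wderiv g))"
proof -
  let ?f = "wderiv g"
  have h: "has_weak_deriv g ?f" "has_weak_deriv ?f (wderiv ?f)" "sqint (wderiv ?f)" "sqint ?f"
    using assms by (auto simp: L2_iff)
  have "(LINT y|circle_measure. 1 *\<^sub>R ?f y) = 0" using has_weak_deriv_integral_eq_0[OF h(1)] by simp
  then have ae: "AE x in circle_measure. norm (?f x) \<le> (LINT y|circle_measure. norm (wderiv ?f y))"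
    using weighted_mean_bound[OF h(2), of "\<lambda>x. 1" "2*pi"] by simp
  have "nrm ?f \<le> 3 * (LINT y|circle_measure. norm (wderiv ?f y))"
    by (intro sqint_bounded(2)[OF sqint_measurable[OF h(4)] ae]) simp
  also have "\<dots> \<le> 3 * (3 * nrm (wderiv ?f))" using sqint_integrable(2)[OF h(3)] by simp
  finally show ?thesis by simp
qed

lemma En_wderiv_le: "Sob (Suc k) g \<Longrightarrow> En k (wderiv g) \<le> 10 ^ k * nrm ((wderiv ^^ Suc k) g)"
proof (induction k arbitrary: g)
  case (Suc k)
  let ?f = "wderiv g"
  have IH: "En k (wderiv ?f) \<le> 10 ^ k * nrm ((wderiv ^^ Suc k) ?f)" using Suc by simp
  have eq: "(wderiv ^^ Suc k) ?f = (wderiv ^^ Suc (Suc k)) g" by (simp add: funpow_swap1)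
  have "nrm ?f \<le> 9 * nrm (wderiv ?f)" using Sob_le[OF _ Suc.prems, of "Suc (Suc 0)"] by (intro nrm_derivative_le) simp
  also have "nrm (wderiv ?f) \<le> En k (wderiv ?f)" by (rule nrm_le_En)
  finally have "nrm ?f \<le> 9 * En k (wderiv ?f)" by simp
  \<comment> \<open>The Poincare constant 9 plus 1 for the remaining terms; a factor 10 accrues with
    each order.\<close>
  then have "En (Suc k) ?f \<le> 10 * En k (wderiv ?f)" unfolding En.simps by linarith
  also have "\<dots> \<le> 10 * (10 ^ k * nrm ((wderiv ^^ Suc k) ?f))" using IH by simp
  finally show ?case unfolding eq by simp
qed simp

lemma Hnorm_alt:
  assumes "Sob n h" shows "Hnorm n h = sqrt ((nrm h)\<^sup>2 + (nrm ((wderiv ^^ n) h))\<^sup>2)"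
proof -
  have "Sob 0 ((wderiv ^^ n) h)" using Sob_funpow[of n 0 h] assms by simp
  then have "integrable circle_measure (\<lambda>x. (norm (h x))\<^sup>2)" "integrable circle_measure (\<lambda>x. (norm ((wderiv ^^ n) h x))\<^sup>2)"
    using Sob_L2[OF assms] by (auto simp: L2_iff sqint_def)
  then show ?thesis unfolding Hnorm_def nrm_sq by simp
qed

lemma nrm_funpow_le: "Sob n h \<Longrightarrow> nrm ((wderiv ^^ n) h) \<le> En n h"
proof (induction n arbitrary: h)
  case (Suc n)
  have "nrm ((wderiv ^^ n) (wderiv h)) \<le> En n (wderiv h)" using Suc by simp
  then show ?case by (simp add: funpow_swap1 add_increasing)
qed simp

lemma Hnorm_le_En:
  assumes "Sob n h" "n \<ge> 1" shows "Hnorm n h \<le> En n h"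
proof -
  obtain k where n: "n = Suc k" using assms(2) by (cases n) auto
  have 1: "nrm ((wderiv ^^ n) h) \<le> En k (wderiv h)" 
    using nrm_funpow_le[of k "wderiv h"] assms(1) n by (simp add: funpow_swap1)
  have "Hnorm n h \<le> nrm h + nrm ((wderiv ^^ n) h)" unfolding Hnorm_alt[OF assms(1)]
    using sqrt_sum_squares_le_sum[of "nrm h" "nrm ((wderiv ^^ n) h)"] by simp
  then show ?thesis using 1 n by simp
qed

lemma Hnorm_nonneg: "Hnorm n h \<ge> 0"
  by (simp add: Hnorm_def)

text \<open>\<open>Hnorm\<close> contains no derivative strictly between the orders 0 and n. Since
  derivatives have mean 0, the top one controls those in between, so \<open>En\<close>, which is
  better suited to induction on the order, is equivalent to \<open>Hnorm\<close>.\<close>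

lemma En_le_Hnorm:
  assumes "Sob n h" "n \<ge> 1" shows "En n h \<le> (1 + 10 ^ n) * Hnorm n h"
proof -
  obtain k where n: "n = Suc k" using assms(2) by (cases n) auto
  have a: "nrm h \<le> Hnorm n h" "nrm ((wderiv ^^ n) h) \<le> Hnorm n h"
    unfolding Hnorm_alt[OF assms(1)] by (auto intro!: real_le_rsqrt)
  have "En n h \<le> nrm h + 10 ^ k * nrm ((wderiv ^^ n) h)"
    using En_wderiv_le[of k h] assms(1) n by simp
  also have "10 ^ k * nrm ((wderiv ^^ n) h) \<le> 10 ^ n * Hnorm n h"
    using a(2) by (intro mult_mono) (auto simp: n)
  finally show ?thesis using a(1) by (simp add: distrib_right)
qed

section \<open>Classical derivatives of Sobolev functions\<close>

lemma has_vector_derivative_within_Un: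
  assumes "(f has_vector_derivative D) (at x within S)" "(f has_vector_derivative D) (at x within T)"
  shows "(f has_vector_derivative D) (at x within (S \<union> T))"
  using assms unfolding has_vector_derivative_def has_derivative_within by (auto simp: at_within_union intro: filterlim_sup)

text \<open>For n \<ge> 2 the weak derivative has an absolutely continuous representative F, and h
  is an integral of F, so F is the classical derivative. This ties the pointwise condition on
  \<open>cderiv c\<close> in \<open>In\<close> to the weak calculus.\<close>

lemma Hspace_cderiv:
  fixes h :: "real \<Rightarrow> 'a::euclidean_space"
  assumes h: "h \<in> Hspace n" and n: "n \<ge> 2"
  shows "continuous_on {0..2*pi} (cderiv h)" "periodic (cderiv h)"
    "AE x in circle_measure. wderiv h x = cderiv h x"
proof -
  have hp: "periodic h" "continuous_on UNIV h" "Sob n h" using h by (auto simp: Hspace_iff)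
  have S2: "Sob (Suc (Suc 0)) h" using Sob_le[OF _ hp(3), of "Suc (Suc 0)"] n by auto
  have w: "has_weak_deriv h (wderiv h)" "has_weak_deriv (wderiv h) (wderiv (wderiv h))" using S2 by auto
  obtain F where F: "acd F (wderiv (wderiv h))" "F 0 = F (2*pi)" "AE x in circle_measure. wderiv h x = F x" 
    using has_weak_derivE[OF w(2)] .
  have cF: "continuous_on {0..2*pi} F" by (rule acd_continuous[OF F(1)])
  have a: "acd h (wderiv h)" by (rule acd_of_continuous[OF w(1) continuous_on_subset[OF hp(2)]]) simp
  have "AE x in lebesgue. x \<in> {0..2*pi} \<longrightarrow> wderiv h x = F x" using F(3) by (subst (asm) AE_restrict_space_iff) auto
  then obtain N where N: "N \<in> null_sets lebesgue" "\<And>y. y \<in> {0..2*pi} - N \<Longrightarrow> wderiv h y = F y"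
    by (auto elim!: AE_E3)
  have eq: "h x = h 0 + integral {0..x} F" if x: "x \<in> {0..2*pi}" for x
  proof -
    have "integral {0..x} (wderiv h) = integral {0..x} F"
      using N x by (intro integral_spike[of N]) (auto simp: negligible_iff_null_sets)
    then show ?thesis using acd_eq[OF a x] by simp
  qed
  have d: "(h has_vector_derivative F x) (at x within {0..2*pi})" if x: "x \<in> {0..2*pi}" for x
  proof -
    have "((\<lambda>x. h 0 + integral {0..x} F) has_vector_derivative F x) (at x within {0..2*pi})"
      using integral_has_vector_derivative[OF cF x] by (auto intro!: derivative_eq_intros)
    then show ?thesis by (rule has_vector_derivative_transform[OF x, rotated]) (rule eq)
  qed
  have inner: "cderiv h x = F x" if x: "0 < x" "x < 2*pi" for x
  proof -
    have "(h has_vector_derivative F x) (at x within {0<..<2*pi})"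
      using x by (intro has_vector_derivative_within_subset[OF d]) auto
    moreover have "at x within {0<..<2*pi} = at x" using x by (intro at_within_open) auto
    ultimately have "(h has_vector_derivative F x) (at x)" by (simp only:)
    then show ?thesis unfolding cderiv_def by (rule vector_derivative_at)
  qed
  \<comment> \<open>At 0 the fundamental theorem yields a derivative from the right only. The one
    from the left is the derivative at 2 pi shifted by a period, and both agree because F has equal
    end values.\<close>
  have "cderiv h 0 = F 0"
  proof -
    have "(h has_vector_derivative F 0) (at (0 + 2*pi) within {0..2*pi})" using d[of "2*pi"] F(2) by simp
    then have "(h has_vector_derivative F 0) (at ((\<lambda>y. y + 2*pi) 0) within (\<lambda>y. y + 2*pi) ` {-2*pi..0})"
      by (simp add: image_add_atLeastAtMost')
    then have "(h \<circ> (\<lambda>y. y + 2*pi) has_vector_derivative 1 *\<^sub>R F 0) (at 0 within {-2*pi..0})"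
      by (intro vector_diff_chain_within) (auto intro!: derivative_eq_intros)
    moreover have "h \<circ> (\<lambda>y. y + 2*pi) = h" using hp(1) by (auto simp: periodic_def)
    ultimately have "(h has_vector_derivative F 0) (at 0 within {-2*pi..0})" by simp
    then have "(h has_vector_derivative F 0) (at 0 within ({-2*pi..0} \<union> {0..2*pi}))"
      using d[of 0] by (intro has_vector_derivative_within_Un) auto
    then have "(h has_vector_derivative F 0) (at 0 within {-2*pi<..<2*pi})"
      by (rule has_vector_derivative_within_subset) auto
    moreover have "at 0 within {-2*pi<..<2*pi} = at 0" by (intro at_within_open) auto
    ultimately have "(h has_vector_derivative F 0) (at 0)" by (simp only:)
    then show ?thesis unfolding cderiv_def by (rule vector_derivative_at)
  qed
  moreover show per: "periodic (cderiv h)" by (rule periodic_cderiv[OF hp(1)])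
  ultimately have all: "F x = cderiv h x" if "x \<in> {0..2*pi}" for x
    using inner[of x] F(2) periodic_ends[OF per] that by (cases "x = 0 \<or> x = 2*pi") auto
  show "continuous_on {0..2*pi} (cderiv h)" by (rule continuous_on_eq[OF cF all])
  have "AE x in circle_measure. F x = cderiv h x" by (rule AE_I2) (use all in auto)
  with F(3) show "AE x in circle_measure. wderiv h x = cderiv h x" by eventually_elim simp
qed

lemma Hspace_cderiv_Sob:
  fixes h :: "real \<Rightarrow> 'a::euclidean_space"
  assumes h: "h \<in> Hspace n" and n: "n \<ge> 2" and m: "Suc m \<le> n"
  shows "Sob m (cderiv h) \<and> En m (cderiv h) = En m (wderiv h)"
proof -
  have "Sob (Suc m) h" using h Sob_le[OF m] by (auto simp: Hspace_iff)
  then have "Sob m (wderiv h)" by simp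
  then show ?thesis using Hspace_cderiv[OF h n]
    by (intro Sob_cong continuous_on_borel_circle)
qed

lemma pinched_mono: "pinched K p \<Longrightarrow> 0 < K \<Longrightarrow> K \<le> K' \<Longrightarrow> pinched K' p"
proof -
  assume p: "pinched K p" and K: "0 < K" "K \<le> K'"
  have "inverse K' \<le> inverse K" by (rule le_imp_inverse_le[OF K(2,1)])
  then have "\<forall>x\<in>{0..2*pi}. inverse K' \<le> norm (p x) \<and> norm (p x) \<le> K'"
    using p K(2) unfolding pinched_def by (meson order_trans)
  then show ?thesis using p unfolding pinched_def by blast
qed

lemma In_pinched:
  fixes c :: "real \<Rightarrow> 'a::euclidean_space"
  assumes c: "c \<in> In n" and n: "n \<ge> 2"
  shows "\<exists>K>0. pinched K (cderiv c)"
proof -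
  have ch: "c \<in> Hspace n" and nz: "\<And>x. cderiv c x \<noteq> 0" using c by (auto simp: In_def)
  have cont: "continuous_on {0..2*pi} (\<lambda>x. norm (cderiv c x))" by (intro continuous_intros Hspace_cderiv[OF ch n])
  obtain x0 where x0: "x0 \<in> {0..2*pi}" "\<And>y. y \<in> {0..2*pi} \<Longrightarrow> norm (cderiv c x0) \<le> norm (cderiv c y)"
    using continuous_attains_inf[OF _ _ cont] by auto
  obtain x1 where x1: "x1 \<in> {0..2*pi}" "\<And>y. y \<in> {0..2*pi} \<Longrightarrow> norm (cderiv c y) \<le> norm (cderiv c x1)"
    using continuous_attains_sup[OF _ _ cont] by auto
  have pos: "norm (cderiv c x0) > 0" using nz by simp
  define K where "K = max (inverse (norm (cderiv c x0))) (norm (cderiv c x1))"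
  have "0 < inverse (norm (cderiv c x0))" using pos by simp
  also have "\<dots> \<le> K" by (simp add: K_def)
  finally have K: "K > 0" .
  have "inverse K \<le> inverse (inverse (norm (cderiv c x0)))"
    using pos by (intro le_imp_inverse_le) (auto simp: K_def)
  then have iK: "inverse K \<le> norm (cderiv c x0)" by simp
  have "pinched K (cderiv c)"
    unfolding pinched_def
  proof (intro conjI ballI)
    fix x assume x: "x \<in> {0..2*pi}"
    show "inverse K \<le> norm (cderiv c x)" using iK x0(2)[OF x] by simp
    show "norm (cderiv c x) \<le> K" using x1(2)[OF x] by (simp add: K_def)
  qed (use Hspace_cderiv[OF ch n] in auto)
  then show ?thesis using K by blast
qed

lemma Bd_le: "j \<le> m \<Longrightarrow> Bd m M f \<Longrightarrow> Bd j M f"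
  unfolding Bd_def using Sob_le[of j m f] by auto

subsection \<open>Arc length derivatives\<close>

abbreviation Dc :: "(real \<Rightarrow> 'a::euclidean_space) \<Rightarrow> (real \<Rightarrow> 'a) \<Rightarrow> real \<Rightarrow> 'a" where
  "Dc c \<equiv> arc_deriv wderiv c"

abbreviation spd :: "(real \<Rightarrow> 'a::euclidean_space) \<Rightarrow> real \<Rightarrow> real" where
  "spd c \<equiv> \<lambda>x. norm (cderiv c x)"

abbreviation ispd :: "(real \<Rightarrow> 'a::euclidean_space) \<Rightarrow> real \<Rightarrow> real" where
  "ispd c \<equiv> \<lambda>x. inverse (norm (cderiv c x))"

text \<open>The L^2(ds) norm. The weight is drawn under the norm as a square root so that the L^2
  results for d\<theta> apply.\<close>

definition dsn :: "(real \<Rightarrow> 'a::euclidean_space) \<Rightarrow> (real \<Rightarrow> 'b::euclidean_space) \<Rightarrow> real" where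
  "dsn c f = nrm (\<lambda>x. sqrt (spd c x) *\<^sub>R f x)"

lemma dsn_nonneg [simp]: "0 \<le> dsn c f"
  by (simp add: dsn_def)

lemma dsn_sq: "(dsn c f)\<^sup>2 = arc_integral c (\<lambda>x. f x \<bullet> f x)"
  unfolding dsn_def nrm_sq arc_integral_def by (simp add: power_mult_distrib power2_norm_eq_inner mult.commute)

lemma arc_integral_scale: "arc_integral c (\<lambda>x. r * f x) = r * arc_integral c f"
  by (simp add: arc_integral_def mult.assoc)

lemma Gmetric_dsn:
  "Gmetric D n a c h h = (\<Sum>j\<le>n. a j (curve_length c) * (dsn c ((arc_deriv D c ^^ j) h))\<^sup>2)"
  unfolding Gmetric_def dsn_sq arc_integral_scale ..

lemma curve_length_dsn: "curve_length c = (dsn c (\<lambda>x. 1::real))\<^sup>2"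
  unfolding dsn_sq curve_length_def by simp

lemma curve_length_nonneg: "curve_length c \<ge> 0"
  by (simp add: curve_length_dsn)

lemma Dc_eq: "Dc c f = (\<lambda>x. ispd c x *\<^sub>R wderiv f x)"
  by (simp add: arc_deriv_def)

lemma Dc_step:
  assumes "Bd m B (ispd c)" "Sob (Suc m) f"
  shows "Sob m (Dc c f)"
  using Bd_Sob_bilinear[OF bounded_bilinear_scaleR, of m] assms unfolding Dc_eq by auto

text \<open>Each arc length derivative costs one order and one multiplication by 1/|c'|. That factor
  has one derivative less than c, and order n - 1 is enough, as the derivative has been taken before
  the multiplication.\<close>

lemma Dc_funpow_bound:
  "\<exists>C\<ge>0. \<forall>(c::real \<Rightarrow> 'a::euclidean_space) f. Bd (n - 1) B (ispd c) \<longrightarrow> Sob n f \<longrightarrow> j \<le> n \<longrightarrow> 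
     Sob (n - j) ((Dc c ^^ j) f) \<and> En (n - j) ((Dc c ^^ j) f) \<le> C * En n f"
proof (induction j)
  case 0
  show ?case by (intro exI[of _ 1]) auto
next
  case (Suc j)
  then obtain C where C: "C \<ge> 0" "\<And>(c::real \<Rightarrow> 'a) f. Bd (n - 1) B (ispd c) \<Longrightarrow> Sob n f \<Longrightarrow> j \<le> n \<Longrightarrow> 
     Sob (n - j) ((Dc c ^^ j) f) \<and> En (n - j) ((Dc c ^^ j) f) \<le> C * En n f" by blast
  obtain A where A: "A \<ge> 0" "\<And>M f g. Bd (n - Suc j) M f \<Longrightarrow> Sob (n - Suc j) g \<Longrightarrow> Sob (n - Suc j) (\<lambda>x. f x *\<^sub>R g x) \<and>
     En (n - Suc j) (\<lambda>x. f x *\<^sub>R g x :: 'a) \<le> A * M * En (n - Suc j) g"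
    using Bd_Sob_bilinear[OF bounded_bilinear_scaleR[where 'a='a], of "n - Suc j"] by blast
  have "Sob (n - Suc j) ((Dc c ^^ Suc j) f) \<and> En (n - Suc j) ((Dc c ^^ Suc j) f) \<le> (A * \<bar>B\<bar> * C) * En n f"
    if c: "Bd (n - 1) B (ispd c)" and f: "Sob n f" and j: "Suc j \<le> n" for c :: "real \<Rightarrow> 'a" and f
  proof -
    let ?g = "(Dc c ^^ j) f"
    have g: "Sob (n - j) ?g \<and> En (n - j) ?g \<le> C * En n f" using C(2)[OF c f] j by simp
    have nj: "n - j = Suc (n - Suc j)" using j by simp
    have w: "Sob (n - Suc j) (wderiv ?g)" "En (n - Suc j) (wderiv ?g) \<le> En (n - j) ?g" using g unfolding nj by auto
    have b: "Bd (n - Suc j) B (ispd c)" by (rule Bd_le[OF _ c]) simp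
    have B: "B = \<bar>B\<bar>" using Bd_nonneg[OF b] by simp
    have "A * B * En (n - Suc j) (wderiv ?g) \<le> A * B * (C * En n f)"
      using w(2) g A(1) Bd_nonneg[OF b] by (intro mult_left_mono) auto
    then show ?thesis using A(2)[OF b w(1)] B unfolding funpow.simps comp_def Dc_eq[of c ?g] by (auto simp: mult.assoc)
  qed
  then show ?case using A(1) C(1) by (intro exI[of _ "A * \<bar>B\<bar> * C"]) auto
qed

lemma In_ispd_Bd:
  fixes c :: "real \<Rightarrow> 'a::euclidean_space"
  assumes c: "c \<in> In n" and n: "n \<ge> 2"
  shows "\<exists>B. Bd (n - 1) B (ispd c)"
proof -
  obtain K where K: "K > 0" "pinched K (cderiv c)" using In_pinched[OF c n] by blast
  have S: "Sob (n - 1) (cderiv c)" using Hspace_cderiv_Sob[of c n "n - 1"] c n by (auto simp: In_def)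
  \<comment> \<open>\<open>inverse_norm_Bd\<close> asks for pinching and norm bound with the same
    constant, hence the maximum.\<close>
  define K' where "K' = max K (En (n - 1) (cderiv c))"
  have K': "K' > 0" using K by (simp add: K'_def max_def)
  obtain C where "\<And>p::real \<Rightarrow> 'a. pinched K' p \<Longrightarrow> Sob (n - 1) p \<Longrightarrow> En (n - 1) p \<le> K' \<Longrightarrow> Bd (n - 1) C (\<lambda>x. inverse (norm (p x)))"
    using inverse_norm_Bd[OF K'] by blast
  moreover have "pinched K' (cderiv c)" by (rule pinched_mono[OF K(2,1)]) (simp add: K'_def)
  moreover have "En (n - 1) (cderiv c) \<le> K'" by (simp add: K'_def)
  ultimately show ?thesis using S by blast
qed

lemma In_Dc_Sob:
  fixes c :: "real \<Rightarrow> 'a::euclidean_space"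
  assumes "c \<in> In n" "n \<ge> 2" "Sob n f" "j \<le> n"
  shows "Sob (n - j) ((Dc c ^^ j) f)"
proof -
  obtain B where "Bd (n - 1) B (ispd c)" using In_ispd_Bd[OF assms(1,2)] by blast
  then show ?thesis using Dc_funpow_bound[of n B j, where 'a='a] assms(3,4) by blast
qed

lemma wderiv_eq_spd_Dc:
  assumes "cderiv c x \<noteq> 0" shows "wderiv f x = spd c x *\<^sub>R Dc c f x"
  using assms by (simp add: arc_deriv_def)

context
  fixes c :: "real \<Rightarrow> 'a::euclidean_space" and n :: nat
  assumes c: "c \<in> In n" and n: "n \<ge> 2"
begin

lemma c_Hspace: "c \<in> Hspace n" and c_nz: "cderiv c x \<noteq> 0"
  using c by (auto simp: In_def)

lemma spd_continuous: "continuous_on {0..2*pi} (spd c)"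
  by (intro continuous_intros Hspace_cderiv[OF c_Hspace n])

lemma sqrt_spd_L2: "(\<lambda>x. sqrt (spd c x)) \<in> L2"
  using Hspace_cderiv(2)[OF c_Hspace n]
  by (intro L2_continuous continuous_intros Hspace_cderiv[OF c_Hspace n]) (auto simp: periodic_def)

lemma curve_length_pos: "curve_length c > 0"
proof -
  obtain K where K: "K > 0" "pinched K (cderiv c)" using In_pinched[OF c n] by blast
  have "0 < inverse K * (2*pi)" using K by simp
  also have "\<dots> = (LINT x|circle_measure. inverse K)" by simp
  also have "\<dots> \<le> (LINT x|circle_measure. spd c x)"
  proof (rule integral_mono)
    show "integrable circle_measure (spd c)"
      using spd_continuous by (simp add: absolutely_integrable_continuous_real flip: absolutely_integrable_circle_iff)
  qed (use K in \<open>auto simp: pinched_def\<close>)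
  finally show ?thesis by (simp add: curve_length_def arc_integral_def)
qed

lemma spd_scale_sqint: "f \<in> L2 \<Longrightarrow> sqint (\<lambda>x. sqrt (spd c x) *\<^sub>R f x)"
proof -
  assume f: "f \<in> L2"
  obtain K where K: "K > 0" "pinched K (cderiv c)" using In_pinched[OF c n] by blast
  have "AE x in circle_measure. norm (sqrt (spd c x) *\<^sub>R f x) \<le> sqrt K * norm (f x)"
    using K by (intro AE_I2) (auto simp: pinched_def intro!: mult_right_mono)
  moreover have "(\<lambda>x. sqrt (spd c x) *\<^sub>R f x) \<in> borel_measurable circle_measure"
    using f sqrt_spd_L2 by (intro borel_measurable_scaleR) (auto simp: L2_def)
  moreover have "sqint f" using f by (simp add: L2_iff)
  ultimately show ?thesis using sqint_dominated[of f _ "sqrt K"] by blast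
qed

text \<open>|g'| splits into the root of |c'|, whose squared L^2 norm is the length, and the root of
  |c'| times |D_s g|; then Cauchy-Schwarz applies.\<close>

lemma arc_L1_bound:
  assumes "Dc c g \<in> L2" 
  shows "(LINT x|circle_measure. norm (wderiv g x)) \<le> sqrt (curve_length c) * dsn c (Dc c g)"
proof -
  have "(LINT x|circle_measure. norm (wderiv g x)) = 
     (LINT x|circle_measure. norm (sqrt (spd c x)) * norm (sqrt (spd c x) *\<^sub>R Dc c g x))"
    by (intro Bochner_Integration.integral_cong) (auto simp: wderiv_eq_spd_Dc[OF c_nz])
  also have "\<dots> \<le> nrm (\<lambda>x. sqrt (spd c x)) * nrm (\<lambda>x. sqrt (spd c x) *\<^sub>R Dc c g x)"
    using sqrt_spd_L2 by (intro Cauchy_Schwarz_circle spd_scale_sqint assms) (simp add: L2_iff)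
  also have "nrm (\<lambda>x. sqrt (spd c x)) = sqrt (curve_length c)" by (simp add: curve_length_dsn dsn_def)
  finally show ?thesis by (simp add: dsn_def)
qed

text \<open>The integral of D_s g ds is that of g' d\<theta>, hence 0: with weight |c'| the field
  D_s g has mean 0. Its distance from the mean is thus its norm, bounded by the L^1 norm of its
  derivative. Integrating the square over the length gives the second claim.\<close>

lemma arc_sup_bound:
  assumes g: "Sob (Suc (Suc 0)) g"
  shows "AE x in circle_measure. norm (Dc c g x) \<le> sqrt (curve_length c) * dsn c (Dc c (Dc c g))"
    and "dsn c (Dc c g) \<le> curve_length c * dsn c (Dc c (Dc c g))"
proof -
  obtain B where B: "Bd (n - 1) B (ispd c)" using In_ispd_Bd[OF c n] by blast
  have S1: "Sob (Suc 0) (Dc c g)" using n by (intro Dc_step[OF Bd_le[OF _ B] g]) auto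
  have S0: "Sob 0 (Dc c (Dc c g))" using n by (intro Dc_step[OF Bd_le[OF _ B] S1]) auto
  let ?l = "curve_length c"
  have wg: "has_weak_deriv g (wderiv g)" using g by simp
  have "(LINT y|circle_measure. spd c y *\<^sub>R Dc c g y) = 0"
    using has_weak_deriv_integral_eq_0[OF wg] by (simp flip: wderiv_eq_spd_Dc[OF c_nz])
  then have "AE x in circle_measure. norm (Dc c g x) \<le> (LINT y|circle_measure. norm (wderiv (Dc c g) y))"
    using weighted_mean_bound[OF _ spd_continuous, of "Dc c g" "wderiv (Dc c g)" ?l] S1 curve_length_pos
    by (simp add: curve_length_def arc_integral_def)
  moreover have le: "(LINT y|circle_measure. norm (wderiv (Dc c g) y)) \<le> sqrt ?l * dsn c (Dc c (Dc c g))"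
    using S0 by (intro arc_L1_bound) simp
  ultimately show ae: "AE x in circle_measure. norm (Dc c g x) \<le> sqrt ?l * dsn c (Dc c (Dc c g))"
    by (auto elim: eventually_mono)
  have "dsn c (Dc c g) \<le> (sqrt ?l * dsn c (Dc c (Dc c g))) * nrm (\<lambda>x. sqrt (spd c x))"
    unfolding dsn_def[of c "Dc c g"]
  proof (rule nrm_dominated)
    show "sqint (\<lambda>x. sqrt (spd c x))" using sqrt_spd_L2 by (simp add: L2_iff)
    show "(\<lambda>x. sqrt (spd c x) *\<^sub>R Dc c g x) \<in> borel_measurable circle_measure"
      using spd_scale_sqint[OF Sob_L2[OF S1]] by (rule sqint_measurable)
    show "AE x in circle_measure. norm (sqrt (spd c x) *\<^sub>R Dc c g x) \<le> sqrt ?l * dsn c (Dc c (Dc c g)) * norm (sqrt (spd c x))"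
      using ae by eventually_elim (auto simp: mult.commute intro!: mult_left_mono)
  qed (simp add: curve_length_nonneg)
  also have "nrm (\<lambda>x. sqrt (spd c x)) = sqrt ?l" by (simp add: curve_length_dsn dsn_def)
  also have "(sqrt ?l * dsn c (Dc c (Dc c g))) * sqrt ?l = ?l * dsn c (Dc c (Dc c g))"
    using curve_length_nonneg[of c] by (simp add: mult.commute mult.left_commute)
  finally show "dsn c (Dc c g) \<le> ?l * dsn c (Dc c (Dc c g))" .
qed

text \<open>Order j = 0 is excluded because f itself need not have mean 0, whereas its arc length
  derivatives do, with respect to ds.\<close>

lemma dsn_chain:
  assumes f: "Sob n f" and j: "1 \<le> j" "j \<le> k" "k \<le> n"
  shows "dsn c ((Dc c ^^ j) f) \<le> curve_length c ^ (k - j) * dsn c ((Dc c ^^ k) f)"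
  using j(2,3)
proof (induction k rule: dec_induct)
  case (step k)
  have k: "1 \<le> k" "k < n" using step j by auto
  then obtain i where i: "k = Suc i" by (cases k) auto
  \<comment> \<open>The Poincare inequality for the derivative of order k starts from the one of
    order i = k - 1, which still has two weak derivatives because k < n.\<close>
  have "Sob (n - i) ((Dc c ^^ i) f)" using k i by (intro In_Dc_Sob[OF c n f]) auto
  then have "Sob (Suc (Suc 0)) ((Dc c ^^ i) f)" using Sob_le[of "Suc (Suc 0)" "n - i" "(Dc c ^^ i) f"] k i by linarith
  from arc_sup_bound(2)[OF this] have "dsn c ((Dc c ^^ k) f) \<le> curve_length c * dsn c ((Dc c ^^ Suc k) f)" by (simp add: i)
  then have "curve_length c ^ (k - j) * dsn c ((Dc c ^^ k) f) \<le> curve_length c ^ (k - j) * (curve_length c * dsn c ((Dc c ^^ Suc k) f))"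
    using curve_length_nonneg[of c] by (intro mult_left_mono) auto
  moreover have "Suc k - j = Suc (k - j)" using step by simp
  ultimately show ?case using step by (simp add: mult.assoc mult.left_commute)
qed simp

end

lemma dsn_pinched:
  fixes f :: "real \<Rightarrow> 'b::euclidean_space"
  assumes p: "pinched K (cderiv c)" "K > 0" and f: "f \<in> L2"
  shows "nrm f \<le> sqrt K * dsn c f" "dsn c f \<le> sqrt K * nrm f"
proof -
  have cont: "continuous_on {0..2*pi} (\<lambda>x. sqrt (spd c x))" using p by (intro continuous_intros) (auto simp: pinched_def)
  have m: "(\<lambda>x. sqrt (spd c x) *\<^sub>R f x) \<in> borel_measurable circle_measure"
    using f by (intro borel_measurable_scaleR continuous_on_borel_circle[OF cont]) (auto simp: L2_def)
  have fs: "sqint f" using f by (simp add: L2_iff)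
  have ae: "AE x in circle_measure. norm (sqrt (spd c x) *\<^sub>R f x) \<le> sqrt K * norm (f x)"
    using p by (intro AE_I2) (auto simp: pinched_def intro!: mult_right_mono)
  show "dsn c f \<le> sqrt K * nrm f" unfolding dsn_def using p by (intro nrm_dominated[OF fs m ae]) simp
  have ae2: "AE x in circle_measure. norm (f x) \<le> sqrt K * norm (sqrt (spd c x) *\<^sub>R f x)"
  proof (rule AE_I2)
    fix x assume "x \<in> space circle_measure"
    then have "inverse K \<le> spd c x" using p by (simp add: pinched_def)
    then have "1 \<le> K * spd c x" using p(2) by (simp add: field_simps)
    then have "1 \<le> sqrt K * sqrt (spd c x)" by (simp flip: real_sqrt_mult)
    then show "norm (f x) \<le> sqrt K * norm (sqrt (spd c x) *\<^sub>R f x)" 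
      using mult_right_mono[of 1 "sqrt K * sqrt (spd c x)" "norm (f x)"] by (simp add: mult.assoc)
  qed
  show "nrm f \<le> sqrt K * dsn c f" unfolding dsn_def using p(2) fs
    by (intro nrm_dominated[OF sqint_dominated[OF fs m ae] _ ae2]) (auto simp: sqint_measurable)
qed

text \<open>The converse of \<open>Dc_funpow_bound\<close>: f' = |c'| D_s f leads back from arc
  length to \<theta>. The induction hypothesis is applied to D_s f, whose order is lower by one, so
  |c'| is used up to order m - 1 \<le> k.\<close>

lemma En_le_arc:
  "\<exists>C\<ge>0. \<forall>(c::real \<Rightarrow> 'a::euclidean_space) f S. Bd k B (spd c) \<longrightarrow> (\<forall>x. cderiv c x \<noteq> 0) \<longrightarrow> m \<le> Suc k \<longrightarrow>
     (\<forall>j\<le>m. Sob (m - j) ((Dc c ^^ j) f) \<and> nrm ((Dc c ^^ j) f) \<le> S) \<longrightarrow> En m f \<le> C * S"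
proof (induction m)
  case 0
  show ?case by (intro exI[of _ 1]) auto
next
  case (Suc m)
  then obtain C where C: "C \<ge> 0" "\<And>(c::real \<Rightarrow> 'a) f S. Bd k B (spd c) \<Longrightarrow> (\<forall>x. cderiv c x \<noteq> 0) \<Longrightarrow> m \<le> Suc k \<Longrightarrow>
     (\<forall>j\<le>m. Sob (m - j) ((Dc c ^^ j) f) \<and> nrm ((Dc c ^^ j) f) \<le> S) \<Longrightarrow> En m f \<le> C * S" by blast
  obtain A where A: "A \<ge> 0" "\<And>M f g. Bd m M f \<Longrightarrow> Sob m g \<Longrightarrow> Sob m (\<lambda>x. f x *\<^sub>R g x) \<and>
     En m (\<lambda>x. f x *\<^sub>R g x :: 'a) \<le> A * M * En m g"
    using Bd_Sob_bilinear[OF bounded_bilinear_scaleR[where 'a='a], of m] by blast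
  have "En (Suc m) f \<le> (1 + A * \<bar>B\<bar> * C) * S"
    if b: "Bd k B (spd c)" and nz: "\<forall>x. cderiv c x \<noteq> 0" and m: "Suc m \<le> Suc k" 
      and f: "\<forall>j\<le>Suc m. Sob (Suc m - j) ((Dc c ^^ j) f) \<and> nrm ((Dc c ^^ j) f) \<le> S" for c :: "real \<Rightarrow> 'a" and f S
  proof -
    have "nrm f \<le> S" using f[rule_format, of 0] by simp
    have f': "\<forall>j\<le>m. Sob (m - j) ((Dc c ^^ j) (Dc c f)) \<and> nrm ((Dc c ^^ j) (Dc c f)) \<le> S"
    proof (intro allI impI)
      fix j assume "j \<le> m"
      then show "Sob (m - j) ((Dc c ^^ j) (Dc c f)) \<and> nrm ((Dc c ^^ j) (Dc c f)) \<le> S"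
        using f[rule_format, of "Suc j"] by (simp add: funpow_swap1)
    qed
    have IH: "En m (Dc c f) \<le> C * S" using m by (intro C(2)[OF b nz _ f']) simp
    have S: "Sob m (Dc c f)" using f'[rule_format, of 0] by simp
    have bm: "Bd m B (spd c)" using m by (intro Bd_le[OF _ b]) simp
    have B: "B \<ge> 0" by (rule Bd_nonneg[OF bm])
    have "En m (wderiv f) = En m (\<lambda>x. spd c x *\<^sub>R Dc c f x)"
      using wderiv_eq_spd_Dc[of c _ f] nz by (intro arg_cong[of _ _ "En m"]) auto
    also have "\<dots> \<le> A * B * En m (Dc c f)" using A(2)[OF bm S] by blast
    also have "\<dots> \<le> A * B * (C * S)" using IH A(1) B by (intro mult_left_mono) auto
    finally show ?thesis using \<open>nrm f \<le> S\<close> B by (simp add: distrib_right mult.assoc)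
  qed
  then show ?case using A(1) C(1) by (intro exI[of _ "1 + A * \<bar>B\<bar> * C"]) auto
qed

subsection \<open>Continuity of the metric\<close>

lemma cvS_cong:
  assumes fs: "cvS m F fs f" and s: "\<forall>\<^sub>F s in F. Sob m (gs s) \<and> (AE x in circle_measure. fs s x = gs s x)"
    and f: "Sob m g" "AE x in circle_measure. f x = g x"
  shows "cvS m F gs g"
  unfolding cvS_def
proof (intro conjI allI impI)
  fix \<epsilon> :: real assume "\<epsilon> > 0"
  then have "\<forall>\<^sub>F s in F. Sob m (\<lambda>x. fs s x - f x) \<and> En m (\<lambda>x. fs s x - f x) \<le> \<epsilon>"
    using fs unfolding cvS_def by blast
  with s show "\<forall>\<^sub>F s in F. Sob m (\<lambda>x. gs s x - g x) \<and> En m (\<lambda>x. gs s x - g x) \<le> \<epsilon>"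
  proof eventually_elim
    case (elim s)
    have L: "Sob m (\<lambda>x. gs s x - g x)" using elim f by (intro Sob_diff) auto
    have ae: "AE x in circle_measure. fs s x = gs s x" using elim by blast
    from ae f(2) have "AE x in circle_measure. fs s x - f x = gs s x - g x" by eventually_elim simp
    then show ?case using elim Sob_cong[of m "\<lambda>x. fs s x - f x" "\<lambda>x. gs s x - g x"] Sob_periodic[OF L] Sob_measurable[OF L] by auto
  qed
qed (rule f)

text \<open>The root of |c'| occurs only as the weight of L^2(ds) norms and is never differentiated,
  hence the order 0.\<close>

lemma cvB_sqrt_norm:
  fixes ps :: "'s \<Rightarrow> real \<Rightarrow> 'a::euclidean_space"
  assumes cv: "cvB m F ps p" and c: "\<forall>\<^sub>F s in F. periodic (ps s) \<and> continuous_on {0..2*pi} (ps s)"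
    and p: "pinched K p" and K: "K > 0"
  shows "cvB 0 F (\<lambda>s x. sqrt (norm (ps s x))) (\<lambda>x. sqrt (norm (p x)))"
proof (rule continuous_uniform_imp_cvB_0)
  have cp: "continuous_on {0..2*pi} p" "periodic p" using p by (auto simp: pinched_def)
  have c': "\<forall>\<^sub>F s in F. continuous_on {0..2*pi} (ps s)" using c by eventually_elim auto
  show "\<forall>\<^sub>F s in F. periodic (\<lambda>x. sqrt (norm (ps s x))) \<and> continuous_on {0..2*pi} (\<lambda>x. sqrt (norm (ps s x)))"
    using c by eventually_elim (auto intro!: continuous_intros simp: periodic_def)
  show "periodic (\<lambda>x. sqrt (norm (p x)))" using cp by (simp add: periodic_def)
  show "continuous_on {0..2*pi} (\<lambda>x. sqrt (norm (p x)))" using cp by (intro continuous_intros)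
  fix \<epsilon> :: real assume e: "\<epsilon> > 0"
  \<comment> \<open>The roots of a and b differ by at most |a - b| divided by the root of b, and on
    a pinched field the latter is at least 1 / sqrt K.\<close>
  define d where "d = \<epsilon> / sqrt K"
  have d: "d > 0" using e K by (simp add: d_def)
  from cvB_uniform[OF cv c' cp(1) d]
  show "\<forall>\<^sub>F s in F. \<forall>x\<in>{0..2*pi}. norm (sqrt (norm (ps s x)) - sqrt (norm (p x))) \<le> \<epsilon>"
  proof eventually_elim
    case (elim s)
    show ?case
    proof
      fix x assume x: "x \<in> {0..2*pi}"
      let ?a = "norm (ps s x)" and ?b = "norm (p x)"
      have b: "inverse K \<le> ?b" using p x by (simp add: pinched_def)
      then have b0: "?b > 0" using K by (meson inverse_positive_iff_positive order_less_le_trans)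
      have "1 \<le> K * ?b" using b K by (simp add: field_simps)
      then have Kb: "1 \<le> sqrt K * sqrt ?b" by (simp flip: real_sqrt_mult)
      have "\<bar>?a - ?b\<bar> \<le> norm (ps s x - p x)" by (rule norm_triangle_ineq3)
      then have ab: "\<bar>?a - ?b\<bar> \<le> d" using elim x by force
      have "?a - ?b = (sqrt ?a - sqrt ?b) * (sqrt ?a + sqrt ?b)" by (simp add: algebra_simps)
      then have "\<bar>?a - ?b\<bar> = \<bar>sqrt ?a - sqrt ?b\<bar> * (sqrt ?a + sqrt ?b)" by (simp add: abs_mult)
      moreover have "\<bar>sqrt ?a - sqrt ?b\<bar> * sqrt ?b \<le> \<bar>sqrt ?a - sqrt ?b\<bar> * (sqrt ?a + sqrt ?b)"
        by (intro mult_left_mono) auto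
      ultimately have 1: "\<bar>sqrt ?a - sqrt ?b\<bar> * sqrt ?b \<le> d" using ab by linarith
      have "\<bar>sqrt ?a - sqrt ?b\<bar> * 1 \<le> \<bar>sqrt ?a - sqrt ?b\<bar> * (sqrt K * sqrt ?b)" using Kb by (intro mult_left_mono) auto
      also have "\<dots> = sqrt K * (\<bar>sqrt ?a - sqrt ?b\<bar> * sqrt ?b)" by simp
      also have "\<dots> \<le> sqrt K * d" using 1 K by (intro mult_left_mono) auto
      also have "\<dots> = \<epsilon>" using K by (simp add: d_def)
      finally show "norm (sqrt ?a - sqrt ?b) \<le> \<epsilon>" by simp
    qed
  qed
qed

text \<open>Serves the continuity of the speed along smooth pieces. At the top order the arc length
  derivatives converge in L^2 only; so fields converge in the sense of \<open>cvS\<close>, while the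
  factors 1/|c'| converge in the sense of \<open>cvB\<close> and may multiply them.\<close>

lemma G_In_continuous:
  fixes cs hs :: "'s \<Rightarrow> real \<Rightarrow> 'a::euclidean_space"
  assumes n: "n \<ge> 2" and c: "c \<in> In n" and cs: "\<forall>\<^sub>F s in F. cs s \<in> In n" and cvc: "cvS n F cs c" and cvh: "cvS n F hs h"
    and a: "\<And>j l. j \<le> n \<Longrightarrow> l > 0 \<Longrightarrow> isCont (a j) l"
  shows "((\<lambda>s. G_In n a (cs s) (hs s) (hs s)) \<longlongrightarrow> G_In n a c h h) F"
proof -
  obtain k where k: "n = Suc k" "k \<ge> 1" using n by (cases n) auto
  have cH: "c \<in> Hspace n" using c by (simp add: In_def)
  have csH: "\<forall>\<^sub>F s in F. cs s \<in> Hspace n" using cs by eventually_elim (simp add: In_def)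
  obtain K where K: "K > 0" "pinched K (cderiv c)" using In_pinched[OF c n] by blast
  have per: "\<forall>\<^sub>F s in F. periodic (cderiv (cs s)) \<and> continuous_on {0..2*pi} (cderiv (cs s))"
    using csH by eventually_elim (auto intro: Hspace_cderiv n)
  have "cvS k F (\<lambda>s. wderiv (cs s)) (wderiv c)" using cvc unfolding k(1) by (rule cvS_wderiv)
  then have p: "cvS k F (\<lambda>s. cderiv (cs s)) (cderiv c)"
  proof (rule cvS_cong)
    show "\<forall>\<^sub>F s in F. Sob k (cderiv (cs s)) \<and> (AE x in circle_measure. wderiv (cs s) x = cderiv (cs s) x)"
      using csH by eventually_elim (use Hspace_cderiv_Sob[OF _ n, of _ k] Hspace_cderiv(3)[OF _ n] k in auto)
    show "Sob k (cderiv c)" using Hspace_cderiv_Sob[OF cH n, of k] k by simp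
  qed (rule Hspace_cderiv(3)[OF cH n])
  obtain k' where k': "k = Suc k'" using k by (cases k) auto
  have pB: "cvB k F (\<lambda>s. cderiv (cs s)) (cderiv c)" using p unfolding k' by (rule cvS_imp_cvB)
  have w: "cvB k F (\<lambda>s. ispd (cs s)) (ispd c)" by (rule cvB_inverse_norm[OF per K(2,1) pB])
  have u: "cvB 0 F (\<lambda>s x. sqrt (spd (cs s) x)) (\<lambda>x. sqrt (spd c x))" by (rule cvB_sqrt_norm[OF pB per K(2,1)])
  have wle: "cvB j F (\<lambda>s. ispd (cs s)) (ispd c)" if "j \<le> k" for j
    using that w by (induction k rule: dec_induct) (auto dest: cvB_lower)
  have D: "j \<le> n \<Longrightarrow> cvS (n - j) F (\<lambda>s. (Dc (cs s) ^^ j) (hs s)) ((Dc c ^^ j) h)" for j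
  proof (induction j)
    case (Suc j)
    have nj: "n - j = Suc (n - Suc j)" using Suc.prems by simp
    have IH: "cvS (Suc (n - Suc j)) F (\<lambda>s. (Dc (cs s) ^^ j) (hs s)) ((Dc c ^^ j) h)" using Suc nj by simp
    have "cvS (n - Suc j) F (\<lambda>s x. ispd (cs s) x *\<^sub>R wderiv ((Dc (cs s) ^^ j) (hs s)) x) (\<lambda>x. ispd c x *\<^sub>R wderiv ((Dc c ^^ j) h) x)"
      using k by (intro cvS_bilinear[OF bounded_bilinear_scaleR] wle cvS_wderiv IH) simp
    moreover have "(Dc c ^^ Suc j) h = (\<lambda>x. ispd c x *\<^sub>R wderiv ((Dc c ^^ j) h) x)" for c h :: "real \<Rightarrow> 'a"
      unfolding funpow.simps comp_def by (rule Dc_eq)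
    ultimately show ?case by (simp only:)
  qed (use cvh in simp)
  have dsn: "((\<lambda>s. dsn (cs s) ((Dc (cs s) ^^ j) (hs s))) \<longlongrightarrow> dsn c ((Dc c ^^ j) h)) F" if "j \<le> n" for j
    unfolding dsn_def using cvS_le[OF _ D[OF that]] by (intro cvS_nrm cvS_bilinear[OF bounded_bilinear_scaleR] u) simp
  have len: "((\<lambda>s. curve_length (cs s)) \<longlongrightarrow> curve_length c) F"
    unfolding curve_length_dsn dsn_def using u by (intro tendsto_intros cvS_nrm) (simp add: cvB_imp_cvS)
  show ?thesis unfolding Gmetric_dsn
    using isCont_tendsto_compose[OF a len] curve_length_pos[OF c n] dsn by (intro tendsto_intros) auto
qed

subsection \<open>Growth along paths\<close>

text \<open>A mean value inequality for functions that need not be differentiable, such as norms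
  along a path. It holds up to a small error on short intervals around each point and is additive
  over adjacent intervals, so bisection extends it.\<close>

lemma growth_by_local_bound:
  fixes f s :: "real \<Rightarrow> real"
  assumes ab: "a \<le> b" and s: "continuous_on {a..b} s"
    and loc: "\<And>t \<epsilon>. t \<in> {a..b} \<Longrightarrow> \<epsilon> > 0 \<Longrightarrow> \<forall>\<^sub>F x in at t within {a..b}. \<bar>f x - f t\<bar> \<le> (s t + \<epsilon>) * \<bar>x - t\<bar>"
  shows "\<bar>f b - f a\<bar> \<le> integral {a..b} s"
proof (rule field_le_epsilon)
  fix \<delta> :: real assume \<delta>: "\<delta> > 0"
  define e where "e = \<delta> / (b - a + 1)"
  have e: "e > 0" "e * (b - a) \<le> \<delta>" using \<delta> ab by (auto simp: e_def field_simps)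
  have si: "s integrable_on {u..v}" if "a \<le> u" "v \<le> b" for u v
    using that by (intro integrable_continuous_interval continuous_on_subset[OF s]) auto
  have "a \<le> a \<and> b \<le> b \<longrightarrow> \<bar>f b - f a\<bar> \<le> integral {a..b} s + e * (b - a)"
  proof (rule Bolzano[where P = "\<lambda>u v. a \<le> u \<and> v \<le> b \<longrightarrow> \<bar>f v - f u\<bar> \<le> integral {u..v} s + e * (v - u)", OF ab])
    fix u v w :: real
    assume uv: "a \<le> u \<and> v \<le> b \<longrightarrow> \<bar>f v - f u\<bar> \<le> integral {u..v} s + e * (v - u)"
      and vw: "a \<le> v \<and> w \<le> b \<longrightarrow> \<bar>f w - f v\<bar> \<le> integral {v..w} s + e * (w - v)" and o: "u \<le> v" "v \<le> w"
    show "a \<le> u \<and> w \<le> b \<longrightarrow> \<bar>f w - f u\<bar> \<le> integral {u..w} s + e * (w - u)"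
    proof
      assume uw: "a \<le> u \<and> w \<le> b"
      have "integral {u..v} s + integral {v..w} s = integral {u..w} s"
        using uw o si by (intro Henstock_Kurzweil_Integration.integral_combine) auto
      moreover have "\<bar>f v - f u\<bar> \<le> integral {u..v} s + e * (v - u)" "\<bar>f w - f v\<bar> \<le> integral {v..w} s + e * (w - v)"
        using uv vw uw o by auto
      moreover have "e * (v - u) + e * (w - v) = e * (w - u)" by (simp add: algebra_simps)
      ultimately show "\<bar>f w - f u\<bar> \<le> integral {u..w} s + e * (w - u)" by linarith
    qed
  next
    fix x assume x: "a \<le> x" "x \<le> b"
    have e2: "e/2 > 0" using e by simp
    have "\<forall>\<^sub>F y in at x within {a..b}. \<bar>f y - f x\<bar> \<le> (s x + e/2) * \<bar>y - x\<bar>" using x by (intro loc e2) auto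
    then obtain d1 where d1: "d1 > 0" "\<And>y. y \<in> {a..b} \<Longrightarrow> y \<noteq> x \<Longrightarrow> dist y x < d1 \<Longrightarrow> \<bar>f y - f x\<bar> \<le> (s x + e/2) * \<bar>y - x\<bar>"
      unfolding eventually_at by blast
    have "\<forall>e>0. \<exists>d>0. \<forall>y\<in>{a..b}. dist y x < d \<longrightarrow> dist (s y) (s x) < e"
      using s x unfolding continuous_on_iff by simp
    then have "\<exists>d2>0. \<forall>y\<in>{a..b}. dist y x < d2 \<longrightarrow> dist (s y) (s x) < e/2" using e2 by blast
    then obtain d2 where d2: "d2 > 0" "\<And>y. y \<in> {a..b} \<Longrightarrow> dist y x < d2 \<Longrightarrow> dist (s y) (s x) < e/2" by blast
    show "\<exists>d>0. \<forall>u v. u \<le> x \<and> x \<le> v \<and> v - u < d \<longrightarrow> a \<le> u \<and> v \<le> b \<longrightarrow> \<bar>f v - f u\<bar> \<le> integral {u..v} s + e * (v - u)"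
    proof (intro exI[of _ "min d1 d2"] conjI allI impI)
      show "min d1 d2 > 0" using d1 d2 by simp
      fix u v assume *: "u \<le> x \<and> x \<le> v \<and> v - u < min d1 d2" "a \<le> u \<and> v \<le> b"
      have fu: "\<bar>f u - f x\<bar> \<le> (s x + e/2) * (x - u)"
        using d1(2)[of u] * by (cases "u = x") (auto simp: dist_real_def)
      have fv: "\<bar>f v - f x\<bar> \<le> (s x + e/2) * (v - x)"
        using d1(2)[of v] * by (cases "v = x") (auto simp: dist_real_def)
      have "integral {u..v} (\<lambda>y. s x - e/2) \<le> integral {u..v} s"
      proof (rule integral_le)
        show "s integrable_on {u..v}" using si * by auto
        fix y assume "y \<in> {u..v}"
        then have "dist (s y) (s x) < e/2" using * by (intro d2(2)) (auto simp: dist_real_def)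
        then show "s x - e/2 \<le> s y" unfolding dist_real_def by linarith
      qed auto
      then have "(v - u) * (s x - e/2) \<le> integral {u..v} s" using * by simp
      \<comment> \<open>One half of e comes from the local bound at x, the other from replacing s by
        its value at x under the integral; together they make up the error e (v - u).\<close>
      moreover have "(s x + e/2) * (x - u) + (s x + e/2) * (v - x) = (v - u) * (s x - e/2) + e * (v - u)"
        by (simp add: field_simps)
      ultimately show "\<bar>f v - f u\<bar> \<le> integral {u..v} s + e * (v - u)" using fu fv by linarith
    qed
  qed
  then show "\<bar>f b - f a\<bar> \<le> integral {a..b} s + \<delta>" using e by auto
qed

lemma local_bound_compose:
  fixes g :: "real \<Rightarrow> real"
  assumes g: "\<And>\<epsilon>. \<epsilon> > 0 \<Longrightarrow> \<forall>\<^sub>F x in at t within T. \<bar>g x - g t\<bar> \<le> (m + \<epsilon>) * \<bar>x - t\<bar>" and m: "m \<ge> 0"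
    and \<Psi>: "(\<Psi> has_real_derivative \<psi>) (at (g t))" and M: "\<bar>\<psi>\<bar> * m \<le> M" and \<epsilon>: "\<epsilon> > 0"
  shows "\<forall>\<^sub>F x in at t within T. \<bar>\<Psi> (g x) - \<Psi> (g t)\<bar> \<le> (M + \<epsilon>) * \<bar>x - t\<bar>"
proof -
  \<comment> \<open>With e \<le> 1 the product (|\<psi>| + e)(m + e) exceeds |\<psi>| m by at most e
    (|\<psi>| + m + 1), which this choice keeps below \<epsilon>.\<close>
  define e where "e = min 1 (\<epsilon> / (\<bar>\<psi>\<bar> + m + 1))"
  have den: "\<bar>\<psi>\<bar> + m + 1 > 0" using m by linarith
  have e: "e > 0" "e \<le> 1" using \<epsilon> den by (auto simp: e_def)
  have "e * (\<bar>\<psi>\<bar> + m + 1) \<le> \<epsilon> / (\<bar>\<psi>\<bar> + m + 1) * (\<bar>\<psi>\<bar> + m + 1)"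
    using den by (intro mult_right_mono) (auto simp: e_def)
  then have e3: "e * (\<bar>\<psi>\<bar> + m + 1) \<le> \<epsilon>" using den by simp
  have "e * e \<le> e * 1" using e by (intro mult_left_mono) auto
  moreover have "(\<bar>\<psi>\<bar> + e) * (m + e) = \<bar>\<psi>\<bar> * m + e * (\<bar>\<psi>\<bar> + m) + e * e" by (simp add: algebra_simps)
  ultimately have prod: "(\<bar>\<psi>\<bar> + e) * (m + e) \<le> M + \<epsilon>" using e3 M by (simp add: distrib_left)
  have gt: "(g \<longlongrightarrow> g t) (at t within T)"
  proof (rule tendstoI)
    fix r :: real assume r: "r > 0"
    have "\<forall>\<^sub>F x in at t within T. \<bar>x - t\<bar> < r / (m + 1)"
      unfolding eventually_at using r m by (intro exI[of _ "r / (m + 1)"]) (auto simp: dist_real_def)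
    with g[OF zero_less_one] show "\<forall>\<^sub>F x in at t within T. dist (g x) (g t) < r"
    proof eventually_elim
      case (elim x)
      have "(m + 1) * \<bar>x - t\<bar> < (m + 1) * (r / (m + 1))" using elim m by (intro mult_strict_left_mono) auto
      then show ?case using elim m by (simp add: dist_real_def)
    qed
  qed
  have "((\<lambda>y. (\<Psi> y - \<Psi> (g t)) / (y - g t)) \<longlongrightarrow> \<psi>) (at (g t))" using \<Psi> by (simp add: has_field_derivative_iff)
  then have "\<forall>\<^sub>F y in at (g t). dist ((\<Psi> y - \<Psi> (g t)) / (y - g t)) \<psi> < e" using e(1) by (rule tendstoD)
  \<comment> \<open>Near t the function g may return to the value g(t), so a punctured neighbourhood
    is not enough; at y = g(t) both sides vanish.\<close>
  then have "\<forall>\<^sub>F y in nhds (g t). \<bar>\<Psi> y - \<Psi> (g t)\<bar> \<le> (\<bar>\<psi>\<bar> + e) * \<bar>y - g t\<bar>"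
    unfolding eventually_at_filter
  proof eventually_elim
    case (elim y)
    show ?case
    proof (cases "y = g t")
      case False
      then have "\<bar>(\<Psi> y - \<Psi> (g t)) / (y - g t) - \<psi>\<bar> < e" using elim by (simp add: dist_real_def)
      then have "\<bar>(\<Psi> y - \<Psi> (g t)) / (y - g t)\<bar> \<le> \<bar>\<psi>\<bar> + e" by linarith
      then show ?thesis using False by (simp add: abs_divide divide_le_eq)
    qed simp
  qed
  then have "\<forall>\<^sub>F x in at t within T. \<bar>\<Psi> (g x) - \<Psi> (g t)\<bar> \<le> (\<bar>\<psi>\<bar> + e) * \<bar>g x - g t\<bar>"
    using gt by (rule eventually_compose_filterlim)
  with g[OF e(1)] show ?thesis
  proof eventually_elim
    case (elim x)
    have "(\<bar>\<psi>\<bar> + e) * \<bar>g x - g t\<bar> \<le> (\<bar>\<psi>\<bar> + e) * ((m + e) * \<bar>x - t\<bar>)" using elim e by (intro mult_left_mono) auto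
    also have "\<dots> = ((\<bar>\<psi>\<bar> + e) * (m + e)) * \<bar>x - t\<bar>" by simp
    also have "\<dots> \<le> (M + \<epsilon>) * \<bar>x - t\<bar>" using prod by (intro mult_right_mono) auto
    finally show ?case using elim by linarith
  qed
qed

section \<open>Path derivatives and seminorms along paths\<close>

lemma has_path_deriv_single: 
  "has_path_deriv {p} \<gamma> v t T \<longleftrightarrow> ((\<lambda>s. p (\<lambda>\<theta>. (\<gamma> s \<theta> - \<gamma> t \<theta>) /\<^sub>R (s - t) - v \<theta>)) \<longlongrightarrow> 0) (at t within T)"
  by (simp add: has_path_deriv_def)

lemma periodic_shift_int:
  assumes "periodic f" shows "f (x + 2 * pi * of_int k) = f x"
proof -
  have nat: "f (y + 2 * pi * of_nat j) = f y" for y j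
  proof (induction j)
    case (Suc j)
    have "f (y + 2 * pi * of_nat (Suc j)) = f ((y + 2 * pi * of_nat j) + 2 * pi)" by (simp add: algebra_simps)
    also have "\<dots> = f (y + 2 * pi * of_nat j)" using assms unfolding periodic_def by blast
    finally show ?case using Suc by simp
  qed simp
  show ?thesis
  proof (cases k)
    case (nonneg j)
    then show ?thesis using nat[of x j] by simp
  next
    case (neg j)
    then have "real_of_int k = - real (Suc j)" by simp
    then have "x = (x + 2 * pi * of_int k) + 2 * pi * of_nat (Suc j)" by (simp only: mult_minus_right diff_add_cancel add_uminus_conv_diff)
    then show ?thesis using nat by metis
  qed
qed

lemma periodic_eqI:
  assumes "periodic f" "periodic g" "\<And>x. x \<in> {0..2*pi} \<Longrightarrow> f x = g x"
  shows "f = g"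
proof
  fix x
  define y where "y = x + 2 * pi * of_int (- \<lfloor>x / (2*pi)\<rfloor>)"
  have z: "of_int \<lfloor>x / (2*pi)\<rfloor> \<le> x / (2*pi)" "x / (2*pi) \<le> of_int \<lfloor>x / (2*pi)\<rfloor> + 1" by linarith+
  have "of_int \<lfloor>x / (2*pi)\<rfloor> * (2*pi) \<le> x" "x \<le> (of_int \<lfloor>x / (2*pi)\<rfloor> + 1) * (2*pi)"
    using mult_right_mono[OF z(1), of "2*pi"] mult_right_mono[OF z(2), of "2*pi"] by simp_all
  then have "y \<in> {0..2*pi}" by (auto simp: y_def algebra_simps)
  then have "f y = g y" by (rule assms)
  then show "f x = g x" unfolding y_def periodic_shift_int[OF assms(1)] periodic_shift_int[OF assms(2)] .
qed

lemma Hspace_quotient: "f \<in> Hspace n \<Longrightarrow> g \<in> Hspace n \<Longrightarrow> (\<lambda>\<theta>. (f \<theta> - g \<theta>) /\<^sub>R r) \<in> Hspace n"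
  using Hspace_scaleR[OF Hspace_diff, of f n g "inverse r"] by simp

lemma nrm_le_Hnorm: "Sob n h \<Longrightarrow> nrm h \<le> Hnorm n h"
  unfolding Hnorm_alt by (auto intro!: real_le_rsqrt)

text \<open>\<open>velocity\<close> is a choice, so the speed can be computed only if path
  derivatives are unique. The norm gives equality almost everywhere; continuity and periodicity turn
  it into equality of functions.\<close>

lemma has_path_deriv_unique:
  fixes \<gamma> :: "real \<Rightarrow> real \<Rightarrow> 'a::euclidean_space"
  assumes v: "has_path_deriv {Hnorm n} \<gamma> v t T" "has_path_deriv {Hnorm n} \<gamma> w t T"
    and H: "v \<in> Hspace n" "w \<in> Hspace n" "\<And>s. s \<in> T \<Longrightarrow> \<gamma> s \<in> Hspace n" "t \<in> T" and nt: "at t within T \<noteq> bot"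
  shows "v = w"
proof -
  let ?q = "\<lambda>s \<theta>. (\<gamma> s \<theta> - \<gamma> t \<theta>) /\<^sub>R (s - t)"
  have lim: "((\<lambda>s. Hnorm n (\<lambda>\<theta>. ?q s \<theta> - v \<theta>) + Hnorm n (\<lambda>\<theta>. ?q s \<theta> - w \<theta>)) \<longlongrightarrow> 0 + 0) (at t within T)"
    using v unfolding has_path_deriv_single by (intro tendsto_add)
  have "\<forall>\<^sub>F s in at t within T. nrm (\<lambda>\<theta>. v \<theta> - w \<theta>) \<le> Hnorm n (\<lambda>\<theta>. ?q s \<theta> - v \<theta>) + Hnorm n (\<lambda>\<theta>. ?q s \<theta> - w \<theta>)"
    unfolding eventually_at_filter
  proof (rule always_eventually, intro allI impI)
    fix s assume "s \<noteq> t" "s \<in> T"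
    then have q: "?q s \<in> Hspace n" using H by (intro Hspace_quotient) auto
    have S: "Sob n (\<lambda>\<theta>. ?q s \<theta> - v \<theta>)" "Sob n (\<lambda>\<theta>. ?q s \<theta> - w \<theta>)"
      using Hspace_diff[OF q] H by (auto simp: Hspace_iff)
    have sq: "sqint (\<lambda>\<theta>. ?q s \<theta> - v \<theta>)" "sqint (\<lambda>\<theta>. ?q s \<theta> - w \<theta>)" using S Sob_L2 by (auto simp: L2_iff)
    have "nrm (\<lambda>\<theta>. (?q s \<theta> - w \<theta>) + (-1) *\<^sub>R (?q s \<theta> - v \<theta>)) \<le> nrm (\<lambda>\<theta>. ?q s \<theta> - w \<theta>) + nrm (\<lambda>\<theta>. (-1) *\<^sub>R (?q s \<theta> - v \<theta>))"
      by (intro sqint_add(2) sqint_scaleR sq)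
    also have "(\<lambda>\<theta>. (?q s \<theta> - w \<theta>) + (-1) *\<^sub>R (?q s \<theta> - v \<theta>)) = (\<lambda>\<theta>. v \<theta> - w \<theta>)" by (auto simp: algebra_simps)
    finally show "nrm (\<lambda>\<theta>. v \<theta> - w \<theta>) \<le> Hnorm n (\<lambda>\<theta>. ?q s \<theta> - v \<theta>) + Hnorm n (\<lambda>\<theta>. ?q s \<theta> - w \<theta>)"
      using nrm_le_Hnorm[OF S(1)] nrm_le_Hnorm[OF S(2)] unfolding nrm_scaleR by simp
  qed
  from tendsto_lowerbound[OF lim this nt] have "nrm (\<lambda>\<theta>. v \<theta> - w \<theta>) \<le> 0" by simp
  then have n0: "nrm (\<lambda>\<theta>. v \<theta> - w \<theta>) = 0" using nrm_nonneg[of "\<lambda>\<theta>. v \<theta> - w \<theta>"] by linarith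
  have "(\<lambda>\<theta>. v \<theta> - w \<theta>) \<in> Hspace n" using H by (intro Hspace_diff)
  then have "sqint (\<lambda>\<theta>. v \<theta> - w \<theta>)" using Sob_L2 by (auto simp: Hspace_iff L2_iff)
  then have "AE \<theta> in circle_measure. v \<theta> - w \<theta> = 0" using n0 by (rule nrm_eq_0D)
  then have ae: "AE \<theta> in circle_measure. v \<theta> = w \<theta>" by eventually_elim simp
  show "v = w"
  proof (rule periodic_eqI)
    show "periodic v" "periodic w" using H by (auto simp: Hspace_iff)
    fix x :: real assume "x \<in> {0..2*pi}"
    then show "v x = w x"
      using H by (intro continuous_AE_eq[OF _ _ ae]) (auto simp: Hspace_iff intro: continuous_on_subset)
  qed
qed

lemma path_deriv_continuous:
  fixes \<gamma> :: "real \<Rightarrow> real \<Rightarrow> 'a::euclidean_space"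
  assumes n: "n \<ge> 1" and d: "has_path_deriv {Hnorm n} \<gamma> v t T" and H: "v \<in> Hspace n" "\<And>s. s \<in> T \<Longrightarrow> \<gamma> s \<in> Hspace n" "t \<in> T"
  shows "cvS n (at t within T) \<gamma> (\<gamma> t)"
  unfolding cvS_def
proof (intro conjI allI impI)
  show "Sob n (\<gamma> t)" using H by (simp add: Hspace_iff)
  fix \<epsilon> :: real assume e: "\<epsilon> > 0"
  let ?q = "\<lambda>s \<theta>. (\<gamma> s \<theta> - \<gamma> t \<theta>) /\<^sub>R (s - t)"
  define C :: real where "C = 1 + 10 ^ n"
  have C: "C > 0" by (simp add: C_def add_pos_pos)
  \<comment> \<open>Once the difference quotient is within \<open>Hnorm\<close> distance 1 of v, its
    \<open>En\<close> norm is at most C + \<open>En n v\<close>.\<close>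
  define M where "M = C + En n v"
  have M: "M > 0" using C by (simp add: M_def add_pos_nonneg)
  have "\<forall>\<^sub>F s in at t within T. dist (Hnorm n (\<lambda>\<theta>. ?q s \<theta> - v \<theta>)) 0 < 1"
    using d unfolding has_path_deriv_single by (rule tendstoD) simp
  moreover have "\<forall>\<^sub>F s in at t within T. \<bar>s - t\<bar> < \<epsilon> / M"
    unfolding eventually_at using e M by (intro exI[of _ "\<epsilon> / M"]) (auto simp: dist_real_def)
  moreover have "\<forall>\<^sub>F s in at t within T. s \<noteq> t \<and> s \<in> T" by (simp add: eventually_at_filter)
  ultimately show "\<forall>\<^sub>F s in at t within T. Sob n (\<lambda>x. \<gamma> s x - \<gamma> t x) \<and> En n (\<lambda>x. \<gamma> s x - \<gamma> t x) \<le> \<epsilon>"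
  proof eventually_elim
    case (elim s)
    have q: "?q s \<in> Hspace n" using H elim by (intro Hspace_quotient) auto
    have S: "Sob n (\<lambda>\<theta>. ?q s \<theta> - v \<theta>)" "Sob n (?q s)" "Sob n v"
      using Hspace_diff[OF q H(1)] q H(1) by (auto simp: Hspace_iff)
    have "En n (\<lambda>\<theta>. ?q s \<theta> - v \<theta>) \<le> C * Hnorm n (\<lambda>\<theta>. ?q s \<theta> - v \<theta>)" unfolding C_def by (rule En_le_Hnorm[OF S(1) n])
    also have "\<dots> \<le> C * 1" using elim C Hnorm_nonneg by (intro mult_left_mono) (auto simp: dist_real_def)
    finally have "En n (\<lambda>\<theta>. (?q s \<theta> - v \<theta>) + v \<theta>) \<le> M" using Sob_add[OF S(1,3)] by (simp add: M_def)
    then have qM: "En n (?q s) \<le> M" by simp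
    have eq: "(\<lambda>x. \<gamma> s x - \<gamma> t x) = (\<lambda>x. (s - t) *\<^sub>R ?q s x)" using elim by auto
    have "En n (\<lambda>x. (s - t) *\<^sub>R ?q s x) = \<bar>s - t\<bar> * En n (?q s)" using Sob_scaleR[OF S(2)] by blast
    also have "\<dots> \<le> (\<epsilon> / M) * M" using qM elim e M by (intro mult_mono) auto
    finally show ?case using Sob_scaleR[OF S(2)] M unfolding eq by simp
  qed
qed

text \<open>Covers the functionals whose growth is followed: the length, |c'| at a point, and
  Sobolev norms of c'. Subadditivity, homogeneity and continuity suffice for a slope bound along
  paths.\<close>

definition Hseminorm :: "nat \<Rightarrow> ((real \<Rightarrow> 'a::euclidean_space) \<Rightarrow> real) \<Rightarrow> bool" where
  "Hseminorm n N \<longleftrightarrow> (\<forall>f\<in>Hspace n. \<forall>g\<in>Hspace n. N (\<lambda>x. f x + g x) \<le> N f + N g) \<and>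
     (\<forall>f\<in>Hspace n. \<forall>r. N (\<lambda>x. r *\<^sub>R f x) = \<bar>r\<bar> * N f) \<and>
     (\<exists>C. \<forall>f\<in>Hspace n. 0 \<le> N f \<and> N f \<le> C * Hnorm n f)"

text \<open>By the reverse triangle inequality the increment of N is at most N of the increment of
  the path, which is |s - t| times N of a difference quotient close to v.\<close>

lemma Hseminorm_path:
  fixes \<gamma> :: "real \<Rightarrow> real \<Rightarrow> 'a::euclidean_space"
  assumes N: "Hseminorm n N" and d: "has_path_deriv {Hnorm n} \<gamma> v t T" 
    and H: "v \<in> Hspace n" "\<And>s. s \<in> T \<Longrightarrow> \<gamma> s \<in> Hspace n" "t \<in> T" and e: "\<epsilon> > 0"
  shows "\<forall>\<^sub>F s in at t within T. \<bar>N (\<gamma> s) - N (\<gamma> t)\<bar> \<le> (N v + \<epsilon>) * \<bar>s - t\<bar>"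
proof -
  let ?q = "\<lambda>s \<theta>. (\<gamma> s \<theta> - \<gamma> t \<theta>) /\<^sub>R (s - t)"
  have add: "N (\<lambda>x. f x + g x) \<le> N f + N g" if "f \<in> Hspace n" "g \<in> Hspace n" for f g
    using N that unfolding Hseminorm_def by blast
  have scale: "N (\<lambda>x. r *\<^sub>R f x) = \<bar>r\<bar> * N f" if "f \<in> Hspace n" for f r
    using N that unfolding Hseminorm_def by blast
  obtain C where C: "\<And>f. f \<in> Hspace n \<Longrightarrow> N f \<le> C * Hnorm n f" using N unfolding Hseminorm_def by blast
  have "((\<lambda>s. C * Hnorm n (\<lambda>\<theta>. ?q s \<theta> - v \<theta>)) \<longlongrightarrow> C * 0) (at t within T)"
    using d unfolding has_path_deriv_single by (intro tendsto_intros)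
  then have "\<forall>\<^sub>F s in at t within T. dist (C * Hnorm n (\<lambda>\<theta>. ?q s \<theta> - v \<theta>)) (C * 0) < \<epsilon>" using e by (rule tendstoD)
  moreover have "\<forall>\<^sub>F s in at t within T. s \<noteq> t \<and> s \<in> T" by (simp add: eventually_at_filter)
  ultimately show ?thesis
  proof eventually_elim
    case (elim s)
    have gs: "\<gamma> s \<in> Hspace n" "\<gamma> t \<in> Hspace n" using H elim by auto
    have q: "?q s \<in> Hspace n" using gs by (rule Hspace_quotient)
    have qv: "(\<lambda>\<theta>. ?q s \<theta> - v \<theta>) \<in> Hspace n" by (rule Hspace_diff[OF q H(1)])
    have "N (\<lambda>\<theta>. (?q s \<theta> - v \<theta>) + v \<theta>) \<le> N (\<lambda>\<theta>. ?q s \<theta> - v \<theta>) + N v" by (rule add[OF qv H(1)])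
    moreover have "N (\<lambda>\<theta>. ?q s \<theta> - v \<theta>) \<le> \<epsilon>" using C[OF qv] elim by (simp add: dist_real_def)
    ultimately have Nq: "N (?q s) \<le> N v + \<epsilon>" by simp
    have D: "(\<lambda>x. \<gamma> s x - \<gamma> t x) \<in> Hspace n" "(\<lambda>x. \<gamma> t x - \<gamma> s x) \<in> Hspace n" using gs by (auto intro: Hspace_diff)
    have st: "s - t \<noteq> 0" using elim by simp
    then have "(s - t) * inverse (s - t) = 1" by (rule right_inverse)
    moreover have "(t - s) * inverse (s - t) = - ((s - t) * inverse (s - t))" by (simp add: left_diff_distrib)
    ultimately have eq: "(\<lambda>x. \<gamma> s x - \<gamma> t x) = (\<lambda>x. (s - t) *\<^sub>R ?q s x)" "(\<lambda>x. \<gamma> t x - \<gamma> s x) = (\<lambda>x. (t - s) *\<^sub>R ?q s x)"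
      by (simp_all only: scaleR_scaleR scaleR_one scaleR_minus_left minus_diff_eq)
    have ND: "N (\<lambda>x. \<gamma> s x - \<gamma> t x) = \<bar>s - t\<bar> * N (?q s)" "N (\<lambda>x. \<gamma> t x - \<gamma> s x) = \<bar>s - t\<bar> * N (?q s)"
      using scale[OF q, of "s - t"] scale[OF q, of "t - s"] unfolding eq by (auto simp: abs_minus_commute)
    have "\<bar>N (\<gamma> s) - N (\<gamma> t)\<bar> \<le> \<bar>s - t\<bar> * N (?q s)"
      using add[OF D(1) gs(2)] add[OF D(2) gs(1)] ND by simp
    also have "\<dots> \<le> \<bar>s - t\<bar> * (N v + \<epsilon>)" using Nq by (intro mult_left_mono) auto
    finally show ?case by (simp add: mult.commute)
  qed
qed

text \<open>A smooth piece reduced to two derivatives: the second one makes the velocity, and with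
  it the speed, continuous.\<close>

definition seg :: "nat \<Rightarrow> (real \<Rightarrow> real \<Rightarrow> 'a::euclidean_space) \<Rightarrow> (real \<Rightarrow> real \<Rightarrow> 'a) \<Rightarrow> real set \<Rightarrow> bool" where
  "seg n \<gamma> v T \<longleftrightarrow> (\<forall>t\<in>T. \<gamma> t \<in> In n \<and> v t \<in> Hspace n \<and> has_path_deriv {Hnorm n} \<gamma> (v t) t T \<and>
      (\<exists>w\<in>Hspace n. has_path_deriv {Hnorm n} v w t T))"

lemma smooth_path_seg:
  assumes "smooth_path_on (Hspace n) {Hnorm n} \<gamma> T" "\<And>t. t \<in> T \<Longrightarrow> \<gamma> t \<in> In n"
  shows "\<exists>v. seg n \<gamma> v T"
proof -
  obtain \<Gamma> where \<Gamma>: "\<Gamma> 0 = \<gamma>" "\<And>k t. t \<in> T \<Longrightarrow> \<Gamma> k t \<in> Hspace n \<and> has_path_deriv {Hnorm n} (\<Gamma> k) (\<Gamma> (Suc k) t) t T"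
    using assms(1) unfolding smooth_path_on_def by blast
  have "seg n \<gamma> (\<Gamma> (Suc 0)) T"
    unfolding seg_def
  proof (intro ballI conjI)
    fix t assume t: "t \<in> T"
    show "\<gamma> t \<in> In n" by (rule assms(2)[OF t])
    show "\<Gamma> (Suc 0) t \<in> Hspace n" using \<Gamma>(2)[OF t] by blast
    show "has_path_deriv {Hnorm n} \<gamma> (\<Gamma> (Suc 0) t) t T" using \<Gamma>(2)[OF t, of 0] \<Gamma>(1) by simp
    show "\<exists>w\<in>Hspace n. has_path_deriv {Hnorm n} (\<Gamma> (Suc 0)) w t T" using \<Gamma>(2)[OF t] by blast
  qed
  then show ?thesis by blast
qed

lemma metric_coeffsD:
  assumes "metric_coeffs n a"
  shows "j \<le> n \<Longrightarrow> l > 0 \<Longrightarrow> isCont (a j) l" "j \<le> n \<Longrightarrow> l > 0 \<Longrightarrow> a j l \<ge> 0" "l > 0 \<Longrightarrow> a 0 l > 0" "l > 0 \<Longrightarrow> a n l > 0"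
proof -
  assume "j \<le> n" "l > 0"
  then have "(cderiv ^^ 0) (a j) differentiable (at l)"
    using assms unfolding metric_coeffs_def smooth_on_def by blast
  then show "isCont (a j) l" using differentiable_imp_continuous_within by auto
qed (use assms in \<open>auto simp: metric_coeffs_def\<close>)

lemma G_In_nonneg:
  assumes "n \<ge> 2" "metric_coeffs n a" "c \<in> In n"
  shows "G_In n a c h h \<ge> 0"
  unfolding Gmetric_dsn using metric_coeffsD(2)[OF assms(2)] curve_length_pos[OF assms(3,1)]
  by (intro sum_nonneg mult_nonneg_nonneg) auto

text \<open>Not only a technicality: the Bochner integral defining \<^term>\<open>path_len\<close> is 0 when the speed is
  not integrable, so no lower bound on lengths is available without this.\<close>

lemma seg_speed_continuous:
  assumes n: "n \<ge> 2" and a: "metric_coeffs n a" and sg: "seg n \<gamma> v T"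
  shows "continuous_on T (\<lambda>t. sqrt (G_In n a (\<gamma> t) (v t) (v t)))"
  unfolding continuous_on_def
proof
  fix t assume t: "t \<in> T"
  have In: "\<gamma> s \<in> In n" if "s \<in> T" for s using sg that by (simp add: seg_def)
  have g: "cvS n (at t within T) \<gamma> (\<gamma> t)"
    using sg t n by (intro path_deriv_continuous[of n \<gamma> "v t"]) (auto simp: seg_def In_def)
  obtain w where w: "w \<in> Hspace n" "has_path_deriv {Hnorm n} v w t T" using sg t by (auto simp: seg_def)
  have v: "cvS n (at t within T) v (v t)"
    using sg t n w by (intro path_deriv_continuous[of n v w]) (auto simp: seg_def)
  have "\<forall>\<^sub>F s in at t within T. \<gamma> s \<in> In n" using In by (simp add: eventually_at_filter)
  then show "((\<lambda>t. sqrt (G_In n a (\<gamma> t) (v t) (v t))) \<longlongrightarrow> sqrt (G_In n a (\<gamma> t) (v t) (v t))) (at t within T)"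
    by (intro tendsto_real_sqrt G_In_continuous n In t g v metric_coeffsD(1)[OF a])
qed

text \<open>Hypothesis \<open>b\<close> says that \<Psi> of N has slope at most K times the metric
  norm in every direction h; it is applied to the velocity.\<close>

lemma seg_growth:
  assumes n: "n \<ge> 2" and a: "metric_coeffs n a" and sg: "seg n \<gamma> v {l..r}" and N: "Hseminorm n N"
    and K: "K \<ge> 0"
    and \<Psi>: "\<And>t. t \<in> {l..r} \<Longrightarrow> (\<Psi> has_real_derivative \<psi> (N (\<gamma> t))) (at (N (\<gamma> t)))"
    and b: "\<And>t h. t \<in> {l..r} \<Longrightarrow> h \<in> Hspace n \<Longrightarrow> \<bar>\<psi> (N (\<gamma> t))\<bar> * N h \<le> K * sqrt (G_In n a (\<gamma> t) h h)"
    and x: "x \<in> {l..r}"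
  shows "\<bar>\<Psi> (N (\<gamma> x)) - \<Psi> (N (\<gamma> l))\<bar> \<le> K * integral {l..x} (\<lambda>t. sqrt (G_In n a (\<gamma> t) (v t) (v t)))"
proof -
  let ?s = "\<lambda>t. sqrt (G_In n a (\<gamma> t) (v t) (v t))"
  have "\<bar>\<Psi> (N (\<gamma> x)) - \<Psi> (N (\<gamma> l))\<bar> \<le> integral {l..x} (\<lambda>t. K * ?s t)"
  proof (rule growth_by_local_bound[where f = "\<lambda>t. \<Psi> (N (\<gamma> t))"])
    show "l \<le> x" using x by simp
    show "continuous_on {l..x} (\<lambda>t. K * ?s t)"
      using x by (intro continuous_intros continuous_on_subset[OF seg_speed_continuous[OF n a sg]]) auto
    fix t \<epsilon> :: real assume t: "t \<in> {l..x}" and e: "\<epsilon> > 0"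
    have t': "t \<in> {l..r}" using t x by auto
    have v: "v t \<in> Hspace n" "has_path_deriv {Hnorm n} \<gamma> (v t) t {l..r}" using sg t' by (auto simp: seg_def)
    have "\<forall>\<^sub>F y in at t within {l..r}. \<bar>\<Psi> (N (\<gamma> y)) - \<Psi> (N (\<gamma> t))\<bar> \<le> (K * ?s t + \<epsilon>) * \<bar>y - t\<bar>"
    proof (rule local_bound_compose[where g = "\<lambda>t. N (\<gamma> t)", OF _ _ \<Psi>[OF t'] b[OF t' v(1)] e])
      show "0 \<le> N (v t)" using N v(1) by (auto simp: Hseminorm_def)
      show "\<forall>\<^sub>F y in at t within {l..r}. \<bar>N (\<gamma> y) - N (\<gamma> t)\<bar> \<le> (N (v t) + \<delta>) * \<bar>y - t\<bar>" if "\<delta> > 0" for \<delta>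
        using sg t' by (intro Hseminorm_path[OF N v(2,1) _ t' that]) (auto simp: seg_def In_def)
    qed
    moreover have "at t within {l..x} \<le> at t within {l..r}" using x by (intro at_le) auto
    ultimately show "\<forall>\<^sub>F y in at t within {l..x}. \<bar>\<Psi> (N (\<gamma> y)) - \<Psi> (N (\<gamma> t))\<bar> \<le> (K * ?s t + \<epsilon>) * \<bar>y - t\<bar>"
      by (rule filter_leD[rotated])
  qed
  then show ?thesis by simp
qed

text \<open>In the interior of a piece, derivatives within the piece and within [0, 1] coincide. At
  break points the one-sided derivatives may differ and the choice is unspecified.\<close>

lemma velocity_eq:
  fixes \<gamma> :: "real \<Rightarrow> real \<Rightarrow> 'a::euclidean_space"
  assumes sg: "seg n \<gamma> v {l..r}" and lr: "0 \<le> l" "r \<le> 1" and t: "l < t" "t < r"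
  shows "velocity (Hspace n) {Hnorm n} \<gamma> t = v t"
proof -
  have "at t within {l..r} = at t" using t by (intro at_within_interior) auto
  moreover have "at t within {0..1} = at t" using t lr by (intro at_within_interior) auto
  ultimately have eq: "has_path_deriv {Hnorm n} \<gamma> w t {0..1} \<longleftrightarrow> has_path_deriv {Hnorm n} \<gamma> w t {l..r}" for w
    unfolding has_path_deriv_single by simp
  have v: "v t \<in> Hspace n" "has_path_deriv {Hnorm n} \<gamma> (v t) t {l..r}" using sg t by (auto simp: seg_def)
  show ?thesis unfolding velocity_def
  proof (rule some_equality)
    show "v t \<in> Hspace n \<and> has_path_deriv {Hnorm n} \<gamma> (v t) t {0..1}" using v eq by blast
    fix w assume w: "w \<in> Hspace n \<and> has_path_deriv {Hnorm n} \<gamma> w t {0..1}"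
    have "at t within {l..r} \<noteq> bot" using \<open>at t within {l..r} = at t\<close> by simp
    then show "w = v t" using w v eq sg t by (intro has_path_deriv_unique[of n \<gamma> w t "{l..r}" "v t"]) (auto simp: seg_def In_def)
  qed
qed

lemma partition_bounds:
  fixes \<tau> :: "nat \<Rightarrow> real"
  assumes "\<And>i. i < m \<Longrightarrow> \<tau> i < \<tau> (Suc i)" "i \<le> j" "j \<le> m"
  shows "\<tau> i \<le> \<tau> j"
  using assms(2,3)
proof (induction j rule: dec_induct)
  case (step k)
  then show ?case using assms(1)[of k] by auto
qed simp

lemma path_growth_partial:
  fixes \<gamma> :: "real \<Rightarrow> real \<Rightarrow> 'a::euclidean_space"
  assumes n: "n \<ge> 2" and a: "metric_coeffs n a" and \<tau>: "\<tau> 0 = 0" "\<tau> m = 1" "\<And>i. i < m \<Longrightarrow> \<tau> i < \<tau> (Suc i)"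
    and sg: "\<And>i. i < m \<Longrightarrow> seg n \<gamma> (v i) {\<tau> i..\<tau> (Suc i)}" and N: "Hseminorm n N" and K: "K \<ge> 0"
    and \<Psi>: "\<And>t. t \<in> {0..1} \<Longrightarrow> (\<Psi> has_real_derivative \<psi> (N (\<gamma> t))) (at (N (\<gamma> t)))"
    and b: "\<And>t h. t \<in> {0..1} \<Longrightarrow> h \<in> Hspace n \<Longrightarrow> \<bar>\<psi> (N (\<gamma> t))\<bar> * N h \<le> K * sqrt (G_In n a (\<gamma> t) h h)"
  defines "\<sigma> \<equiv> \<lambda>t. sqrt (G_In n a (\<gamma> t) (velocity (Hspace n) {Hnorm n} \<gamma> t) (velocity (Hspace n) {Hnorm n} \<gamma> t))"
  shows "i \<le> m \<Longrightarrow> \<sigma> integrable_on {0..\<tau> i} \<and> (\<forall>x\<in>{0..\<tau> i}. \<bar>\<Psi> (N (\<gamma> x)) - \<Psi> (N (\<gamma> 0))\<bar> \<le> K * integral {0..x} \<sigma>)"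
proof (induction i)
  case 0
  have "\<sigma> integrable_on {0..0}" using integrable_on_refl[of \<sigma> "0::real"] unfolding cbox_interval .
  then show ?case by (simp add: \<tau>(1))
next
  case (Suc i)
  let ?l = "\<tau> i" and ?r = "\<tau> (Suc i)"
  let ?s = "\<lambda>t. sqrt (G_In n a (\<gamma> t) (v i t) (v i t))"
  have i: "i < m" using Suc.prems by simp
  have IH: "\<sigma> integrable_on {0..?l}" "\<And>x. x\<in>{0..?l} \<Longrightarrow> \<bar>\<Psi> (N (\<gamma> x)) - \<Psi> (N (\<gamma> 0))\<bar> \<le> K * integral {0..x} \<sigma>"
    using Suc by auto
  have lr: "0 \<le> ?l" "?l < ?r" "?r \<le> 1"
    using partition_bounds[of m \<tau> 0 i, OF \<tau>(3)] partition_bounds[of m \<tau> "Suc i" m, OF \<tau>(3)] \<tau> i by auto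
  \<comment> \<open>At the two end points \<open>velocity\<close> may be arbitrary; a finite set
    affects neither integrability nor the integral.\<close>
  have eq: "\<sigma> t = ?s t" if "t \<in> {?l..?r} - {?l, ?r}" for t
    using velocity_eq[OF sg[OF i] lr(1,3), of t] that by (auto simp: \<sigma>_def)
  have si: "?s integrable_on {?l..?r}"
    by (rule integrable_continuous_interval[OF seg_speed_continuous[OF n a sg[OF i]]])
  have \<sigma>i: "\<sigma> integrable_on {?l..?r}"
    using si by (rule integrable_spike_finite[of "{?l, ?r}", rotated 2]) (use eq in auto)
  have \<sigma>0: "\<sigma> integrable_on {0..?r}"
    using lr IH(1) \<sigma>i by (intro Henstock_Kurzweil_Integration.integrable_combine[of 0 ?l ?r]) auto
  have "\<bar>\<Psi> (N (\<gamma> x)) - \<Psi> (N (\<gamma> 0))\<bar> \<le> K * integral {0..x} \<sigma>" if x: "x \<in> {0..?r}" for x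
  proof (cases "x \<le> ?l")
    case True
    then show ?thesis using IH(2) x by auto
  next
    case False
    have x': "x \<in> {?l..?r}" using False x by auto
    have "\<bar>\<Psi> (N (\<gamma> x)) - \<Psi> (N (\<gamma> ?l))\<bar> \<le> K * integral {?l..x} ?s"
      using lr by (intro seg_growth[OF n a sg[OF i] N K \<Psi> b x']) auto
    also have "integral {?l..x} ?s = integral {?l..x} \<sigma>"
      using x' by (intro integral_spike[of "{?l, ?r}"]) (auto simp: eq)
    finally have 1: "\<bar>\<Psi> (N (\<gamma> x)) - \<Psi> (N (\<gamma> ?l))\<bar> \<le> K * integral {?l..x} \<sigma>" .
    have "integral {0..?l} \<sigma> + integral {?l..x} \<sigma> = integral {0..x} \<sigma>"
      using lr x' by (intro Henstock_Kurzweil_Integration.integral_combine integrable_on_subinterval[OF \<sigma>0]) auto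
    then have "K * integral {0..?l} \<sigma> + K * integral {?l..x} \<sigma> = K * integral {0..x} \<sigma>" by (simp flip: distrib_left)
    then show ?thesis using 1 IH(2)[of ?l] lr by auto
  qed
  then show ?case using \<sigma>0 by blast
qed

lemma pw_smooth_paths_In_segs:
  assumes "\<gamma> \<in> pw_smooth_paths (Hspace n) {Hnorm n} (In n) c0 c1"
  obtains m \<tau> v where "\<tau> 0 = (0::real)" "\<tau> m = 1" "\<And>i::nat. i < m \<Longrightarrow> \<tau> i < \<tau> (Suc i)" "\<And>i. i < m \<Longrightarrow> seg n \<gamma> (v i) {\<tau> i..\<tau> (Suc i)}"
proof -
  obtain m \<tau> where *: "\<tau> 0 = (0::real)" "\<tau> m = 1" "\<And>i::nat. i < m \<Longrightarrow> \<tau> i < \<tau> (Suc i) \<and> smooth_path_on (Hspace n) {Hnorm n} \<gamma> {\<tau> i..\<tau> (Suc i)}"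
    and In: "\<And>t. t \<in> {0..1} \<Longrightarrow> \<gamma> t \<in> In n"
    using assms unfolding pw_smooth_paths_def by blast
  have "\<exists>v. seg n \<gamma> v {\<tau> i..\<tau> (Suc i)}" if i: "i < m" for i
  proof (rule smooth_path_seg)
    show "smooth_path_on (Hspace n) {Hnorm n} \<gamma> {\<tau> i..\<tau> (Suc i)}" using * i by blast
    fix t assume "t \<in> {\<tau> i..\<tau> (Suc i)}"
    then show "\<gamma> t \<in> In n" using In partition_bounds[of m \<tau> 0 i] partition_bounds[of m \<tau> "Suc i" m] * i by auto
  qed
  then obtain v where "\<And>i. i < m \<Longrightarrow> seg n \<gamma> (v i) {\<tau> i..\<tau> (Suc i)}" by metis
  then show thesis using that * by blast
qed

lemma path_growth:
  fixes \<gamma> :: "real \<Rightarrow> real \<Rightarrow> 'a::euclidean_space"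
  assumes n: "n \<ge> 2" and a: "metric_coeffs n a" and \<gamma>: "\<gamma> \<in> pw_smooth_paths (Hspace n) {Hnorm n} (In n) c0 c1"
    and N: "Hseminorm n N" and K: "K \<ge> 0"
    and \<Psi>: "\<And>t. t \<in> {0..1} \<Longrightarrow> (\<Psi> has_real_derivative \<psi> (N (\<gamma> t))) (at (N (\<gamma> t)))"
    and b: "\<And>t h. t \<in> {0..1} \<Longrightarrow> h \<in> Hspace n \<Longrightarrow> \<bar>\<psi> (N (\<gamma> t))\<bar> * N h \<le> K * sqrt (G_In n a (\<gamma> t) h h)"
    and x: "x \<in> {0..1}"
  shows "\<bar>\<Psi> (N (\<gamma> x)) - \<Psi> (N c0)\<bar> \<le> K * path_len (Hspace n) {Hnorm n} (G_In n a) \<gamma>"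
proof -
  obtain m \<tau> v where \<tau>: "\<tau> 0 = 0" "\<tau> m = 1" "\<And>i. i < m \<Longrightarrow> \<tau> i < \<tau> (Suc i)" "\<And>i. i < m \<Longrightarrow> seg n \<gamma> (v i) {\<tau> i..\<tau> (Suc i)}"
    by (rule pw_smooth_paths_In_segs[OF \<gamma>]) (rule that)
  let ?\<sigma> = "\<lambda>t. sqrt (G_In n a (\<gamma> t) (velocity (Hspace n) {Hnorm n} \<gamma> t) (velocity (Hspace n) {Hnorm n} \<gamma> t))"
  have In: "\<And>t. t \<in> {0..1} \<Longrightarrow> \<gamma> t \<in> In n" and g0: "\<gamma> 0 = c0"
    using \<gamma> unfolding pw_smooth_paths_def by blast+
  have main: "?\<sigma> integrable_on {0..\<tau> m} \<and> (\<forall>x\<in>{0..\<tau> m}. \<bar>\<Psi> (N (\<gamma> x)) - \<Psi> (N (\<gamma> 0))\<bar> \<le> K * integral {0..x} ?\<sigma>)"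
    by (rule path_growth_partial[where v = v, OF n a \<tau>(1,2) \<tau>(3) \<tau>(4) N K \<Psi> b order_refl]) auto
  then have int: "?\<sigma> integrable_on {0..1}" and bd: "\<bar>\<Psi> (N (\<gamma> x)) - \<Psi> (N c0)\<bar> \<le> K * integral {0..x} ?\<sigma>"
    using x g0 \<tau>(2) by auto
  have pos: "0 \<le> ?\<sigma> t" if "t \<in> {0..1}" for t using G_In_nonneg[OF n a In[OF that]] by simp
  \<comment> \<open>\<open>path_len\<close> is a Bochner integral. Nonnegativity turns gauge
    integrability into absolute integrability, so that its value is the gauge integral and not the
    default 0.\<close>
  have "?\<sigma> absolutely_integrable_on {0..1}" using int pos by (rule nonnegative_absolutely_integrable_1)
  then have "integrable (lebesgue_on {0..1}) ?\<sigma>" by (simp add: integrable_restrict_space set_integrable_def)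
  then have "path_len (Hspace n) {Hnorm n} (G_In n a) \<gamma> = integral {0..1} ?\<sigma>"
    unfolding path_len_def by (intro lebesgue_integral_eq_integral) auto
  moreover have "integral {0..x} ?\<sigma> \<le> integral {0..1} ?\<sigma>"
    using x pos by (intro integral_subset_le integrable_on_subinterval[OF int] int) auto
  ultimately show ?thesis using bd mult_left_mono[OF _ K] by (smt (verit))
qed

section \<open>The three seminorms whose growth is estimated\<close>

lemma curve_length_wderiv:
  fixes h :: "real \<Rightarrow> 'a::euclidean_space"
  assumes h: "h \<in> Hspace n" and n: "n \<ge> 2"
  shows "curve_length h = (LINT x|circle_measure. norm (wderiv h x))"
proof -
  have S: "Sob (Suc 0) h" using h Sob_le[of "Suc 0" n h] n by (auto simp: Hspace_iff)
  have m: "wderiv h \<in> borel_measurable circle_measure" using Sob_measurable[of 0 "wderiv h"] S by simp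
  have "cderiv h \<in> borel_measurable circle_measure" by (rule continuous_on_borel_circle[OF Hspace_cderiv(1)[OF h n]])
  then show ?thesis unfolding curve_length_def arc_integral_def using Hspace_cderiv(3)[OF h n] m
    by (intro integral_cong_AE borel_measurable_times borel_measurable_const borel_measurable_norm) (auto elim: eventually_mono)
qed

lemma Hspace_Sob: "h \<in> Hspace n \<Longrightarrow> m \<le> n \<Longrightarrow> Sob m h"
  using Sob_le by (auto simp: Hspace_iff)

lemma wderiv_add_AE:
  fixes f :: "real \<Rightarrow> 'a::euclidean_space"
  assumes "Sob (Suc k) f" "Sob (Suc k) g"
  shows "AE x in circle_measure. wderiv (\<lambda>x. f x + g x) x = wderiv f x + wderiv g x"
  using assms by (intro wderiv_AE has_weak_deriv_add) auto

lemma wderiv_scaleR_AE: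
  fixes f :: "real \<Rightarrow> 'a::euclidean_space"
  assumes "Sob (Suc k) f"
  shows "AE x in circle_measure. wderiv (\<lambda>x. r *\<^sub>R f x) x = r *\<^sub>R wderiv f x"
  using assms by (intro wderiv_AE has_weak_deriv_scaleR) auto

lemma En_wderiv_add:
  fixes f :: "real \<Rightarrow> 'a::euclidean_space"
  assumes f: "Sob (Suc m) f" and g: "Sob (Suc m) g"
  shows "En m (wderiv (\<lambda>x. f x + g x)) \<le> En m (wderiv f) + En m (wderiv g)"
proof -
  have S: "Sob m (wderiv f)" "Sob m (wderiv g)" "Sob m (wderiv (\<lambda>x. f x + g x))" using f g Sob_add[OF f g] by auto
  have ae: "AE x in circle_measure. wderiv (\<lambda>x. f x + g x) x = wderiv f x + wderiv g x" by (rule wderiv_add_AE[OF f g])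
  have T: "Sob m (\<lambda>x. wderiv f x + wderiv g x)" using Sob_add[OF S(1,2)] by blast
  show ?thesis using Sob_cong[OF S(3) Sob_periodic[OF T] Sob_measurable[OF T] ae] Sob_add[OF S(1,2)] by simp
qed

lemma En_wderiv_scaleR:
  fixes f :: "real \<Rightarrow> 'a::euclidean_space"
  assumes f: "Sob (Suc m) f"
  shows "En m (wderiv (\<lambda>x. r *\<^sub>R f x)) = \<bar>r\<bar> * En m (wderiv f)"
proof -
  have S: "Sob m (wderiv f)" "Sob m (wderiv (\<lambda>x. r *\<^sub>R f x))" using f Sob_scaleR[OF f] by auto
  have ae: "AE x in circle_measure. wderiv (\<lambda>x. r *\<^sub>R f x) x = r *\<^sub>R wderiv f x" by (rule wderiv_scaleR_AE[OF f])
  have T: "Sob m (\<lambda>x. r *\<^sub>R wderiv f x)" using Sob_scaleR[OF S(1)] by blast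
  show ?thesis using Sob_cong[OF S(2) Sob_periodic[OF T] Sob_measurable[OF T] ae] Sob_scaleR[OF S(1)] by simp
qed

lemma En_wderiv_Hnorm:
  assumes h: "h \<in> Hspace n" and m: "Suc m \<le> n"
  shows "En m (wderiv h) \<le> (1 + 10 ^ n) * Hnorm n h"
proof -
  have "En (Suc m) h \<le> En n h" using h Sob_le[OF m] by (auto simp: Hspace_iff)
  moreover have "En n h \<le> (1 + 10 ^ n) * Hnorm n h" using h m by (intro En_le_Hnorm) (auto simp: Hspace_iff)
  ultimately show ?thesis using nrm_nonneg[of h] unfolding En.simps by linarith
qed

lemma Hseminorm_En_wderiv:
  assumes m: "Suc m \<le> n"
  shows "Hseminorm n (\<lambda>f::real \<Rightarrow> 'a::euclidean_space. En m (wderiv f))"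
  unfolding Hseminorm_def
proof (intro conjI ballI allI)
  fix f g :: "real \<Rightarrow> 'a" and r :: real assume f: "f \<in> Hspace n"
  show "En m (wderiv (\<lambda>x. r *\<^sub>R f x)) = \<bar>r\<bar> * En m (wderiv f)"
    by (rule En_wderiv_scaleR[OF Hspace_Sob[OF f m]])
  assume g: "g \<in> Hspace n"
  show "En m (wderiv (\<lambda>x. f x + g x)) \<le> En m (wderiv f) + En m (wderiv g)"
    by (rule En_wderiv_add[OF Hspace_Sob[OF f m] Hspace_Sob[OF g m]])
next
  show "\<exists>C. \<forall>f\<in>Hspace n. 0 \<le> En m (wderiv f) \<and> En m (wderiv (f :: real \<Rightarrow> 'a)) \<le> C * Hnorm n f"
    using En_wderiv_Hnorm[OF _ m] by (intro exI[of _ "1 + 10 ^ n"]) auto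
qed

text \<open>On the vector space \<open>Hspace n\<close> the length is the L^1 norm of the
  derivative. Along a path it therefore changes at most at the rate \<open>curve_length\<close> of
  the velocity, read as a curve; this takes the place of the first variation formula.\<close>

lemma Hseminorm_curve_length:
  assumes n: "n \<ge> 2"
  shows "Hseminorm n (curve_length :: (real \<Rightarrow> 'a::euclidean_space) \<Rightarrow> real)"
  unfolding Hseminorm_def
proof (intro conjI ballI allI)
  have n1: "Suc 0 \<le> n" using n by simp
  fix f g :: "real \<Rightarrow> 'a" and r :: real assume f: "f \<in> Hspace n"
  have Sf: "Sob (Suc 0) f" by (rule Hspace_Sob[OF f n1])
  have i: "integrable circle_measure (wderiv f)" using Sf by (auto simp: has_weak_deriv_def)
  have rf: "(\<lambda>x. r *\<^sub>R f x) \<in> Hspace n" by (rule Hspace_scaleR[OF f])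
  have "Sob (Suc 0) (\<lambda>x. r *\<^sub>R f x)" by (rule Hspace_Sob[OF rf n1])
  then have "wderiv (\<lambda>x. r *\<^sub>R f x) \<in> borel_measurable circle_measure" by (auto simp: has_weak_deriv_def)
  then have "(LINT x|circle_measure. norm (wderiv (\<lambda>x. r *\<^sub>R f x) x)) = (LINT x|circle_measure. \<bar>r\<bar> * norm (wderiv f x))"
    using wderiv_scaleR_AE[OF Sf, of r] i
    by (intro integral_cong_AE) (auto elim: eventually_mono)
  then show "curve_length (\<lambda>x. r *\<^sub>R f x) = \<bar>r\<bar> * curve_length f"
    unfolding curve_length_wderiv[OF f n] curve_length_wderiv[OF rf n] by simp
  assume g: "g \<in> Hspace n"
  have Sg: "Sob (Suc 0) g" by (rule Hspace_Sob[OF g n1])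
  have j: "integrable circle_measure (wderiv g)" using Sg by (auto simp: has_weak_deriv_def)
  have fg: "(\<lambda>x. f x + g x) \<in> Hspace n" by (rule Hspace_add[OF f g])
  have "Sob (Suc 0) (\<lambda>x. f x + g x)" by (rule Hspace_Sob[OF fg n1])
  then have k: "integrable circle_measure (wderiv (\<lambda>x. f x + g x))" by (auto simp: has_weak_deriv_def)
  have "(LINT x|circle_measure. norm (wderiv (\<lambda>x. f x + g x) x)) \<le> (LINT x|circle_measure. norm (wderiv f x) + norm (wderiv g x))"
  proof (rule integral_mono_AE)
    show "AE x in circle_measure. norm (wderiv (\<lambda>x. f x + g x) x) \<le> norm (wderiv f x) + norm (wderiv g x)"
      using wderiv_add_AE[OF Sf Sg] by eventually_elim (simp add: norm_triangle_ineq)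
  qed (use i j k in auto)
  then show "curve_length (\<lambda>x. f x + g x) \<le> curve_length f + curve_length g"
    unfolding curve_length_wderiv[OF f n] curve_length_wderiv[OF g n] curve_length_wderiv[OF fg n] using i j by simp
next
  have "0 \<le> curve_length f \<and> curve_length f \<le> (3 * (1 + 10 ^ n)) * Hnorm n f" if f: "f \<in> Hspace n" for f :: "real \<Rightarrow> 'a"
  proof -
    have S: "Sob (Suc 0) f" using n by (intro Hspace_Sob[OF f]) simp
    then have "curve_length f \<le> 3 * nrm (wderiv f)"
      unfolding curve_length_wderiv[OF f n] by (intro sqint_integrable(2)) (simp add: L2_iff)
    moreover have "En 0 (wderiv f) \<le> (1 + 10 ^ n) * Hnorm n f" using n by (intro En_wderiv_Hnorm[OF f]) simp
    ultimately show ?thesis using curve_length_nonneg[of f] unfolding mult.assoc En.simps by linarith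
  qed
  then show "\<exists>C. \<forall>f\<in>Hspace n. 0 \<le> curve_length f \<and> curve_length (f::real \<Rightarrow> 'a) \<le> C * Hnorm n f" by blast
qed

text \<open>For n \<ge> 2 the derivative at a point is a continuous functional on H^n. The weak
  calculus gives additivity and homogeneity almost everywhere; continuity carries them to the point
  x.\<close>

lemma Hseminorm_cderiv_at:
  assumes n: "n \<ge> 2" and x: "x \<in> {0..2*pi}"
  shows "Hseminorm n (\<lambda>f::real \<Rightarrow> 'a::euclidean_space. norm (cderiv f x))"
  unfolding Hseminorm_def
proof (intro conjI ballI allI)
  have n1: "Suc 0 \<le> n" using n by simp
  fix f g :: "real \<Rightarrow> 'a" and r :: real assume f: "f \<in> Hspace n"
  have Sf: "Sob (Suc 0) f" by (rule Hspace_Sob[OF f n1])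
  have rf: "(\<lambda>x. r *\<^sub>R f x) \<in> Hspace n" by (rule Hspace_scaleR[OF f])
  have "AE x in circle_measure. cderiv (\<lambda>x. r *\<^sub>R f x) x = r *\<^sub>R cderiv f x"
    using wderiv_scaleR_AE[OF Sf, of r] Hspace_cderiv(3)[OF rf n] Hspace_cderiv(3)[OF f n] by eventually_elim simp
  then have "cderiv (\<lambda>x. r *\<^sub>R f x) x = r *\<^sub>R cderiv f x"
    by (intro continuous_AE_eq[OF _ _ _ x] continuous_intros Hspace_cderiv(1)[OF rf n] Hspace_cderiv(1)[OF f n])
  then show "norm (cderiv (\<lambda>x. r *\<^sub>R f x) x) = \<bar>r\<bar> * norm (cderiv f x)" by simp
  assume g: "g \<in> Hspace n"
  have Sg: "Sob (Suc 0) g" by (rule Hspace_Sob[OF g n1])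
  have fg: "(\<lambda>x. f x + g x) \<in> Hspace n" by (rule Hspace_add[OF f g])
  have "AE x in circle_measure. cderiv (\<lambda>x. f x + g x) x = cderiv f x + cderiv g x"
    using wderiv_add_AE[OF Sf Sg] Hspace_cderiv(3)[OF fg n] Hspace_cderiv(3)[OF f n] Hspace_cderiv(3)[OF g n] by eventually_elim simp
  then have "cderiv (\<lambda>x. f x + g x) x = cderiv f x + cderiv g x"
    by (intro continuous_AE_eq[OF _ _ _ x] continuous_intros Hspace_cderiv(1)[OF fg n] Hspace_cderiv(1)[OF f n] Hspace_cderiv(1)[OF g n])
  then show "norm (cderiv (\<lambda>x. f x + g x) x) \<le> norm (cderiv f x) + norm (cderiv g x)" by (simp add: norm_triangle_ineq)
next
  have "norm (cderiv f x) \<le> (3 * (1 + 10 ^ n)) * Hnorm n f" if f: "f \<in> Hspace n" for f :: "real \<Rightarrow> 'a"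
  proof -
    have m: "Suc (Suc 0) \<le> n" using n by simp
    have S: "Sob (Suc 0) (cderiv f)" "En (Suc 0) (cderiv f) = En (Suc 0) (wderiv f)"
      using Hspace_cderiv_Sob[OF f n m] by blast+
    have "norm (cderiv f x) \<le> 3 * En (Suc 0) (cderiv f)"
      by (rule continuous_AE_le[OF Hspace_cderiv(1)[OF f n] Sob_sup[OF S(1)] x])
    then show ?thesis unfolding S(2) using En_wderiv_Hnorm[OF f m] unfolding mult.assoc by linarith
  qed
  then show "\<exists>C. \<forall>f\<in>Hspace n. 0 \<le> norm (cderiv f x) \<and> norm (cderiv (f::real \<Rightarrow> 'a) x) \<le> C * Hnorm n f"
    by (intro exI[of _ "3 * (1 + 10 ^ n)"]) auto
qed

subsection \<open>Uniform estimates on metric balls\<close>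

lemma dsn_le_G:
  assumes n: "n \<ge> 2" and a: "metric_coeffs n a" and c: "c \<in> In n" and k: "k \<le> n"
  shows "sqrt (a k (curve_length c)) * dsn c ((Dc c ^^ k) h) \<le> sqrt (G_In n a c h h)"
proof -
  let ?l = "curve_length c"
  have l: "?l > 0" by (rule curve_length_pos[OF c n])
  have "a k ?l * (dsn c ((Dc c ^^ k) h))\<^sup>2 \<le> G_In n a c h h"
    unfolding Gmetric_dsn using k metric_coeffsD(2)[OF a _ l]
    by (intro member_le_sum[of k "{..n}" "\<lambda>j. a j ?l * (dsn c ((Dc c ^^ j) h))\<^sup>2"]) auto
  then have "sqrt (a k ?l * (dsn c ((Dc c ^^ k) h))\<^sup>2) \<le> sqrt (G_In n a c h h)" by (rule real_sqrt_le_mono)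
  then show ?thesis by (simp add: real_sqrt_mult)
qed

lemma length_rate:
  fixes c h :: "real \<Rightarrow> 'a::euclidean_space"
  assumes n: "n \<ge> 2" and a: "metric_coeffs n a" and c: "c \<in> In n" and h: "h \<in> Hspace n" and k: "1 \<le> k" "k \<le> n"
  shows "curve_length c powr (1/2 - real k) * sqrt (a k (curve_length c)) * curve_length h \<le> sqrt (G_In n a c h h)"
proof -
  let ?l = "curve_length c"
  have l: "?l > 0" by (rule curve_length_pos[OF c n])
  have Sn: "Sob n h" using h by (simp add: Hspace_iff)
  have "Sob (n - 1) ((Dc c ^^ 1) h)" using n by (intro In_Dc_Sob[OF c n Sn]) simp
  then have "Dc c h \<in> L2" by (intro Sob_L2) simp
  then have "curve_length h \<le> sqrt ?l * dsn c (Dc c h)"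
    unfolding curve_length_wderiv[OF h n] by (rule arc_L1_bound[OF c n])
  also have "dsn c (Dc c h) \<le> ?l ^ (k - 1) * dsn c ((Dc c ^^ k) h)" using dsn_chain[OF c n Sn, of 1 k] k by simp
  finally have "curve_length h \<le> sqrt ?l * ?l ^ (k - 1) * dsn c ((Dc c ^^ k) h)"
    using l by (simp add: mult_left_mono mult.assoc)
  then have "?l powr (1/2 - real k) * sqrt (a k ?l) * curve_length h 
    \<le> ?l powr (1/2 - real k) * sqrt (a k ?l) * (sqrt ?l * ?l ^ (k - 1) * dsn c ((Dc c ^^ k) h))"
    using metric_coeffsD(2)[OF a k(2) l] by (intro mult_left_mono) auto
  also have "\<dots> = (?l powr (1/2 - real k) * (sqrt ?l * ?l ^ (k - 1))) * (sqrt (a k ?l) * dsn c ((Dc c ^^ k) h))"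
    by simp
  \<comment> \<open>The weight in the integrals exactly cancels the root of the length from
    Cauchy-Schwarz and its power k - 1 from the Poincare inequalities.\<close>
  also have "?l powr (1/2 - real k) * (sqrt ?l * ?l ^ (k - 1)) = 1"
  proof -
    have "sqrt ?l * ?l ^ (k - 1) = ?l powr (1/2) * ?l powr (real (k - 1))"
      using l by (simp add: powr_half_sqrt powr_realpow)
    also have "\<dots> = ?l powr (1/2 + real (k - 1))" by (rule powr_add[symmetric])
    finally have e: "sqrt ?l * ?l ^ (k - 1) = ?l powr (1/2 + real (k - 1))" .
    have "?l powr (1/2 - real k) * (sqrt ?l * ?l ^ (k - 1)) = ?l powr ((1/2 - real k) + (1/2 + real (k - 1)))"
      unfolding e by (rule powr_add[symmetric])
    also have "(1/2 - real k) + (1/2 + real (k - 1)) = 0" using k by simp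
    finally show ?thesis using l by simp
  qed
  finally show ?thesis using dsn_le_G[OF n a c k(2), of h] by simp
qed

text \<open>If all increments stayed below B, monotone convergence over the exhausting intervals
  would bound the integral over S by B. One statement serves both ends of the half line.\<close>

lemma primitive_unbounded:
  fixes f W :: "real \<Rightarrow> real"
  assumes c: "continuous_on {0<..} f" and f0: "\<And>x. x > 0 \<Longrightarrow> f x \<ge> 0"
    and W: "\<And>x. x > 0 \<Longrightarrow> (W has_real_derivative f x) (at x)"
    and lr: "\<And>i. 0 < l i" "\<And>i::nat. l i \<le> r i" "incseq (\<lambda>i. {l i..r i})" and S: "S = (\<Union>i. {l i..r i})"
    and inf: "(\<integral>\<^sup>+x\<in>S. ennreal (f x) \<partial>lborel) = \<infinity>"
  shows "\<exists>i. W (r i) - W (l i) > B"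
proof (rule ccontr)
  assume "\<not> ?thesis"
  then have le: "W (r i) - W (l i) \<le> B" for i by (simp add: not_less)
  \<comment> \<open>Continuity of f is known on the positive half line only; extension by 0 makes it
    Borel on the whole line.\<close>
  define g where "g x = indicator {0<..} x *\<^sub>R f x" for x
  have gm [measurable]: "g \<in> borel_measurable borel"
    unfolding g_def using c by (intro borel_measurable_continuous_on_indicator) auto
  have Sb [measurable]: "S \<in> sets borel" unfolding S by auto
  have S0: "x > 0" if "x \<in> S" for x using that lr(1) unfolding S by (auto intro: order_less_le_trans)
  have "(\<integral>\<^sup>+x\<in>S. ennreal (f x) \<partial>lborel) = (\<integral>\<^sup>+x\<in>S. ennreal (g x) \<partial>lborel)"
    by (intro nn_integral_cong) (auto simp: indicator_def g_def dest: S0)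
  also have "\<dots> = emeasure (density lborel (\<lambda>x. ennreal (g x))) S"
    by (subst emeasure_density) auto
  also have "\<dots> = (SUP i. emeasure (density lborel (\<lambda>x. ennreal (g x))) {l i..r i})"
    unfolding S by (intro SUP_emeasure_incseq[symmetric] lr(3)) auto
  also have "\<dots> \<le> ennreal B"
  proof (rule SUP_least)
    fix i
    have pos: "x > 0" if "l i \<le> x" for x using lr(1)[of i] that by simp
    have "emeasure (density lborel (\<lambda>x. ennreal (g x))) {l i..r i} = (\<integral>\<^sup>+x. ennreal (g x) * indicator {l i..r i} x \<partial>lborel)"
      by (subst emeasure_density) auto
    also have "\<dots> = W (r i) - W (l i)"
    proof (rule nn_integral_FTC_Icc[OF gm])
      fix x assume "x \<in> {l i..r i}"
      then have x: "l i \<le> x" by simp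
      have "g x = f x" using pos[OF x] by (simp add: g_def)
      then show "(W has_real_derivative g x) (at x)" "0 \<le> g x" using W f0 pos[OF x] by auto
    qed (rule lr)
    also have "\<dots> \<le> ennreal B" using le by (rule ennreal_leI)
    finally show "emeasure (density lborel (\<lambda>x. ennreal (g x))) {l i..r i} \<le> ennreal B" .
  qed
  finally show False using inf by (simp add: top_unique)
qed

text \<open>Growth is controlled along paths, so estimates are stated for every time of every such
  path rather than for the points of a ball; the end point is left free.\<close>

definition short_path :: "nat \<Rightarrow> (nat \<Rightarrow> real \<Rightarrow> real) \<Rightarrow> (real \<Rightarrow> 'a::euclidean_space) \<Rightarrow> real \<Rightarrow> (real \<Rightarrow> real \<Rightarrow> 'a) \<Rightarrow> bool" where
  "short_path n a c0 R \<gamma> \<longleftrightarrow> (\<exists>c1. \<gamma> \<in> pw_smooth_paths (Hspace n) {Hnorm n} (In n) c0 c1) \<and>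
     path_len (Hspace n) {Hnorm n} (G_In n a) \<gamma> < R"

lemma short_path_growth:
  fixes \<gamma> :: "real \<Rightarrow> real \<Rightarrow> 'a::euclidean_space"
  assumes n: "n \<ge> 2" and a: "metric_coeffs n a" and \<gamma>: "short_path n a c0 R \<gamma>"
    and N: "Hseminorm n N" and K: "K \<ge> 0"
    and \<Psi>: "\<And>t. t \<in> {0..1} \<Longrightarrow> (\<Psi> has_real_derivative \<psi> (N (\<gamma> t))) (at (N (\<gamma> t)))"
    and b: "\<And>t h. t \<in> {0..1} \<Longrightarrow> h \<in> Hspace n \<Longrightarrow> \<bar>\<psi> (N (\<gamma> t))\<bar> * N h \<le> K * sqrt (G_In n a (\<gamma> t) h h)"
    and x: "x \<in> {0..1}"
  shows "\<bar>\<Psi> (N (\<gamma> x)) - \<Psi> (N c0)\<bar> \<le> K * R"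
proof -
  obtain c1 where c1: "\<gamma> \<in> pw_smooth_paths (Hspace n) {Hnorm n} (In n) c0 c1" and R: "path_len (Hspace n) {Hnorm n} (G_In n a) \<gamma> < R"
    using \<gamma> unfolding short_path_def by blast
  have "\<bar>\<Psi> (N (\<gamma> x)) - \<Psi> (N c0)\<bar> \<le> K * path_len (Hspace n) {Hnorm n} (G_In n a) \<gamma>"
    by (rule path_growth[where \<psi> = \<psi>, OF n a c1 N K \<Psi> b x])
  also have "\<dots> \<le> K * R" using R K by (intro mult_left_mono) auto
  finally show ?thesis .
qed

lemma short_path_In: "short_path n a c0 R \<gamma> \<Longrightarrow> t \<in> {0..1} \<Longrightarrow> \<gamma> t \<in> In n"
  unfolding short_path_def pw_smooth_paths_def by blast

text \<open>The density may fail to be integrable both at 0 and at infinity, so the primitive has no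
  canonical base point; comparisons of its values are all that enters.\<close>

lemma metric_density_primitive:
  assumes a: "metric_coeffs n a" and k: "k \<le> n"
  defines "f \<equiv> \<lambda>r. r powr (1/2 - real k) * sqrt (a k r)"
  obtains W where "continuous_on {0<..} f" "\<And>x. x > 0 \<Longrightarrow> f x \<ge> 0" "\<And>x. x > 0 \<Longrightarrow> (W has_real_derivative f x) (at x)"
    "\<And>x y. 0 < x \<Longrightarrow> x \<le> y \<Longrightarrow> W x \<le> W y"
proof -
  have ic: "isCont f x" if "x > 0" for x
    unfolding f_def using that metric_coeffsD(1)[OF a k that] by (intro continuous_intros) auto
  have c: "continuous_on {0<..} f" using ic by (intro continuous_at_imp_continuous_on) auto
  have pos: "f x \<ge> 0" if "x > 0" for x unfolding f_def using metric_coeffsD(2)[OF a k that] by simp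
  have "\<exists>F. \<forall>x::real. ereal 0 < ereal x \<longrightarrow> ereal x < \<infinity> \<longrightarrow> (F has_vector_derivative f x) (at x)"
    by (rule einterval_antiderivative) (use ic in auto)
  then obtain W where W: "\<And>x. x > 0 \<Longrightarrow> (W has_real_derivative f x) (at x)"
    by (auto simp: has_real_derivative_iff_has_vector_derivative)
  have "W x \<le> W y" if "0 < x" "x \<le> y" for x y
  proof (rule DERIV_nonneg_imp_nondecreasing[OF that(2)])
    fix z assume "x \<le> z" "z \<le> y"
    then show "\<exists>d. (W has_real_derivative d) (at z) \<and> 0 \<le> d" using W[of z] pos[of z] that by auto
  qed
  then show thesis using that c pos W by blast
qed

lemma length_change:
  fixes \<gamma> :: "real \<Rightarrow> real \<Rightarrow> 'a::euclidean_space"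
  assumes n: "n \<ge> 2" and a: "metric_coeffs n a" and \<gamma>: "short_path n a c0 R \<gamma>" and k: "1 \<le> k" "k \<le> n"
    and W: "\<And>x. x > 0 \<Longrightarrow> (W has_real_derivative (x powr (1/2 - real k) * sqrt (a k x))) (at x)" and t: "t \<in> {0..1}"
  shows "\<bar>W (curve_length (\<gamma> t)) - W (curve_length c0)\<bar> \<le> R"
proof -
  have "\<bar>W (curve_length (\<gamma> t)) - W (curve_length c0)\<bar> \<le> 1 * R"
  proof (rule short_path_growth[OF n a \<gamma> Hseminorm_curve_length[OF n] _ _ _ t])
    fix t :: real assume t: "t \<in> {0..1}"
    have c: "\<gamma> t \<in> In n" by (rule short_path_In[OF \<gamma> t])
    have l: "curve_length (\<gamma> t) > 0" by (rule curve_length_pos[OF c n])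
    show "(W has_real_derivative (\<lambda>x. x powr (1/2 - real k) * sqrt (a k x)) (curve_length (\<gamma> t))) (at (curve_length (\<gamma> t)))"
      using W[OF l] by simp
    fix h :: "real \<Rightarrow> 'a" assume h: "h \<in> Hspace n"
    show "\<bar>(\<lambda>x. x powr (1/2 - real k) * sqrt (a k x)) (curve_length (\<gamma> t))\<bar> * curve_length h \<le> 1 * sqrt (G_In n a (\<gamma> t) h h)"
      using length_rate[OF n a c h k] metric_coeffsD(2)[OF a k(2) l] by (simp add: abs_mult)
  qed simp
  then show ?thesis by simp
qed

text \<open>W changes by at most R along a short path but is unbounded towards the end where its
  density has infinite integral. The two ends are treated separately because different k may be
  responsible for them.\<close>

lemma length_bounds:
  fixes c0 :: "real \<Rightarrow> 'a::euclidean_space"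
  assumes n: "n \<ge> 2" and a: "metric_coeffs n a"
    and inf0: "(MAX k\<in>{1..n}. \<integral>\<^sup>+ r\<in>{0<..1}. ennreal (r powr (1 / 2 - real k) * sqrt (a k r)) \<partial>lborel) = \<infinity>"
    and inf1: "(MAX k\<in>{1..n}. \<integral>\<^sup>+ r\<in>{1..}. ennreal (r powr (1 / 2 - real k) * sqrt (a k r)) \<partial>lborel) = \<infinity>"
  shows "\<exists>r1>0. \<exists>r2. \<forall>\<gamma> t. short_path n a c0 R \<gamma> \<longrightarrow> t \<in> {0..1} \<longrightarrow> r1 \<le> curve_length (\<gamma> t) \<and> curve_length (\<gamma> t) \<le> r2"
proof -
  let ?l0 = "curve_length c0"
  have fin: "finite {1..n}" "{1..n} \<noteq> {}" using n by auto
  have "\<exists>r1>0. \<forall>\<gamma> t. short_path n a c0 R \<gamma> \<longrightarrow> t \<in> {0..1} \<longrightarrow> r1 \<le> curve_length (\<gamma> t)"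
  proof -
    let ?F = "\<lambda>k. \<integral>\<^sup>+ r\<in>{0<..1}. ennreal (r powr (1 / 2 - real k) * sqrt (a k r)) \<partial>lborel"
    \<comment> \<open>A maximum over finitely many k is attained, so an infinite maximum means one
      divergent integral.\<close>
    have "Max (?F ` {1..n}) \<in> ?F ` {1..n}" using fin by (intro Max_in) auto
    then have "\<exists>k\<in>{1..n}. ?F k = \<infinity>" unfolding inf0 by (metis (no_types, lifting) imageE)
    then obtain k where k: "1 \<le> k" "k \<le> n" and inf: "?F k = \<infinity>" by auto
    obtain W where W: "continuous_on {0<..} (\<lambda>r. r powr (1/2 - real k) * sqrt (a k r))" 
      "\<And>x. x > 0 \<Longrightarrow> x powr (1/2 - real k) * sqrt (a k x) \<ge> 0" 
      "\<And>x. x > 0 \<Longrightarrow> (W has_real_derivative (x powr (1/2 - real k) * sqrt (a k x))) (at x)"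
      "\<And>x y. 0 < x \<Longrightarrow> x \<le> y \<Longrightarrow> W x \<le> W y"
      by (rule metric_density_primitive[OF a k(2)]) (rule that)
    \<comment> \<open>The threshold makes W at 1/(i + 1) smaller than W at the initial length by
      more than R, a drop that no short path achieves.\<close>
    have "\<exists>i. W 1 - W (inverse (real (Suc i))) > W 1 - W ?l0 + R"
    proof (rule primitive_unbounded[OF W(1-3), where r = "\<lambda>i. 1" and S = "{0<..1}"])
      show "incseq (\<lambda>i. {inverse (real (Suc i))..1})"
        by (intro incseq_SucI) (auto intro: order_trans[rotated] le_imp_inverse_le)
      show "{0<..1} = (\<Union>i. {inverse (real (Suc i))..1})"
      proof (intro set_eqI iffI)
        fix x :: real assume x: "x \<in> {0<..1}"
        then obtain i where "inverse (real (Suc i)) < x" using reals_Archimedean[of x] by auto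
        then show "x \<in> (\<Union>i. {inverse (real (Suc i))..1})" using x by (auto intro: less_imp_le)
      next
        fix x :: real assume "x \<in> (\<Union>i. {inverse (real (Suc i))..1})"
        then obtain i where "inverse (real (Suc i)) \<le> x" "x \<le> 1" by auto
        moreover have "0 < inverse (real (Suc i))" by simp
        ultimately show "x \<in> {0<..1}" unfolding greaterThanAtMost_iff by linarith
      qed
    qed (use inf in \<open>auto simp: field_simps\<close>)
    then obtain i where "W 1 - W (inverse (real (Suc i))) > W 1 - W ?l0 + R" by blast
    then have i: "W (inverse (real (Suc i))) < W ?l0 - R" by linarith
    have "inverse (real (Suc i)) \<le> curve_length (\<gamma> t)" if "short_path n a c0 R \<gamma>" "t \<in> {0..1}" for \<gamma> t
    proof (rule ccontr)
      assume "\<not> inverse (real (Suc i)) \<le> curve_length (\<gamma> t)"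
      then have "W (curve_length (\<gamma> t)) \<le> W (inverse (real (Suc i)))"
        using curve_length_pos[OF short_path_In[OF that] n] by (intro W(4)) auto
      then show False using i length_change[OF n a that(1) k W(3) that(2)] by linarith
    qed
    then show ?thesis by (intro exI[of _ "inverse (real (Suc i))"]) auto
  qed
  moreover have "\<exists>r2. \<forall>\<gamma> t. short_path n a c0 R \<gamma> \<longrightarrow> t \<in> {0..1} \<longrightarrow> curve_length (\<gamma> t) \<le> r2"
  proof -
    let ?F = "\<lambda>k. \<integral>\<^sup>+ r\<in>{1..}. ennreal (r powr (1 / 2 - real k) * sqrt (a k r)) \<partial>lborel"
    have "Max (?F ` {1..n}) \<in> ?F ` {1..n}" using fin by (intro Max_in) auto
    then have "\<exists>k\<in>{1..n}. ?F k = \<infinity>" unfolding inf1 by (metis (no_types, lifting) imageE)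
    then obtain k where k: "1 \<le> k" "k \<le> n" and inf: "?F k = \<infinity>" by auto
    obtain W where W: "continuous_on {0<..} (\<lambda>r. r powr (1/2 - real k) * sqrt (a k r))" 
      "\<And>x. x > 0 \<Longrightarrow> x powr (1/2 - real k) * sqrt (a k x) \<ge> 0" 
      "\<And>x. x > 0 \<Longrightarrow> (W has_real_derivative (x powr (1/2 - real k) * sqrt (a k x))) (at x)"
      "\<And>x y. 0 < x \<Longrightarrow> x \<le> y \<Longrightarrow> W x \<le> W y"
      by (rule metric_density_primitive[OF a k(2)]) (rule that)
    have "\<exists>i. W (1 + real i) - W 1 > W ?l0 + R - W 1"
    proof (rule primitive_unbounded[OF W(1-3), where r = "\<lambda>i. 1 + real i" and l = "\<lambda>i. 1" and S = "{1..}"])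
      show "incseq (\<lambda>i. {1..1 + real i})" by (intro incseq_SucI) auto
      show "{1..} = (\<Union>i. {1..1 + real i})"
      proof (intro set_eqI iffI)
        fix x :: real assume x: "x \<in> {1..}"
        obtain i where "x < real i" using reals_Archimedean2 by blast
        then show "x \<in> (\<Union>i. {1..1 + real i})" using x by (auto intro!: exI[of _ i])
      qed auto
    qed (use inf in auto)
    then obtain i where i: "W (1 + real i) > W ?l0 + R" by auto
    have "curve_length (\<gamma> t) \<le> 1 + real i" if "short_path n a c0 R \<gamma>" "t \<in> {0..1}" for \<gamma> t
    proof (rule ccontr)
      assume "\<not> curve_length (\<gamma> t) \<le> 1 + real i"
      then have "W (1 + real i) \<le> W (curve_length (\<gamma> t))" by (intro W(4)) auto
      then show False using i length_change[OF n a that(1) k W(3) that(2)] by linarith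
    qed
    then show ?thesis by (intro exI[of _ "1 + real i"]) auto
  qed
  ultimately show ?thesis by blast
qed

text \<open>Only a_0 and a_n are known to be positive, so G yields the norms of order 0 and n
  directly, and those in between descend from order n by \<open>dsn_chain\<close>. Compactness of
  [r1, r2] turns positivity into a uniform lower bound.\<close>

lemma arc_norms_le_G:
  assumes n: "n \<ge> 2" and a: "metric_coeffs n a" and r: "0 < r1"
  shows "\<exists>C>0. \<forall>(c::real \<Rightarrow> 'a::euclidean_space) h. c \<in> In n \<longrightarrow> r1 \<le> curve_length c \<longrightarrow> curve_length c \<le> r2 \<longrightarrow> h \<in> Hspace n \<longrightarrow>
     (\<forall>j\<le>n. dsn c ((Dc c ^^ j) h) \<le> C * sqrt (G_In n a c h h)) \<and>
     (\<forall>x\<in>{0..2*pi}. norm (cderiv h x) \<le> C * sqrt (G_In n a c h h) * norm (cderiv c x))"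
proof -
  have low: "\<exists>\<alpha>>0. \<forall>l\<in>{r1..r2}. \<alpha> \<le> a k l" if k: "k \<le> n" "\<And>l. l > 0 \<Longrightarrow> a k l > 0" for k
  proof (cases "r1 \<le> r2")
    case True
    have "continuous_on {r1..r2} (a k)" using metric_coeffsD(1)[OF a k(1)] r by (intro continuous_at_imp_continuous_on) auto
    then obtain l0 where l0: "l0 \<in> {r1..r2}" "\<forall>l\<in>{r1..r2}. a k l0 \<le> a k l"
      using continuous_attains_inf[of "{r1..r2}" "a k"] True by auto
    then show ?thesis using k(2)[of l0] r by (intro exI[of _ "a k l0"]) auto
  qed (auto intro: exI[of _ 1])
  obtain \<alpha>0 where \<alpha>0: "\<alpha>0 > 0" "\<And>l. l\<in>{r1..r2} \<Longrightarrow> \<alpha>0 \<le> a 0 l" using low[of 0] metric_coeffsD(3)[OF a] by blast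
  obtain \<alpha>n where \<alpha>n: "\<alpha>n > 0" "\<And>l. l\<in>{r1..r2} \<Longrightarrow> \<alpha>n \<le> a n l" using low[of n] metric_coeffsD(4)[OF a] by blast
  define \<alpha> where "\<alpha> = min \<alpha>0 \<alpha>n"
  have \<alpha>: "\<alpha> > 0" using \<alpha>0 \<alpha>n by (simp add: \<alpha>_def)
  define M where "M = max 1 r2"
  have M: "M \<ge> 1" by (simp add: M_def)
  \<comment> \<open>M^n covers the powers of the length in \<open>dsn_chain\<close>, the extra
    factor M the root of the length in the sup bound, and 1 / sqrt \<alpha> the coefficients of the
    metric.\<close>
  define C where "C = M ^ Suc n / sqrt \<alpha>"
  have C: "C > 0" using M \<alpha> by (simp add: C_def)
  show ?thesis
  proof (intro exI[of _ C] conjI allI impI ballI C)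
    fix c h :: "real \<Rightarrow> 'a"
    assume c: "c \<in> In n" and l: "r1 \<le> curve_length c" "curve_length c \<le> r2" and h: "h \<in> Hspace n"
    let ?l = "curve_length c" and ?s = "sqrt (G_In n a c h h)"
    have Sn: "Sob n h" using h by (simp add: Hspace_iff)
    have s0: "?s \<ge> 0" using G_In_nonneg[OF n a c] by simp
    have l0: "?l > 0" by (rule curve_length_pos[OF c n])
    have ends: "dsn c ((Dc c ^^ k) h) \<le> ?s / sqrt \<alpha>" if k: "k = 0 \<or> k = n" for k
    proof -
      have "\<alpha> \<le> a k ?l" using k \<alpha>0(2)[of ?l] \<alpha>n(2)[of ?l] l by (auto simp: \<alpha>_def)
      then have "sqrt \<alpha> * dsn c ((Dc c ^^ k) h) \<le> sqrt (a k ?l) * dsn c ((Dc c ^^ k) h)"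
        by (intro mult_right_mono) auto
      also have "\<dots> \<le> ?s" using k by (intro dsn_le_G[OF n a c]) auto
      finally show ?thesis using \<alpha> by (simp add: pos_le_divide_eq mult.commute)
    qed
    have dj: "dsn c ((Dc c ^^ j) h) \<le> M ^ n * (?s / sqrt \<alpha>)" if j: "j \<le> n" for j
    proof (cases "j = 0")
      case True
      have "1 * (?s / sqrt \<alpha>) \<le> M ^ n * (?s / sqrt \<alpha>)" using M s0 \<alpha> by (intro mult_right_mono) auto
      then show ?thesis using ends[of j] True by simp
    next
      case False
      have "?l ^ (n - j) \<le> M ^ (n - j)" using l l0 by (intro power_mono) (auto simp: M_def)
      also have "\<dots> \<le> M ^ n" using M by (intro power_increasing) auto
      finally have p: "?l ^ (n - j) \<le> M ^ n" .
      have "dsn c ((Dc c ^^ j) h) \<le> ?l ^ (n - j) * dsn c ((Dc c ^^ n) h)"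
        using False j by (intro dsn_chain[OF c n Sn]) auto
      also have "\<dots> \<le> M ^ n * (?s / sqrt \<alpha>)" using p ends[of n] M by (intro mult_mono) auto
      finally show ?thesis .
    qed
    have mono: "M ^ n * (?s / sqrt \<alpha>) \<le> C * ?s"
    proof -
      have "M ^ n * (?s / sqrt \<alpha>) \<le> M ^ Suc n * (?s / sqrt \<alpha>)"
        using M s0 \<alpha> by (intro mult_right_mono power_increasing) auto
      then show ?thesis by (simp add: C_def)
    qed
    show "dsn c ((Dc c ^^ j) h) \<le> C * ?s" if "j \<le> n" for j using dj[OF that] mono by linarith
    have S2: "Sob (Suc (Suc 0)) h" using n by (intro Hspace_Sob[OF h]) simp
    have "sqrt ?l \<le> sqrt M" using l by (simp add: M_def)
    also have "\<dots> \<le> M" using M by (simp add: real_le_lsqrt power2_eq_square)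
    finally have sl: "sqrt ?l \<le> M" .
    have "sqrt ?l * dsn c ((Dc c ^^ 2) h) \<le> M * (M ^ n * (?s / sqrt \<alpha>))"
      using sl dj[OF n] M by (intro mult_mono) auto
    also have "\<dots> = C * ?s" by (simp add: C_def)
    finally have "sqrt ?l * dsn c (Dc c (Dc c h)) \<le> C * ?s" by (simp add: numeral_2_eq_2)
    then have ae: "AE x in circle_measure. norm (Dc c h x) \<le> C * ?s"
      using arc_sup_bound(1)[OF c n S2] by (auto elim: eventually_mono)
    have cH: "c \<in> Hspace n" and nz: "\<And>x. cderiv c x \<noteq> 0" using c by (auto simp: In_def)
    fix x assume x: "x \<in> {0..2*pi}"
    have "norm (ispd c x *\<^sub>R cderiv h x) \<le> C * ?s"
    proof (rule continuous_AE_le[OF _ _ x])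
      show "continuous_on {0..2*pi} (\<lambda>x. ispd c x *\<^sub>R cderiv h x)"
        using nz by (intro continuous_intros Hspace_cderiv(1)[OF cH n] Hspace_cderiv(1)[OF h n]) auto
      show "AE x in circle_measure. norm (ispd c x *\<^sub>R cderiv h x) \<le> C * ?s"
        using ae Hspace_cderiv(3)[OF h n] by eventually_elim (simp add: arc_deriv_def)
    qed
    then show "norm (cderiv h x) \<le> C * ?s * norm (cderiv c x)" using nz[of x] by (simp add: field_simps)
  qed
qed

text \<open>For fixed x the rate of ln |c'(x)| is at most |h'(x)| / |c'(x)|, which is |D_s h(x)|.
  The total change C R enlarges the pinching constant of c0 by the factor exp (C R).\<close>

lemma speed_bounds:
  fixes c0 :: "real \<Rightarrow> 'a::euclidean_space"
  assumes n: "n \<ge> 2" and a: "metric_coeffs n a" and c0: "c0 \<in> In n"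
    and C: "C > 0" "\<And>\<gamma> t h x. short_path n a c0 R \<gamma> \<Longrightarrow> t \<in> {0..1} \<Longrightarrow> h \<in> Hspace n \<Longrightarrow> x \<in> {0..2*pi} \<Longrightarrow>
      norm (cderiv h x) \<le> C * sqrt (G_In n a (\<gamma> t) h h) * norm (cderiv (\<gamma> t) x)"
  shows "\<exists>K>0. \<forall>\<gamma> t. short_path n a c0 R \<gamma> \<longrightarrow> t \<in> {0..1} \<longrightarrow> pinched K (cderiv (\<gamma> t))"
proof -
  obtain K0 where K0: "K0 > 0" "pinched K0 (cderiv c0)" using In_pinched[OF c0 n] by blast
  define K where "K = K0 * exp (C * R)"
  have "pinched K (cderiv (\<gamma> t))" if \<gamma>: "short_path n a c0 R \<gamma>" and t: "t \<in> {0..1}" for \<gamma> t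
    unfolding pinched_def
  proof (intro conjI ballI)
    have cH: "\<gamma> t \<in> Hspace n" using short_path_In[OF \<gamma> t] by (simp add: In_def)
    show "periodic (cderiv (\<gamma> t))" "continuous_on {0..2*pi} (cderiv (\<gamma> t))" using Hspace_cderiv[OF cH n] by auto
    fix x assume x: "x \<in> {0..2*pi}"
    have pos: "norm (cderiv (\<gamma> t) x) > 0" if "t \<in> {0..1}" for t using short_path_In[OF \<gamma> that] by (auto simp: In_def)
    have "\<bar>ln (norm (cderiv (\<gamma> t) x)) - ln (norm (cderiv c0 x))\<bar> \<le> C * R"
    proof (rule short_path_growth[where \<psi> = inverse, OF n a \<gamma> Hseminorm_cderiv_at[OF n x] _ _ _ t])
      show "0 \<le> C" using C(1) by simp
      fix t :: real assume t: "t \<in> {0..1}"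
      show "(ln has_real_derivative inverse (norm (cderiv (\<gamma> t) x))) (at (norm (cderiv (\<gamma> t) x)))"
        using DERIV_ln[OF pos[OF t]] .
      fix h :: "real \<Rightarrow> 'a" assume h: "h \<in> Hspace n"
      show "\<bar>inverse (norm (cderiv (\<gamma> t) x))\<bar> * norm (cderiv h x) \<le> C * sqrt (G_In n a (\<gamma> t) h h)"
        using C(2)[OF \<gamma> t h x] pos[OF t] by (simp add: field_simps)
    qed
    moreover have c0p: "inverse K0 \<le> norm (cderiv c0 x)" "norm (cderiv c0 x) \<le> K0" using K0 x by (auto simp: pinched_def)
    moreover have p0: "norm (cderiv c0 x) > 0" using c0 by (simp add: In_def)
    ultimately have 1: "ln (norm (cderiv (\<gamma> t) x)) \<le> ln (norm (cderiv c0 x)) + C * R" "ln (norm (cderiv c0 x)) \<le> ln (norm (cderiv (\<gamma> t) x)) + C * R"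
      by linarith+
    have "norm (cderiv (\<gamma> t) x) = exp (ln (norm (cderiv (\<gamma> t) x)))" using pos[OF t] by simp
    also have "\<dots> \<le> exp (ln (norm (cderiv c0 x)) + C * R)" using 1 by simp
    also have "\<dots> = norm (cderiv c0 x) * exp (C * R)" using p0 by (simp add: exp_add)
    also have "\<dots> \<le> K" unfolding K_def using c0p by (intro mult_right_mono) auto
    finally show "norm (cderiv (\<gamma> t) x) \<le> K" .
    have "inverse K0 \<le> norm (cderiv c0 x)" by (rule c0p)
    also have "norm (cderiv c0 x) = exp (ln (norm (cderiv c0 x)))" using p0 by simp
    also have "\<dots> \<le> exp (ln (norm (cderiv (\<gamma> t) x)) + C * R)" using 1 by simp
    also have "\<dots> = norm (cderiv (\<gamma> t) x) * exp (C * R)" using pos[OF t] by (simp add: exp_add)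
    finally have "inverse K0 * inverse (exp (C * R)) \<le> (norm (cderiv (\<gamma> t) x) * exp (C * R)) * inverse (exp (C * R))"
      by (intro mult_right_mono) auto
    then show "inverse K \<le> norm (cderiv (\<gamma> t) x)" by (simp add: K_def mult.assoc)
  qed
  moreover have "K > 0" using K0 by (simp add: K_def)
  ultimately show ?thesis by blast
qed

section \<open>Bounds on higher derivatives of curves and equivalence of norms\<close>

lemma spd_Bd:
  assumes K: "K > 0"
  shows "\<exists>B. \<forall>p::real \<Rightarrow> 'a::euclidean_space. pinched K p \<and> Sob m p \<and> En m p \<le> K \<longrightarrow> Bd m B (\<lambda>x. norm (p x))"
proof (cases m)
  case 0
  then show ?thesis using pinched_inverse_norm(4)[OF _ K] by blast
next
  case (Suc i)
  obtain C where C: "C \<ge> 0" "\<And>p::real \<Rightarrow> 'a. pinched K p \<Longrightarrow> Sob (Suc i) p \<Longrightarrow> En i p \<le> K \<Longrightarrow> 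
     Sob (Suc i) (\<lambda>x. norm (p x)) \<and> En (Suc i) (\<lambda>x. norm (p x)) \<le> C * (1 + En i (wderiv p))"
    using norm_Sob[OF K, of i] by blast
  have "Bd m (3 * (C * (1 + K))) (\<lambda>x. norm (p x))" if p: "pinched K p" "Sob m p" "En m p \<le> K" for p :: "real \<Rightarrow> 'a"
  proof -
    have E: "En i p \<le> K" "En i (wderiv p) \<le> K"
    proof -
      have "nrm p + En i (wderiv p) \<le> K" "En i p \<le> K" using p(2,3) Sob_Suc_lower[of i p] unfolding Suc by auto
      then show "En i p \<le> K" "En i (wderiv p) \<le> K" using nrm_nonneg[of p] by linarith+
    qed
    have S: "Sob (Suc i) (\<lambda>x. norm (p x)) \<and> En (Suc i) (\<lambda>x. norm (p x)) \<le> C * (1 + En i (wderiv p))"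
      using p E(1) by (intro C(2)) (auto simp: Suc)
    moreover have "C * (1 + En i (wderiv p)) \<le> C * (1 + K)" using C(1) E(2) by (intro mult_left_mono) auto
    ultimately have "3 * En (Suc i) (\<lambda>x. norm (p x)) \<le> 3 * (C * (1 + K))" by linarith
    then show ?thesis unfolding Suc using Bd_SobI[OF conjunct1[OF S]] by (rule Bd_mono[rotated])
  qed
  then show ?thesis by blast
qed

text \<open>In h' = |c'| D_s h the factor D_s h is estimated by \<open>En_le_arc\<close>, which
  needs |c'| in H^m only, and the factor |c'| by \<open>norm_Sob\<close>, which is affine in the
  norm of c'. So the unbounded norm enters once and linearly. The number s stands for the root of
  G.\<close>

lemma En_growth_rate:
  assumes K: "K > 0" and C: "C > 0" and m: "Suc (Suc m) \<le> n" and n: "n \<ge> 2"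
  shows "\<exists>D\<ge>0. \<forall>(c::real \<Rightarrow> 'a::euclidean_space) h s. c \<in> In n \<longrightarrow> pinched K (cderiv c) \<longrightarrow> En m (cderiv c) \<le> K \<longrightarrow> h \<in> Hspace n \<longrightarrow>
     (\<forall>j\<le>n. dsn c ((Dc c ^^ j) h) \<le> C * s) \<longrightarrow> En (Suc m) (wderiv h) \<le> D * s * (1 + En (Suc m) (wderiv c))"
proof -
  obtain B where B: "\<And>p::real \<Rightarrow> 'a. pinched K p \<Longrightarrow> Sob m p \<Longrightarrow> En m p \<le> K \<Longrightarrow> Bd m B (\<lambda>x. norm (p x))"
    using spd_Bd[OF K, of m] by blast
  obtain A where A: "A \<ge> 0" "\<And>(c::real \<Rightarrow> 'a) f S. Bd m B (spd c) \<Longrightarrow> (\<forall>x. cderiv c x \<noteq> 0) \<Longrightarrow>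
     (\<forall>j\<le>Suc m. Sob (Suc m - j) ((Dc c ^^ j) f) \<and> nrm ((Dc c ^^ j) f) \<le> S) \<Longrightarrow> En (Suc m) f \<le> A * S"
    using En_le_arc[of m B "Suc m", where 'a='a] by blast
  obtain U where U: "U \<ge> 0" "\<And>p::real \<Rightarrow> 'a. pinched K p \<Longrightarrow> Sob (Suc m) p \<Longrightarrow> En m p \<le> K \<Longrightarrow> 
     Sob (Suc m) (\<lambda>x. norm (p x)) \<and> En (Suc m) (\<lambda>x. norm (p x)) \<le> U * (1 + En m (wderiv p))"
    using norm_Sob[OF K, of m] by blast
  obtain P where P: "P \<ge> 0" "\<And>f g. Sob (Suc m) f \<Longrightarrow> Sob (Suc m) g \<Longrightarrow> Sob (Suc m) (\<lambda>x. f x *\<^sub>R g x) \<and>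
     En (Suc m) (\<lambda>x. f x *\<^sub>R g x :: 'a) \<le> P * En (Suc m) f * En (Suc m) g"
    using Sob_algebra[OF bounded_bilinear_scaleR[where 'a='a], of m] by blast
  let ?D = "P * U * (A * (sqrt K * C))"
  have "En (Suc m) (wderiv h) \<le> ?D * s * (1 + En (Suc m) (wderiv c))"
    if c: "c \<in> In n" and p: "pinched K (cderiv c)" "En m (cderiv c) \<le> K" and h: "h \<in> Hspace n"
      and d: "\<forall>j\<le>n. dsn c ((Dc c ^^ j) h) \<le> C * s" for c h :: "real \<Rightarrow> 'a" and s
  proof -
    have cH: "c \<in> Hspace n" and nz: "\<forall>x. cderiv c x \<noteq> 0" using c by (auto simp: In_def)
    have Sn: "Sob n h" using h by (simp add: Hspace_iff)
    have "dsn c ((Dc c ^^ 0) h) \<le> C * s" using d by blast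
    then have "0 \<le> C * s" using dsn_nonneg order_trans by blast
    then have s0: "s \<ge> 0" using C by (simp add: zero_le_mult_iff)
    have pS: "Sob (Suc m) (cderiv c)" "En (Suc m) (cderiv c) = En (Suc m) (wderiv c)" "Sob m (cderiv c)"
      using Hspace_cderiv_Sob[OF cH n m] Hspace_cderiv_Sob[OF cH n, of m] m by auto
    have b: "Bd m B (spd c)" by (rule B[OF p(1) pS(3) p(2)])
    have DS: "Sob (Suc m - j) ((Dc c ^^ Suc j) h)" "nrm ((Dc c ^^ Suc j) h) \<le> sqrt K * (C * s)" if j: "j \<le> Suc m" for j
    proof -
      have S: "Sob (n - Suc j) ((Dc c ^^ Suc j) h)" using j m by (intro In_Dc_Sob[OF c n Sn]) simp
      have "Suc m - j \<le> n - Suc j" using m by simp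
      then show "Sob (Suc m - j) ((Dc c ^^ Suc j) h)" using S Sob_le by blast
      have "nrm ((Dc c ^^ Suc j) h) \<le> sqrt K * dsn c ((Dc c ^^ Suc j) h)" by (rule dsn_pinched(1)[OF p(1) K Sob_L2[OF S]])
      also have "\<dots> \<le> sqrt K * (C * s)" using d[rule_format, of "Suc j"] j m K by (intro mult_left_mono) auto
      finally show "nrm ((Dc c ^^ Suc j) h) \<le> sqrt K * (C * s)" .
    qed
    have g: "En (Suc m) (Dc c h) \<le> A * (sqrt K * (C * s))"
    proof (rule A(2)[OF b nz], intro allI impI)
      fix j assume "j \<le> Suc m"
      from DS[OF this] show "Sob (Suc m - j) ((Dc c ^^ j) (Dc c h)) \<and> nrm ((Dc c ^^ j) (Dc c h)) \<le> sqrt K * (C * s)"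
        by (simp add: funpow_swap1)
    qed
    have gS: "Sob (Suc m) (Dc c h)" using DS(1)[of 0] by simp
    have u: "Sob (Suc m) (spd c)" "En (Suc m) (spd c) \<le> U * (1 + En (Suc m) (wderiv c))"
    proof -
      have *: "Sob (Suc m) (spd c) \<and> En (Suc m) (spd c) \<le> U * (1 + En m (wderiv (cderiv c)))" by (rule U(2)[OF p(1) pS(1) p(2)])
      then show "Sob (Suc m) (spd c)" by blast
      have "En m (wderiv (cderiv c)) \<le> En (Suc m) (wderiv c)" unfolding pS(2)[symmetric] by simp
      then have "U * (1 + En m (wderiv (cderiv c))) \<le> U * (1 + En (Suc m) (wderiv c))" using U(1) by (intro mult_left_mono) auto
      then show "En (Suc m) (spd c) \<le> U * (1 + En (Suc m) (wderiv c))" using * by linarith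
    qed
    have "En (Suc m) (wderiv h) = En (Suc m) (\<lambda>x. spd c x *\<^sub>R Dc c h x)"
      using wderiv_eq_spd_Dc[of c _ h] nz by (intro arg_cong[of _ _ "En (Suc m)"]) auto
    also have "\<dots> \<le> P * En (Suc m) (spd c) * En (Suc m) (Dc c h)" using P(2)[OF u(1) gS] by blast
    also have "\<dots> \<le> P * (U * (1 + En (Suc m) (wderiv c))) * (A * (sqrt K * (C * s)))"
      using u(2) g P(1) U(1) by (intro mult_mono mult_left_mono mult_nonneg_nonneg) (auto intro: add_nonneg_nonneg)
    also have "\<dots> = ?D * s * (1 + En (Suc m) (wderiv c))" by (simp only: mult_ac)
    finally show ?thesis .
  qed
  moreover have "?D \<ge> 0" using P(1) U(1) A(1) K C by simp
  ultimately show ?thesis by blast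
qed

lemma En_bounds:
  fixes c0 :: "real \<Rightarrow> 'a::euclidean_space"
  assumes n: "n \<ge> 2" and a: "metric_coeffs n a" and c0: "c0 \<in> In n" and K: "K > 0" and C: "C > 0"
    and pin: "\<And>\<gamma> t. short_path n a c0 R \<gamma> \<Longrightarrow> t \<in> {0..1} \<Longrightarrow> pinched K (cderiv (\<gamma> t))"
    and d: "\<And>\<gamma> t h j. short_path n a c0 R \<gamma> \<Longrightarrow> t \<in> {0..1} \<Longrightarrow> h \<in> Hspace n \<Longrightarrow> j \<le> n \<Longrightarrow> 
      dsn (\<gamma> t) ((Dc (\<gamma> t) ^^ j) h) \<le> C * sqrt (G_In n a (\<gamma> t) h h)"
  shows "Suc m \<le> n \<Longrightarrow> \<exists>B. \<forall>\<gamma> t. short_path n a c0 R \<gamma> \<longrightarrow> t \<in> {0..1} \<longrightarrow> En m (cderiv (\<gamma> t)) \<le> B"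
proof (induction m)
  case 0
  have "En 0 (cderiv (\<gamma> t)) \<le> 3 * K" if "short_path n a c0 R \<gamma>" "t \<in> {0..1}" for \<gamma> t
  proof -
    have p: "pinched K (cderiv (\<gamma> t))" by (rule pin[OF that])
    then have "nrm (cderiv (\<gamma> t)) \<le> 3 * K" using K
      by (intro sqint_bounded(2) continuous_on_borel_circle AE_I2) (auto simp: pinched_def)
    then show ?thesis by simp
  qed
  then show ?case by blast
next
  case (Suc m)
  then obtain B where B: "\<And>\<gamma> t. short_path n a c0 R \<gamma> \<Longrightarrow> t \<in> {0..1} \<Longrightarrow> En m (cderiv (\<gamma> t)) \<le> B" by auto
  \<comment> \<open>The growth rate takes the pinching constant and the bound from the induction
    hypothesis as one number.\<close>
  define L where "L = max K B"
  have L: "L > 0" "K \<le> L" "B \<le> L" using K by (auto simp: L_def)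
  obtain D where D: "D \<ge> 0" "\<And>(c::real \<Rightarrow> 'a) h s. c \<in> In n \<Longrightarrow> pinched L (cderiv c) \<Longrightarrow> En m (cderiv c) \<le> L \<Longrightarrow> h \<in> Hspace n \<Longrightarrow>
     (\<forall>j\<le>n. dsn c ((Dc c ^^ j) h) \<le> C * s) \<Longrightarrow> En (Suc m) (wderiv h) \<le> D * s * (1 + En (Suc m) (wderiv c))"
    using En_growth_rate[OF L(1) C Suc.prems n, where 'a='a] by blast
  let ?N = "\<lambda>f::real \<Rightarrow> 'a. En (Suc m) (wderiv f)"
  let ?B = "(1 + ?N c0) * exp (D * R)"
  have "En (Suc m) (cderiv (\<gamma> t)) \<le> ?B" if \<gamma>: "short_path n a c0 R \<gamma>" and t: "t \<in> {0..1}" for \<gamma> t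
  proof -
    \<comment> \<open>A Gronwall argument: the rate of N is at most D times the speed times 1 + N,
      so ln (1 + N) changes by at most D R. The summand 1 keeps the logarithm defined where N
      vanishes.\<close>
    have "\<bar>ln (1 + ?N (\<gamma> t)) - ln (1 + ?N c0)\<bar> \<le> D * R"
    proof (rule short_path_growth[where \<psi> = "\<lambda>y. inverse (1 + y)" and \<Psi> = "\<lambda>y. ln (1 + y)", OF n a \<gamma> Hseminorm_En_wderiv[OF Suc.prems] D(1) _ _ t])
      fix t :: real assume t: "t \<in> {0..1}"
      have pos: "1 + ?N (\<gamma> t) > 0" by (rule add_pos_nonneg) (rule zero_less_one, rule En_nonneg)
      show "((\<lambda>y. ln (1 + y)) has_real_derivative inverse (1 + ?N (\<gamma> t))) (at (?N (\<gamma> t)))"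
        using pos by (auto intro!: derivative_eq_intros simp: field_simps simp del: En.simps)
      fix h :: "real \<Rightarrow> 'a" assume h: "h \<in> Hspace n"
      have "?N h \<le> D * sqrt (G_In n a (\<gamma> t) h h) * (1 + ?N (\<gamma> t))"
        using d[OF \<gamma> t h] B[OF \<gamma> t] L
        by (intro D(2) short_path_In[OF \<gamma> t] pinched_mono[OF pin[OF \<gamma> t] K] h) auto
      then have "?N h * inverse (1 + ?N (\<gamma> t)) \<le> (D * sqrt (G_In n a (\<gamma> t) h h) * (1 + ?N (\<gamma> t))) * inverse (1 + ?N (\<gamma> t))"
        using pos by (intro mult_right_mono) auto
      also have "\<dots> = D * sqrt (G_In n a (\<gamma> t) h h)" using pos by (simp only: mult.assoc right_inverse[OF less_imp_neq[OF pos, symmetric]] mult_1_right)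
      finally show "\<bar>inverse (1 + ?N (\<gamma> t))\<bar> * ?N h \<le> D * sqrt (G_In n a (\<gamma> t) h h)"
        using pos by (simp only: abs_of_pos positive_imp_inverse_positive mult.commute)
    qed
    moreover have pos: "1 + ?N (\<gamma> t) > 0" "1 + ?N c0 > 0" by (rule add_pos_nonneg, rule zero_less_one, rule En_nonneg)+
    ultimately have "ln (1 + ?N (\<gamma> t)) \<le> ln (1 + ?N c0) + D * R" by linarith
    then have "exp (ln (1 + ?N (\<gamma> t))) \<le> exp (ln (1 + ?N c0) + D * R)" by (simp only: exp_le_cancel_iff)
    then have "1 + ?N (\<gamma> t) \<le> ?B" using pos by (simp only: exp_ln exp_add)
    moreover have "\<gamma> t \<in> Hspace n" using short_path_In[OF \<gamma> t] by (simp add: In_def)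
    then have "En (Suc m) (cderiv (\<gamma> t)) = ?N (\<gamma> t)" using Hspace_cderiv_Sob[OF _ n Suc.prems] by blast
    ultimately show ?thesis by linarith
  qed
  then show ?case by blast
qed

text \<open>Finitely many orders are involved and the bounds survive enlarging the constant, so the
  maximum serves them all.\<close>

lemma uniform_constant:
  fixes Q :: "nat \<Rightarrow> real \<Rightarrow> bool"
  assumes ex: "\<And>j. j \<le> n \<Longrightarrow> \<exists>C. Q j C" and mono: "\<And>j C D. C \<le> D \<Longrightarrow> Q j C \<Longrightarrow> Q j D"
  shows "\<exists>C. \<forall>j\<le>n. Q j C"
proof -
  obtain f where f: "\<And>j. j \<le> n \<Longrightarrow> Q j (f j)" using ex by metis
  have "Q j (Max (f ` {..n}))" if "j \<le> n" for j
    using that by (intro mono[OF _ f]) auto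
  then show ?thesis by blast
qed

text \<open>Two opposite passages: \<open>En_le_arc\<close> multiplies by |c'| to return to
  \<theta>, \<open>Dc_funpow_bound\<close> divides by it. Both factors are bounded at order n - 1,
  which a curve in H^n just affords.\<close>

lemma norm_equivalence:
  fixes c0 :: "real \<Rightarrow> 'a::euclidean_space"
  assumes n: "n \<ge> 2" and a: "metric_coeffs n a" and K: "K > 0" and r: "0 < r1" and C: "C > 0"
  shows "\<exists>D>0. \<forall>(c::real \<Rightarrow> 'a) h. c \<in> In n \<longrightarrow> r1 \<le> curve_length c \<longrightarrow> curve_length c \<le> r2 \<longrightarrow>
     pinched K (cderiv c) \<longrightarrow> En (n - 1) (cderiv c) \<le> K \<longrightarrow> h \<in> Hspace n \<longrightarrow>
     (\<forall>j\<le>n. dsn c ((Dc c ^^ j) h) \<le> C * sqrt (G_In n a c h h)) \<longrightarrow>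
     Hnorm n h \<le> D * sqrt (G_In n a c h h) \<and> sqrt (G_In n a c h h) \<le> D * Hnorm n h"
proof -
  obtain B where B: "\<And>p::real \<Rightarrow> 'a. pinched K p \<Longrightarrow> Sob (n - 1) p \<Longrightarrow> En (n - 1) p \<le> K \<Longrightarrow> Bd (n - 1) B (\<lambda>x. norm (p x))"
    using spd_Bd[OF K, of "n - 1"] by blast
  obtain B' where B': "\<And>p::real \<Rightarrow> 'a. pinched K p \<Longrightarrow> Sob (n - 1) p \<Longrightarrow> En (n - 1) p \<le> K \<Longrightarrow> Bd (n - 1) B' (\<lambda>x. inverse (norm (p x)))"
    using inverse_norm_Bd[OF K, of "n - 1"] by blast
  have n': "n = Suc (n - 1)" "n \<ge> 1" using n by auto
  obtain A where A: "A \<ge> 0" "\<And>(c::real \<Rightarrow> 'a) f S. Bd (n - 1) B (spd c) \<Longrightarrow> (\<forall>x. cderiv c x \<noteq> 0) \<Longrightarrow>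
     (\<forall>j\<le>n. Sob (n - j) ((Dc c ^^ j) f) \<and> nrm ((Dc c ^^ j) f) \<le> S) \<Longrightarrow> En n f \<le> A * S"
    using En_le_arc[of "n - 1" B n, where 'a='a] n' by auto
  let ?Q = "\<lambda>j U. \<forall>(c::real \<Rightarrow> 'a) f. Bd (n - 1) B' (ispd c) \<longrightarrow> Sob n f \<longrightarrow> j \<le> n \<longrightarrow> En (n - j) ((Dc c ^^ j) f) \<le> U * En n f"
  have "\<exists>U. \<forall>j\<le>n. ?Q j U"
  proof (rule uniform_constant)
    show "\<exists>U. ?Q j U" for j using Dc_funpow_bound[of n B' j, where 'a='a] by blast
    show "?Q j V" if "U \<le> V" "?Q j U" for j U V
    proof (intro allI impI)
      fix c f :: "real \<Rightarrow> 'a" assume "Bd (n - 1) B' (ispd c)" "Sob n f" "j \<le> n"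
      then have "En (n - j) ((Dc c ^^ j) f) \<le> U * En n f" using that(2) by blast
      also have "\<dots> \<le> V * En n f" using that(1) by (intro mult_right_mono) auto
      finally show "En (n - j) ((Dc c ^^ j) f) \<le> V * En n f" .
    qed
  qed
  then obtain U where U: "\<And>j (c::real \<Rightarrow> 'a) f. j \<le> n \<Longrightarrow> Bd (n - 1) B' (ispd c) \<Longrightarrow> Sob n f \<Longrightarrow> En (n - j) ((Dc c ^^ j) f) \<le> U * En n f"
    by blast
  have "\<exists>M. \<forall>j\<le>n. \<forall>l\<in>{r1..r2}. a j l \<le> M"
  proof (rule uniform_constant)
    fix j assume j: "j \<le> n"
    have "continuous_on {r1..r2} (a j)" using metric_coeffsD(1)[OF a j] r by (intro continuous_at_imp_continuous_on) auto
    then have "compact (a j ` {r1..r2})" by (intro compact_continuous_image) auto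
    then have "bounded (a j ` {r1..r2})" by (rule compact_imp_bounded)
    then obtain M where "\<forall>y\<in>a j ` {r1..r2}. norm y \<le> M" unfolding bounded_iff by (elim exE)
    then show "\<exists>M. \<forall>l\<in>{r1..r2}. a j l \<le> M" by (intro exI[of _ M]) force
  qed force
  then obtain M where M: "\<And>j l. j \<le> n \<Longrightarrow> l \<in> {r1..r2} \<Longrightarrow> a j l \<le> M" by blast
  define D1 where "D1 = A * (sqrt K * C)"
  \<comment> \<open>\<open>Suc n\<close> counts the terms of G, M bounds their coefficients,
    \<open>sqrt K * \<bar>U\<bar>\<close> bounds arc length derivatives by \<open>En\<close>, and
    the last factor passes from \<open>En\<close> to \<open>Hnorm\<close>.\<close>
  define D2 where "D2 = sqrt (real (Suc n) * \<bar>M\<bar>) * (sqrt K * \<bar>U\<bar>) * (1 + 10 ^ n)"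
  define D where "D = 1 + D1 + D2"
  have D: "D1 \<ge> 0" "D2 \<ge> 0" using A(1) K C by (auto simp: D1_def D2_def)
  have "Hnorm n h \<le> D * sqrt (G_In n a c h h) \<and> sqrt (G_In n a c h h) \<le> D * Hnorm n h"
    if c: "c \<in> In n" and l: "r1 \<le> curve_length c" "curve_length c \<le> r2" and p: "pinched K (cderiv c)" "En (n - 1) (cderiv c) \<le> K"
      and h: "h \<in> Hspace n" and d: "\<forall>j\<le>n. dsn c ((Dc c ^^ j) h) \<le> C * sqrt (G_In n a c h h)" for c h :: "real \<Rightarrow> 'a"
  proof
    let ?s = "sqrt (G_In n a c h h)"
    have s0: "?s \<ge> 0" using G_In_nonneg[OF n a c] by simp
    have cH: "c \<in> Hspace n" and nz: "\<forall>x. cderiv c x \<noteq> 0" using c by (auto simp: In_def)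
    have Sn: "Sob n h" using h by (simp add: Hspace_iff)
    have pS: "Sob (n - 1) (cderiv c)" using Hspace_cderiv_Sob[OF cH n, of "n - 1"] n by simp
    have S: "Sob (n - j) ((Dc c ^^ j) h)" if "j \<le> n" for j by (rule In_Dc_Sob[OF c n Sn that])
    have "En n h \<le> A * (sqrt K * (C * ?s))"
    proof (rule A(2)[OF B[OF p(1) pS p(2)] nz], intro allI impI conjI)
      fix j assume j: "j \<le> n"
      show "Sob (n - j) ((Dc c ^^ j) h)" by (rule S[OF j])
      have "nrm ((Dc c ^^ j) h) \<le> sqrt K * dsn c ((Dc c ^^ j) h)" by (rule dsn_pinched(1)[OF p(1) K Sob_L2[OF S[OF j]]])
      also have "\<dots> \<le> sqrt K * (C * ?s)" using d j K by (intro mult_left_mono) auto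
      finally show "nrm ((Dc c ^^ j) h) \<le> sqrt K * (C * ?s)" .
    qed
    then have "Hnorm n h \<le> D1 * ?s" using Hnorm_le_En[OF Sn n'(2)] by (simp add: D1_def mult.assoc)
    also have "\<dots> \<le> D * ?s" using D s0 by (intro mult_right_mono) (auto simp: D_def)
    finally show "Hnorm n h \<le> D * ?s" .
    let ?E = "En n h"
    have b: "Bd (n - 1) B' (ispd c)" by (rule B'[OF p(1) pS p(2)])
    have "G_In n a c h h \<le> (\<Sum>j\<le>n. \<bar>M\<bar> * (sqrt K * (\<bar>U\<bar> * ?E))\<^sup>2)"
      unfolding Gmetric_dsn
    proof (rule sum_mono)
      fix j assume "j \<in> {..n}"
      then have j: "j \<le> n" by simp
      have aM: "0 \<le> a j (curve_length c)" "a j (curve_length c) \<le> \<bar>M\<bar>"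
        using metric_coeffsD(2)[OF a j curve_length_pos[OF c n]] M[OF j, of "curve_length c"] l by auto
      have "dsn c ((Dc c ^^ j) h) \<le> sqrt K * nrm ((Dc c ^^ j) h)" by (rule dsn_pinched(2)[OF p(1) K Sob_L2[OF S[OF j]]])
      also have "\<dots> \<le> sqrt K * (\<bar>U\<bar> * ?E)"
      proof (rule mult_left_mono)
        have "nrm ((Dc c ^^ j) h) \<le> En (n - j) ((Dc c ^^ j) h)" by (rule nrm_le_En)
        also have "\<dots> \<le> U * ?E" by (rule U[OF j b Sn])
        also have "\<dots> \<le> \<bar>U\<bar> * ?E" by (intro mult_right_mono) auto
        finally show "nrm ((Dc c ^^ j) h) \<le> \<bar>U\<bar> * ?E" .
      qed (use K in simp)
      finally have "(dsn c ((Dc c ^^ j) h))\<^sup>2 \<le> (sqrt K * (\<bar>U\<bar> * ?E))\<^sup>2" by (rule power_mono) simp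
      then show "a j (curve_length c) * (dsn c ((Dc c ^^ j) h))\<^sup>2 \<le> \<bar>M\<bar> * (sqrt K * (\<bar>U\<bar> * ?E))\<^sup>2"
        using aM by (intro mult_mono) auto
    qed
    also have "\<dots> = (real (Suc n) * \<bar>M\<bar>) * (sqrt K * (\<bar>U\<bar> * ?E))\<^sup>2" by simp
    finally have "?s \<le> sqrt ((real (Suc n) * \<bar>M\<bar>) * (sqrt K * (\<bar>U\<bar> * ?E))\<^sup>2)" by (rule real_sqrt_le_mono)
    also have "\<dots> = sqrt (real (Suc n) * \<bar>M\<bar>) * (sqrt K * (\<bar>U\<bar> * ?E))"
      unfolding real_sqrt_mult real_sqrt_abs using K by (simp add: abs_mult)
    also have "\<dots> \<le> sqrt (real (Suc n) * \<bar>M\<bar>) * (sqrt K * (\<bar>U\<bar> * ((1 + 10 ^ n) * Hnorm n h)))"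
      using En_le_Hnorm[OF Sn n'(2)] K by (intro mult_left_mono) auto
    also have "\<dots> = D2 * Hnorm n h" unfolding D2_def by (simp only: mult.assoc)
    also have "\<dots> \<le> D * Hnorm n h" using D Hnorm_nonneg[of n h] by (intro mult_right_mono) (auto simp: D_def)
    finally show "?s \<le> D * Hnorm n h" .
  qed
  moreover have "D > 0" using D by (simp add: D_def)
  ultimately show ?thesis by blast
qed

text \<open>Bounds must hold at all times in order to be propagated along the path, but afterwards
  only the end point matters. The L^2(ds) estimates are kept next to those in H^n(d\<theta>), as the
  claim on smooth balls is about the former.\<close>

lemma short_path_estimates:
  fixes c0 :: "real \<Rightarrow> 'a::euclidean_space"
  assumes n: "n \<ge> 2" and a: "metric_coeffs n a"
    and inf0: "(MAX k\<in>{1..n}. \<integral>\<^sup>+ r\<in>{0<..1}. ennreal (r powr (1 / 2 - real k) * sqrt (a k r)) \<partial>lborel) = \<infinity>"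
    and inf1: "(MAX k\<in>{1..n}. \<integral>\<^sup>+ r\<in>{1..}. ennreal (r powr (1 / 2 - real k) * sqrt (a k r)) \<partial>lborel) = \<infinity>"
    and c0: "c0 \<in> In n"
  shows "\<exists>C>0. \<forall>\<gamma> h. short_path n a c0 R \<gamma> \<longrightarrow> h \<in> Hspace n \<longrightarrow> 
    (\<forall>j\<le>n. dsn (\<gamma> 1) ((Dc (\<gamma> 1) ^^ j) h) \<le> C * sqrt (G_In n a (\<gamma> 1) h h)) \<and>
    Hnorm n h \<le> C * sqrt (G_In n a (\<gamma> 1) h h) \<and> sqrt (G_In n a (\<gamma> 1) h h) \<le> C * Hnorm n h"
proof -
  obtain r1 r2 where r1: "r1 > 0" and l: "\<And>\<gamma> t. short_path n a c0 R \<gamma> \<Longrightarrow> t \<in> {0..1} \<Longrightarrow> r1 \<le> curve_length (\<gamma> t) \<and> curve_length (\<gamma> t) \<le> r2"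
    using length_bounds[OF n a inf0 inf1, of c0 R] by blast
  obtain C where C: "C > 0" "\<And>(c::real \<Rightarrow> 'a) h. c \<in> In n \<Longrightarrow> r1 \<le> curve_length c \<Longrightarrow> curve_length c \<le> r2 \<Longrightarrow> h \<in> Hspace n \<Longrightarrow>
     (\<forall>j\<le>n. dsn c ((Dc c ^^ j) h) \<le> C * sqrt (G_In n a c h h)) \<and>
     (\<forall>x\<in>{0..2*pi}. norm (cderiv h x) \<le> C * sqrt (G_In n a c h h) * norm (cderiv c x))"
    using arc_norms_le_G[OF n a r1, of r2, where 'a='a] by blast
  have C': "(\<forall>j\<le>n. dsn (\<gamma> t) ((Dc (\<gamma> t) ^^ j) h) \<le> C * sqrt (G_In n a (\<gamma> t) h h)) \<and>
     (\<forall>x\<in>{0..2*pi}. norm (cderiv h x) \<le> C * sqrt (G_In n a (\<gamma> t) h h) * norm (cderiv (\<gamma> t) x))"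
    if "short_path n a c0 R \<gamma>" "t \<in> {0..1}" "h \<in> Hspace n" for \<gamma> t h
    using C(2)[OF short_path_In[OF that(1,2)] _ _ that(3)] l[OF that(1,2)] by blast
  obtain K where K: "K > 0" "\<And>\<gamma> t. short_path n a c0 R \<gamma> \<Longrightarrow> t \<in> {0..1} \<Longrightarrow> pinched K (cderiv (\<gamma> t))"
    using speed_bounds[OF n a c0 C(1), of R] C' by blast
  have "\<exists>B. \<forall>\<gamma> t. short_path n a c0 R \<gamma> \<longrightarrow> t \<in> {0..1} \<longrightarrow> En (n - 1) (cderiv (\<gamma> t)) \<le> B"
  proof (rule En_bounds[OF n a c0 K(1) C(1)])
    show "pinched K (cderiv (\<gamma> t))" if "short_path n a c0 R \<gamma>" "t \<in> {0..1}" for \<gamma> t by (rule K(2)[OF that])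
    show "dsn (\<gamma> t) ((Dc (\<gamma> t) ^^ j) h) \<le> C * sqrt (G_In n a (\<gamma> t) h h)"
      if "short_path n a c0 R \<gamma>" "t \<in> {0..1}" "h \<in> Hspace n" "j \<le> n" for \<gamma> t h j
      using C'[OF that(1-3)] that(4) by blast
  qed (use n in simp)
  then obtain B where B: "\<And>\<gamma> t. short_path n a c0 R \<gamma> \<Longrightarrow> t \<in> {0..1} \<Longrightarrow> En (n - 1) (cderiv (\<gamma> t)) \<le> B" by blast
  define L where "L = max K B"
  have L: "L > 0" "K \<le> L" "B \<le> L" using K by (auto simp: L_def)
  obtain D where D: "D > 0" "\<And>(c::real \<Rightarrow> 'a) h. c \<in> In n \<Longrightarrow> r1 \<le> curve_length c \<Longrightarrow> curve_length c \<le> r2 \<Longrightarrow>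
     pinched L (cderiv c) \<Longrightarrow> En (n - 1) (cderiv c) \<le> L \<Longrightarrow> h \<in> Hspace n \<Longrightarrow>
     (\<forall>j\<le>n. dsn c ((Dc c ^^ j) h) \<le> C * sqrt (G_In n a c h h)) \<Longrightarrow>
     Hnorm n h \<le> D * sqrt (G_In n a c h h) \<and> sqrt (G_In n a c h h) \<le> D * Hnorm n h"
    using norm_equivalence[OF n a L(1) r1 C(1), of r2, where 'a='a] by blast
  show ?thesis
  proof (intro exI[of _ "C + D"] conjI allI impI)
    show "C + D > 0" using C(1) D(1) by simp
    fix \<gamma> and h :: "real \<Rightarrow> 'a" assume \<gamma>: "short_path n a c0 R \<gamma>" and h: "h \<in> Hspace n"
    have t: "(1::real) \<in> {0..1}" by simp
    have In: "\<gamma> 1 \<in> In n" by (rule short_path_In[OF \<gamma> t])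
    let ?s = "sqrt (G_In n a (\<gamma> 1) h h)"
    have s0: "?s \<ge> 0" using G_In_nonneg[OF n a In] by simp
    have d: "\<forall>j\<le>n. dsn (\<gamma> 1) ((Dc (\<gamma> 1) ^^ j) h) \<le> C * ?s" using C'[OF \<gamma> t h] by blast
    have e: "Hnorm n h \<le> D * ?s \<and> ?s \<le> D * Hnorm n h"
      using l[OF \<gamma> t] B[OF \<gamma> t] L by (intro D(2)[OF In _ _ pinched_mono[OF K(2)[OF \<gamma> t] K(1) L(2)] _ h d]) auto
    have m: "C * ?s \<le> (C + D) * ?s" "D * ?s \<le> (C + D) * ?s" "D * Hnorm n h \<le> (C + D) * Hnorm n h"
      using C(1) D(1) s0 Hnorm_nonneg[of n h] by (auto intro!: mult_right_mono)
    show "Hnorm n h \<le> (C + D) * ?s" "?s \<le> (C + D) * Hnorm n h" using e m by linarith+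
    show "dsn (\<gamma> 1) ((Dc (\<gamma> 1) ^^ j) h) \<le> (C + D) * ?s" if "j \<le> n" for j using d that m(1) by force
  qed
qed

lemma ball_In_short_path:
  fixes c0 :: "real \<Rightarrow> 'a::euclidean_space"
  assumes "c \<in> ball_In n a c0 R"
  shows "\<exists>\<gamma>. short_path n a c0 R \<gamma> \<and> \<gamma> 1 = c"
proof -
  have "dist_In n a c0 c < ereal R" using assms by (simp add: ball_In_def)
  then obtain \<gamma> where "\<gamma> \<in> pw_smooth_paths (Hspace n) {Hnorm n} (In n) c0 c" "ereal (path_len (Hspace n) {Hnorm n} (G_In n a) \<gamma>) < ereal R"
    unfolding dist_In_def geo_dist_def INF_less_iff by blast
  moreover from this(1) have "\<gamma> 1 = c" unfolding pw_smooth_paths_def by blast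
  ultimately show ?thesis unfolding short_path_def by auto
qed

subsection \<open>Smooth immersions\<close>

lemma Imm_In: "c \<in> Imm \<Longrightarrow> c \<in> In n"
  by (simp add: Imm_def In_def Cinf_Hspace)

lemma Imm_arc_deriv_Cinf:
  fixes c :: "real \<Rightarrow> 'a::euclidean_space"
  assumes c: "c \<in> Imm" and f: "f \<in> Cinf"
  shows "arc_deriv cderiv c f \<in> Cinf"
proof -
  have "ispd c \<in> Cinf" using c by (intro Cinf_inverse_norm Cinf_cderiv) (auto simp: Imm_def)
  then have "(\<lambda>x. ispd c x *\<^sub>R cderiv f x) \<in> Cinf"
    by (intro Cinf_bilinear[OF bounded_bilinear_scaleR] Cinf_cderiv f)
  then show ?thesis by (simp add: arc_deriv_def)
qed

text \<open>The smooth and the weak iterates agree only almost everywhere, and the induction carries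
  just that: \<open>wderiv_cong\<close> makes their chosen weak derivatives identical, so the next
  step can start from the smooth iterate.\<close>

lemma Imm_arc_deriv_funpow:
  fixes c :: "real \<Rightarrow> 'a::euclidean_space"
  assumes c: "c \<in> Imm" and h: "h \<in> Cinf"
  shows "(arc_deriv cderiv c ^^ j) h \<in> Cinf \<and> periodic ((Dc c ^^ j) h) \<and> (Dc c ^^ j) h \<in> borel_measurable circle_measure \<and>
    (AE x in circle_measure. (arc_deriv cderiv c ^^ j) h x = (Dc c ^^ j) h x)"
proof (induction j)
  case 0
  then show ?case using h by (auto simp: Cinf_periodic Cinf_measurable)
next
  case (Suc j)
  let ?f = "(arc_deriv cderiv c ^^ j) h" and ?g = "(Dc c ^^ j) h"
  have f: "?f \<in> Cinf" using Suc by blast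
  have i: "ispd c \<in> Cinf" using c by (intro Cinf_inverse_norm Cinf_cderiv) (auto simp: Imm_def)
  have w: "wderiv ?f = wderiv ?g"
    using Suc by (intro wderiv_cong) (auto simp: Cinf_periodic Cinf_measurable)
  have hw: "has_weak_deriv ?f (wderiv ?f)" by (rule has_weak_deriv_wderiv[OF has_weak_deriv_Cinf[OF f]])
  have Dg: "(Dc c ^^ Suc j) h = (\<lambda>x. ispd c x *\<^sub>R wderiv ?f x)" unfolding funpow.simps comp_def w by (rule Dc_eq)
  have "AE x in circle_measure. wderiv ?f x = cderiv ?f x" by (rule wderiv_AE[OF has_weak_deriv_Cinf[OF f]])
  then have "AE x in circle_measure. (arc_deriv cderiv c ^^ Suc j) h x = (Dc c ^^ Suc j) h x"
    unfolding Dg by eventually_elim (simp add: arc_deriv_def)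
  moreover have "periodic (\<lambda>x. ispd c x *\<^sub>R wderiv ?f x)"
    using hw Cinf_periodic[OF i] by (simp add: has_weak_deriv_def periodic_def)
  moreover have "(\<lambda>x. ispd c x *\<^sub>R wderiv ?f x) \<in> borel_measurable circle_measure"
    using hw by (intro borel_measurable_scaleR Cinf_measurable[OF i]) (auto simp: has_weak_deriv_def)
  moreover have "(arc_deriv cderiv c ^^ Suc j) h \<in> Cinf" using Imm_arc_deriv_Cinf[OF c f] by simp
  ultimately show ?case unfolding Dg by blast
qed

lemma Imm_dsn:
  fixes c :: "real \<Rightarrow> 'a::euclidean_space"
  assumes c: "c \<in> Imm" and h: "h \<in> Cinf"
  shows "dsn c ((arc_deriv cderiv c ^^ j) h) = dsn c ((Dc c ^^ j) h)"
proof -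
  note * = Imm_arc_deriv_funpow[OF c h, of j]
  have cc: "c \<in> Cinf" using c by (simp add: Imm_def)
  have s: "(\<lambda>x. sqrt (spd c x)) \<in> borel_measurable circle_measure"
    by (intro continuous_on_borel_circle continuous_intros Cinf_continuous_on Cinf_cderiv cc)
  have "(arc_deriv cderiv c ^^ j) h \<in> borel_measurable circle_measure" using * Cinf_measurable by blast
  then have "(LINT x|circle_measure. (norm (sqrt (spd c x) *\<^sub>R (arc_deriv cderiv c ^^ j) h x))\<^sup>2) = 
     (LINT x|circle_measure. (norm (sqrt (spd c x) *\<^sub>R (Dc c ^^ j) h x))\<^sup>2)"
    using * by (intro integral_cong_AE borel_measurable_power borel_measurable_norm borel_measurable_scaleR[OF s, THEN measurable_compose[OF _ borel_measurable_norm]])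
      (auto elim: eventually_mono)
  then show ?thesis by (simp add: dsn_def nrm_def)
qed

lemma G_Imm_eq_G_In:
  fixes c :: "real \<Rightarrow> 'a::euclidean_space"
  shows "c \<in> Imm \<Longrightarrow> h \<in> Cinf \<Longrightarrow> G_Imm n a c h h = G_In n a c h h"
  unfolding Gmetric_dsn by (simp add: Imm_dsn)

lemma Hnorm_ds_sq_eq:
  fixes c :: "real \<Rightarrow> 'a::euclidean_space"
  assumes c: "c \<in> Imm" and h: "h \<in> Cinf"
  shows "Hnorm_ds_sq n c h = (dsn c h)\<^sup>2 + (dsn c ((Dc c ^^ n) h))\<^sup>2"
proof -
  let ?f = "(arc_deriv cderiv c ^^ n) h"
  have f: "?f \<in> Cinf" using Imm_arc_deriv_funpow[OF c h] by blast
  have cc: "c \<in> Cinf" using c by (simp add: Imm_def)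
  have i: "integrable circle_measure (\<lambda>x. (g x \<bullet> g x) * spd c x)" if "g \<in> Cinf" for g :: "real \<Rightarrow> 'a"
    unfolding absolutely_integrable_circle_iff[symmetric]
    by (intro absolutely_integrable_continuous_real continuous_intros Cinf_continuous_on Cinf_cderiv cc that)
  have "Hnorm_ds_sq n c h = arc_integral c (\<lambda>x. h x \<bullet> h x) + arc_integral c (\<lambda>x. ?f x \<bullet> ?f x)"
    unfolding Hnorm_ds_sq_def arc_integral_def using i[OF h] i[OF f] by (simp add: power2_norm_eq_inner distrib_right)
  then show ?thesis unfolding dsn_sq[symmetric] Imm_dsn[OF c h] .
qed

lemma Cinf_sup_bound:
  fixes f :: "real \<Rightarrow> 'a::euclidean_space"
  assumes f: "f \<in> Cinf"
  shows "nrm f \<le> 3 * (SUP \<theta>\<in>{0..2*pi}. norm (f \<theta>))"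
proof -
  have "compact ((\<lambda>x. norm (f x)) ` {0..2*pi})"
    by (intro compact_continuous_image continuous_intros Cinf_continuous_on f) auto
  then have bdd: "bdd_above ((\<lambda>x. norm (f x)) ` {0..2*pi})" by (intro bounded_imp_bdd_above compact_imp_bounded)
  have le: "norm (f x) \<le> (SUP \<theta>\<in>{0..2*pi}. norm (f \<theta>))" if "x \<in> {0..2*pi}" for x
    by (rule cSUP_upper[OF that bdd])
  have "norm (f 0) \<le> (SUP \<theta>\<in>{0..2*pi}. norm (f \<theta>))" by (rule le) simp
  then have "0 \<le> (SUP \<theta>\<in>{0..2*pi}. norm (f \<theta>))" using norm_ge_zero[of "f 0"] by linarith
  then show ?thesis using le by (intro sqint_bounded(2) Cinf_measurable f AE_I2) auto
qed

text \<open>On the circle the sup norms of a smooth function and of its n-th derivative bound its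
  H^n norm up to the factor 3, so convergence in the seminorms of order 0 and n forces convergence
  in \<open>Hnorm n\<close>.\<close>

lemma Cinf_path_deriv_Hnorm:
  fixes \<gamma> :: "real \<Rightarrow> real \<Rightarrow> 'a::euclidean_space"
  assumes d: "has_path_deriv Cinf_seminorms \<gamma> v t T" and v: "v \<in> Cinf" and \<gamma>: "\<And>s. s \<in> T \<Longrightarrow> \<gamma> s \<in> Cinf" and t: "t \<in> T"
  shows "has_path_deriv {Hnorm n} \<gamma> v t T"
proof -
  let ?e = "\<lambda>s \<theta>. (\<gamma> s \<theta> - \<gamma> t \<theta>) /\<^sub>R (s - t) - v \<theta>"
  let ?p = "\<lambda>k h. SUP \<theta>\<in>{0..2 * pi}. norm ((cderiv ^^ k) (h :: real \<Rightarrow> 'a) \<theta>)"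
  have p: "((\<lambda>s. ?p k (?e s)) \<longlongrightarrow> 0) (at t within T)" for k
    using d unfolding has_path_deriv_def Cinf_seminorms_def by auto
  have lim: "((\<lambda>s. 3 * ?p 0 (?e s) + 3 * ?p n (?e s)) \<longlongrightarrow> 3 * 0 + 3 * 0) (at t within T)"
    by (intro tendsto_intros p)
  have ev: "\<forall>\<^sub>F s in at t within T. Hnorm n (?e s) \<le> 3 * ?p 0 (?e s) + 3 * ?p n (?e s)"
    unfolding eventually_at_filter
  proof (rule always_eventually, intro allI impI)
    fix s assume "s \<noteq> t" "s \<in> T"
    then have e: "?e s \<in> Cinf" using \<gamma> t v by (intro Cinf_diff Cinf_scaleR) auto
    have S: "Sob n (?e s)" "Sob 0 ((wderiv ^^ n) (?e s))" using Cinf_Sob[OF e] Sob_funpow[of n 0 "?e s"] by auto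
    have dn: "(cderiv ^^ n) (?e s) \<in> Cinf" by (rule Cinf_funpow_cderiv[OF e])
    have "sqint ((wderiv ^^ n) (?e s))" using S(2) by (simp add: L2_iff)
    then have "nrm ((cderiv ^^ n) (?e s)) = nrm ((wderiv ^^ n) (?e s))"
      by (rule sqint_cong_AE(2)[OF _ Cinf_measurable[OF dn] wderiv_funpow_Cinf[OF e]])
    moreover have "Hnorm n (?e s) \<le> nrm (?e s) + nrm ((wderiv ^^ n) (?e s))"
      unfolding Hnorm_alt[OF S(1)] by (rule sqrt_sum_squares_le_sum) auto
    ultimately show "Hnorm n (?e s) \<le> 3 * ?p 0 (?e s) + 3 * ?p n (?e s)"
      using Cinf_sup_bound[OF e] Cinf_sup_bound[OF dn] by simp
  qed
  show ?thesis unfolding has_path_deriv_single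
    by (rule tendsto_sandwich[OF _ ev tendsto_const]) (use lim in \<open>auto simp: Hnorm_nonneg\<close>)
qed

lemma partition_cell:
  fixes \<tau> :: "nat \<Rightarrow> real"
  assumes "\<tau> 0 \<le> t" "t \<le> \<tau> m" "t \<notin> \<tau> ` {..m}"
  shows "\<exists>i<m. \<tau> i < t \<and> t < \<tau> (Suc i)"
  using assms
proof (induction m)
  case (Suc m)
  show ?case
  proof (cases "t \<le> \<tau> m")
    case True
    moreover have "t \<notin> \<tau> ` {..m}" using Suc.prems(3) by (auto simp: atMost_Suc)
    ultimately obtain i where "i < m" "\<tau> i < t" "t < \<tau> (Suc i)" using Suc.IH[OF Suc.prems(1)] by blast
    then show ?thesis by (intro exI[of _ i]) auto
  next
    case False
    have "t \<noteq> \<tau> (Suc m)" using Suc.prems(3) by auto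
    then show ?thesis using False Suc.prems(2) by (intro exI[of _ m]) auto
  qed
qed force

text \<open>The two velocities are chosen in different spaces and for different topologies. But a
  derivative in all C^k seminorms is one in the H^n norm, where uniqueness holds, so they agree off
  the finitely many break points, which do not affect the integral.\<close>

lemma Imm_path_is_In_path:
  fixes \<gamma> :: "real \<Rightarrow> real \<Rightarrow> 'a::euclidean_space"
  assumes \<gamma>: "\<gamma> \<in> pw_smooth_paths Cinf Cinf_seminorms Imm c0 c1"
  shows "\<gamma> \<in> pw_smooth_paths (Hspace n) {Hnorm n} (In n) c0 c1"
    and "path_len Cinf Cinf_seminorms (G_Imm n a) \<gamma> = path_len (Hspace n) {Hnorm n} (G_In n a) \<gamma>"
proof -
  obtain m \<tau> where ends: "\<gamma> 0 = c0" "\<gamma> 1 = c1" and Imm: "\<And>t. t \<in> {0..1} \<Longrightarrow> \<gamma> t \<in> Imm" 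
    and \<tau>: "\<tau> 0 = (0::real)" "\<tau> m = 1" "\<And>i::nat. i < m \<Longrightarrow> \<tau> i < \<tau> (Suc i) \<and> smooth_path_on Cinf Cinf_seminorms \<gamma> {\<tau> i..\<tau> (Suc i)}"
    using \<gamma> unfolding pw_smooth_paths_def by blast
  have sub: "0 \<le> \<tau> i" "\<tau> (Suc i) \<le> 1" if "i < m" for i
    using partition_bounds[of m \<tau> 0 i] partition_bounds[of m \<tau> "Suc i" m] \<tau> that by auto
  have In: "\<gamma> t \<in> In n" if "t \<in> {0..1}" for t by (rule Imm_In[OF Imm[OF that]])
  have sp: "smooth_path_on (Hspace n) {Hnorm n} \<gamma> {\<tau> i..\<tau> (Suc i)}" if i: "i < m" for i
  proof -
    let ?T = "{\<tau> i..\<tau> (Suc i)}"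
    obtain \<Gamma> where \<Gamma>: "\<Gamma> 0 = \<gamma>" "\<And>k t. t \<in> ?T \<Longrightarrow> \<Gamma> k t \<in> Cinf \<and> has_path_deriv Cinf_seminorms (\<Gamma> k) (\<Gamma> (Suc k) t) t ?T"
      using \<tau>(3)[OF i] unfolding smooth_path_on_def by blast
    have "\<Gamma> k t \<in> Hspace n \<and> has_path_deriv {Hnorm n} (\<Gamma> k) (\<Gamma> (Suc k) t) t ?T" if "t \<in> ?T" for k t
      using \<Gamma>(2) that by (intro conjI Cinf_Hspace Cinf_path_deriv_Hnorm) auto
    then show ?thesis unfolding smooth_path_on_def using \<Gamma>(1) by blast
  qed
  show "\<gamma> \<in> pw_smooth_paths (Hspace n) {Hnorm n} (In n) c0 c1"
    unfolding pw_smooth_paths_def using ends In \<tau> sp by blast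
  have vel: "velocity Cinf Cinf_seminorms \<gamma> t \<in> Cinf \<and> velocity Cinf Cinf_seminorms \<gamma> t = velocity (Hspace n) {Hnorm n} \<gamma> t"
    if t: "t \<in> {0..1}" "t \<notin> \<tau> ` {..m}" for t
  proof -
    obtain i where i: "i < m" "\<tau> i < t" "t < \<tau> (Suc i)" using partition_cell[of \<tau> t m] t \<tau> by auto
    let ?T = "{\<tau> i..\<tau> (Suc i)}"
    have tT: "t \<in> ?T" using i by simp
    have at: "at t within ?T = at t" using i by (intro at_within_interior) auto
    have at1: "at t within {0..1} = at t" using i sub[OF i(1)] by (intro at_within_interior) auto
    have eq: "has_path_deriv P \<gamma> w t {0..1} \<longleftrightarrow> has_path_deriv P \<gamma> w t ?T" for P w
      unfolding has_path_deriv_def at at1 ..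
    have gC: "\<gamma> s \<in> Cinf" if "s \<in> ?T" for s using Imm[of s] sub[OF i(1)] that by (auto simp: Imm_def)
    obtain \<Gamma> where \<Gamma>: "\<Gamma> 0 = \<gamma>" "\<And>k t. t \<in> ?T \<Longrightarrow> \<Gamma> k t \<in> Cinf \<and> has_path_deriv Cinf_seminorms (\<Gamma> k) (\<Gamma> (Suc k) t) t ?T"
      using \<tau>(3)[OF i(1)] unfolding smooth_path_on_def by blast
    have v1: "\<Gamma> (Suc 0) t \<in> Cinf" "has_path_deriv Cinf_seminorms \<gamma> (\<Gamma> (Suc 0) t) t {0..1}"
      using \<Gamma>(2)[OF tT, of 0] \<Gamma>(2)[OF tT, of "Suc 0"] eq \<Gamma>(1) by auto
    have uniq: "w = w'" if "w \<in> Hspace n" "w' \<in> Hspace n" "has_path_deriv {Hnorm n} \<gamma> w t {0..1}" "has_path_deriv {Hnorm n} \<gamma> w' t {0..1}" for w w'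
      using that gC tT at eq by (intro has_path_deriv_unique[of n \<gamma> w t ?T w']) (auto intro: Cinf_Hspace)
    have up: "has_path_deriv {Hnorm n} \<gamma> w t {0..1}" if "has_path_deriv Cinf_seminorms \<gamma> w t {0..1}" "w \<in> Cinf" for w
      using that gC tT unfolding eq by (intro Cinf_path_deriv_Hnorm) auto
    have c: "velocity Cinf Cinf_seminorms \<gamma> t \<in> Cinf \<and> has_path_deriv Cinf_seminorms \<gamma> (velocity Cinf Cinf_seminorms \<gamma> t) t {0..1}"
      unfolding velocity_def using someI[of "\<lambda>v. v \<in> Cinf \<and> has_path_deriv Cinf_seminorms \<gamma> v t {0..1}" "\<Gamma> (Suc 0) t"] v1 by blast
    have hh: "velocity (Hspace n) {Hnorm n} \<gamma> t \<in> Hspace n \<and> has_path_deriv {Hnorm n} \<gamma> (velocity (Hspace n) {Hnorm n} \<gamma> t) t {0..1}"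
      unfolding velocity_def using someI[of "\<lambda>v. v \<in> Hspace n \<and> has_path_deriv {Hnorm n} \<gamma> v t {0..1}" "\<Gamma> (Suc 0) t"] 
        up[OF v1(2,1)] Cinf_Hspace[OF v1(1), of n] by blast
    show ?thesis using c hh up uniq Cinf_Hspace by blast
  qed
  show "path_len Cinf Cinf_seminorms (G_Imm n a) \<gamma> = path_len (Hspace n) {Hnorm n} (G_In n a) \<gamma>"
    unfolding path_len_def
  proof (rule integral_discrete_difference[where X = "\<tau> ` {..m} \<inter> {0..1}"])
    fix x assume "x \<in> \<tau> ` {..m} \<inter> {0..1}"
    then have x: "x \<in> {0..1}" by simp
    show "{x} \<in> sets (lebesgue_on {0..1})" using x by (subst sets_restrict_space_iff) auto
    show "emeasure (lebesgue_on {0..1}) {x} = 0" using x by (subst emeasure_restrict_space) auto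
  next
    fix x assume "x \<in> space (lebesgue_on {0..1})" "x \<notin> \<tau> ` {..m} \<inter> {0..1}"
    then have x: "x \<in> {0..1}" "x \<notin> \<tau> ` {..m}" by auto
    show "sqrt (G_Imm n a (\<gamma> x) (velocity Cinf Cinf_seminorms \<gamma> x) (velocity Cinf Cinf_seminorms \<gamma> x)) =
      sqrt (G_In n a (\<gamma> x) (velocity (Hspace n) {Hnorm n} \<gamma> x) (velocity (Hspace n) {Hnorm n} \<gamma> x))"
      using vel[OF x] G_Imm_eq_G_In[OF Imm[OF x(1)]] by metis
  qed (auto intro: countable_finite)
qed

lemma ball_Imm_short_path:
  fixes c0 :: "real \<Rightarrow> 'a::euclidean_space"
  assumes "c \<in> ball_Imm n a c0 R"
  shows "\<exists>\<gamma>. short_path n a c0 R \<gamma> \<and> \<gamma> 1 = c"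
proof -
  have "dist_Imm n a c0 c < ereal R" using assms by (simp add: ball_Imm_def)
  then obtain \<gamma> where \<gamma>: "\<gamma> \<in> pw_smooth_paths Cinf Cinf_seminorms Imm c0 c" "ereal (path_len Cinf Cinf_seminorms (G_Imm n a) \<gamma>) < ereal R"
    unfolding dist_Imm_def geo_dist_def INF_less_iff by blast
  moreover from this(1) have "\<gamma> 1 = c" unfolding pw_smooth_paths_def by blast
  ultimately show ?thesis unfolding short_path_def using Imm_path_is_In_path[OF \<gamma>(1)] by auto
qed

theorem proposition4p6:
  fixes n :: nat and a :: "nat \<Rightarrow> real \<Rightarrow> real"
  assumes "n \<ge> 2"
    and "metric_coeffs n a"
    and "(MAX k\<in>{1..n}. \<integral>\<^sup>+ r\<in>{0<..1}. ennreal (r powr (1 / 2 - real k) * sqrt (a k r)) \<partial>lborel) = \<infinity>"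
    and "(MAX k\<in>{1..n}. \<integral>\<^sup>+ r\<in>{1..}. ennreal (r powr (1 / 2 - real k) * sqrt (a k r)) \<partial>lborel) = \<infinity>"
  shows "(\<forall>c0 \<in> (Imm :: (real \<Rightarrow> real ^ 'd) set). \<forall>R::real. \<exists>C>0.
            \<forall>c \<in> ball_Imm n a c0 R. \<forall>h \<in> Cinf.
              Hnorm_ds_sq n c h \<le> C * G_Imm n a c h h)
       \<and> (\<forall>c0 \<in> (In n :: (real \<Rightarrow> real ^ 'd) set). \<forall>R::real. \<exists>C>0.
            \<forall>c \<in> ball_In n a c0 R. \<forall>h \<in> Hspace n.
              inverse C * Hnorm n h \<le> sqrt (G_In n a c h h) \<and>
              sqrt (G_In n a c h h) \<le> C * Hnorm n h)"
proof (intro conjI ballI allI)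
  fix c0 :: "real \<Rightarrow> real ^ 'd" and R :: real
  assume "c0 \<in> Imm"
  then have c0: "c0 \<in> In n" by (rule Imm_In)
  obtain C where C: "C > 0" and est: "\<And>\<gamma> h. short_path n a c0 R \<gamma> \<Longrightarrow> h \<in> Hspace n \<Longrightarrow> 
    (\<forall>j\<le>n. dsn (\<gamma> 1) ((Dc (\<gamma> 1) ^^ j) h) \<le> C * sqrt (G_In n a (\<gamma> 1) h h))"
    using short_path_estimates[OF assms c0, of R] by blast
  show "\<exists>C>0. \<forall>c \<in> ball_Imm n a c0 R. \<forall>h \<in> Cinf. Hnorm_ds_sq n c h \<le> C * G_Imm n a c h h"
  \<comment> \<open>Two terms, of order 0 and n, each at most C^2 G after squaring the estimate by
    the root of G.\<close>
  proof (intro exI[of _ "2 * C\<^sup>2"] conjI ballI)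
    show "2 * C\<^sup>2 > 0" using C by simp
    fix c h :: "real \<Rightarrow> real ^ 'd" assume c: "c \<in> ball_Imm n a c0 R" and h: "h \<in> Cinf"
    have Imm: "c \<in> Imm" using c by (simp add: ball_Imm_def)
    let ?G = "G_In n a c h h"
    have G: "?G \<ge> 0" by (rule G_In_nonneg[OF assms(1,2) Imm_In[OF Imm]])
    have d: "(dsn c ((Dc c ^^ j) h))\<^sup>2 \<le> C\<^sup>2 * ?G" if "j \<le> n" for j
    proof -
      have "dsn c ((Dc c ^^ j) h) \<le> C * sqrt ?G"
        using ball_Imm_short_path[OF c] est Cinf_Hspace[OF h, of n] that by blast
      then have "(dsn c ((Dc c ^^ j) h))\<^sup>2 \<le> (C * sqrt ?G)\<^sup>2" by (rule power_mono) simp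
      then show ?thesis using G by (simp add: power_mult_distrib)
    qed
    have "Hnorm_ds_sq n c h \<le> C\<^sup>2 * ?G + C\<^sup>2 * ?G"
      unfolding Hnorm_ds_sq_eq[OF Imm h] using d[of 0] d[of n] by simp
    then show "Hnorm_ds_sq n c h \<le> 2 * C\<^sup>2 * G_Imm n a c h h" unfolding G_Imm_eq_G_In[OF Imm h] by simp
  qed
next
  fix c0 :: "real \<Rightarrow> real ^ 'd" and R :: real
  assume c0: "c0 \<in> In n"
  obtain C where C: "C > 0" and est: "\<And>\<gamma> h. short_path n a c0 R \<gamma> \<Longrightarrow> h \<in> Hspace n \<Longrightarrow> 
    Hnorm n h \<le> C * sqrt (G_In n a (\<gamma> 1) h h) \<and> sqrt (G_In n a (\<gamma> 1) h h) \<le> C * Hnorm n h"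
    using short_path_estimates[OF assms c0, of R] by blast
  show "\<exists>C>0. \<forall>c \<in> ball_In n a c0 R. \<forall>h \<in> Hspace n.
     inverse C * Hnorm n h \<le> sqrt (G_In n a c h h) \<and> sqrt (G_In n a c h h) \<le> C * Hnorm n h"
  proof (intro exI[of _ C] conjI ballI C)
    fix c h :: "real \<Rightarrow> real ^ 'd" assume c: "c \<in> ball_In n a c0 R" and h: "h \<in> Hspace n"
    have e: "Hnorm n h \<le> C * sqrt (G_In n a c h h)" "sqrt (G_In n a c h h) \<le> C * Hnorm n h"
      using ball_In_short_path[OF c] est h by blast+
    show "inverse C * Hnorm n h \<le> sqrt (G_In n a c h h)"
      using e(1) C by (simp add: field_simps)
    show "sqrt (G_In n a c h h) \<le> C * Hnorm n h" by (rule e(2))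
  qed
qed

end
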